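(* Let $a>0$. There exists a unique nonzero, nonnegative, radial solution $Q\in H^1(\mathbb{R}^3)$ to $$-\mathcal{H}_aQ-Q+Q^3=0.$$
   Context: $\mathcal{H}_a=-\Delta+a|x|^{-2}$ on $\mathbb{R}^3$ (Friedrichs extension from $C_c^\infty(\mathbb{R}^3\setminus\{0\})$). *)

theory Defs
  imports "HOL-Analysis.Analysis"
begin

type_synonym R3 = "real^3"


subsection \<open>Test functions\<close>

definition partial :: "3 \<Rightarrow> (R3 \<Rightarrow> real) \<Rightarrow> R3 \<Rightarrow> real" where
  "partial i f x = frechet_derivative f (at x) (axis i 1)"

primrec Ck :: "nat \<Rightarrow> (R3 \<Rightarrow> real) \<Rightarrow> bool" where
  "Ck 0 f \<longleftrightarrow> continuous_on UNIV f"
| "Ck (Suc k) f \<longleftrightarrow> (\<forall>x. f differentiable at x) \<and> (\<forall>i. Ck k (partial i f))"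

definition test_functions :: "R3 set \<Rightarrow> (R3 \<Rightarrow> real) set" where
  "test_functions \<Omega> =
     {\<phi>. (\<forall>k. Ck k \<phi>) \<and> compact (closure {x. \<phi> x \<noteq> 0}) \<and> closure {x. \<phi> x \<noteq> 0} \<subseteq> \<Omega>}"

definition laplacian :: "(R3 \<Rightarrow> real) \<Rightarrow> R3 \<Rightarrow> real" where
  "laplacian f x = (\<Sum>i\<in>UNIV. partial i (partial i f) x)"


subsection \<open>Real \<open>L\<^sup>2\<close> and \<open>H\<^sup>1\<close>\<close>

text \<open>
  Elements of these spaces are represented by Borel measurable functions; such a
  function stands for its class modulo equality almost everywhere.
\<close>

definition L2 :: "(R3 \<Rightarrow> real) set" where
  "L2 = {u \<in> borel_measurable lborel. integrable lborel (\<lambda>x. (u x)\<^sup>2)}"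

definition L2_inner :: "(R3 \<Rightarrow> real) \<Rightarrow> (R3 \<Rightarrow> real) \<Rightarrow> real" where
  "L2_inner u v = (\<integral>x. u x * v x \<partial>lborel)"

definition L2_tendsto :: "(nat \<Rightarrow> R3 \<Rightarrow> real) \<Rightarrow> (R3 \<Rightarrow> real) \<Rightarrow> bool" where
  "L2_tendsto \<phi> u \<longleftrightarrow>
     (\<lambda>n. L2_inner (\<lambda>x. \<phi> n x - u x) (\<lambda>x. \<phi> n x - u x)) \<longlonglongrightarrow> 0"

definition H1 :: "(R3 \<Rightarrow> real) set" where
  "H1 = {u \<in> L2. \<forall>i. \<exists>g\<in>L2. \<forall>\<phi>\<in>test_functions UNIV.
           L2_inner u (partial i \<phi>) = - L2_inner g \<phi>}"


subsection \<open>Friedrichs extension\<close>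

text \<open>
  Let \<open>L\<close> be a nonnegative symmetric operator with dense domain \<open>D\<close>. Its form
  \<open>q(\<phi>, \<psi>) = \<langle>L \<phi>, \<psi>\<rangle>\<close> on \<open>D\<close> is closable. A function \<open>u\<close> is in the domain of the
  closed form when it is the \<open>L\<^sup>2\<close>-limit of a \<open>q\<close>-Cauchy sequence in \<open>D\<close>, and the
  closed form is the limit of \<open>q\<close> along such sequences. The Friedrichs extension is the
  operator associated with the closed form.
\<close>

definition form_approx ::
  "(R3 \<Rightarrow> real) set \<Rightarrow> ((R3 \<Rightarrow> real) \<Rightarrow> R3 \<Rightarrow> real) \<Rightarrow> (nat \<Rightarrow> R3 \<Rightarrow> real) \<Rightarrow> (R3 \<Rightarrow> real) \<Rightarrow> bool" where
  "form_approx D L \<phi> u \<longleftrightarrow>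
     u \<in> L2 \<and> (\<forall>n. \<phi> n \<in> D) \<and> L2_tendsto \<phi> u \<and>
     (\<forall>\<epsilon>>0. \<exists>N. \<forall>m\<ge>N. \<forall>n\<ge>N.
        L2_inner (L (\<lambda>x. \<phi> m x - \<phi> n x)) (\<lambda>x. \<phi> m x - \<phi> n x) < \<epsilon>)"

definition form_domain ::
  "(R3 \<Rightarrow> real) set \<Rightarrow> ((R3 \<Rightarrow> real) \<Rightarrow> R3 \<Rightarrow> real) \<Rightarrow> (R3 \<Rightarrow> real) set" where
  "form_domain D L = {u. \<exists>\<phi>. form_approx D L \<phi> u}"

text \<open>\<open>closed_form D L u v c\<close>: the value of the closed form at \<open>(u, v)\<close> is \<open>c\<close>.\<close>

definition closed_form ::
  "(R3 \<Rightarrow> real) set \<Rightarrow> ((R3 \<Rightarrow> real) \<Rightarrow> R3 \<Rightarrow> real) \<Rightarrow> (R3 \<Rightarrow> real) \<Rightarrow> (R3 \<Rightarrow> real) \<Rightarrow> real \<Rightarrow> bool" where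
  "closed_form D L u v c \<longleftrightarrow>
     (\<exists>\<phi> \<psi>. form_approx D L \<phi> u \<and> form_approx D L \<psi> v \<and>
        (\<lambda>n. L2_inner (L (\<phi> n)) (\<psi> n)) \<longlonglongrightarrow> c)"

text \<open>
  \<open>friedrichs D L u f\<close>: \<open>u\<close> is in the operator domain of the Friedrichs extension, which
  maps it to \<open>f\<close>; the image \<open>f\<close> is determined up to equality almost everywhere.
\<close>

definition friedrichs ::
  "(R3 \<Rightarrow> real) set \<Rightarrow> ((R3 \<Rightarrow> real) \<Rightarrow> R3 \<Rightarrow> real) \<Rightarrow> (R3 \<Rightarrow> real) \<Rightarrow> (R3 \<Rightarrow> real) \<Rightarrow> bool" where
  "friedrichs D L u f \<longleftrightarrow>
     u \<in> form_domain D L \<and> f \<in> L2 \<and>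
     (\<forall>v\<in>form_domain D L. closed_form D L u v (L2_inner f v))"

definition H_a :: "real \<Rightarrow> (R3 \<Rightarrow> real) \<Rightarrow> (R3 \<Rightarrow> real) \<Rightarrow> bool" where
  "H_a a = friedrichs (test_functions (- {0}))
             (\<lambda>\<phi> x. - laplacian \<phi> x + a / (norm x)\<^sup>2 * \<phi> x)"


subsection \<open>The elliptic equation\<close>

definition solves :: "real \<Rightarrow> (R3 \<Rightarrow> real) \<Rightarrow> bool" where
  "solves a Q \<longleftrightarrow>
     (\<exists>HQ. H_a a Q HQ \<and> (AE x in lborel. - HQ x - Q x + (Q x) ^ 3 = 0))"

definition radial :: "(R3 \<Rightarrow> real) \<Rightarrow> bool" where
  "radial u \<longleftrightarrow> (\<exists>f :: real \<Rightarrow> real. AE x in lborel. u x = f (norm x))"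

definition nonneg_radial_solution :: "real \<Rightarrow> (R3 \<Rightarrow> real) \<Rightarrow> bool" where
  "nonneg_radial_solution a Q \<longleftrightarrow>
     Q \<in> H1 \<and> \<not> (AE x in lborel. Q x = 0) \<and> (AE x in lborel. 0 \<le> Q x) \<and> radial Q \<and> solves a Q"

end

theory Submission imports Defs "HOL-Real_Asymp.Real_Asymp" begin

text \<open>
  Writing \<open>Q(x) = u(|x|) / |x|\<close> turns the equation into \<open>u'' = (1 + a/r\<^sup>2) u - u\<^sup>3/r\<^sup>2\<close> on the
  half-line with \<open>u > 0\<close> and \<open>u \<rightarrow> 0\<close> at both ends; such a \<open>u\<close> is called a profile.

  Uniqueness. A Pohozaev-type energy \<open>J(u)\<close> (\<open>Jfun\<close>) has derivative \<open>g u\<^sup>2\<close> with an explicit \<open>g\<close> that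
  changes sign once, from positive to negative, and \<open>J(u)\<close> vanishes at both ends for a profile, so
  \<open>J(u) > 0\<close>. For two profiles with Wronskian \<open>W = v' u - u' v\<close>, the function
  \<open>X = (v/u)\<^sup>2 J(u) - J(v)\<close> vanishes at both ends and \<open>X' = 2 (v/u) (W/u\<^sup>2) J(u)\<close>, so \<open>X\<close> increases
  strictly on a maximal interval with \<open>W > 0\<close>. At a zero of \<open>W\<close> the sign of \<open>X\<close> is that of
  \<open>u\<^sup>2 - v\<^sup>2\<close>, hence that of \<open>W'\<close>, which makes the increase impossible. So \<open>W \<le> 0\<close>, and by symmetry \<open>W = 0\<close>.

  Existence. With \<open>\<alpha>\<^sup>2 - \<alpha> = a\<close> and \<open>0 \<le> t \<le> 1\<close>, the equation
  \<open>u'' = ((1 - t) + a/r\<^sup>2) u - t u\<^sup>3/r\<^sup>2\<close> is solved from the origin as \<open>u = r\<^sup>\<alpha> y\<close>, \<open>y(0) = 1\<close>, by a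
  contraction depending continuously on \<open>t\<close>. If \<open>J\<close> becomes negative while decreasing, \<open>u\<close> never crosses
  zero; this holds at \<open>t = 0\<close>, whereas \<open>u\<close> crosses zero at \<open>t = 1\<close>. Both conditions are open, so some
  \<open>t\<close> satisfies neither, and its solution becomes a profile after rescaling.

  A radial solution is reduced to a profile by testing with radial functions: the lemma of
  du Bois-Reymond makes \<open>u\<close> twice differentiable, uniqueness for linear equations makes it positive,
  and the integrability of \<open>u\<^sup>2\<close>, \<open>u\<^sup>2/r\<^sup>2\<close> (Hardy) and \<open>u\<^sup>6/r\<^sup>4\<close> makes it vanish at both ends.
\<close>

section \<open>Uniqueness of the positive profile\<close>

text \<open>The parameter t is a shooting height in disguise. Rescaling the solution with y(0) = 1
  to the original equation gives sqrt(t) u(r / sqrt(1 - t)), whose leading coefficient sqrt(t) (1 -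
  t)^(-\<alpha>/2) at the origin runs through all of (0, \<infinity>). So t = 0 and t = 1 stand for
  the heights zero and infinity, where ordinary shooting has no limit object: the first end is a
  linear equation, the second has lost its mass term and is invariant under dilations. Both ends can
  be analysed directly, and the interval of parameters is compact.

  In the uniqueness part the obstacle is the ratio v/u in X, which nothing controls near the ends
  although J(u) tends to 0 there. X is therefore rewritten through W/u, and W is compared with u by
  integrating W' from the end.

  In the reduction to profiles, the Friedrichs extension enters only through its weak equation,
  tested off the origin, and through the integrability of Q^2/|x|^2 on its form domain. For a > 0
  the latter is read off the form itself, and the equation puts Q^3 in L^2.\<close>

lemma deriv_nonneg_imp_le:
  fixes f f' :: "real \<Rightarrow> real"
  assumes "a \<le> b" "\<And>x. \<lbrakk>a \<le> x; x \<le> b\<rbrakk> \<Longrightarrow> (f has_real_derivative f' x) (at x)"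
    "\<And>x. \<lbrakk>a < x; x < b\<rbrakk> \<Longrightarrow> 0 \<le> f' x"
  shows "f a \<le> f b"
proof (cases "a = b")
  case False
  then obtain z where "a < z" "z < b" "f b - f a = (b - a) * f' z"
    using MVT2[of a b f f'] assms by force
  then show ?thesis using assms(1) assms(3)[of z] mult_nonneg_nonneg[of "b - a" "f' z"] by linarith
qed simp

lemma deriv_nonpos_imp_ge:
  fixes f f' :: "real \<Rightarrow> real"
  assumes "a \<le> b" "\<And>x. \<lbrakk>a \<le> x; x \<le> b\<rbrakk> \<Longrightarrow> (f has_real_derivative f' x) (at x)"
    "\<And>x. \<lbrakk>a < x; x < b\<rbrakk> \<Longrightarrow> f' x \<le> 0"
  shows "f b \<le> f a"
  using deriv_nonneg_imp_le[OF assms(1), of "\<lambda>x. - f x" "\<lambda>x. - f' x"] assms(2,3)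
  by (auto intro: DERIV_minus)

lemma deriv_pos_imp_less:
  fixes f f' :: "real \<Rightarrow> real"
  assumes "a < b" "\<And>x. \<lbrakk>a \<le> x; x \<le> b\<rbrakk> \<Longrightarrow> (f has_real_derivative f' x) (at x)"
    "\<And>x. \<lbrakk>a < x; x < b\<rbrakk> \<Longrightarrow> 0 < f' x"
  shows "f a < f b"
proof -
  obtain z where "a < z" "z < b" "f b - f a = (b - a) * f' z"
    using MVT2[of a b f f'] assms by force
  then show ?thesis using assms(1) assms(3)[of z] mult_pos_pos[of "b - a" "f' z"] by linarith
qed

section \<open>A Pohozaev energy for the radial equation\<close>

definition Jfun :: "real \<Rightarrow> real \<Rightarrow> real \<Rightarrow> (real \<Rightarrow> real) \<Rightarrow> (real \<Rightarrow> real) \<Rightarrow> real \<Rightarrow> real" where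
  "Jfun a s l u u' r = r powr (2/3) * (1/2 * (u' r)\<^sup>2 - 1/2 * ((s + a * (1/r)\<^sup>2) * (u r)\<^sup>2)
      + l/4 * ((u r)^4 * (1/r)\<^sup>2) - 1/3 * (u r * u' r * (1/r)) - 1/18 * ((u r)\<^sup>2 * (1/r)\<^sup>2))"

lemma powr_two_thirds_deriv:
  assumes "r > 0"
  shows "((\<lambda>r. r powr (2/3)) has_real_derivative (2/3 * r powr (2/3) / r)) (at r)"
proof -
  have "((\<lambda>r. r powr (2/3)) has_real_derivative (2/3 * r powr (2/3 - 1))) (at r)"
    using has_real_derivative_powr[OF assms, of "2/3"] by simp
  moreover have "r powr (2/3 - 1) = r powr (2/3) / r" using assms by (subst powr_diff) simp
  ultimately show ?thesis by (simp only: times_divide_eq_right)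
qed

text \<open>Take r^m times the mechanical energy and add -c r^(m-1) u u' and -d r^(m-2) u^2. In the
  derivative, u'^2 cancels iff c = m/2, and u^4 cancels iff m/4 - 1/2 + c = 0; this forces m = 2/3
  and c = 1/3, and then d = 1/18 removes u u'. Only a multiple of u^2 with an explicit factor
  survives. The coefficients \<open>s\<close> and \<open>l\<close> stay free because shooting uses s
  = 1 - t and l = t.\<close>

lemma Jfun_deriv:
  assumes r: "r > 0" and u: "(u has_real_derivative u' r) (at r)"
    and u': "(u' has_real_derivative ((s + a/r\<^sup>2) * u r - l * (u r)^3/r\<^sup>2)) (at r)"
  shows "(Jfun a s l u u' has_real_derivative
     r powr (2/3) * ((2/27 + a/3) * (1/r)^3 - 2/3 * s * (1/r)) * (u r)\<^sup>2) (at r)"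
proof -
  have alg: "2/3 * A * q * (1/2 * P\<^sup>2 - 1/2 * ((s + a*q\<^sup>2) * U\<^sup>2) + l/4 * (U^4*q\<^sup>2)
      - 1/3 * (U * P*q) - 1/18 * (U\<^sup>2*q\<^sup>2)) +
     (P * ((s + a*q\<^sup>2) * U - l * U^3*q\<^sup>2) + (a*q^3) * U\<^sup>2 - (s + a*q\<^sup>2) * U * P
      + l * U^3 * P *q\<^sup>2 - l * U^4*q^3/2 - P\<^sup>2*q/3
      - U * ((s + a*q\<^sup>2) * U - l * U^3*q\<^sup>2)*q/3 + U * P*q\<^sup>2/3
      - U * P*q\<^sup>2/9 + U\<^sup>2*q^3/9) * A
     = A * ((2/27 + a/3)*q^3 - 2/3 * s * q) * U\<^sup>2" for A q P U :: real
    by (simp add: field_simps power2_eq_square power3_eq_cube power4_eq_xxxx)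
  \<comment> \<open>The factor 1/r enters as a function \<open>Q\<close> with Q' = -Q^2, which keeps
    the differentiation polynomial.\<close>
  have E: "((\<lambda>r. 1/2 * (u' r)\<^sup>2 - 1/2 * ((s + a * (Q r)\<^sup>2) * (u r)\<^sup>2)
      + l/4 * ((u r)^4 * (Q r)\<^sup>2) - 1/3 * (u r * u' r * (Q r)) - 1/18 * ((u r)\<^sup>2 * (Q r)\<^sup>2)) has_real_derivative
     (u' r * D + (a*(Q r)^3) * (u r)\<^sup>2 - (s + a*(Q r)\<^sup>2) * u r * u' r
      + l * (u r)^3 * u' r * (Q r)\<^sup>2 - l * (u r)^4*(Q r)^3/2 - (u' r)\<^sup>2 * Q r/3
      - u r * D*(Q r)/3 + u r * u' r*(Q r)\<^sup>2/3
      - u r * u' r*(Q r)\<^sup>2/9 + (u r)\<^sup>2*(Q r)^3/9)) (at r)"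
    if i: "(Q has_real_derivative (- ((Q r)\<^sup>2))) (at r)" and u': "(u' has_real_derivative D) (at r)" for Q D
    by (rule derivative_eq_intros u u' i refl)+
       (simp add: field_simps power2_eq_square power3_eq_cube power4_eq_xxxx)
  have i: "((\<lambda>r. 1/r) has_real_derivative (- ((1/r)\<^sup>2))) (at r)"
    using r by (auto intro!: derivative_eq_intros simp: field_simps power2_eq_square)
  have u'': "(u' has_real_derivative ((s + a * (1/r)\<^sup>2) * u r - l * (u r)^3 * (1/r)\<^sup>2)) (at r)"
    using u' by (simp add: power_divide)
  show ?thesis unfolding Jfun_def[abs_def]
    by (rule DERIV_cong[OF DERIV_mult[OF powr_two_thirds_deriv[OF r] E[OF i u'']]], subst alg[of _ "1/r" "u' r", symmetric]) simp
qed

lemma abs_Jfun_le: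
  assumes r: "r > 0" and x: "\<bar>u r\<bar> \<le> x" and y: "\<bar>u' r\<bar> \<le> y" and a: "a \<ge> 0"
    and s: "0 \<le> s" "s \<le> 1" and l: "0 \<le> l" "l \<le> 1"
  shows "\<bar>Jfun a s l u u' r\<bar> \<le> r powr (2/3) * (1/2 * y\<^sup>2 + 1/2 * ((1 + a * (1/r)\<^sup>2) * x\<^sup>2)
     + 1/4 * (x^4 * (1/r)\<^sup>2) + 1/3 * (x * y * (1/r)) + 1/18 * (x\<^sup>2 * (1/r)\<^sup>2))"
proof -
  have x0: "x \<ge> 0" "y \<ge> 0" using x y by auto
  have 1: "(u r)\<^sup>2 \<le> x\<^sup>2" "(u' r)\<^sup>2 \<le> y\<^sup>2" using x y by (auto simp: abs_le_square_iff[symmetric] x0)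
  have 2: "(u r)^4 \<le> x^4" using power_mono[OF x, of 4] by simp
  have 3: "\<bar>u r * u' r\<bar> \<le> x * y" unfolding abs_mult using x y x0 by (intro mult_mono) auto
  have t1: "(s + a * (1/r)\<^sup>2) * (u r)\<^sup>2 \<le> (1 + a * (1/r)\<^sup>2) * x\<^sup>2" "0 \<le> (s + a * (1/r)\<^sup>2) * (u r)\<^sup>2"
    using 1 a s by (auto intro!: mult_mono)
  have t2: "l * ((u r)^4 * (1/r)\<^sup>2) \<le> 1 * (x^4 * (1/r)\<^sup>2)" "0 \<le> l * ((u r)^4 * (1/r)\<^sup>2)"
    using 2 l by (intro mult_mono mult_right_mono mult_nonneg_nonneg; simp)+
  have t3: "\<bar>u r * u' r * (1/r)\<bar> \<le> x*y*(1/r)" unfolding abs_mult[of _ "1/r"] using r 3 by (auto intro!: divide_right_mono)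
  have t4: "(u r)\<^sup>2 * (1/r)\<^sup>2 \<le> x\<^sup>2 * (1/r)\<^sup>2" "0 \<le> (u r)\<^sup>2 * (1/r)\<^sup>2"
    using 1 by (auto intro!: mult_right_mono divide_right_mono)
  have "\<bar>1/2 * (u' r)\<^sup>2 - 1/2 * ((s + a * (1/r)\<^sup>2) * (u r)\<^sup>2)
      + l/4 * ((u r)^4 * (1/r)\<^sup>2) - 1/3 * (u r * u' r * (1/r)) - 1/18 * ((u r)\<^sup>2 * (1/r)\<^sup>2)\<bar>
     \<le> 1/2 * y\<^sup>2 + 1/2 * ((1 + a * (1/r)\<^sup>2) * x\<^sup>2)
     + 1/4 * (x^4 * (1/r)\<^sup>2) + 1/3 * (x * y * (1/r)) + 1/18 * (x\<^sup>2 * (1/r)\<^sup>2)"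
    using t1 t2 t3 t4 1(2) zero_le_power2[of "u' r"] by linarith
  then show ?thesis unfolding Jfun_def abs_mult by (simp add: mult_left_mono)
qed

section \<open>Behaviour of profiles at the origin and at infinity\<close>

definition profile :: "real \<Rightarrow> (real \<Rightarrow> real) \<Rightarrow> (real \<Rightarrow> real) \<Rightarrow> bool" where
  "profile a u u' \<longleftrightarrow> (\<forall>r>0. u r > 0 \<and> (u has_real_derivative u' r) (at r) \<and>
      (u' has_real_derivative ((1 + a/r\<^sup>2) * u r - (u r)^3/r\<^sup>2)) (at r)) \<and>
     (u \<longlongrightarrow> 0) (at_right 0) \<and> (u \<longlongrightarrow> 0) at_top"

text \<open>As soon as u < sqrt a the right-hand side is nonnegative, so u is convex near 0. A
  negative slope there would keep u above a positive value down to the origin, against u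
  \<rightarrow> 0. The slope is then nonnegative and monotone, hence bounded, and integrating from
  u(0+) = 0 gives the linear bound.\<close>

lemma profile_near_0:
  assumes a: "a > 0" and p: "profile a u u'"
  obtains C d where "C > 0" "d > 0" "\<And>r. \<lbrakk>0 < r; r < d\<rbrakk> \<Longrightarrow> 0 \<le> u' r \<and> u' r \<le> C \<and> u r \<le> C * r"
proof -
  have pos: "u r > 0" and du: "(u has_real_derivative u' r) (at r)"
    and ddu: "(u' has_real_derivative ((1 + a/r\<^sup>2) * u r - (u r)^3/r\<^sup>2)) (at r)" if "r > 0" for r
    using p that by (auto simp: profile_def)
  have lim: "(u \<longlongrightarrow> 0) (at_right 0)" using p by (simp add: profile_def)
  have "eventually (\<lambda>r. u r < sqrt a) (at_right 0)"
    using order_tendstoD(2)[OF lim] a by simp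
  then obtain d where d: "d > 0" "\<And>r. \<lbrakk>0 < r; r < d\<rbrakk> \<Longrightarrow> u r < sqrt a"
    unfolding eventually_at_right_field by auto
  have conv: "(1 + a/r\<^sup>2) * u r - (u r)^3/r\<^sup>2 \<ge> 0" if "0 < r" "r < d" for r
  proof -
    have "(u r)\<^sup>2 \<le> (sqrt a)\<^sup>2" using d(2)[OF that] pos[OF that(1)]
      by (intro power_mono) auto
    then have "(u r)\<^sup>2 \<le> a" using a by simp
    then have "0 \<le> u r * (1 + (a - (u r)\<^sup>2)/r\<^sup>2)"
      using pos[OF that(1)] by (intro mult_nonneg_nonneg add_nonneg_nonneg divide_nonneg_nonneg) auto
    also have "\<dots> = (1 + a/r\<^sup>2) * u r - (u r)^3/r\<^sup>2"
      using that by (simp add: field_simps power2_eq_square power3_eq_cube)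
    finally show ?thesis .
  qed
  have mono: "u' r \<le> u' s" if "0 < r" "r \<le> s" "s < d" for r s
    by (rule deriv_nonneg_imp_le[OF that(2) ddu]) (use that conv in auto)
  have u'0: "0 \<le> u' r" if r: "0 < r" "r < d" for r
  proof (rule ccontr)
    assume n: "\<not> 0 \<le> u' r"
    have "u r \<le> u s" if "0 < s" "s \<le> r" for s
    proof (rule deriv_nonpos_imp_ge[OF that(2) du])
      fix x assume "s < x" "x < r"
      then show "u' x \<le> 0" using mono[of x r] that r n by auto
    qed (use that in auto)
    then have "eventually (\<lambda>s. u r \<le> u s) (at_right 0)"
      unfolding eventually_at_right_field using r by (intro exI[of _ r]) auto
    from tendsto_lowerbound[OF lim this] have "u r \<le> 0" by simp
    with pos[OF r(1)] show False by simp
  qed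
  define C where "C = max 1 (u' (d/2))"
  have C: "u' r \<le> C" if "0 < r" "r < d/2" for r
    using mono[of r "d/2"] that by (auto simp: C_def)
  have "u r \<le> C * r" if r: "0 < r" "r < d/2" for r
  proof -
    have "u r - C * r \<le> u s - C * s" if "0 < s" "s \<le> r" for s
    proof (rule deriv_nonpos_imp_ge[OF that(2)])
      fix x assume "s \<le> x"
      then have "x > 0" using that by simp
      then show "((\<lambda>r. u r - C * r) has_real_derivative u' x - C) (at x)"
        by (auto intro!: derivative_eq_intros du)
    qed (use that r C in auto)
    then have "eventually (\<lambda>s. u r - C * r \<le> u s - C * s) (at_right 0)"
      unfolding eventually_at_right_field using r by (intro exI[of _ r]) auto
    moreover have "((\<lambda>s. u s - C * s) \<longlongrightarrow> 0) (at_right 0)"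
      by (rule tendsto_eq_intros lim refl)+ simp_all
    ultimately have "u r - C * r \<le> 0" by (intro tendsto_lowerbound) auto
    then show ?thesis by simp
  qed
  then show thesis using d C u'0 by (intro that[of C "d/2"]) (auto simp: C_def)
qed

text \<open>Beyond \<open>R\<close> the inequalities u < 1/2 and r \<ge> 1 leave u'' \<ge> u/2. So u
  is convex and, as it tends to 0, decreasing; the surplus of u/2 over u/4 yields the decay rate
  1/2.\<close>

lemma profile_near_inf:
  assumes a: "a > 0" and p: "profile a u u'"
  obtains C R where "C > 0" "R > 0" "\<And>r. r \<ge> R \<Longrightarrow> u' r < 0 \<and> u r \<le> C * exp (-r/2) \<and> \<bar>u' r\<bar> \<le> C * exp (-r/2)"
proof -
  have pos: "u r > 0" and du: "(u has_real_derivative u' r) (at r)"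
    and ddu: "(u' has_real_derivative ((1 + a/r\<^sup>2) * u r - (u r)^3/r\<^sup>2)) (at r)" if "r > 0" for r
    using p that by (auto simp: profile_def)
  have lim: "(u \<longlongrightarrow> 0) at_top" using p by (simp add: profile_def)
  have "eventually (\<lambda>r. u r < 1/2) at_top" using order_tendstoD(2)[OF lim, of "1/2"] by simp
  then obtain R0 where R0: "\<And>r. r \<ge> R0 \<Longrightarrow> u r < 1/2" by (auto simp: eventually_at_top_linorder)
  define R where "R = max R0 1"
  have R: "R \<ge> 1" "\<And>r. r \<ge> R \<Longrightarrow> u r < 1/2" using R0 by (auto simp: R_def)
  have conv: "(1 + a/r\<^sup>2) * u r - (u r)^3/r\<^sup>2 \<ge> u r / 2" if "r \<ge> R" for r
  proof -
    have r: "r \<ge> 1" using that R by simp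
    have "(u r)\<^sup>2 / r\<^sup>2 \<le> (1/2)\<^sup>2/1\<^sup>2" using pos[of r] R(2)[OF that] r
      by (intro frac_le power_mono) auto
    then have "0 \<le> u r * (1/2 + (a/r\<^sup>2 - (u r)\<^sup>2/r\<^sup>2) - 0)"
    proof (intro mult_nonneg_nonneg)
      have "0 \<le> a / r\<^sup>2" using a by simp
      moreover have "(1/2)\<^sup>2/1\<^sup>2 = (1/4::real)" by (simp add: power2_eq_square)
      ultimately show "0 \<le> 1/2 + (a/r\<^sup>2 - (u r)\<^sup>2/r\<^sup>2) - 0" using \<open>(u r)\<^sup>2 / r\<^sup>2 \<le> _\<close> by linarith
    qed (use pos[of r] r in auto)
    also have "\<dots> = (1 + a/r\<^sup>2) * u r - (u r)^3/r\<^sup>2 - u r/2"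
      using r by (simp add: field_simps power2_eq_square power3_eq_cube)
    finally show ?thesis by simp
  qed
  have mono: "u' r \<le> u' s" if "R \<le> r" "r \<le> s" for r s
  proof (rule deriv_nonneg_imp_le[OF that(2) ddu])
    fix x assume "r < x"
    then have "u x / 2 \<le> (1 + a/x\<^sup>2) * u x - (u x)^3/x\<^sup>2" "u x > 0" using conv[of x] pos[of x] that R(1) by auto
    then show "0 \<le> (1 + a/x\<^sup>2) * u x - (u x)^3/x\<^sup>2" by linarith
  qed (use that R in auto)
  have neg: "u' r < 0" if r: "R \<le> r" for r
  proof (rule ccontr)
    assume n: "\<not> u' r < 0"
    have "u r \<le> u s" if "r \<le> s" for s
    proof (rule deriv_nonneg_imp_le[OF that du])
      fix x assume "r < x"
      then show "0 \<le> u' x" using mono[of r x] r n by auto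
    qed (use r R in auto)
    then have "eventually (\<lambda>s. u r \<le> u s) at_top"
      unfolding eventually_at_top_linorder by auto
    from tendsto_lowerbound[OF lim this] have "u r \<le> 0" by simp
    with pos[of r] r R show False by simp
  qed
  \<comment> \<open>The derivative of (u' + u/2) exp(-r/2) is (u'' - u/4) exp(-r/2) \<ge> 0. A
    positive value of u' + u/2 would therefore persist, whereas u' + u/2 < u/2 tends to 0.\<close>
  have zle: "u' r + u r/2 \<le> 0" if r: "R \<le> r" for r
  proof (rule ccontr)
    assume n: "\<not> u' r + u r/2 \<le> 0"
    have "u' r + u r/2 \<le> u s/2" if s: "r \<le> s" for s
    proof -
      have "(u' r + u r/2) * exp (-r/2) \<le> (u' s + u s/2) * exp (-s/2)"
      proof (rule deriv_nonneg_imp_le[OF s])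
        fix x assume x: "r \<le> x"
        have x0: "x > 0" using x r R by simp
        show "((\<lambda>x. (u' x + u x/2) * exp (-x/2)) has_real_derivative
           ((1 + a/x\<^sup>2) * u x - (u x)^3/x\<^sup>2 - u x / 4) * exp (-x/2)) (at x)"
          by (auto intro!: derivative_eq_intros ddu du x0 simp: field_simps)
      next
        fix x assume x: "r < x"
        show "0 \<le> ((1 + a/x\<^sup>2) * u x - (u x)^3/x\<^sup>2 - u x / 4) * exp (-x/2)"
        proof (intro mult_nonneg_nonneg)
          have "u x / 2 \<le> (1 + a/x\<^sup>2) * u x - (u x)^3/x\<^sup>2" "u x > 0" using conv[of x] pos[of x] x r R(1) by auto
          then show "0 \<le> (1 + a/x\<^sup>2) * u x - (u x)^3/x\<^sup>2 - u x / 4" by linarith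
        qed auto
      qed
      then have "(u' r + u r/2) * exp (-r/2) * exp (s/2) \<le> (u' s + u s/2) * exp (-s/2) * exp (s/2)"
        by (intro mult_right_mono) auto
      then have "(u' r + u r/2) * exp (s/2 - r/2) \<le> (u' s + u s/2)"
        by (simp add: mult.assoc exp_add[symmetric])
      moreover have "(u' r + u r/2) * 1 \<le> (u' r + u r/2) * exp (s/2 - r/2)"
        using n s by (intro mult_left_mono) auto
      ultimately show ?thesis using neg[of s] r s by simp
    qed
    then have "eventually (\<lambda>s. u' r + u r/2 \<le> u s/2) at_top"
      unfolding eventually_at_top_linorder by auto
    moreover have "((\<lambda>s. u s/2) \<longlongrightarrow> 0) at_top" by (rule tendsto_eq_intros lim refl)+ simp_all
    ultimately have "u' r + u r/2 \<le> 0" by (intro tendsto_lowerbound) auto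
    with n show False by simp
  qed
  define K where "K = u R * exp (R/2)"
  have dec: "u r \<le> K * exp (-r/2)" if r: "R \<le> r" for r
  proof -
    have "u r * exp (r/2) \<le> u R * exp (R/2)"
    proof (rule deriv_nonpos_imp_ge[OF r])
      fix x assume x: "R \<le> x"
      have x0: "x > 0" using x R by simp
      show "((\<lambda>x. u x * exp (x/2)) has_real_derivative (u' x + u x/2) * exp (x/2)) (at x)"
        by (auto intro!: derivative_eq_intros ddu du x0 simp: algebra_simps)
    next
      fix x assume "R < x"
      then show "(u' x + u x/2) * exp (x/2) \<le> 0"
        using zle[of x] by (intro mult_nonpos_nonneg) auto
    qed
    then show ?thesis by (simp add: K_def exp_minus field_simps)
  qed
  have K: "K > 0" using pos[of R] R by (simp add: K_def)
  \<comment> \<open>By convexity -u' decreases, so the slope found by the mean value theorem on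
    [r - 1, r] bounds -u'(r) by u(r - 1); moving back by 1 costs the factor exp(1/2).\<close>
  have dec': "- u' r \<le> K * exp (1/2) * exp (-r/2)" if r: "R + 1 \<le> r" for r
  proof -
    have "\<exists>z>r - 1. z < r \<and> u r - u (r - 1) = (r - (r - 1)) * u' z"
      using r R by (intro MVT2 du) auto
    then obtain z where z: "r - 1 < z" "z < r" "u r - u (r - 1) = u' z" by auto
    have "u' z \<le> u' r" using z r by (intro mono) auto
    then have "- u' r \<le> u (r - 1)" using z pos[of r] r R by simp
    also have "\<dots> \<le> K * exp (-(r - 1)/2)" using r by (intro dec) auto
    also have "\<dots> = K * exp (1/2) * exp (-r/2)" by (simp add: exp_add[symmetric] field_simps)
    finally show ?thesis .
  qed
  show thesis
  proof (rule that[of "K * exp (1/2)" "R + 1"])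
    fix r assume r: "r \<ge> R + 1"
    have "K * exp (-r/2) * 1 \<le> K * exp (-r/2) * exp (1/2)" using K by (intro mult_left_mono) auto
    then show "u' r < 0 \<and> u r \<le> K * exp (1/2) * exp (-r/2) \<and> \<bar>u' r\<bar> \<le> K * exp (1/2) * exp (-r/2)"
      using neg[of r] r dec[of r] dec'[OF r] by (auto simp: mult_ac)
  qed (use K R in auto)
qed

section \<open>Positivity of the energy along a profile\<close>

lemma pos_if_strict_increasing_from_0:
  fixes f :: "real \<Rightarrow> real"
  assumes lim: "(f \<longlongrightarrow> 0) (at_right 0)" and r: "0 < r"
    and inc: "\<And>x y. \<lbrakk>0 < x; x < y; y \<le> r\<rbrakk> \<Longrightarrow> f x < f y"
  shows "f r > 0"
proof -
  have "eventually (\<lambda>s. f s \<le> f (r/2)) (at_right 0)"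
    unfolding eventually_at_right_field using r inc by (intro exI[of _ "r/2"]) (auto intro: less_imp_le)
  from tendsto_upperbound[OF lim this] have "0 \<le> f (r/2)" by simp
  also have "\<dots> < f r" using r by (intro inc) auto
  finally show ?thesis .
qed

lemma neg_if_strict_increasing_to_0:
  fixes f :: "real \<Rightarrow> real"
  assumes lim: "(f \<longlongrightarrow> 0) at_top"
    and inc: "\<And>x y. \<lbrakk>r \<le> x; x < y\<rbrakk> \<Longrightarrow> f x < f y"
  shows "f r < 0"
proof -
  have "f r < f (r + 1)" by (intro inc) auto
  moreover have "eventually (\<lambda>s. f (r + 1) \<le> f s) at_top"
    unfolding eventually_at_top_linorder using inc
    by (intro exI[of _ "r+2"]) (auto intro: less_imp_le)
  then have "f (r + 1) \<le> 0" using lim by (intro tendsto_lowerbound) auto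
  ultimately show ?thesis by simp
qed

text \<open>The majorant of \<open>abs_Jfun_le\<close> for |u| \<le> C r and |u'| \<le> C, which is
  of order r^(2/3). It stands alone because profiles and the shooting solutions both obey these
  bounds near 0.\<close>

lemma Jfun_majorant_tendsto_0:
  fixes a C :: real
  assumes "a > 0" "C > 0"
  shows "((\<lambda>r. r powr (2/3) * (1/2 * (C)\<^sup>2 + 1/2 * ((1 + a * (1/r)\<^sup>2) * (C*r)\<^sup>2) + 1/4 * ((C*r)^4 * (1/r)\<^sup>2) + 1/3 * ((C*r) * (C) * (1/r)) + 1/18 * ((C*r)\<^sup>2 * (1/r)\<^sup>2))) \<longlongrightarrow> 0) (at_right 0)"
  using assms by real_asymp

lemma Jfun_profile_tendsto_0:
  assumes a: "a > 0" and p: "profile a u u'"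
  shows "(Jfun a 1 1 u u' \<longlongrightarrow> 0) (at_right 0)"
proof -
  obtain C d where C: "C > 0" "d > 0" "\<And>r. \<lbrakk>0 < r; r < d\<rbrakk> \<Longrightarrow> 0 \<le> u' r \<and> u' r \<le> C \<and> u r \<le> C * r"
    using profile_near_0[OF a p] by metis
  have pos: "u r > 0" if "r > 0" for r using p that by (auto simp: profile_def)
  show ?thesis
  proof (rule Lim_null_comparison)
    show "eventually (\<lambda>r. norm (Jfun a 1 1 u u' r) \<le>
        r powr (2/3) * (1/2 * (C)\<^sup>2 + 1/2 * ((1 + a * (1/r)\<^sup>2) * (C*r)\<^sup>2) + 1/4 * ((C*r)^4 * (1/r)\<^sup>2) + 1/3 * ((C*r) * (C) * (1/r)) + 1/18 * ((C*r)\<^sup>2 * (1/r)\<^sup>2))) (at_right 0)"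
      unfolding eventually_at_right_field
    proof (intro exI[of _ d] conjI allI impI C(2))
      fix r assume r: "0 < r" "r < d"
      have "\<bar>u r\<bar> \<le> C * r" "\<bar>u' r\<bar> \<le> C" using C(3)[OF r] pos[OF r(1)] by auto
      from abs_Jfun_le[where u = u and u' = u', OF r(1) this, of a 1 1] a
      show "norm (Jfun a 1 1 u u' r) \<le> r powr (2/3) * (1/2 * (C)\<^sup>2 + 1/2 * ((1 + a * (1/r)\<^sup>2) * (C*r)\<^sup>2) + 1/4 * ((C*r)^4 * (1/r)\<^sup>2) + 1/3 * ((C*r) * (C) * (1/r)) + 1/18 * ((C*r)\<^sup>2 * (1/r)\<^sup>2))"
        by simp
    qed
    show "((\<lambda>r. r powr (2/3) * (1/2 * (C)\<^sup>2 + 1/2 * ((1 + a * (1/r)\<^sup>2) * (C*r)\<^sup>2) + 1/4 * ((C*r)^4 * (1/r)\<^sup>2) + 1/3 * ((C*r) * (C) * (1/r)) + 1/18 * ((C*r)\<^sup>2 * (1/r)\<^sup>2)))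
       \<longlongrightarrow> 0) (at_right 0)" by (rule Jfun_majorant_tendsto_0[OF a C(1)])
  qed
qed

lemma Jfun_profile_tendsto_inf:
  assumes a: "a > 0" and p: "profile a u u'"
  shows "(Jfun a 1 1 u u' \<longlongrightarrow> 0) at_top"
proof -
  obtain C R where C: "C > 0" "R > 0" "\<And>r. r \<ge> R \<Longrightarrow> u' r < 0 \<and> u r \<le> C * exp (-r/2) \<and> \<bar>u' r\<bar> \<le> C * exp (-r/2)"
    using profile_near_inf[OF a p] by metis
  have pos: "u r > 0" if "r > 0" for r using p that by (auto simp: profile_def)
  let ?e = "\<lambda>r::real. C * exp (-r/2)"
  show ?thesis
  proof (rule Lim_null_comparison)
    show "eventually (\<lambda>r. norm (Jfun a 1 1 u u' r) \<le>
        r powr (2/3) * (1/2 * (?e r)\<^sup>2 + 1/2 * ((1 + a * (1/r)\<^sup>2) * (?e r)\<^sup>2) + 1/4 * ((?e r)^4 * (1/r)\<^sup>2) + 1/3 * ((?e r) * (?e r) * (1/r)) + 1/18 * ((?e r)\<^sup>2 * (1/r)\<^sup>2))) at_top"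
      unfolding eventually_at_top_linorder
    proof (intro exI[of _ R] conjI allI impI)
      fix r assume r: "r \<ge> R"
      then have r0: "r > 0" using C by simp
      have "\<bar>u r\<bar> \<le> ?e r" "\<bar>u' r\<bar> \<le> ?e r" using C(3)[OF r] pos[OF r0] by auto
      from abs_Jfun_le[where u = u and u' = u', OF r0 this, of a 1 1] a
      show "norm (Jfun a 1 1 u u' r) \<le>
        r powr (2/3) * (1/2 * (?e r)\<^sup>2 + 1/2 * ((1 + a * (1/r)\<^sup>2) * (?e r)\<^sup>2) + 1/4 * ((?e r)^4 * (1/r)\<^sup>2) + 1/3 * ((?e r) * (?e r) * (1/r)) + 1/18 * ((?e r)\<^sup>2 * (1/r)\<^sup>2))"
        by simp
    qed
    show "((\<lambda>r. r powr (2/3) * (1/2 * (?e r)\<^sup>2 + 1/2 * ((1 + a * (1/r)\<^sup>2) * (?e r)\<^sup>2) + 1/4 * ((?e r)^4 * (1/r)\<^sup>2) + 1/3 * ((?e r) * (?e r) * (1/r)) + 1/18 * ((?e r)\<^sup>2 * (1/r)\<^sup>2)))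
       \<longlongrightarrow> 0) at_top" using C(1) a by real_asymp
  qed
qed

lemma Jfun_profile_pos:
  assumes a: "a > 0" and p: "profile a u u'" and r: "r > 0"
  shows "Jfun a 1 1 u u' r > 0"
proof -
  have pos: "u r > 0" and du: "(u has_real_derivative u' r) (at r)"
    and ddu: "(u' has_real_derivative ((1 + a/r\<^sup>2) * u r - 1 * (u r)^3/r\<^sup>2)) (at r)" if "r > 0" for r
    using p that by (auto simp: profile_def)
  let ?G = "\<lambda>r. r powr (2/3) * ((2/27 + a/3) * (1/r)^3 - 2/3 * (1/r)) * (u r)\<^sup>2"
  have dJ: "(Jfun a 1 1 u u' has_real_derivative ?G r) (at r)" if "r > 0" for r
    using Jfun_deriv[OF that du[OF that] ddu[OF that]] by simp
  \<comment> \<open>The radius at which the factor of u^2 in J' changes sign: (2/27 + a/3) / b^3 =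
    (2/3) / b.\<close>
  define b where "b = sqrt (1/9 + a/2)"
  have b: "b > 0" "b\<^sup>2 = 1/9 + a/2" using a by (auto simp: b_def add_nonneg_nonneg)
  have ab: "a = 2 * b\<^sup>2 - 2/9" using b by simp
  have fac: "(2/27 + a/3) * (1/x)^3 - 2/3 * (1/x) = 2/3 * (b\<^sup>2 - x\<^sup>2) / x^3" if "x > 0" for x :: real
    using that unfolding ab by (simp add: field_simps power2_eq_square power3_eq_cube)
  have Gpos: "?G x > 0" if "0 < x" "x < b" for x
  proof -
    have "x\<^sup>2 < b\<^sup>2" using that by (intro power_strict_mono) auto
    then have "0 < x powr (2/3) * (2/3 * (b\<^sup>2 - x\<^sup>2) / x^3) * (u x)\<^sup>2"
      using that pos[of x] by (intro mult_pos_pos divide_pos_pos) auto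
    then show ?thesis by (simp only: fac[OF that(1)])
  qed
  have Gneg: "- ?G x > 0" if "x > b" for x
  proof -
    have x: "x > 0" using b that by simp
    have "b\<^sup>2 < x\<^sup>2" using that b by (intro power_strict_mono) auto
    then have "0 < x powr (2/3) * (2/3 * (x\<^sup>2 - b\<^sup>2) / x^3) * (u x)\<^sup>2" using x pos[of x]
      by (intro mult_pos_pos divide_pos_pos) auto
    also have "x powr (2/3) * (2/3 * (x\<^sup>2 - b\<^sup>2) / x^3) * (u x)\<^sup>2
        = - (x powr (2/3) * (2/3 * (b\<^sup>2 - x\<^sup>2) / x^3) * (u x)\<^sup>2)" by (simp add: right_diff_distrib diff_divide_distrib left_diff_distrib)
    finally show ?thesis by (simp only: fac[OF x])
  qed
  show ?thesis
  proof (cases "r \<le> b")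
    case True
    show ?thesis
    proof (rule pos_if_strict_increasing_from_0[OF Jfun_profile_tendsto_0[OF a p] r])
      fix x y assume xy: "0 < x" "x < y" "y \<le> r"
      show "Jfun a 1 1 u u' x < Jfun a 1 1 u u' y"
        by (rule deriv_pos_imp_less[OF xy(2) dJ Gpos]) (use xy True in auto)
    qed
  next
    case False
    have lim: "((\<lambda>x. - Jfun a 1 1 u u' x) \<longlongrightarrow> 0) at_top"
      using tendsto_minus[OF Jfun_profile_tendsto_inf[OF a p]] by simp
    have "- Jfun a 1 1 u u' r < 0"
    proof (rule neg_if_strict_increasing_to_0[OF lim])
      fix x y assume xy: "r \<le> x" "x < y"
      show "- Jfun a 1 1 u u' x < - Jfun a 1 1 u u' y"
        by (rule deriv_pos_imp_less[OF xy(2) DERIV_minus[OF dJ] Gneg]) (use xy False b in auto)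
    qed
    then show ?thesis by simp
  qed
qed


section \<open>Comparison of two profiles through their Wronskian\<close>

lemma last_zero_before_pos:
  fixes f :: "real \<Rightarrow> real"
  assumes c: "continuous_on {b..x} f" and "b < x" "f b \<le> 0" "f x > 0"
  obtains z where "b \<le> z" "z < x" "f z = 0" "\<And>y. \<lbrakk>z < y; y \<le> x\<rbrakk> \<Longrightarrow> f y > 0"
proof -
  define S where "S = {y \<in> {b..x}. f y \<in> {..0}}"
  have "S = {b..x} \<inter> f -` {..0}" by (auto simp: S_def)
  then have "closed S" using continuous_closed_preimage[OF c, of "{..0}"] by simp
  moreover have "bounded S" by (rule bounded_subset[of "{b..x}"]) (auto simp: S_def)
  ultimately have "compact S" by (simp add: compact_eq_bounded_closed)
  moreover have "b \<in> S" using assms by (auto simp: S_def)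
  then have "S \<noteq> {}" by blast
  ultimately obtain z where z: "z \<in> S" "\<And>y. y \<in> S \<Longrightarrow> y \<le> z" using compact_attains_sup[of S] by metis
  have zx0: "b \<le> z" "z \<le> x" "f z \<le> 0" using z(1) by (auto simp: S_def)
  then have zx: "b \<le> z" "z < x" "f z \<le> 0" using assms(4) by (auto intro!: le_neq_trans)
  have pos: "f y > 0" if "z < y" "y \<le> x" for y
  proof (rule ccontr)
    assume "\<not> f y > 0"
    then have "y \<in> S" using that zx by (simp add: S_def)
    with z(2)[of y] that show False by simp
  qed
  have "f z = 0"
  proof (rule ccontr)
    assume "f z \<noteq> 0"
    then have "f z < 0" using zx by simp
    moreover have "continuous_on {z..x} f" by (rule continuous_on_subset[OF c]) (use zx in auto)
    ultimately obtain y where "z \<le> y" "y \<le> x" "f y = 0"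
      using IVT'[of f z 0 x] assms(4) zx by auto
    then show False using pos[of y] \<open>f z \<noteq> 0\<close> by (cases "y = z") auto
  qed
  with zx pos show thesis by (intro that) auto
qed

lemma first_zero_after_pos:
  fixes f :: "real \<Rightarrow> real"
  assumes c: "continuous_on {x..b} f" and "x < b" "f b \<le> 0" "f x > 0"
  obtains z where "x < z" "z \<le> b" "f z = 0" "\<And>y. \<lbrakk>x \<le> y; y < z\<rbrakk> \<Longrightarrow> f y > 0"
proof -
  have "continuous_on {-b..-x} (\<lambda>y. f (-y))"
    by (rule continuous_on_compose2[OF c]) (auto intro!: continuous_intros)
  then obtain z where z: "-b \<le> z" "z < -x" "f (-z) = 0"
    "\<And>y. \<lbrakk>z < y; y \<le> -x\<rbrakk> \<Longrightarrow> f (-y) > 0"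
  proof (rule last_zero_before_pos)
    show "-b < -x" "f (-(-b)) \<le> 0" "0 < f (-(-x))" using assms by auto
  qed blast
  have "f y > 0" if "x \<le> y" "y < -z" for y using z(4)[of "-y"] that by auto
  with z show thesis by (intro that[of "-z"]) auto
qed

text \<open>The derivative of v' u - u' v: the common linear coefficient and the product of the
  slopes cancel, so its sign is decided by the cubic terms alone.\<close>

lemma wronskian_deriv_eq:
  "(c * V - V^3/R) * U + p * q - ((c * U - U^3/R) * V + q * p) = U * V * (U\<^sup>2 - V\<^sup>2) / (R :: real)"
  by (simp add: algebra_simps diff_divide_distrib power2_eq_square power3_eq_cube)

lemma deriv_quotient_square:
  fixes f g :: "real \<Rightarrow> real"
  assumes "(f has_real_derivative f') (at r)" "(g has_real_derivative g') (at r)" "g r \<noteq> 0"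
  shows "((\<lambda>r. (f r / g r)\<^sup>2) has_real_derivative 2 * (f r / g r) * ((f' * g r - g' * f r) / (g r)\<^sup>2)) (at r)"
proof -
  have e: "(f' * g r - f r * g') / (g r * g r) = (f' * g r - g' * f r) / (g r)\<^sup>2"
    by (simp only: power2_eq_square mult.commute[of "f r" g'])
  have "((\<lambda>r. f r / g r) has_real_derivative (f' * g r - g' * f r) / (g r)\<^sup>2) (at r)"
    using DERIV_divide[OF assms] unfolding e .
  from DERIV_power[OF this, of 2] show ?thesis by (simp only: numeral_2_eq_2 diff_Suc_Suc diff_zero power_one_right of_nat_Suc) (simp add: mult.assoc mult.commute mult.left_commute)
qed

lemma wronskian_not_pos:
  assumes a: "a > 0" and pu: "profile a u u'" and pv: "profile a v v'" and r0: "r0 > 0"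
  shows "v' r0 * u r0 - u' r0 * v r0 \<le> 0"
proof (rule ccontr)
  have posu: "u r > 0" and du: "(u has_real_derivative u' r) (at r)"
    and ddu: "(u' has_real_derivative ((1 + a/r\<^sup>2) * u r - 1 * (u r)^3/r\<^sup>2)) (at r)" if "r > 0" for r
    using pu that by (auto simp: profile_def)
  have posv: "v r > 0" and dv: "(v has_real_derivative v' r) (at r)"
    and ddv: "(v' has_real_derivative ((1 + a/r\<^sup>2) * v r - 1 * (v r)^3/r\<^sup>2)) (at r)" if "r > 0" for r
    using pv that by (auto simp: profile_def)
  define W where "W = (\<lambda>r. v' r * u r - u' r * v r)"
  define W' where "W' = (\<lambda>r. u r * v r * ((u r)\<^sup>2 - (v r)\<^sup>2) / r\<^sup>2)"
  define X where "X = (\<lambda>r. (v r / u r)\<^sup>2 * Jfun a 1 1 u u' r - Jfun a 1 1 v v' r)"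
  define p where "p = (\<lambda>r. W r / u r)"
  have dW: "(W has_real_derivative W' r) (at r)" if r: "r > 0" for r
  proof -
    have "(W has_real_derivative ((1 + a/r\<^sup>2) * v r - 1 * (v r)^3/r\<^sup>2) * u r + u' r * v' r
        - (((1 + a/r\<^sup>2) * u r - 1 * (u r)^3/r\<^sup>2) * v r + v' r * u' r)) (at r)"
      unfolding W_def by (intro DERIV_diff DERIV_mult du dv ddu ddv r)
    moreover have "((1 + a/r\<^sup>2) * v r - 1 * (v r)^3/r\<^sup>2) * u r + u' r * v' r
        - (((1 + a/r\<^sup>2) * u r - 1 * (u r)^3/r\<^sup>2) * v r + v' r * u' r) = W' r"
      unfolding W'_def by (simp only: mult_1_left wronskian_deriv_eq)
    ultimately show ?thesis by simp
  qed
  have contW: "continuous_on S W" if "S \<subseteq> {0<..}" for S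
  proof (rule DERIV_continuous_on[where D = W'])
    fix x assume "x \<in> S"
    then have "x > 0" using that by auto
    then show "(W has_real_derivative W' x) (at x within S)" by (rule has_field_derivative_at_within[OF dW])
  qed
  \<comment> \<open>Both energies have the same factor g in their derivatives, so (v/u)^2 g u^2
    cancels g v^2 and only the derivative of (v/u)^2 contributes.\<close>
  have dX: "(X has_real_derivative 2 * (v r / u r) * (W r / (u r)\<^sup>2) * Jfun a 1 1 u u' r) (at r)" if r: "r > 0" for r
  proof -
    let ?g = "r powr (2/3) * ((2/27 + a/3) * (1/r)^3 - 2/3 * 1 * (1/r))"
    have q2: "((\<lambda>r. (v r / u r)\<^sup>2) has_real_derivative 2 * (v r / u r) * (W r / (u r)\<^sup>2)) (at r)"
      unfolding W_def by (rule deriv_quotient_square[OF dv[OF r] du[OF r]]) (use posu[OF r] in simp)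
    have Ju: "(Jfun a 1 1 u u' has_real_derivative ?g * (u r)\<^sup>2) (at r)"
      by (rule Jfun_deriv[where u = u and u' = u', OF r du[OF r] ddu[OF r]])
    have Jv: "(Jfun a 1 1 v v' has_real_derivative ?g * (v r)\<^sup>2) (at r)"
      by (rule Jfun_deriv[where u = v and u' = v', OF r dv[OF r] ddv[OF r]])
    have D: "(X has_real_derivative (2 * (v r / u r) * (W r / (u r)\<^sup>2)) * Jfun a 1 1 u u' r
       + ?g * (u r)\<^sup>2 * (v r / u r)\<^sup>2 - ?g * (v r)\<^sup>2) (at r)"
      unfolding X_def by (intro DERIV_diff DERIV_mult q2 Ju Jv)
    have "(u r)\<^sup>2 * (v r / u r)\<^sup>2 = (v r)\<^sup>2"
      unfolding power_divide using posu[OF r] by simp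
    then have e: "?g * (u r)\<^sup>2 * (v r / u r)\<^sup>2 = ?g * (v r)\<^sup>2" by (simp only: mult.assoc)
    show ?thesis by (rule DERIV_cong[OF D]) (simp only: e add_diff_cancel_right')
  qed
  \<comment> \<open>Put w = v/u and v' = p + w u'. The quadratic part of J(v) cancels against that
    of w^2 J(u) up to terms containing p, and the quartic parts leave u^2 - v^2. This form serves
    twice: where W = 0 only the last term remains, and at the ends it replaces the uncontrolled
    ratio v/u by p = W/u.\<close>
  have X_eq: "X r = r powr (2/3) * (1/2 * (p r * (p r - 2 * v' r)) + 1/3 * (v r * p r * (1/r))
      + 1/4 * ((v r)\<^sup>2 * ((u r)\<^sup>2 - (v r)\<^sup>2) * (1/r)\<^sup>2))" if r: "r > 0" for r
  proof -
    define w where "w = v r / u r"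
    have "p r = v' r - u' r * w" using posu[OF r] by (simp add: p_def W_def w_def diff_divide_distrib)
    then have 1: "v' r = p r + u' r * w" by simp
    have 2: "v r = w * u r" using posu[OF r] by (simp add: w_def)
    have alg: "w\<^sup>2 * (A * (1/2 * P\<^sup>2 - 1/2 * ((1 + a * q\<^sup>2) * U\<^sup>2)
      + 1/4 * (U^4 * q\<^sup>2) - 1/3 * (U * P * q) - 1/18 * (U\<^sup>2 * q\<^sup>2)))
      - A * (1/2 * (s + P * w)\<^sup>2 - 1/2 * ((1 + a * q\<^sup>2) * (w * U)\<^sup>2)
      + 1/4 * ((w * U)^4 * q\<^sup>2) - 1/3 * ((w * U) * (s + P * w) * q) - 1/18 * ((w * U)\<^sup>2 * q\<^sup>2))
      = A * (1/2 * (s * (s - 2 * (s + P * w))) + 1/3 * (w * U * s * q) + 1/4 * ((w * U)\<^sup>2 * (U\<^sup>2 - (w * U)\<^sup>2) * q\<^sup>2))"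
      for A P U q s :: real
      by (simp add: field_simps power2_eq_square power4_eq_xxxx)
    have "X r = w\<^sup>2 * Jfun a 1 1 u u' r - Jfun a 1 1 v v' r" by (simp only: X_def w_def)
    then show ?thesis unfolding Jfun_def 1 2 alg .
  qed
  have X0: "X r \<ge> 0" if "r > 0" "W r = 0" "W' r \<ge> 0" for r
  proof -
    have "0 \<le> u r * v r * ((u r)\<^sup>2 - (v r)\<^sup>2)" using that by (simp add: W'_def zero_le_divide_iff)
    moreover have "u r * v r > 0" using posu[of r] posv[of r] that by simp
    ultimately have "(u r)\<^sup>2 - (v r)\<^sup>2 \<ge> 0" using mult_pos_neg[of "u r * v r" "(u r)\<^sup>2 - (v r)\<^sup>2"] by linarith
    then show ?thesis using that by (simp add: X_eq p_def)
  qed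
  have X1: "X r \<le> 0" if "r > 0" "W r = 0" "W' r \<le> 0" for r
  proof -
    have "u r * v r * ((u r)\<^sup>2 - (v r)\<^sup>2) \<le> 0" using that by (simp add: W'_def divide_le_0_iff)
    moreover have "u r * v r > 0" using posu[of r] posv[of r] that by simp
    ultimately have "(u r)\<^sup>2 - (v r)\<^sup>2 \<le> 0" using mult_pos_pos[of "u r * v r" "(u r)\<^sup>2 - (v r)\<^sup>2"] by linarith
    then have "(v r)\<^sup>2 * ((u r)\<^sup>2 - (v r)\<^sup>2) * (1/r)\<^sup>2 \<le> 0" by (intro mult_nonpos_nonneg mult_nonneg_nonpos) auto
    then have "r powr (2/3) * (1/2 * (p r * (p r - 2 * v' r)) + 1/3 * (v r * p r * (1/r))
      + 1/4 * ((v r)\<^sup>2 * ((u r)\<^sup>2 - (v r)\<^sup>2) * (1/r)\<^sup>2)) \<le> 0" using that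
      by (intro mult_nonneg_nonpos) (auto simp: p_def)
    then show ?thesis by (simp only: X_eq[OF that(1)])
  qed
  have Xinc: "X x < X y" if xy: "0 < x" "x < y" "\<And>z. \<lbrakk>x < z; z < y\<rbrakk> \<Longrightarrow> W z > 0" for x y
  proof (rule deriv_pos_imp_less[OF xy(2) dX])
    fix z assume z: "x < z" "z < y"
    then have "z > 0" using xy by simp
    then show "0 < 2 * (v z / u z) * (W z / (u z)\<^sup>2) * Jfun a 1 1 u u' z"
      using posu[of z] posv[of z] xy(3)[OF z] Jfun_profile_pos[OF a pu, of z] by simp
  qed (use xy in auto)
  obtain Cu d1 where Cu: "Cu > 0" "d1 > 0" "\<And>r. \<lbrakk>0 < r; r < d1\<rbrakk> \<Longrightarrow> 0 \<le> u' r \<and> u' r \<le> Cu \<and> u r \<le> Cu * r"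
    using profile_near_0[OF a pu] by metis
  obtain Cv d2 where Cv: "Cv > 0" "d2 > 0" "\<And>r. \<lbrakk>0 < r; r < d2\<rbrakk> \<Longrightarrow> 0 \<le> v' r \<and> v' r \<le> Cv \<and> v r \<le> Cv * r"
    using profile_near_0[OF a pv] by metis
  obtain Du R1 where Du: "Du > 0" "R1 > 0" "\<And>r. r \<ge> R1 \<Longrightarrow> u' r < 0 \<and> u r \<le> Du * exp (-r/2) \<and> \<bar>u' r\<bar> \<le> Du * exp (-r/2)"
    using profile_near_inf[OF a pu] by metis
  obtain Dv R2 where Dv: "Dv > 0" "R2 > 0" "\<And>r. r \<ge> R2 \<Longrightarrow> v' r < 0 \<and> v r \<le> Dv * exp (-r/2) \<and> \<bar>v' r\<bar> \<le> Dv * exp (-r/2)"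
    using profile_near_inf[OF a pv] by metis
  have X_abs: "\<bar>X r\<bar> \<le> r powr (2/3) * (1/2 * (P * (P + 2 * y)) + 1/3 * (x * P * (1/r)) + 1/4 * (x\<^sup>2 * (z\<^sup>2 + x\<^sup>2) * (1/r)\<^sup>2))"
    if r: "r > 0" and P: "\<bar>p r\<bar> \<le> P" and y: "\<bar>v' r\<bar> \<le> y" and x: "v r \<le> x" and z: "u r \<le> z" for r P x y z
  proof -
    have x0: "\<bar>v r\<bar> \<le> x" "\<bar>u r\<bar> \<le> z" "0 \<le> P" "0 \<le> y" "0 \<le> x" "0 \<le> z" using posv[OF r] posu[OF r] x z P y by auto
    have 1: "\<bar>p r * (p r - 2 * v' r)\<bar> \<le> P * (P + 2 * y)"
      unfolding abs_mult using P y x0 by (intro mult_mono) auto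
    have 2: "\<bar>v r * p r * (1/r)\<bar> \<le> x * P * (1/r)"
      unfolding abs_mult using P x0 r by (intro mult_mono) auto
    have m: "(v r)\<^sup>2 \<le> x\<^sup>2" "(u r)\<^sup>2 \<le> z\<^sup>2"
      using power_mono[OF x0(1), of 2] power_mono[OF x0(2), of 2] by simp_all
    have "\<bar>(u r)\<^sup>2 - (v r)\<^sup>2\<bar> \<le> z\<^sup>2 + x\<^sup>2"
      using m zero_le_power2[of "u r"] zero_le_power2[of "v r"] by linarith
    then have 3: "\<bar>(v r)\<^sup>2 * ((u r)\<^sup>2 - (v r)\<^sup>2) * (1/r)\<^sup>2\<bar> \<le> x\<^sup>2 * (z\<^sup>2 + x\<^sup>2) * (1/r)\<^sup>2"
      unfolding abs_mult using power_mono[OF x0(1), of 2] by (intro mult_mono) auto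
    have "\<bar>1/2 * (p r * (p r - 2 * v' r)) + 1/3 * (v r * p r * (1/r)) + 1/4 * ((v r)\<^sup>2 * ((u r)\<^sup>2 - (v r)\<^sup>2) * (1/r)\<^sup>2)\<bar>
      \<le> 1/2 * (P * (P + 2 * y)) + 1/3 * (x * P * (1/r)) + 1/4 * (x\<^sup>2 * (z\<^sup>2 + x\<^sup>2) * (1/r)\<^sup>2)"
    proof -
      have e: "\<bar>1/2 * A + 1/3 * B + 1/4 * D\<bar> \<le> 1/2 * A' + 1/3 * B' + 1/4 * D'"
        if "\<bar>A\<bar> \<le> A'" "\<bar>B\<bar> \<le> B'" "\<bar>D\<bar> \<le> D'" for A B D A' B' D' :: real
        using that by linarith
      show ?thesis by (rule e[OF 1 2 3])
    qed
    then show ?thesis unfolding X_eq[OF r] abs_mult by (simp add: mult_left_mono)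
  qed
  \<comment> \<open>Near 0 the function u increases, so |W'(s)| \<le> 2 C^3 s u(r) for all s \<le>
    r. Integrating from the origin, where W \<rightarrow> 0, bounds W(r) by r^2 u(r) up to a
    constant, and thus p by r^2.\<close>
  have Xlim0: "(X \<longlongrightarrow> 0) (at_right 0)"
  proof -
    define C where "C = max Cu Cv"
    define d where "d = min d1 d2"
    have C: "C > 0" and Cuv: "\<And>r. \<lbrakk>0 < r; r < d\<rbrakk> \<Longrightarrow> 0 \<le> u' r \<and> u' r \<le> C \<and> u r \<le> C * r \<and> 0 \<le> v' r \<and> v' r \<le> C \<and> v r \<le> C * r"
    proof -
      show "C > 0" using Cu by (simp add: C_def)
      fix r assume r: "0 < r" "r < d"
      have "Cu * r \<le> C * r" "Cv * r \<le> C * r" using r by (auto simp: C_def intro!: mult_right_mono)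
      moreover have "Cu \<le> C" "Cv \<le> C" by (auto simp: C_def)
      ultimately show "0 \<le> u' r \<and> u' r \<le> C \<and> u r \<le> C * r \<and> 0 \<le> v' r \<and> v' r \<le> C \<and> v r \<le> C * r"
        using Cu(3)[of r] Cv(3)[of r] r unfolding d_def min_less_iff_conj by (meson order_trans)
    qed
    have d: "d > 0" using Cu Cv by (simp add: d_def)
    have umono: "u s \<le> u r" if "0 < s" "s \<le> r" "r < d" for r s
      by (rule deriv_nonneg_imp_le[OF that(2) du]) (use that Cuv in auto)
    have ul: "(u \<longlongrightarrow> 0) (at_right 0)" and vl: "(v \<longlongrightarrow> 0) (at_right 0)"
      using pu pv by (auto simp: profile_def)
    have Wl: "(W \<longlongrightarrow> 0) (at_right 0)"
    proof (rule Lim_null_comparison)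
      show "eventually (\<lambda>r. norm (W r) \<le> C * u r + C * v r) (at_right 0)"
        unfolding eventually_at_right_field
      proof (intro exI[of _ d] conjI allI impI d)
        fix r assume r: "0 < r" "r < d"
        have "\<bar>v' r * u r\<bar> \<le> C * u r" "\<bar>u' r * v r\<bar> \<le> C * v r"
          unfolding abs_mult using Cuv[OF r] posu[OF r(1)] posv[OF r(1)] by (auto intro!: mult_mono)
        then show "norm (W r) \<le> C * u r + C * v r" by (simp add: W_def)
      qed
      show "((\<lambda>r. C * u r + C * v r) \<longlongrightarrow> 0) (at_right 0)" by (rule tendsto_eq_intros ul vl refl)+ simp
    qed
    have W'b: "\<bar>W' s\<bar> \<le> 2 * C^3 * s * u r" if "0 < s" "s \<le> r" "r < d" for s r
    proof -
      have us: "0 < u s" "u s \<le> C * s" "0 < v s" "v s \<le> C * s" using Cuv[of s] posu[of s] posv[of s] that by auto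
      have "\<bar>(u s)\<^sup>2 - (v s)\<^sup>2\<bar> \<le> (C * s)\<^sup>2 + (C * s)\<^sup>2"
        using power_mono[of "u s" "C * s" 2] power_mono[of "v s" "C * s" 2] us zero_le_power2[of "u s"] zero_le_power2[of "v s"]
        unfolding abs_le_iff by linarith
      then have "\<bar>u s * v s * ((u s)\<^sup>2 - (v s)\<^sup>2)\<bar> \<le> u r * (C * s) * ((C * s)\<^sup>2 + (C * s)\<^sup>2)"
        unfolding abs_mult using us umono[of s r] that C by (intro mult_mono) auto
      then have "\<bar>W' s\<bar> \<le> u r * (C * s) * ((C * s)\<^sup>2 + (C * s)\<^sup>2) / s\<^sup>2"
        unfolding W'_def abs_divide by (simp add: divide_right_mono)
      also have "\<dots> = 2 * C^3 * s * u r" using that by (simp add: field_simps power2_eq_square power3_eq_cube)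
      finally show ?thesis .
    qed
    have Wb: "\<bar>W r\<bar> \<le> 2 * C^3 * r\<^sup>2 * u r" if r: "0 < r" "r < d" for r
    proof -
      have step: "\<bar>W r - W s\<bar> \<le> 2 * C^3 * r\<^sup>2 * u r" if s: "0 < s" "s < r" for s
      proof -
        obtain z where z: "s < z" "z < r" "W r - W s = (r - s) * W' z"
          using MVT2[OF s(2), of W W'] dW s(1) by (meson less_le_trans)
        have "\<bar>W' z\<bar> \<le> 2 * C^3 * z * u r" using z s r by (intro W'b) auto
        also have "\<dots> \<le> 2 * C^3 * r * u r" using z C posu[OF r(1)] by (intro mult_right_mono mult_left_mono) auto
        finally have "\<bar>W r - W s\<bar> \<le> r * (2 * C^3 * r * u r)"
          unfolding z(3) abs_mult using s r by (intro mult_mono) auto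
        then show ?thesis by (simp add: power2_eq_square mult_ac)
      qed
      have "eventually (\<lambda>s. \<bar>W r - W s\<bar> \<le> 2 * C^3 * r\<^sup>2 * u r) (at_right 0)"
        unfolding eventually_at_right_field using step r by (intro exI[of _ r]) auto
      moreover have "((\<lambda>s. \<bar>W r - W s\<bar>) \<longlongrightarrow> \<bar>W r - 0\<bar>) (at_right 0)"
        by (intro tendsto_intros Wl)
      ultimately have "\<bar>W r - 0\<bar> \<le> 2 * C^3 * r\<^sup>2 * u r"
        by (intro tendsto_upperbound[where F = "at_right (0::real)"]) simp_all
      then show ?thesis by simp
    qed
    show ?thesis
    proof (rule Lim_null_comparison)
      let ?b = "\<lambda>r. r powr (2/3) * (1/2 * ((2 * C^3 * r\<^sup>2) * ((2 * C^3 * r\<^sup>2) + 2 * C)) + 1/3 * ((C * r) * (2 * C^3 * r\<^sup>2) * (1/r))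
         + 1/4 * ((C * r)\<^sup>2 * ((C * r)\<^sup>2 + (C * r)\<^sup>2) * (1/r)\<^sup>2))"
      show "eventually (\<lambda>r. norm (X r) \<le> ?b r) (at_right 0)"
        unfolding eventually_at_right_field
      proof (intro exI[of _ d] conjI allI impI d)
        fix r assume r: "0 < r" "r < d"
        have "\<bar>p r\<bar> \<le> 2 * C^3 * r\<^sup>2" using Wb[OF r] posu[OF r(1)]
          by (simp add: p_def abs_divide divide_le_eq)
        then show "norm (X r) \<le> ?b r" using Cuv[OF r] r
          unfolding real_norm_def by (intro X_abs) auto
      qed
      show "(?b \<longlongrightarrow> 0) (at_right 0)" using C by real_asymp
    qed
  qed
  \<comment> \<open>The mirror image: near infinity u decreases, so u(r) dominates u on [r,
    \<infinity>), and |W'(s)| \<le> 2 C^3 u(r) / s^2 is integrated back from infinity.\<close>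
  have Xlim1: "(X \<longlongrightarrow> 0) at_top"
  proof -
    define C where "C = max Du Dv"
    define R where "R = max 1 (max R1 R2)"
    let ?e = "\<lambda>r::real. C * exp (-r/2)"
    have C: "C > 0" using Du by (simp add: C_def)
    have R: "R \<ge> 1" by (simp add: R_def)
    have Cuv: "u' r < 0 \<and> \<bar>u' r\<bar> \<le> ?e r \<and> u r \<le> ?e r \<and> \<bar>v' r\<bar> \<le> ?e r \<and> v r \<le> ?e r" if "r \<ge> R" for r
    proof -
      have "Du * exp (-r/2) \<le> ?e r" "Dv * exp (-r/2) \<le> ?e r" by (auto simp: C_def intro!: mult_right_mono)
      moreover have "r \<ge> R1" "r \<ge> R2" using that by (auto simp: R_def)
      ultimately show ?thesis using Du(3)[of r] Dv(3)[of r] by (meson order_trans)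
    qed
    have umono: "u s \<le> u r" if "R \<le> r" "r \<le> s" for r s
      by (rule deriv_nonpos_imp_ge[OF that(2) du]) (use that R Cuv in \<open>auto intro: less_imp_le\<close>)
    have el: "?e r \<le> C" if "r \<ge> 0" for r :: real
      using C that by simp
    have Wl: "(W \<longlongrightarrow> 0) at_top"
    proof (rule Lim_null_comparison)
      show "eventually (\<lambda>r. norm (W r) \<le> ?e r * ?e r + ?e r * ?e r) at_top"
        unfolding eventually_at_top_linorder
      proof (intro exI[of _ R] allI impI)
        fix r assume r: "R \<le> r"
        have "\<bar>v' r * u r\<bar> \<le> ?e r * ?e r" "\<bar>u' r * v r\<bar> \<le> ?e r * ?e r"
        proof -
          have b: "\<bar>u' r\<bar> \<le> ?e r" "\<bar>v' r\<bar> \<le> ?e r" using Cuv[OF r] by blast+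
          have b': "\<bar>u r\<bar> \<le> ?e r" "\<bar>v r\<bar> \<le> ?e r" "0 \<le> ?e r"
            using Cuv[OF r] posu[of r] posv[of r] r R C by linarith+
          note b = b b'
          show "\<bar>v' r * u r\<bar> \<le> ?e r * ?e r" "\<bar>u' r * v r\<bar> \<le> ?e r * ?e r"
            unfolding abs_mult by (intro mult_mono b abs_ge_zero)+
        qed
        then have "\<bar>W r\<bar> \<le> ?e r * ?e r + ?e r * ?e r" unfolding W_def by linarith
        then show "norm (W r) \<le> ?e r * ?e r + ?e r * ?e r" unfolding real_norm_def .
      qed
      show "((\<lambda>r. ?e r * ?e r + ?e r * ?e r) \<longlongrightarrow> 0) at_top" using C by real_asymp
    qed
    have W'b: "\<bar>W' s\<bar> \<le> 2 * C^3 * u r / s\<^sup>2" if "R \<le> r" "r \<le> s" for s r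
    proof -
      have us: "0 < u s" "u s \<le> C" "0 < v s" "v s \<le> C" using Cuv[of s] posu[of s] posv[of s] that el[of s] R by auto
      have "\<bar>(u s)\<^sup>2 - (v s)\<^sup>2\<bar> \<le> C\<^sup>2 + C\<^sup>2"
        using power_mono[of "u s" C 2] power_mono[of "v s" C 2] us zero_le_power2[of "u s"] zero_le_power2[of "v s"]
        unfolding abs_le_iff by linarith
      then have "\<bar>u s * v s * ((u s)\<^sup>2 - (v s)\<^sup>2)\<bar> \<le> u r * C * (C\<^sup>2 + C\<^sup>2)"
        unfolding abs_mult using us umono[of r s] that C by (intro mult_mono) auto
      then have "\<bar>W' s\<bar> \<le> u r * C * (C\<^sup>2 + C\<^sup>2) / s\<^sup>2"
        unfolding W'_def abs_divide by (simp add: divide_right_mono)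
      also have "\<dots> = 2 * C^3 * u r / s\<^sup>2" by (simp add: power2_eq_square power3_eq_cube)
      finally show ?thesis .
    qed
    have Wb: "\<bar>W r\<bar> \<le> 2 * C^3 * u r / r" if r: "R \<le> r" for r
    proof -
      \<comment> \<open>K/s is a barrier whose derivative matches the bound on W': W - K/s increases
        and W + K/s decreases, and both tend to 0.\<close>
      define K where "K = 2 * C^3 * u r"
      have dK: "((\<lambda>s. K / s) has_real_derivative (- (K / s\<^sup>2))) (at s)" if "s \<ge> r" for s
        using that r R by (auto intro!: derivative_eq_intros simp: power2_eq_square)
      have Kl: "((\<lambda>s. K / s) \<longlongrightarrow> 0) at_top" by real_asymp
      have 1: "W r - K / r \<le> W s - K / s" if s: "r \<le> s" for s
      proof (rule deriv_nonneg_imp_le[OF s DERIV_diff[OF dW dK]])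
        fix x assume "r < x"
        then show "0 \<le> W' x - - (K / x\<^sup>2)" using W'b[of r x] r by (auto simp: K_def)
      qed (use r R in auto)
      have 2: "W s + K / s \<le> W r + K / r" if s: "r \<le> s" for s
      proof (rule deriv_nonpos_imp_ge[OF s DERIV_add[OF dW dK]])
        fix x assume "r < x"
        then show "W' x + - (K / x\<^sup>2) \<le> 0" using W'b[of r x] r by (auto simp: K_def)
      qed (use r R in auto)
      have l: "((\<lambda>s. W s - K / s) \<longlongrightarrow> 0 - 0) at_top" "((\<lambda>s. W s + K / s) \<longlongrightarrow> 0 + 0) at_top"
        by (intro tendsto_intros Wl Kl)+
      have e: "eventually (\<lambda>s. W r - K / r \<le> W s - K / s) at_top" "eventually (\<lambda>s. W s + K / s \<le> W r + K / r) at_top"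
        unfolding eventually_at_top_linorder using 1 2 by blast+
      have "W r - K / r \<le> 0 - 0" by (rule tendsto_lowerbound[OF l(1) e(1)]) simp
      moreover have "0 + 0 \<le> W r + K / r" by (rule tendsto_upperbound[OF l(2) e(2)]) simp
      ultimately show ?thesis by (simp add: K_def)
    qed
    show ?thesis
    proof (rule Lim_null_comparison)
      let ?b = "\<lambda>r. r powr (2/3) * (1/2 * ((2 * C^3 / r) * ((2 * C^3 / r) + 2 * ?e r)) + 1/3 * (?e r * (2 * C^3 / r) * (1/r))
         + 1/4 * ((?e r)\<^sup>2 * ((?e r)\<^sup>2 + (?e r)\<^sup>2) * (1/r)\<^sup>2))"
      show "eventually (\<lambda>r. norm (X r) \<le> ?b r) at_top"
        unfolding eventually_at_top_linorder
      proof (intro exI[of _ R] allI impI)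
        fix r assume r: "R \<le> r"
        then have r0: "r > 0" using R by simp
        have "\<bar>p r\<bar> \<le> 2 * C^3 / r" using Wb[OF r] posu[OF r0]
          by (simp add: p_def abs_divide divide_le_eq)
        then show "norm (X r) \<le> ?b r" using Cuv[OF r] r0
          unfolding real_norm_def by (intro X_abs) auto
      qed
      show "(?b \<longlongrightarrow> 0) at_top" using C by real_asymp
    qed
  qed
  assume "\<not> v' r0 * u r0 - u' r0 * v r0 \<le> 0"
  then have W0: "W r0 > 0" by (simp add: W_def)
  have "X r0 > 0"
  proof (cases "\<exists>b. 0 < b \<and> b < r0 \<and> W b \<le> 0")
    case True
    then obtain b where b: "0 < b" "b < r0" "W b \<le> 0" by blast
    obtain z where z: "b \<le> z" "z < r0" "W z = 0" "\<And>y. \<lbrakk>z < y; y \<le> r0\<rbrakk> \<Longrightarrow> W y > 0"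
    proof (rule last_zero_before_pos[OF contW b(2,3) W0])
      show "{b..r0} \<subseteq> {0<..}" using b(1) by auto
    qed blast
    have z0: "z > 0" using z b by simp
    have "W' z \<ge> 0"
    proof (rule ccontr)
      assume "\<not> W' z \<ge> 0"
      then have "W' z < 0" by simp
      from DERIV_neg_dec_right[OF dW[OF z0] this] obtain e where e: "e > 0" "\<forall>h>0. h < e \<longrightarrow> W (z + h) < W z" by blast
      define h where "h = min (e/2) ((r0 - z)/2)"
      have h: "h > 0" "h < e" "h < r0 - z" using e(1) z(1,2) by (simp_all add: h_def min_def)
      then have "W (z + h) < 0" using e(2) z(3) by metis
      then show False using h z(4)[of "z + h"] by simp
    qed
    then have "0 \<le> X z" using X0[OF z0 z(3)] by simp
    also have "X z < X r0" by (rule Xinc[OF z0 z(2)]) (use z(4) in auto)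
    finally show ?thesis .
  next
    case False
    show ?thesis
    proof (rule pos_if_strict_increasing_from_0[OF Xlim0 r0])
      fix x y assume xy: "0 < x" "x < y" "y \<le> r0"
      show "X x < X y"
      proof (rule Xinc[OF xy(1,2)])
        fix z assume "x < z" "z < y"
        then have "0 < z" "z < r0" using xy by auto
        then show "W z > 0" using False not_le by blast
      qed
    qed
  qed
  moreover have "X r0 < 0"
  proof (cases "\<exists>b. b > r0 \<and> W b \<le> 0")
    case True
    then obtain b where b: "r0 < b" "W b \<le> 0" by blast
    obtain z where z: "r0 < z" "z \<le> b" "W z = 0" "\<And>y. \<lbrakk>r0 \<le> y; y < z\<rbrakk> \<Longrightarrow> W y > 0"
    proof (rule first_zero_after_pos[OF contW b W0])
      show "{r0..b} \<subseteq> {0<..}" using r0 by auto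
    qed blast
    have z0: "z > 0" using z r0 by simp
    have "W' z \<le> 0"
    proof (rule ccontr)
      assume "\<not> W' z \<le> 0"
      then have "W' z > 0" by simp
      from DERIV_pos_inc_left[OF dW[OF z0] this] obtain e where e: "e > 0" "\<forall>h>0. h < e \<longrightarrow> W (z - h) < W z" by blast
      define h where "h = min (e/2) ((z - r0)/2)"
      have h: "h > 0" "h < e" "h < z - r0" using e(1) z(1,2) by (simp_all add: h_def min_def)
      then have "W (z - h) < 0" using e(2) z(3) by metis
      then show False using h z(4)[of "z - h"] by simp
    qed
    then have "X z \<le> 0" using X1[OF z0 z(3)] by simp
    moreover have "X r0 < X z" by (rule Xinc[OF r0 z(1)]) (use z(4) in auto)
    ultimately show ?thesis by simp
  next
    case False
    show ?thesis
    proof (rule neg_if_strict_increasing_to_0[OF Xlim1])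
      fix x y assume xy: "r0 \<le> x" "x < y"
      show "X x < X y"
      proof (rule Xinc)
        fix z assume "x < z" "z < y"
        then have "z > r0" using xy by auto
        then show "W z > 0" using False not_le by blast
      qed (use xy r0 in auto)
    qed
  qed
  ultimately show False by simp
qed

text \<open>That W vanishes gives only proportionality; that its derivative u v (u^2 - v^2) / r^2
  vanishes as well fixes the factor to be 1.\<close>

theorem profile_unique:
  assumes a: "a > 0" and pu: "profile a u u'" and pv: "profile a v v'" and r: "r > 0"
  shows "u r = v r"
proof -
  have posu: "u r > 0" and du: "(u has_real_derivative u' r) (at r)"
    and ddu: "(u' has_real_derivative ((1 + a/r\<^sup>2) * u r - (u r)^3/r\<^sup>2)) (at r)" if "r > 0" for r
    using pu that by (auto simp: profile_def)
  have posv: "v r > 0" and dv: "(v has_real_derivative v' r) (at r)"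
    and ddv: "(v' has_real_derivative ((1 + a/r\<^sup>2) * v r - (v r)^3/r\<^sup>2)) (at r)" if "r > 0" for r
    using pv that by (auto simp: profile_def)
  have W: "v' s * u s - u' s * v s = 0" if "s > 0" for s
    using wronskian_not_pos[OF a pu pv that] wronskian_not_pos[OF a pv pu that] by linarith
  let ?D = "((1 + a/r\<^sup>2) * v r - (v r)^3/r\<^sup>2) * u r + u' r * v' r
        - (((1 + a/r\<^sup>2) * u r - (u r)^3/r\<^sup>2) * v r + v' r * u' r)"
  have "((\<lambda>s. v' s * u s - u' s * v s) has_real_derivative ?D) (at r)"
    by (intro DERIV_diff DERIV_mult du dv ddu ddv r)
  moreover have "((\<lambda>s. v' s * u s - u' s * v s) has_real_derivative 0) (at r)"
    by (rule has_field_derivative_transform_within_open[of "\<lambda>_. 0" _ _ "{0<..}"]) (use r W in auto)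
  ultimately have "?D = 0" by (rule DERIV_unique)
  moreover have "?D = u r * v r * ((u r)\<^sup>2 - (v r)\<^sup>2) / r\<^sup>2"
    by (rule wronskian_deriv_eq)
  ultimately have "(u r)\<^sup>2 = (v r)\<^sup>2" using posu[OF r] posv[OF r] r by simp
  then show ?thesis using posu[OF r] posv[OF r] by (simp add: power2_eq_iff_nonneg)
qed

section \<open>Shooting from the origin\<close>

text \<open>Gronwall in both directions: e = u^2 + u'^2 satisfies |e'| \<le> (1 + B) e, so e
  exp(-(1+B) t) decreases and e exp((1+B) t) increases, and e vanishes at \<open>x\<close>.\<close>

lemma linear_ode_zero:
  fixes u u' b :: "real \<Rightarrow> real"
  assumes bnd: "\<And>t. t \<in> {c..d} \<Longrightarrow> \<bar>b t\<bar> \<le> B"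
    and du: "\<And>t. t \<in> {c..d} \<Longrightarrow> (u has_real_derivative u' t) (at t)"
    and du': "\<And>t. t \<in> {c..d} \<Longrightarrow> (u' has_real_derivative b t * u t) (at t)"
    and x: "x \<in> {c..d}" "u x = 0" "u' x = 0" and y: "y \<in> {c..d}"
  shows "u y = 0"
proof -
  define e where "e = (\<lambda>t. (u t)\<^sup>2 + (u' t)\<^sup>2)"
  have de: "(e has_real_derivative 2 * (u t * u' t) * (1 + b t)) (at t)" if "t \<in> {c..d}" for t
    unfolding e_def
    by (rule DERIV_cong[OF DERIV_add[OF DERIV_power[OF du[OF that]] DERIV_power[OF du'[OF that]]]])
       (simp add: algebra_simps)
  have e0: "e t \<ge> 0" for t by (simp add: e_def)
  have B: "B \<ge> 0" using bnd[OF x(1)] by simp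
  have b: "\<bar>2 * (u t * u' t) * (1 + b t)\<bar> \<le> (1 + B) * e t" if "t \<in> {c..d}" for t
  proof -
    have "\<bar>2 * (u t * u' t)\<bar> \<le> e t"
      using sum_squares_ge_zero[of "u t + u' t" 0] sum_squares_ge_zero[of "u t - u' t" 0]
      by (simp add: e_def abs_le_iff power2_eq_square algebra_simps)
    moreover have "\<bar>1 + b t\<bar> \<le> 1 + B" using bnd[OF that] by simp
    ultimately have "\<bar>2 * (u t * u' t)\<bar> * \<bar>1 + b t\<bar> \<le> e t * (1 + B)" using e0 by (intro mult_mono) auto
    then show ?thesis by (simp only: abs_mult mult.commute)
  qed
  have "e y \<le> 0"
  proof (cases "x \<le> y")
    case True
    have "e y * exp (- (1 + B) * y) \<le> e x * exp (- (1 + B) * x)"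
    proof (rule deriv_nonpos_imp_ge[OF True])
      fix t assume t: "x \<le> t" "t \<le> y"
      then have "t \<in> {c..d}" using x y by auto
      from de[OF this] show "((\<lambda>t. e t * exp (- (1 + B) * t)) has_real_derivative
          (2 * (u t * u' t) * (1 + b t) - (1 + B) * e t) * exp (- (1 + B) * t)) (at t)"
        by (auto intro!: derivative_eq_intros simp: algebra_simps)
    next
      fix t assume t: "x < t" "t < y"
      then have "t \<in> {c..d}" using x y by auto
      from b[OF this] show "(2 * (u t * u' t) * (1 + b t) - (1 + B) * e t) * exp (- (1 + B) * t) \<le> 0"
        by (intro mult_nonpos_nonneg) auto
    qed
    then show ?thesis using x by (simp add: e_def mult_le_0_iff)
  next
    case False
    then have yx: "y \<le> x" by simp
    have "e y * exp ((1 + B) * y) \<le> e x * exp ((1 + B) * x)"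
    proof (rule deriv_nonneg_imp_le[OF yx])
      fix t assume t: "y \<le> t" "t \<le> x"
      then have "t \<in> {c..d}" using x y by auto
      from de[OF this] show "((\<lambda>t. e t * exp ((1 + B) * t)) has_real_derivative
          (2 * (u t * u' t) * (1 + b t) + (1 + B) * e t) * exp ((1 + B) * t)) (at t)"
        by (auto intro!: derivative_eq_intros simp: algebra_simps)
    next
      fix t assume t: "y < t" "t < x"
      then have "t \<in> {c..d}" using x y by auto
      from b[OF this] show "0 \<le> (2 * (u t * u' t) * (1 + b t) + (1 + B) * e t) * exp ((1 + B) * t)"
        by (intro mult_nonneg_nonneg) auto
    qed
    then show ?thesis using x by (simp add: e_def mult_le_0_iff)
  qed
  then have "(u y)\<^sup>2 + (u' y)\<^sup>2 \<le> 0" by (simp add: e_def)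
  then show ?thesis by (simp add: sum_power2_le_zero_iff)
qed

lemma continuous_on_atLeastI:
  fixes f :: "real \<Rightarrow> real"
  assumes "\<And>R. R > 0 \<Longrightarrow> continuous_on {0..R} f"
  shows "continuous_on {0..} f"
proof (unfold continuous_on_eq_continuous_within, intro ballI)
  fix x :: real assume x: "x \<in> {0..}"
  have e: "at x within {0..} = at x within {0..x+1}"
    by (rule at_within_nhd[of x "{..<x+1}"]) auto
  have "continuous_on {0..x+1} f" using x by (intro assms) auto
  then have "continuous (at x within {0..x+1}) f" using x by (auto simp: continuous_on_eq_continuous_within)
  then show "continuous (at x within {0..}) f" by (simp only: e)
qed

lemma integral_from_0_deriv:
  fixes f :: "real \<Rightarrow> real"
  assumes "continuous_on {0..} f" "r > 0"
  shows "((\<lambda>x. integral {0..x} f) has_real_derivative f r) (at r)"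
proof -
  have "continuous_on {0..r+1} f" by (rule continuous_on_subset[OF assms(1)]) auto
  then have "((\<lambda>x. integral {0..x} f) has_real_derivative f r) (at r within {0..r+1})"
    using assms(2) by (intro integral_has_real_derivative) auto
  then show ?thesis using assms(2) by (simp add: at_within_Icc_at)
qed

lemma integral_from_0_continuous:
  fixes f :: "real \<Rightarrow> real"
  assumes "continuous_on {0..} f"
  shows "continuous_on {0..} (\<lambda>x. integral {0..x} f)"
  by (intro continuous_on_atLeastI indefinite_integral_continuous_1 integrable_continuous_real
      continuous_on_subset[OF assms]) auto

lemma integrable_from_0:
  fixes f :: "real \<Rightarrow> real"
  assumes "continuous_on {0..} f"
  shows "f integrable_on {0..r}"
  by (intro integrable_continuous_real continuous_on_subset[OF assms]) auto

section \<open>Inversion of the singular radial operator\<close>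

context
  fixes \<alpha> :: real
  assumes \<alpha>: "\<alpha> > 1"
begin

text \<open>For u = r^\<alpha> y with \<alpha>^2 - \<alpha> = a the term a/r^2 cancels and the
  equation becomes (r^(2\<alpha>) y')' = r^(2\<alpha>) f. Thus \<open>rint f\<close> is the flux
  r^(2\<alpha>) y', and \<open>rmean f\<close> below is y' itself.\<close>

definition rint :: "(real \<Rightarrow> real) \<Rightarrow> real \<Rightarrow> real" where
  "rint f r = integral {0..r} (\<lambda>w. w powr (2*\<alpha>) * f w)"

definition rmean :: "(real \<Rightarrow> real) \<Rightarrow> real \<Rightarrow> real" where
  "rmean f r = r powr (- 2*\<alpha>) * rint f r"

lemma cont_powr: "c > 0 \<Longrightarrow> continuous_on {0..} (\<lambda>w::real. w powr c)"
  by (intro continuous_on_powr' continuous_intros) auto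

lemma cont_rint_integrand:
  "continuous_on {0..} f \<Longrightarrow> continuous_on {0..} (\<lambda>w. w powr (2*\<alpha>) * f w)"
  using \<alpha> by (intro continuous_on_mult cont_powr) auto

lemma rint_deriv: "\<lbrakk>continuous_on {0..} f; r > 0\<rbrakk> \<Longrightarrow> (rint f has_real_derivative r powr (2*\<alpha>) * f r) (at r)"
  unfolding rint_def[abs_def] by (intro integral_from_0_deriv cont_rint_integrand)

lemma cont_rint: "continuous_on {0..} f \<Longrightarrow> continuous_on {0..} (rint f)"
  unfolding rint_def[abs_def] by (intro integral_from_0_continuous cont_rint_integrand)

lemma rint_0: "rint f 0 = 0" by (simp add: rint_def)

lemma rint_eq_rmean: "r > 0 \<Longrightarrow> rint f r = r powr (2*\<alpha>) * rmean f r"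
  by (simp add: rmean_def powr_minus)

lemma rint_nonneg: "\<lbrakk>continuous_on {0..} f; \<And>w. \<lbrakk>0 \<le> w; w \<le> r\<rbrakk> \<Longrightarrow> 0 \<le> f w\<rbrakk> \<Longrightarrow> 0 \<le> rint f r"
  unfolding rint_def by (intro integral_nonneg integrable_from_0 cont_rint_integrand) auto

lemma rint_diff: "\<lbrakk>continuous_on {0..} f; continuous_on {0..} g\<rbrakk> \<Longrightarrow> rint (\<lambda>w. f w - g w) r = rint f r - rint g r"
  unfolding rint_def right_diff_distrib
  by (intro Henstock_Kurzweil_Integration.integral_diff integrable_from_0 cont_rint_integrand)

text \<open>The kernel w^(2\<alpha>) r^(-2\<alpha>) is at most 1 for w \<le> r, which absorbs the
  singular factor r^(-2\<alpha>).\<close>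

lemma abs_rmean_le:
  assumes f: "continuous_on {0..} f" and g: "continuous_on {0..} g" and r: "r \<ge> 0"
    and fg: "\<And>w. \<lbrakk>0 \<le> w; w \<le> r\<rbrakk> \<Longrightarrow> \<bar>f w\<bar> \<le> g w"
  shows "\<bar>rmean f r\<bar> \<le> integral {0..r} g"
proof (cases "r = 0")
  case True then show ?thesis by (simp add: rmean_def rint_0)
next
  case False
  then have r: "r > 0" using r by simp
  have "\<bar>rint f r\<bar> \<le> integral {0..r} (\<lambda>w. r powr (2*\<alpha>) * g w)"
    unfolding rint_def real_norm_def[symmetric]
  proof (rule integral_norm_bound_integral)
    fix w assume "w \<in> {0..r}"
    then have w: "0 \<le> w" "w \<le> r" by auto
    have "w powr (2*\<alpha>) \<le> r powr (2*\<alpha>)" using w \<alpha> by (intro powr_mono2) auto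
    then show "norm (w powr (2*\<alpha>) * f w) \<le> r powr (2*\<alpha>) * g w"
      unfolding real_norm_def abs_mult using fg[OF w] by (intro mult_mono) auto
  qed (intro integrable_from_0 cont_rint_integrand f g continuous_intros)+
  also have "\<dots> = r powr (2*\<alpha>) * integral {0..r} g" by simp
  finally have "r powr (- 2*\<alpha>) * \<bar>rint f r\<bar> \<le> r powr (- 2*\<alpha>) * (r powr (2*\<alpha>) * integral {0..r} g)"
    by (rule mult_left_mono) simp
  also have "\<dots> = (r powr (- 2*\<alpha>) * r powr (2*\<alpha>)) * integral {0..r} g" by simp
  also have "r powr (- 2*\<alpha>) * r powr (2*\<alpha>) = 1" using r by (simp add: powr_add[symmetric])
  finally show ?thesis by (simp add: rmean_def abs_mult)
qed

lemma rmean_diff: "\<lbrakk>continuous_on {0..} f; continuous_on {0..} g\<rbrakk> \<Longrightarrow> rmean (\<lambda>w. f w - g w) r = rmean f r - rmean g r"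
  by (simp add: rmean_def rint_diff right_diff_distrib)

text \<open>Only r = 0 is delicate. The value there is 0, and it is the limit because
  \<open>abs_rmean_le\<close> bounds the function by the integral of |f| over [0, r].\<close>

lemma cont_rmean:
  assumes f: "continuous_on {0..} f"
  shows "continuous_on {0..} (rmean f)"
proof (unfold continuous_on_eq_continuous_within, intro ballI)
  fix x :: real assume x: "x \<in> {0..}"
  show "continuous (at x within {0..}) (rmean f)"
  proof (cases "x = 0")
    case False
    then have "x > 0" using x by simp
    then have "(rint f has_real_derivative x powr (2*\<alpha>) * f x) (at x)" by (intro rint_deriv f)
    then have "isCont (rint f) x" by (rule DERIV_isCont)
    then have "isCont (rmean f) x" unfolding rmean_def[abs_def]
      using \<open>x > 0\<close> by (intro continuous_intros) auto
    then show ?thesis by (rule continuous_at_imp_continuous_at_within)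
  next
    case True
    have c: "continuous_on {0..} (\<lambda>x. integral {0..x} (\<lambda>w. \<bar>f w\<bar>))"
      by (intro integral_from_0_continuous continuous_intros f)
    have "((\<lambda>x. integral {0..x} (\<lambda>w. \<bar>f w\<bar>)) \<longlongrightarrow> 0) (at 0 within {0..})"
      using c by (auto simp: continuous_on_def dest: bspec[of _ _ 0])
    moreover have "eventually (\<lambda>x. norm (rmean f x) \<le> integral {0..x} (\<lambda>w. \<bar>f w\<bar>)) (at 0 within {0..})"
      unfolding eventually_at_topological
      by (intro exI[of _ UNIV]) (auto intro!: abs_rmean_le f continuous_intros)
    ultimately have "(rmean f \<longlongrightarrow> 0) (at 0 within {0..})" by (rule Lim_null_comparison[rotated])
    then show ?thesis unfolding True continuous_within by (simp add: rmean_def rint_0)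
  qed
qed

text \<open>The truncation makes the right-hand side globally Lipschitz in \<open>y\<close>; it is inactive on the solution,
  which stays below \<open>exp\<close> (see \<open>ysol_le_exp\<close>). The weight \<open>wt\<close> turns the integral equation into a contraction.\<close>

definition clip :: "real \<Rightarrow> real \<Rightarrow> real" where
  "clip w y = min (max y 0) (exp w)"

text \<open>\<open>v\<close> is the parameter t. The power 2\<alpha> - 2 comes from u^3/r^2 =
  r^\<alpha> r^(2\<alpha> - 2) y^3 for u = r^\<alpha> y. Only the cubic term is truncated, the
  linear one being Lipschitz already.\<close>

definition rhs :: "real \<Rightarrow> real \<Rightarrow> real \<Rightarrow> real" where
  "rhs v w y = (1 - v) * y - v * (w powr (2*\<alpha> - 2) * (clip w y)^3)"

definition lip :: "real \<Rightarrow> real" where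
  "lip w = 1 + w powr (2*\<alpha> - 2) * (3 * (exp w)\<^sup>2)"

definition wt :: "real \<Rightarrow> real" where
  "wt r = exp (integral {0..r} (\<lambda>w. 2 * (1 + lip w)))"

lemma lip_ge: "lip w \<ge> 1" by (simp add: lip_def)

lemma cont_lip: "continuous_on {0..} lip"
  unfolding lip_def[abs_def] using \<alpha> by (intro continuous_intros cont_powr) auto

lemma clip_lipschitz: "\<bar>(clip w y)^3 - (clip w z)^3\<bar> \<le> 3 * (exp w)\<^sup>2 * \<bar>y - z\<bar>"
proof -
  define p q M where "p = clip w y" and "q = clip w z" and "M = exp w"
  have M: "M > 0" by (simp add: M_def)
  have p: "0 \<le> p" "p \<le> M" "0 \<le> q" "q \<le> M" by (auto simp: p_def q_def clip_def M_def)
  have pq: "\<bar>p - q\<bar> \<le> \<bar>y - z\<bar>" unfolding p_def q_def clip_def M_def[symmetric] using M by (simp add: min_def max_def)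
  have "p^3 - q^3 = (p\<^sup>2 + p * q + q\<^sup>2) * (p - q)" by (simp add: algebra_simps power2_eq_square power3_eq_cube)
  then have "\<bar>p^3 - q^3\<bar> = \<bar>p\<^sup>2 + p * q + q\<^sup>2\<bar> * \<bar>p - q\<bar>" by (simp add: abs_mult)
  also have "\<dots> \<le> (3 * M\<^sup>2) * \<bar>y - z\<bar>"
  proof (intro mult_mono pq)
    have "p\<^sup>2 \<le> M\<^sup>2" "q\<^sup>2 \<le> M\<^sup>2" "p * q \<le> M * M" using p by (auto intro!: power_mono mult_mono)
    then show "\<bar>p\<^sup>2 + p * q + q\<^sup>2\<bar> \<le> 3 * M\<^sup>2" using p by (simp add: power2_eq_square)
  qed auto
  finally show ?thesis by (simp add: p_def q_def M_def)
qed

lemma clip_bound: "\<bar>(clip w y)^3\<bar> \<le> 3 * (exp w)\<^sup>2 * \<bar>y\<bar>"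
  using clip_lipschitz[of w y 0] by (simp add: clip_def min_def)

lemma rhs_lipschitz:
  assumes "0 \<le> v" "v \<le> 1"
  shows "\<bar>rhs v w y - rhs v w z\<bar> \<le> lip w * \<bar>y - z\<bar>"
proof -
  have 1: "\<bar>(1 - v) * (y - z)\<bar> \<le> 1 * \<bar>y - z\<bar>" unfolding abs_mult using assms by (intro mult_right_mono) auto
  have 2: "\<bar>v * (w powr (2*\<alpha> - 2) * ((clip w y)^3 - (clip w z)^3))\<bar> \<le> 1 * (w powr (2*\<alpha> - 2) * (3 * (exp w)\<^sup>2 * \<bar>y - z\<bar>))"
    unfolding abs_mult using assms clip_lipschitz by (intro mult_mono) auto
  have "rhs v w y - rhs v w z = (1 - v) * (y - z) - v * (w powr (2*\<alpha> - 2) * ((clip w y)^3 - (clip w z)^3))"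
    by (simp add: rhs_def algebra_simps)
  then have "\<bar>rhs v w y - rhs v w z\<bar> \<le> 1 * \<bar>y - z\<bar> + 1 * (w powr (2*\<alpha> - 2) * (3 * (exp w)\<^sup>2 * \<bar>y - z\<bar>))"
    using 1 2 by linarith
  then show ?thesis by (simp add: lip_def distrib_right mult.assoc)
qed

lemma rhs_param:
  "\<bar>rhs v w y - rhs v' w y\<bar> \<le> \<bar>v - v'\<bar> * (lip w * \<bar>y\<bar>)"
proof -
  have 2: "\<bar>w powr (2*\<alpha> - 2) * (clip w y)^3\<bar> \<le> w powr (2*\<alpha> - 2) * (3 * (exp w)\<^sup>2 * \<bar>y\<bar>)"
    unfolding abs_mult[of "_ powr _"] using clip_bound by (intro mult_mono) auto
  have "rhs v w y - rhs v' w y = (v' - v) * (y + w powr (2*\<alpha> - 2) * (clip w y)^3)"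
    by (simp add: rhs_def algebra_simps)
  then have "\<bar>rhs v w y - rhs v' w y\<bar> = \<bar>v - v'\<bar> * \<bar>y + w powr (2*\<alpha> - 2) * (clip w y)^3\<bar>"
    by (simp add: abs_mult abs_minus_commute)
  also have "\<dots> \<le> \<bar>v - v'\<bar> * (\<bar>y\<bar> + w powr (2*\<alpha> - 2) * (3 * (exp w)\<^sup>2 * \<bar>y\<bar>))"
    using 2 by (intro mult_left_mono) linarith+
  finally show ?thesis by (simp add: lip_def distrib_right mult.assoc)
qed

lemma rhs_bound: "\<lbrakk>0 \<le> v; v \<le> 1\<rbrakk> \<Longrightarrow> \<bar>rhs v w y\<bar> \<le> lip w * \<bar>y\<bar>"
  using rhs_lipschitz[of v w y 0] by (simp add: rhs_def clip_def min_def)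

lemma cont_rhs: "continuous_on {0..} y \<Longrightarrow> continuous_on {0..} (\<lambda>w. rhs v w (y w))"
  unfolding rhs_def clip_def using \<alpha> by (intro continuous_intros cont_powr) auto

lemma wt_pos: "wt r > 0" by (simp add: wt_def)

lemma wt_0: "wt 0 = 1" by (simp add: wt_def)

lemma cont_wt: "continuous_on {0..} wt"
  unfolding wt_def[abs_def] by (intro continuous_intros integral_from_0_continuous cont_lip)

lemma wt_ge: "r \<ge> 0 \<Longrightarrow> wt r \<ge> 1"
proof -
  have "0 \<le> integral {0..r} (\<lambda>w. 2 * (1 + lip w))"
  proof (intro integral_nonneg integrable_from_0 continuous_intros cont_lip)
    fix x :: real show "0 \<le> 2 * (1 + lip x)" using lip_ge[of x] by simp
  qed
  then show ?thesis by (simp add: wt_def)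
qed

lemma wt_deriv: "r > 0 \<Longrightarrow> (wt has_real_derivative 2 * (1 + lip r) * wt r) (at r)"
  unfolding wt_def[abs_def]
  by (auto intro!: derivative_eq_intros integral_from_0_deriv continuous_intros cont_lip)

lemma integral_wt: "r \<ge> 0 \<Longrightarrow> integral {0..r} (\<lambda>w. 2 * (1 + lip w) * wt w) = wt r - 1"
proof -
  assume r: "r \<ge> 0"
  have "((\<lambda>w. 2 * (1 + lip w) * wt w) has_integral (wt r - wt 0)) {0..r}"
    by (rule fundamental_theorem_of_calculus_interior[OF r])
       (use wt_deriv in \<open>auto intro!: continuous_on_subset[OF cont_wt] simp only: has_real_derivative_iff_has_vector_derivative[symmetric] greaterThanLessThan_iff atLeastAtMost_iff atLeast_iff\<close>)
  then show ?thesis by (simp add: integral_unique wt_0)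
qed

text \<open>From wt' = 2 (1 + lip) wt: integration against \<open>lip\<close> reproduces the weight
  and gains the factor 1/2.\<close>

lemma integral_lip_wt:
  assumes "r \<ge> 0" "K \<ge> 0"
  shows "integral {0..r} (\<lambda>w. K * (lip w * wt w)) \<le> K * wt r / 2"
proof -
  have "integral {0..r} (\<lambda>w. K * (lip w * wt w)) \<le> integral {0..r} (\<lambda>w. K/2 * (2 * (1 + lip w) * wt w))"
  proof (rule integral_le)
    fix w :: real
    have "K * (lip w * wt w) \<le> K * ((1 + lip w) * wt w)"
      using assms wt_pos[of w] by (intro mult_left_mono mult_right_mono) auto
    also have "\<dots> = K/2 * (2 * (1 + lip w) * wt w)" by (simp only: mult_ac) simp
    finally show "K * (lip w * wt w) \<le> K/2 * (2 * (1 + lip w) * wt w)" .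
  qed (intro integrable_from_0 continuous_intros cont_lip cont_wt)+
  also have "\<dots> = K/2 * (wt r - 1)" using integral_wt[OF assms(1)] by simp
  finally show ?thesis using assms by (simp add: algebra_simps)
qed

text \<open>Each of the two integrations gains a factor 1/2; before the second one, lip \<ge> 1 puts
  the Lipschitz factor back under the integral. This is the source of the contraction constant 1/4,
  valid on the whole half-line at once.\<close>

lemma rmean_wt_bound:
  assumes f: "continuous_on {0..} f" and K: "K \<ge> 0" and r: "r \<ge> 0"
    and b: "\<And>w. 0 \<le> w \<Longrightarrow> \<bar>f w\<bar> \<le> K * (lip w * wt w)"
  shows "\<bar>rmean f r\<bar> \<le> K * wt r / 2" "\<bar>integral {0..r} (rmean f)\<bar> \<le> K * wt r / 4"
proof -
  have c: "continuous_on {0..} (\<lambda>w. K * (lip w * wt w))" by (intro continuous_intros cont_lip cont_wt)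
  have 1: "\<bar>rmean f s\<bar> \<le> K * wt s / 2" if "s \<ge> 0" for s
    using abs_rmean_le[OF f c that b] integral_lip_wt[OF that K] by linarith
  then show "\<bar>rmean f r\<bar> \<le> K * wt r / 2" using r .
  have "\<bar>integral {0..r} (rmean f)\<bar> \<le> integral {0..r} (\<lambda>w. K/2 * (lip w * wt w))"
    unfolding real_norm_def[symmetric]
  proof (rule integral_norm_bound_integral)
    fix w assume "w \<in> {0..r}"
    then have w: "w \<ge> 0" by simp
    have "1 * wt w \<le> lip w * wt w" using lip_ge wt_pos[of w] by (intro mult_right_mono) auto
    then have "K/2 * wt w \<le> K/2 * (lip w * wt w)" using K by (intro mult_left_mono) auto
    with 1[OF w] show "norm (rmean f w) \<le> K/2 * (lip w * wt w)" by simp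
  qed (intro integrable_from_0 cont_rmean f continuous_intros cont_lip cont_wt)+
  also have "\<dots> \<le> K/2 * wt r / 2" using K r by (intro integral_lip_wt) auto
  finally show "\<bar>integral {0..r} (rmean f)\<bar> \<le> K * wt r / 4" by simp
qed

section \<open>The fixed point in the weighted space\<close>

definition src :: "real \<Rightarrow> (real \<Rightarrow>\<^sub>C real) \<Rightarrow> real \<Rightarrow> real" where
  "src v g w = rhs v w (wt w * apply_bcontfun g w)"

text \<open>The unknown g stands for y / wt. Bounded continuous functions live on the whole line, so
  \<open>max r 0\<close> extends the image constantly to negative r.\<close>

definition step_fun :: "real \<Rightarrow> (real \<Rightarrow>\<^sub>C real) \<Rightarrow> real \<Rightarrow> real" where
  "step_fun v g r = (1 + integral {0..max r 0} (rmean (src v g))) / wt (max r 0)"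

definition step :: "real \<Rightarrow> (real \<Rightarrow>\<^sub>C real) \<Rightarrow> (real \<Rightarrow>\<^sub>C real)" where
  "step v g = Bcontfun (step_fun v g)"

lemma cont_src: "continuous_on {0..} (src v g)"
  unfolding src_def[abs_def]
  by (intro cont_rhs continuous_on_mult cont_wt continuous_on_subset[OF continuous_on_apply_bcontfun]) auto

lemma src_bound:
  assumes v: "0 \<le> v" "v \<le> 1"
  shows "\<bar>src v g w\<bar> \<le> norm g * (lip w * wt w)"
proof -
  have "\<bar>src v g w\<bar> \<le> lip w * \<bar>wt w * apply_bcontfun g w\<bar>"
    unfolding src_def by (rule rhs_bound[OF v])
  also have "\<dots> \<le> lip w * (wt w * norm g)"
    unfolding abs_mult using wt_pos[of w] lip_ge[of w] norm_bounded[of g w]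
    by (intro mult_mono) auto
  finally show ?thesis by (simp add: mult_ac)
qed

lemma src_diff:
  assumes v: "0 \<le> v" "v \<le> 1"
  shows "\<bar>src v g w - src v' g' w\<bar> \<le> (dist g g' + \<bar>v - v'\<bar> * norm g') * (lip w * wt w)"
proof -
  have "\<bar>src v g w - src v g' w\<bar> \<le> lip w * \<bar>wt w * apply_bcontfun g w - wt w * apply_bcontfun g' w\<bar>"
    unfolding src_def by (rule rhs_lipschitz[OF v])
  also have "\<dots> \<le> lip w * (wt w * dist g g')"
    unfolding right_diff_distrib[symmetric] abs_mult using wt_pos[of w] lip_ge[of w] dist_bounded[of g w g']
    by (intro mult_mono) (auto simp: dist_real_def)
  finally have 1: "\<bar>src v g w - src v g' w\<bar> \<le> dist g g' * (lip w * wt w)" by (simp add: mult_ac)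
  have "\<bar>src v g' w - src v' g' w\<bar> \<le> \<bar>v - v'\<bar> * (lip w * \<bar>wt w * apply_bcontfun g' w\<bar>)"
    unfolding src_def by (rule rhs_param)
  also have "\<dots> \<le> \<bar>v - v'\<bar> * (lip w * (wt w * norm g'))"
    unfolding abs_mult[of "wt _"] using wt_pos[of w] lip_ge[of w] norm_bounded[of g' w]
    by (intro mult_mono) auto
  finally have 2: "\<bar>src v g' w - src v' g' w\<bar> \<le> \<bar>v - v'\<bar> * norm g' * (lip w * wt w)" by (simp add: mult_ac)
  show ?thesis unfolding distrib_right using 1 2 by linarith
qed

lemma step_apply:
  assumes v: "0 \<le> v" "v \<le> 1"
  shows "apply_bcontfun (step v g) = step_fun v g" "norm (step v g) \<le> 1 + norm g / 4"
proof -
  have c: "continuous_on UNIV (step_fun v g)" unfolding step_fun_def[abs_def]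
  proof (intro continuous_intros)
    show "continuous_on UNIV (\<lambda>x::real. integral {0..max x 0} (rmean (src v g)))"
      by (rule continuous_on_compose2[OF integral_from_0_continuous[OF cont_rmean[OF cont_src]]])
         (auto intro!: continuous_intros)
    show "continuous_on UNIV (\<lambda>x::real. wt (max x 0))"
      by (rule continuous_on_compose2[OF cont_wt]) (auto intro!: continuous_intros)
    show "\<forall>x\<in>UNIV. wt (max x 0) \<noteq> 0" using wt_pos less_imp_neq by metis
  qed
  have b: "norm (step_fun v g r) \<le> 1 + norm g / 4" for r
  proof -
    let ?r = "max r 0"
    have "\<bar>integral {0..?r} (rmean (src v g))\<bar> \<le> norm g * wt ?r / 4"
      by (rule rmean_wt_bound[OF cont_src]) (auto intro!: src_bound v)
    then have "\<bar>1 + integral {0..?r} (rmean (src v g))\<bar> \<le> wt ?r + norm g * wt ?r / 4"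
      using wt_ge[of ?r] by linarith
    also have "\<dots> = (1 + norm g / 4) * wt ?r" by (simp add: algebra_simps)
    finally show ?thesis using wt_pos[of ?r] by (simp add: step_fun_def abs_divide divide_le_eq)
  qed
  have "step_fun v g \<in> bcontfun" by (rule bcontfun_normI[OF c b])
  then show 1: "apply_bcontfun (step v g) = step_fun v g" by (simp add: step_def Bcontfun_inverse)
  show "norm (step v g) \<le> 1 + norm g / 4" by (rule norm_bound) (use b 1 in simp)
qed

text \<open>Both arguments vary because the estimate is used twice: v = v' gives the contraction,
  and two fixed points give Lipschitz dependence on the parameter.\<close>

lemma step_contraction:
  assumes v: "0 \<le> v" "v \<le> 1" and v': "0 \<le> v'" "v' \<le> 1"
  shows "dist (step v g) (step v' g') \<le> (dist g g' + \<bar>v - v'\<bar> * norm g') / 4"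
proof (rule dist_bound)
  fix r :: real
  let ?r = "max r 0" and ?K = "dist g g' + \<bar>v - v'\<bar> * norm g'"
  have e: "integral {0..?r} (rmean (\<lambda>w. src v g w - src v' g' w)) = integral {0..?r} (rmean (src v g)) - integral {0..?r} (rmean (src v' g'))"
    unfolding rmean_diff[OF cont_src cont_src, abs_def]
    by (intro Henstock_Kurzweil_Integration.integral_diff integrable_from_0 cont_rmean cont_src)
  have "\<bar>integral {0..?r} (rmean (\<lambda>w. src v g w - src v' g' w))\<bar> \<le> ?K * wt ?r / 4"
    by (rule rmean_wt_bound) (auto intro!: src_diff v continuous_intros cont_src)
  then have "\<bar>(integral {0..?r} (rmean (src v g)) - integral {0..?r} (rmean (src v' g'))) / wt ?r\<bar> \<le> ?K / 4"
    unfolding e abs_divide using wt_pos[of ?r] by (simp add: divide_le_eq)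
  then show "dist (apply_bcontfun (step v g) r) (apply_bcontfun (step v' g') r) \<le> ?K / 4"
    unfolding step_apply[OF v] step_apply[OF v'] dist_real_def step_fun_def
    by (simp add: diff_divide_distrib[symmetric])
qed

definition fixg :: "real \<Rightarrow> (real \<Rightarrow>\<^sub>C real)" where
  "fixg v = (THE g. step v g = g)"

lemma fixg:
  assumes v: "0 \<le> v" "v \<le> 1"
  shows "step v (fixg v) = fixg v" "norm (fixg v) \<le> 2"
proof -
  have "\<exists>!g. step v g = g"
    by (rule banach_fix_type[of "1/4"]) (use step_contraction[OF v v] in auto)
  then show 1: "step v (fixg v) = fixg v" unfolding fixg_def by (rule theI')
  \<comment> \<open>The fixed point equation turns the growth bound into norm \<le> 4/3, rounded up
    to 2.\<close>
  have "norm (fixg v) \<le> 1 + norm (fixg v) / 4" using step_apply(2)[OF v, of "fixg v"] 1 by simp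
  then show "norm (fixg v) \<le> 2" by simp
qed

lemma fixg_lipschitz:
  assumes v: "0 \<le> v" "v \<le> 1" and v': "0 \<le> v'" "v' \<le> 1"
  shows "dist (fixg v) (fixg v') \<le> \<bar>v - v'\<bar>"
proof -
  have "dist (fixg v) (fixg v') \<le> (dist (fixg v) (fixg v') + \<bar>v - v'\<bar> * norm (fixg v')) / 4"
    using step_contraction[OF assms, of "fixg v" "fixg v'"] unfolding fixg(1)[OF v] fixg(1)[OF v'] .
  moreover have "\<bar>v - v'\<bar> * norm (fixg v') \<le> \<bar>v - v'\<bar> * 2" using fixg(2)[OF v'] by (intro mult_left_mono) auto
  ultimately have "3 * dist (fixg v) (fixg v') \<le> \<bar>v - v'\<bar> * 2" by simp
  then have "3 * dist (fixg v) (fixg v') \<le> 3 * \<bar>v - v'\<bar>" by (rule order_trans) simp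
  then show ?thesis by simp
qed

definition ysol :: "real \<Rightarrow> real \<Rightarrow> real" where "ysol v r = wt r * apply_bcontfun (fixg v) r"
definition yder :: "real \<Rightarrow> real \<Rightarrow> real" where "yder v = rmean (src v (fixg v))"
text \<open>The derivative of the flux r^(2\<alpha>) y' is read off the integral directly, so second
  derivatives of u are computed through it rather than through \<open>yder\<close>.\<close>

definition yflux :: "real \<Rightarrow> real \<Rightarrow> real" where "yflux v = rint (src v (fixg v))"

lemma src_fixg: "src v (fixg v) w = rhs v w (ysol v w)"
  by (simp add: src_def ysol_def)

lemma ysol_eq:
  assumes v: "0 \<le> v" "v \<le> 1" and r: "r \<ge> 0"
  shows "ysol v r = 1 + integral {0..r} (yder v)"
proof -
  have "apply_bcontfun (fixg v) r = (1 + integral {0..r} (yder v)) / wt r"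
    using step_apply(1)[OF v, of "fixg v"] r unfolding fixg(1)[OF v]
    by (simp add: step_fun_def yder_def max_def)
  then show ?thesis using wt_pos[of r] by (simp add: ysol_def)
qed

lemma cont_ysol: "continuous_on {0..} (ysol v)"
  unfolding ysol_def[abs_def]
  by (intro continuous_on_mult cont_wt continuous_on_subset[OF continuous_on_apply_bcontfun]) auto

lemma cont_yder: "continuous_on {0..} (yder v)"
  unfolding yder_def by (intro cont_rmean cont_src)

lemma ysol_0: "\<lbrakk>0 \<le> v; v \<le> 1\<rbrakk> \<Longrightarrow> ysol v 0 = 1" by (simp add: ysol_eq)

lemma yder_0: "yder v 0 = 0" by (simp add: yder_def rmean_def rint_0)

lemma ysol_deriv:
  assumes v: "0 \<le> v" "v \<le> 1" and r: "r > 0"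
  shows "(ysol v has_real_derivative yder v r) (at r)"
proof -
  have "((\<lambda>r. 1 + integral {0..r} (yder v)) has_real_derivative 0 + yder v r) (at r)"
    by (intro DERIV_add DERIV_const integral_from_0_deriv cont_yder r)
  then have "((\<lambda>r. 1 + integral {0..r} (yder v)) has_real_derivative yder v r) (at r)" by simp
  then show ?thesis
    by (rule has_field_derivative_transform_within_open[of _ _ _ "{0<..}"]) (use r ysol_eq[OF v] in auto)
qed

lemma yflux_deriv: "r > 0 \<Longrightarrow> (yflux v has_real_derivative r powr (2*\<alpha>) * rhs v r (ysol v r)) (at r)"
  unfolding yflux_def src_fixg[symmetric] by (intro rint_deriv cont_src)

lemma yflux_eq: "r > 0 \<Longrightarrow> yflux v r = r powr (2*\<alpha>) * yder v r"
  unfolding yflux_def yder_def by (rule rint_eq_rmean)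

lemma ysol_lipschitz:
  assumes v: "0 \<le> v" "v \<le> 1" and v': "0 \<le> v'" "v' \<le> 1" and r: "r \<ge> 0"
  shows "\<bar>ysol v r - ysol v' r\<bar> \<le> \<bar>v - v'\<bar> * (2 * wt r)" "\<bar>yder v r - yder v' r\<bar> \<le> \<bar>v - v'\<bar> * (2 * wt r)"
proof -
  have "\<bar>apply_bcontfun (fixg v) r - apply_bcontfun (fixg v') r\<bar> \<le> \<bar>v - v'\<bar>"
    using dist_bounded[of "fixg v" r "fixg v'"] fixg_lipschitz[OF v v'] by (simp add: dist_real_def)
  then have "\<bar>apply_bcontfun (fixg v) r - apply_bcontfun (fixg v') r\<bar> \<le> \<bar>v - v'\<bar> * 2"
    by (rule order_trans) simp
  then have "wt r * \<bar>apply_bcontfun (fixg v) r - apply_bcontfun (fixg v') r\<bar> \<le> wt r * (\<bar>v - v'\<bar> * 2)"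
    using less_imp_le[OF wt_pos] by (rule mult_left_mono)
  moreover have "\<bar>ysol v r - ysol v' r\<bar> = wt r * \<bar>apply_bcontfun (fixg v) r - apply_bcontfun (fixg v') r\<bar>"
    unfolding ysol_def right_diff_distrib[symmetric] abs_mult using wt_pos[of r] by simp
  ultimately show "\<bar>ysol v r - ysol v' r\<bar> \<le> \<bar>v - v'\<bar> * (2 * wt r)" by (simp add: mult_ac)
  let ?K = "dist (fixg v) (fixg v') + \<bar>v - v'\<bar> * norm (fixg v')"
  have "\<bar>v - v'\<bar> * norm (fixg v') \<le> \<bar>v - v'\<bar> * 2" using fixg(2)[OF v'] by (intro mult_left_mono) auto
  then have "?K \<le> \<bar>v - v'\<bar> + \<bar>v - v'\<bar> * 2" using fixg_lipschitz[OF v v'] by (rule add_mono[rotated])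
  then have K: "?K \<le> \<bar>v - v'\<bar> * 4" by (rule order_trans) simp
  have "\<bar>rmean (\<lambda>w. src v (fixg v) w - src v' (fixg v') w) r\<bar> \<le> ?K * wt r / 2"
    by (rule rmean_wt_bound) (auto intro!: src_diff v continuous_intros cont_src r)
  also have "\<dots> \<le> \<bar>v - v'\<bar> * 4 * wt r / 2" using K wt_pos[of r] by (intro divide_right_mono mult_right_mono) auto
  finally show "\<bar>yder v r - yder v' r\<bar> \<le> \<bar>v - v'\<bar> * (2 * wt r)"
    unfolding yder_def rmean_diff[OF cont_src cont_src] by (simp add: mult_ac)
qed

text \<open>While y \<ge> 0 the cubic term only lowers the slope, so y' \<le> I, where I is the
  integral of y. Then (y + I)' \<le> y + I, and y + I starts at 1. This is why exp is the right
  ceiling in \<open>clip\<close>.\<close>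

lemma ysol_le_exp:
  assumes v: "0 \<le> v" "v \<le> 1" and r: "r \<ge> 0" and y0: "\<And>w. \<lbrakk>0 \<le> w; w \<le> r\<rbrakk> \<Longrightarrow> ysol v w \<ge> 0"
  shows "ysol v r \<le> exp r"
proof -
  define I where "I = (\<lambda>r. integral {0..r} (ysol v))"
  have I: "(I has_real_derivative ysol v s) (at s)" if "s > 0" for s
    unfolding I_def by (intro integral_from_0_deriv cont_ysol that)
  have I0: "I s \<ge> 0" if "0 \<le> s" "s \<le> r" for s
    unfolding I_def using that by (intro integral_nonneg integrable_from_0 cont_ysol) (auto intro: y0)
  have cI: "continuous_on {0..} I" unfolding I_def by (intro integral_from_0_continuous cont_ysol)
  have yI: "yder v s \<le> I s" if s: "0 < s" "s \<le> r" for s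
  proof -
    have "rint (src v (fixg v)) s \<le> rint (ysol v) s"
      unfolding rint_def
    proof (intro integral_le integrable_from_0 cont_rint_integrand cont_src cont_ysol)
      fix w assume "w \<in> {0..s}"
      then have w: "ysol v w \<ge> 0" "w \<ge> 0" using s by (auto intro: y0)
      have "(1 - v) * ysol v w \<le> 1 * ysol v w" using v w by (intro mult_right_mono) auto
      moreover have "0 \<le> v * (w powr (2*\<alpha> - 2) * (clip w (ysol v w))^3)"
        using v by (intro mult_nonneg_nonneg) (auto simp: clip_def)
      ultimately have "src v (fixg v) w \<le> ysol v w" unfolding src_fixg rhs_def by linarith
      then show "w powr (2*\<alpha>) * src v (fixg v) w \<le> w powr (2*\<alpha>) * ysol v w" by (intro mult_left_mono) auto
    qed
    then have "yder v s \<le> rmean (ysol v) s" unfolding yder_def rmean_def by (intro mult_left_mono) auto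
    also have "\<dots> \<le> \<bar>rmean (ysol v) s\<bar>" by simp
    also have "\<dots> \<le> integral {0..s} (\<lambda>w. \<bar>ysol v w\<bar>)"
      using s by (intro abs_rmean_le cont_ysol continuous_intros) auto
    also have "\<dots> = I s" unfolding I_def
      by (intro Henstock_Kurzweil_Integration.integral_cong) (use s in \<open>auto intro!: abs_of_nonneg y0\<close>)
    finally show ?thesis .
  qed
  have "(ysol v r + I r) * exp (- r) \<le> (ysol v 0 + I 0) * exp (- 0)"
  proof (cases "r = 0")
    case False
    then have r0: "0 < r" using r by simp
    \<comment> \<open>Derivatives are available only for r > 0, so the mean value theorem is applied
      with mere continuity at 0.\<close>
    have c: "continuous_on {0..r} (\<lambda>r. (ysol v r + I r) * exp (- r))"
      by (intro continuous_intros continuous_on_subset[OF cont_ysol] continuous_on_subset[OF cI]) auto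
    obtain z where z: "0 < z" "z < r" "(ysol v r + I r) * exp (- r) - (ysol v 0 + I 0) * exp (- 0)
        = (r - 0) * ((yder v z + ysol v z) * exp (- z) - (ysol v z + I z) * exp (- z))"
    proof -
      have "\<exists>l z. 0 < z \<and> z < r \<and> ((\<lambda>r. (ysol v r + I r) * exp (- r)) has_real_derivative l) (at z) \<and>
        (ysol v r + I r) * exp (- r) - (ysol v 0 + I 0) * exp (- 0) = (r - 0) * l"
        by (rule MVT[OF r0 c])
           (auto simp: real_differentiable_def intro!: exI derivative_eq_intros ysol_deriv[OF v] I)
      then obtain l z where z: "0 < z" "z < r" "((\<lambda>r. (ysol v r + I r) * exp (- r)) has_real_derivative l) (at z)"
        "(ysol v r + I r) * exp (- r) - (ysol v 0 + I 0) * exp (- 0) = (r - 0) * l" by blast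
      have "((\<lambda>r. (ysol v r + I r) * exp (- r)) has_real_derivative
         ((yder v z + ysol v z) * exp (- z) - (ysol v z + I z) * exp (- z))) (at z)"
        by (auto intro!: derivative_eq_intros ysol_deriv[OF v] I z(1))
      from DERIV_unique[OF this z(3)] z that show thesis by blast
    qed
    have "(yder v z + ysol v z) * exp (- z) \<le> (ysol v z + I z) * exp (- z)"
      using yI[of z] z by (intro mult_right_mono) auto
    then have "r * ((yder v z + ysol v z) * exp (- z) - (ysol v z + I z) * exp (- z)) \<le> 0"
      using r by (intro mult_nonneg_nonpos) auto
    with z(3) show ?thesis by simp
  qed simp
  then have "(ysol v r + I r) * exp (- r) \<le> 1" by (simp add: ysol_0[OF v] I_def)
  then have "ysol v r + I r \<le> exp r" by (simp add: exp_minus field_simps)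
  then show ?thesis using I0[of r] r by simp
qed

end

section \<open>The two alternatives of the shooting argument\<close>

context
  fixes a \<alpha> :: real
  assumes a: "a > 0" and \<alpha>: "\<alpha> > 1" and a_eq: "a = \<alpha>\<^sup>2 - \<alpha>"
begin

definition usol :: "real \<Rightarrow> real \<Rightarrow> real" where "usol v r = r powr \<alpha> * ysol \<alpha> v r"
text \<open>This is u' = \<alpha> r^(\<alpha> - 1) y + r^\<alpha> y', the last term being expressed
  by the flux.\<close>

definition uder :: "real \<Rightarrow> real \<Rightarrow> real" where "uder v r = \<alpha> * usol v r / r + r powr (- \<alpha>) * yflux \<alpha> v r"
definition uJ :: "real \<Rightarrow> real \<Rightarrow> real" where "uJ v = Jfun a (1 - v) v (usol v) (uder v)"

lemma usol_deriv:
  assumes v: "0 \<le> v" "v \<le> 1" and r: "r > 0"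
  shows "(usol v has_real_derivative uder v r) (at r)"
proof -
  have "((\<lambda>r. r powr \<alpha>) has_real_derivative \<alpha> * r powr (\<alpha> - 1)) (at r)"
    by (rule has_real_derivative_powr[OF r])
  from DERIV_mult[OF this ysol_deriv[OF \<alpha> v r]]
  have "(usol v has_real_derivative \<alpha> * r powr (\<alpha> - 1) * ysol \<alpha> v r + yder \<alpha> v r * r powr \<alpha>) (at r)"
    unfolding usol_def[abs_def] .
  moreover have "r powr (\<alpha> - 1) = r powr \<alpha> / r" using r by (simp add: powr_diff)
  moreover have "r powr (- \<alpha>) * r powr (2 * \<alpha>) = r powr \<alpha>" using r by (simp add: powr_add[symmetric])
  then have "yder \<alpha> v r * r powr \<alpha> = r powr (- \<alpha>) * yflux \<alpha> v r"
    unfolding yflux_eq[OF \<alpha> r] mult.assoc[symmetric] by (simp only: mult.commute)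
  ultimately show ?thesis unfolding uder_def usol_def by (simp add: mult.assoc)
qed

text \<open>Nonnegativity on all of [0, r] is what \<open>ysol_le_exp\<close> asks for; it gives 0
  \<le> y \<le> exp, the truncation is inactive, and the truncated equation is the true one at
  r.\<close>

lemma uder_deriv:
  assumes v: "0 \<le> v" "v \<le> 1" and r: "r > 0" and y0: "\<And>w. \<lbrakk>0 \<le> w; w \<le> r\<rbrakk> \<Longrightarrow> ysol \<alpha> v w \<ge> 0"
  shows "(uder v has_real_derivative ((1 - v) + a/r\<^sup>2) * usol v r - v * (usol v r)^3/r\<^sup>2) (at r)"
proof -
  let ?y = "ysol \<alpha> v r"
  have "0 \<le> ?y" "?y \<le> exp r" using y0[of r] ysol_le_exp[OF \<alpha> v _ y0, of r] r by auto
  then have cl: "clip r ?y = ?y" by (simp add: clip_def[OF \<alpha>] max_def min_def)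
  define A P where "A = r powr \<alpha>" and "P = yflux \<alpha> v r"
  have A: "A > 0" using r by (simp add: A_def)
  have pA: "r powr (- \<alpha>) = 1 / A" "r powr (- \<alpha> - 1) = 1 / (A * r)" "r powr (2 * \<alpha>) = A\<^sup>2" "r powr (2 * \<alpha> - 2) = A\<^sup>2 / r\<^sup>2"
    using r by (simp_all add: A_def powr_minus powr_diff powr_add field_simps power2_eq_square flip: powr_add)
  have "((\<lambda>r. r powr (- \<alpha>)) has_real_derivative - \<alpha> * r powr (- \<alpha> - 1)) (at r)"
    by (rule has_real_derivative_powr[OF r])
  then have "(uder v has_real_derivative (\<alpha> * uder v r * r - \<alpha> * usol v r * 1) / (r * r)
      + ((- \<alpha> * r powr (- \<alpha> - 1)) * yflux \<alpha> v r + (r powr (2*\<alpha>) * rhs \<alpha> v r ?y) * r powr (- \<alpha>))) (at r)"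
    unfolding uder_def[abs_def] using r
    by (intro DERIV_add DERIV_divide DERIV_mult DERIV_cmult yflux_deriv[OF \<alpha>] usol_deriv[unfolded uder_def] v DERIV_ident) auto
  moreover have "(\<alpha> * uder v r * r - \<alpha> * usol v r * 1) / (r * r)
      + ((- \<alpha> * r powr (- \<alpha> - 1)) * yflux \<alpha> v r + (r powr (2*\<alpha>) * rhs \<alpha> v r ?y) * r powr (- \<alpha>))
     = ((1 - v) + a/r\<^sup>2) * usol v r - v * (usol v r)^3/r\<^sup>2"
    unfolding uder_def usol_def rhs_def[OF \<alpha>] cl pA A_def[symmetric] P_def[symmetric] a_eq using r A
    by (simp add: field_simps power2_eq_square power3_eq_cube)
  ultimately show ?thesis by simp
qed

lemma uJ_deriv:
  assumes v: "0 \<le> v" "v \<le> 1" and r: "r > 0" and y0: "\<And>w. \<lbrakk>0 \<le> w; w \<le> r\<rbrakk> \<Longrightarrow> ysol \<alpha> v w \<ge> 0"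
  shows "(uJ v has_real_derivative r powr (2/3) * ((2/27 + a/3) * (1/r)^3 - 2/3 * (1 - v) * (1/r)) * (usol v r)\<^sup>2) (at r)"
  unfolding uJ_def
  by (rule Jfun_deriv[where u = "usol v" and u' = "uder v", OF r usol_deriv[OF v r] uder_deriv[OF v r y0]])

text \<open>A zero of a nonnegative y is a minimum, so y' vanishes there too. Read as a linear
  equation with bounded coefficient away from 0, the equation then forces y = 0 on (0, r], against
  y(0) = 1.\<close>

lemma ysol_pos_of_nonneg:
  assumes v: "0 \<le> v" "v \<le> 1" and nn: "\<And>r. r \<ge> 0 \<Longrightarrow> ysol \<alpha> v r \<ge> 0" and r: "r \<ge> 0"
  shows "ysol \<alpha> v r > 0"
proof (rule ccontr)
  assume "\<not> ysol \<alpha> v r > 0"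
  then have z: "ysol \<alpha> v r = 0" using nn[OF r] by simp
  then have r0: "r > 0" using r ysol_0[OF \<alpha> v] by (cases "r = 0") auto
  have "yder \<alpha> v r = 0"
    by (rule DERIV_local_min[OF ysol_deriv[OF \<alpha> v r0] r0]) (use nn z in auto)
  then have fl: "yflux \<alpha> v r = 0" by (simp add: yflux_eq[OF \<alpha> r0])
  have u0: "usol v r = 0" "uder v r = 0" by (simp_all add: usol_def uder_def z fl)
  have all0: "ysol \<alpha> v s = 0" if s: "0 < s" "s \<le> r" for s
  proof -
    define b where "b = (\<lambda>t. (1 - v) + a/t\<^sup>2 - v * (usol v t)\<^sup>2/t\<^sup>2)"
    have "continuous_on {s..r} (usol v)"
      by (rule DERIV_continuous_on[where D = "uder v", OF has_field_derivative_at_within[OF usol_deriv[OF v]]]) (use s in auto)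
    then have "continuous_on {s..r} b" unfolding b_def using s by (intro continuous_intros) auto
    then have "bounded (b ` {s..r})" by (intro compact_imp_bounded compact_continuous_image) auto
    then obtain B where B: "\<And>t. t \<in> {s..r} \<Longrightarrow> \<bar>b t\<bar> \<le> B" unfolding bounded_iff real_norm_def by (metis imageI)
    have "usol v s = 0"
    proof (rule linear_ode_zero[of s r b B "usol v" "uder v" r s])
      fix t assume t: "t \<in> {s..r}"
      then have t0: "t > 0" using s by simp
      show "(usol v has_real_derivative uder v t) (at t)" by (rule usol_deriv[OF v t0])
      have "((1 - v) + a/t\<^sup>2) * usol v t - v * (usol v t)^3/t\<^sup>2 = b t * usol v t"
        unfolding b_def by (simp add: left_diff_distrib power2_eq_square power3_eq_cube)
      then show "(uder v has_real_derivative b t * usol v t) (at t)"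
        using uder_deriv[OF v t0 nn] by simp
    qed (use B u0 s in auto)
    then show ?thesis using s by (simp add: usol_def)
  qed
  have "continuous_on {0..} (ysol \<alpha> v)" by (rule cont_ysol[OF \<alpha>])
  then have "(ysol \<alpha> v \<longlongrightarrow> ysol \<alpha> v 0) (at 0 within {0..})" by (auto simp: continuous_on_def)
  then have l: "(ysol \<alpha> v \<longlongrightarrow> 1) (at_right 0)" unfolding ysol_0[OF \<alpha> v] by (rule tendsto_within_subset) auto
  have "eventually (\<lambda>s. ysol \<alpha> v s \<le> 0) (at_right 0)"
    unfolding eventually_at_right_field using all0 r0 by (intro exI[of _ r]) auto
  from tendsto_upperbound[OF l this] show False by simp
qed

lemma first_zero_ysol:
  assumes v: "0 \<le> v" "v \<le> 1" and r: "r > 0" "ysol \<alpha> v r \<le> 0"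
  obtains z where "z > 0" "z \<le> r" "ysol \<alpha> v z = 0" "\<And>t. \<lbrakk>0 \<le> t; t < z\<rbrakk> \<Longrightarrow> ysol \<alpha> v t > 0"
proof (rule first_zero_after_pos[of 0 r "ysol \<alpha> v"])
  show "continuous_on {0..r} (ysol \<alpha> v)" by (rule continuous_on_subset[OF cont_ysol[OF \<alpha>]]) auto
qed (use r ysol_0[OF \<alpha> v] that in auto)

text \<open>The first condition says that the energy \<open>J\<close> is decreasing from \<open>r\<close> on, as long as the solution is nonnegative.\<close>

definition below :: "real \<Rightarrow> bool" where
  "below v \<longleftrightarrow> (\<exists>r>0. 2/27 + a/3 < 2/3 * (1 - v) * r\<^sup>2 \<and> uJ v r < 0 \<and> (\<forall>w\<in>{0..r}. ysol \<alpha> v w > 0))"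

definition crosses :: "real \<Rightarrow> bool" where
  "crosses v \<longleftrightarrow> (\<exists>r>0. ysol \<alpha> v r < 0)"

lemma uJ_antimono:
  assumes v: "0 \<le> v" "v \<le> 1" and x: "0 < x" "x \<le> z" "2/27 + a/3 \<le> 2/3 * (1 - v) * x\<^sup>2"
    and pos: "\<And>t. \<lbrakk>0 \<le> t; t \<le> z\<rbrakk> \<Longrightarrow> ysol \<alpha> v t \<ge> 0"
  shows "uJ v z \<le> uJ v x"
proof (rule deriv_nonpos_imp_ge[OF x(2)])
  fix t assume t: "x \<le> t" "t \<le> z"
  show "(uJ v has_real_derivative t powr (2/3) * ((2/27 + a/3) * (1/t)^3 - 2/3 * (1 - v) * (1/t)) * (usol v t)\<^sup>2) (at t)"
    by (rule uJ_deriv[OF v]) (use t x pos in auto)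
next
  fix t assume t: "x < t" "t < z"
  then have t0: "t > 0" using x by simp
  have "x\<^sup>2 \<le> t\<^sup>2" using t x by (intro power_mono) auto
  then have "2/3 * (1 - v) * x\<^sup>2 \<le> 2/3 * (1 - v) * t\<^sup>2" using v by (intro mult_left_mono) auto
  then have "(1/t)^3 * (2/27 + a/3 - 2/3 * (1 - v) * t\<^sup>2) \<le> 0" using x t0 by (intro mult_nonneg_nonpos) auto
  also have "(1/t)^3 * (2/27 + a/3 - 2/3 * (1 - v) * t\<^sup>2) = (2/27 + a/3) * (1/t)^3 - 2/3 * (1 - v) * (1/t)"
    using t0 by (simp add: right_diff_distrib power2_eq_square power3_eq_cube)
  finally show "t powr (2/3) * ((2/27 + a/3) * (1/t)^3 - 2/3 * (1 - v) * (1/t)) * (usol v t)\<^sup>2 \<le> 0"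
    by (intro mult_nonpos_nonneg mult_nonneg_nonpos) auto
qed

text \<open>At a zero of u every term of J except r^(2/3) u'^2 / 2 vanishes, so J \<ge> 0 there; but
  J is negative at r and cannot increase before the first zero.\<close>

lemma below_not_crosses:
  assumes v: "0 \<le> v" "v \<le> 1" and b: "below v" shows "\<not> crosses v"
proof
  assume "crosses v"
  then obtain s where s: "s > 0" "ysol \<alpha> v s \<le> 0" by (auto simp: crosses_def intro: less_imp_le)
  obtain r where r: "r > 0" "2/27 + a/3 < 2/3 * (1 - v) * r\<^sup>2" "uJ v r < 0" "\<And>w. \<lbrakk>0 \<le> w; w \<le> r\<rbrakk> \<Longrightarrow> ysol \<alpha> v w > 0"
    using b by (auto simp: below_def)
  obtain z where z: "z > 0" "z \<le> s" "ysol \<alpha> v z = 0" "\<And>t. \<lbrakk>0 \<le> t; t < z\<rbrakk> \<Longrightarrow> ysol \<alpha> v t > 0"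
    using first_zero_ysol[OF v s] by blast
  have rz: "r \<le> z" using r(4)[of z] z(1,3) by (cases "z \<le> r") auto
  have "uJ v z \<le> uJ v r"
  proof (rule uJ_antimono[OF v r(1) rz])
    fix t assume "0 \<le> t" "t \<le> z"
    then show "ysol \<alpha> v t \<ge> 0" using z(3) z(4)[of t] by (cases "t = z") auto
  qed (use r in auto)
  moreover have "uJ v z = z powr (2/3) * (1/2 * (uder v z)\<^sup>2)"
    using z(3) by (simp add: uJ_def Jfun_def usol_def)
  moreover have "0 \<le> z powr (2/3) * (1/2 * (uder v z)\<^sup>2)" by simp
  ultimately show False using r(3) by linarith
qed

lemma tendsto_sol:
  assumes v: "0 \<le> v" "v \<le> 1" and r: "r > 0"
  shows "((\<lambda>t. ysol \<alpha> t r) \<longlongrightarrow> ysol \<alpha> v r) (at v within {0..1})"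
    "((\<lambda>t. yder \<alpha> t r) \<longlongrightarrow> yder \<alpha> v r) (at v within {0..1})"
proof -
  have l: "((\<lambda>t. \<bar>t - v\<bar> * (2 * wt \<alpha> r)) \<longlongrightarrow> \<bar>v - v\<bar> * (2 * wt \<alpha> r)) (at v within {0..1})"
    by (intro tendsto_intros)
  have e: "eventually (\<lambda>t. t \<in> {0..1}) (at v within {0..1})" by (auto simp: eventually_at_filter)
  show "((\<lambda>t. ysol \<alpha> t r) \<longlongrightarrow> ysol \<alpha> v r) (at v within {0..1})"
    by (rule LIM_zero_cancel, rule Lim_null_comparison[OF eventually_mono[OF e]])
       (use ysol_lipschitz(1)[OF \<alpha>] v r l in auto)
  show "((\<lambda>t. yder \<alpha> t r) \<longlongrightarrow> yder \<alpha> v r) (at v within {0..1})"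
    by (rule LIM_zero_cancel, rule Lim_null_comparison[OF eventually_mono[OF e]])
       (use ysol_lipschitz(2)[OF \<alpha>] v r l in auto)
qed

lemma eventually_crosses:
  assumes v: "0 \<le> v" "v \<le> 1" and c: "crosses v"
  shows "eventually crosses (at v within {0..1})"
proof -
  obtain r where r: "r > 0" "ysol \<alpha> v r < 0" using c by (auto simp: crosses_def)
  from order_tendstoD(2)[OF tendsto_sol(1)[OF v r(1)] r(2)]
  show ?thesis by eventually_elim (use r in \<open>auto simp: crosses_def\<close>)
qed

text \<open>Everything happens on a bounded interval. Two conditions are strict inequalities between
  quantities continuous in the parameter; positivity on [0, r] survives because the solutions are
  uniformly close there and y has a positive minimum.\<close>

lemma eventually_below:
  assumes v: "0 \<le> v" "v \<le> 1" and b: "below v"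
  shows "eventually below (at v within {0..1})"
proof -
  obtain r where r: "r > 0" "2/27 + a/3 < 2/3 * (1 - v) * r\<^sup>2" "uJ v r < 0" "\<And>w. \<lbrakk>0 \<le> w; w \<le> r\<rbrakk> \<Longrightarrow> ysol \<alpha> v w > 0"
    using b by (auto simp: below_def)
  have 1: "eventually (\<lambda>t. 2/27 + a/3 < 2/3 * (1 - t) * r\<^sup>2) (at v within {0..1})"
    by (rule order_tendstoD(1)[OF _ r(2)]) (intro tendsto_intros)
  have y: "((\<lambda>t. ysol \<alpha> t r) \<longlongrightarrow> ysol \<alpha> v r) (at v within {0..1})"
    and N: "((\<lambda>t. yder \<alpha> t r) \<longlongrightarrow> yder \<alpha> v r) (at v within {0..1})"
    using tendsto_sol[OF v r(1)] by auto
  have u: "((\<lambda>t. usol t r) \<longlongrightarrow> usol v r) (at v within {0..1})" unfolding usol_def by (intro tendsto_intros y)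
  have u': "((\<lambda>t. uder t r) \<longlongrightarrow> uder v r) (at v within {0..1})"
    unfolding uder_def yflux_eq[OF \<alpha> r(1)] using r by (intro tendsto_intros u N) auto
  have "((\<lambda>t. uJ t r) \<longlongrightarrow> uJ v r) (at v within {0..1})"
    unfolding uJ_def Jfun_def using r by (intro tendsto_intros u u') auto
  then have 2: "eventually (\<lambda>t. uJ t r < 0) (at v within {0..1})" by (rule order_tendstoD(2)) (rule r(3))
  have c: "continuous_on {0..r} (ysol \<alpha> v)" by (rule continuous_on_subset[OF cont_ysol[OF \<alpha>]]) auto
  obtain x where x: "x \<in> {0..r}" "\<And>w. w \<in> {0..r} \<Longrightarrow> ysol \<alpha> v x \<le> ysol \<alpha> v w"
    using continuous_attains_inf[OF compact_Icc _ c] r(1) by force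
  define m where "m = ysol \<alpha> v x"
  have m: "m > 0" using r(4) x by (auto simp: m_def)
  have cw: "continuous_on {0..r} (wt \<alpha>)" by (rule continuous_on_subset[OF cont_wt[OF \<alpha>]]) auto
  obtain x' where x': "x' \<in> {0..r}" "\<And>w. w \<in> {0..r} \<Longrightarrow> wt \<alpha> w \<le> wt \<alpha> x'"
    using continuous_attains_sup[OF compact_Icc _ cw] r(1) by force
  have "((\<lambda>t. \<bar>t - v\<bar> * (2 * wt \<alpha> x')) \<longlongrightarrow> \<bar>v - v\<bar> * (2 * wt \<alpha> x')) (at v within {0..1})"
    by (intro tendsto_intros)
  then have 3: "eventually (\<lambda>t. \<bar>t - v\<bar> * (2 * wt \<alpha> x') < m) (at v within {0..1})"
    by (rule order_tendstoD(2)) (use m in simp)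
  have 4: "eventually (\<lambda>t. t \<in> {0..1}) (at v within {0..1})" by (auto simp: eventually_at_filter)
  show ?thesis using 1 2 3 4
  proof eventually_elim
    case (elim t)
    have "ysol \<alpha> t w > 0" if w: "w \<in> {0..r}" for w
    proof -
      have "\<bar>ysol \<alpha> t w - ysol \<alpha> v w\<bar> \<le> \<bar>t - v\<bar> * (2 * wt \<alpha> w)"
        using elim(4) v w by (intro ysol_lipschitz[OF \<alpha>]) auto
      also have "\<dots> \<le> \<bar>t - v\<bar> * (2 * wt \<alpha> x')" using x'(2)[OF w] by (intro mult_left_mono) auto
      also note elim(3)
      finally show ?thesis using x(2)[OF w] by (simp add: m_def)
    qed
    then show ?case using elim r(1) unfolding below_def by blast
  qed
qed

lemma ysol_rhs_sign:
  assumes y0: "\<And>w. \<lbrakk>0 \<le> w; w \<le> r\<rbrakk> \<Longrightarrow> ysol \<alpha> v w \<ge> 0" and w: "0 \<le> w" "w \<le> r" and v: "0 \<le> v" "v \<le> 1"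
  shows "rhs \<alpha> v w (ysol \<alpha> v w) = (1 - v) * ysol \<alpha> v w - v * (w powr (2*\<alpha> - 2) * (ysol \<alpha> v w)^3)"
proof -
  have "0 \<le> ysol \<alpha> v w" "ysol \<alpha> v w \<le> exp w"
    using y0[of w] w ysol_le_exp[OF \<alpha> v w(1)] y0 by auto
  then have "clip w (ysol \<alpha> v w) = ysol \<alpha> v w" by (simp add: clip_def[OF \<alpha>] max_def min_def)
  then show ?thesis by (simp add: rhs_def[OF \<alpha>])
qed

text \<open>For parameter 0 the source is y itself, so y increases from 1 and u \<ge> r for r \<ge>
  1. A growing u makes the negative part of J' dominate, and J decreases at least linearly.\<close>

lemma below_0: "below 0"
proof -
  have pos: "ysol \<alpha> 0 r > 0" if r: "r \<ge> 0" for r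
  proof (rule ccontr)
    assume n: "\<not> ysol \<alpha> 0 r > 0"
    then have "r > 0" using r ysol_0[OF \<alpha>, of 0] by (cases "r = 0") auto
    then obtain z where z: "z > 0" "z \<le> r" "ysol \<alpha> 0 z = 0" "\<And>t. \<lbrakk>0 \<le> t; t < z\<rbrakk> \<Longrightarrow> ysol \<alpha> 0 t > 0"
      using first_zero_ysol[of 0 r] n by auto
    have nn: "ysol \<alpha> 0 t \<ge> 0" if "0 \<le> t" "t \<le> z" for t using that z(3) z(4)[of t] by (cases "t = z") auto
    have N: "yder \<alpha> 0 t \<ge> 0" if t: "0 \<le> t" "t \<le> z" for t
    proof -
      have "yflux \<alpha> 0 t \<ge> 0" unfolding yflux_def[OF \<alpha>]
        by (rule rint_nonneg[OF \<alpha> cont_src[OF \<alpha>]]) (use nn t in \<open>auto simp: src_fixg[OF \<alpha>] ysol_rhs_sign[OF nn]\<close>)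
      then show ?thesis unfolding yder_def[OF \<alpha>] yflux_def[OF \<alpha>] rmean_def[OF \<alpha>] by simp
    qed
    have "integral {0..z} (yder \<alpha> 0) \<ge> 0"
      using N by (intro integral_nonneg integrable_from_0 cont_yder[OF \<alpha>]) auto
    then have "ysol \<alpha> 0 z \<ge> 1" using ysol_eq[OF \<alpha>, of 0 z] z by simp
    with z(3) show False by simp
  qed
  have N: "yder \<alpha> 0 t \<ge> 0" if t: "0 \<le> t" for t
  proof -
    have "yflux \<alpha> 0 t \<ge> 0" unfolding yflux_def[OF \<alpha>]
    proof (rule rint_nonneg[OF \<alpha> cont_src[OF \<alpha>]])
      fix w :: real assume w: "0 \<le> w" "w \<le> t"
      have "rhs \<alpha> 0 w (ysol \<alpha> 0 w) = (1 - 0) * ysol \<alpha> 0 w - 0 * (w powr (2*\<alpha> - 2) * (ysol \<alpha> 0 w)^3)"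
        by (rule ysol_rhs_sign[OF less_imp_le[OF pos] w]) auto
      then show "0 \<le> src \<alpha> 0 (fixg \<alpha> 0) w" using pos[OF w(1)] by (simp add: src_fixg[OF \<alpha>])
    qed
    then show ?thesis unfolding yder_def[OF \<alpha>] yflux_def[OF \<alpha>] rmean_def[OF \<alpha>] by simp
  qed
  have y1: "ysol \<alpha> 0 r \<ge> 1" if r: "r \<ge> 0" for r
  proof -
    have "integral {0..r} (yder \<alpha> 0) \<ge> 0"
      using N by (intro integral_nonneg integrable_from_0 cont_yder[OF \<alpha>]) auto
    then show ?thesis using ysol_eq[OF \<alpha>, of 0 r] r by simp
  qed
  have u1: "usol 0 r \<ge> r" if "r \<ge> 1" for r
  proof -
    have "r powr 1 \<le> r powr \<alpha>" using that \<alpha> by (intro powr_mono) auto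
    then have "r * 1 \<le> r powr \<alpha> * ysol \<alpha> 0 r" using y1[of r] that by (intro mult_mono) auto
    then show ?thesis by (simp add: usol_def)
  qed
  \<comment> \<open>Beyond \<open>r1\<close> one has t^2 \<ge> 2/9 + a, so the factor in J' is at
    most -(1/3)/t; with t^(2/3) u^2 \<ge> t this gives J' \<le> -1/3.\<close>
  define r1 where "r1 = 1 + a"
  have r1: "r1 \<ge> 1" "2/9 + a \<le> r1\<^sup>2" using a by (auto simp: r1_def power2_eq_square algebra_simps)
  have dec: "uJ 0 r + r / 3 \<le> uJ 0 r1 + r1 / 3" if r: "r1 \<le> r" for r
  proof (rule deriv_nonpos_imp_ge[OF r])
    fix t assume t: "r1 \<le> t" "t \<le> r"
    have "(uJ 0 has_real_derivative t powr (2/3) * ((2/27 + a/3) * (1/t)^3 - 2/3 * (1 - 0) * (1/t)) * (usol 0 t)\<^sup>2) (at t)"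
      by (rule uJ_deriv) (use t r1 pos in \<open>auto intro: less_imp_le\<close>)
    then show "((\<lambda>r. uJ 0 r + r / 3) has_real_derivative t powr (2/3) * ((2/27 + a/3) * (1/t)^3 - 2/3 * (1 - 0) * (1/t)) * (usol 0 t)\<^sup>2 + 1/3) (at t)"
      by (auto intro!: derivative_eq_intros)
  next
    fix t assume t: "r1 < t" "t < r"
    then have t1: "t \<ge> 1" using r1 by simp
    have "r1\<^sup>2 \<le> t\<^sup>2" using t r1 by (intro power_mono) auto
    then have t2: "2/9 + a \<le> t\<^sup>2" using r1 by simp
    have "(1/t)^3 * (2/27 + a/3 - 1/3 * t\<^sup>2) \<le> 0" using t2 t1 by (intro mult_nonneg_nonpos) auto
    moreover have "(1/t)^3 * (2/27 + a/3 - 1/3 * t\<^sup>2) = (2/27 + a/3) * (1/t)^3 - 1/3 * (1/t)"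
      using t1 by (simp add: right_diff_distrib power2_eq_square power3_eq_cube)
    ultimately have g: "(2/27 + a/3) * (1/t)^3 - 2/3 * (1 - 0) * (1/t) \<le> - (1/3 * (1/t))" by simp
    have "1 powr (2/3) \<le> t powr (2/3)" using t1 by (intro powr_mono2) auto
    then have "1 * t \<le> t powr (2/3) * (usol 0 t)\<^sup>2"
    proof (intro mult_mono)
      have "t * 1 \<le> usol 0 t * usol 0 t" using u1[OF t1] t1 by (intro mult_mono) auto
      then show "t \<le> (usol 0 t)\<^sup>2" by (simp add: power2_eq_square)
    qed (use t1 in auto)
    then have "(t powr (2/3) * (usol 0 t)\<^sup>2) * (1/3 * (1/t)) \<ge> t * (1/3 * (1/t))"
      using t1 by (intro mult_right_mono) auto
    then have "1/3 \<le> (t powr (2/3) * (usol 0 t)\<^sup>2) * (1/3 * (1/t))" using t1 by simp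
    moreover have "(t powr (2/3) * (usol 0 t)\<^sup>2) * ((2/27 + a/3) * (1/t)^3 - 2/3 * (1 - 0) * (1/t))
      \<le> (t powr (2/3) * (usol 0 t)\<^sup>2) * (- (1/3 * (1/t)))" using g by (intro mult_left_mono) auto
    ultimately have "(t powr (2/3) * (usol 0 t)\<^sup>2) * ((2/27 + a/3) * (1/t)^3 - 2/3 * (1 - 0) * (1/t)) + 1/3 \<le> 0" by simp
    then show "t powr (2/3) * ((2/27 + a/3) * (1/t)^3 - 2/3 * (1 - 0) * (1/t)) * (usol 0 t)\<^sup>2 + 1/3 \<le> 0"
      by (simp only: mult.assoc mult.commute mult.left_commute)
  qed
  define r where "r = r1 + 1 + 3 * \<bar>uJ 0 r1\<bar>"
  have r: "r > r1" by (simp add: r_def)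
  have "uJ 0 r + r / 3 \<le> uJ 0 r1 + r1 / 3" using r by (intro dec) simp
  then have "uJ 0 r < 0" using abs_ge_self[of "uJ 0 r1"] r_def by linarith
  moreover have "r1\<^sup>2 \<le> r\<^sup>2" using r r1 by (intro power_mono) auto
  then have "2/27 + a/3 < 2/3 * (1 - 0) * r\<^sup>2" using r1 a by simp
  ultimately show ?thesis using r r1 pos unfolding below_def by (intro exI[of _ r]) auto
qed

lemma ysol_tendsto_1:
  assumes v: "0 \<le> v" "v \<le> 1"
  shows "(ysol \<alpha> v \<longlongrightarrow> 1) (at_right 0)" "(yder \<alpha> v \<longlongrightarrow> 0) (at_right 0)"
proof -
  have "(ysol \<alpha> v \<longlongrightarrow> ysol \<alpha> v 0) (at 0 within {0..})" using cont_ysol[OF \<alpha>] by (auto simp: continuous_on_def)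
  then show "(ysol \<alpha> v \<longlongrightarrow> 1) (at_right 0)" unfolding ysol_0[OF \<alpha> v] by (rule tendsto_within_subset) auto
  have "(yder \<alpha> v \<longlongrightarrow> yder \<alpha> v 0) (at 0 within {0..})" using cont_yder[OF \<alpha>] by (auto simp: continuous_on_def)
  then show "(yder \<alpha> v \<longlongrightarrow> 0) (at_right 0)" unfolding yder_0[OF \<alpha>] by (rule tendsto_within_subset) auto
qed

lemma usol_tendsto_0:
  assumes v: "0 \<le> v" "v \<le> 1"
  shows "(usol v \<longlongrightarrow> 0) (at_right 0)"
proof -
  have "((\<lambda>r::real. r powr \<alpha>) \<longlongrightarrow> 0) (at_right 0)" using \<alpha> by real_asymp
  from tendsto_mult[OF this ysol_tendsto_1(1)[OF v]] show ?thesis unfolding usol_def[abs_def] by simp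
qed

lemma uJ_tendsto_0:
  assumes v: "0 \<le> v" "v \<le> 1"
  shows "(uJ v \<longlongrightarrow> 0) (at_right 0)"
proof -
  \<comment> \<open>Close to 0 one has |y| \<le> 2 and |y'| \<le> 1, hence |u| \<le> 2 r and |u'|
    \<le> 2 \<alpha> + 1.\<close>
  define C where "C = 2 * \<alpha> + 1"
  have C: "C > 0" "C \<ge> 2" using \<alpha> by (auto simp: C_def)
  have "eventually (\<lambda>r. dist (ysol \<alpha> v r) 1 < 1) (at_right 0)" "eventually (\<lambda>r. dist (yder \<alpha> v r) 0 < 1) (at_right 0)"
    using tendstoD[OF ysol_tendsto_1(1)[OF v], of 1] tendstoD[OF ysol_tendsto_1(2)[OF v], of 1] by simp_all
  moreover have "eventually (\<lambda>r::real. 0 < r \<and> r < 1) (at_right 0)"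
    unfolding eventually_at_right_field by (intro exI[of _ 1]) auto
  ultimately have ev: "eventually (\<lambda>r. norm (uJ v r) \<le> r powr (2/3) * (1/2 * (C)\<^sup>2 + 1/2 * ((1 + a * (1/r)\<^sup>2) * (C*r)\<^sup>2) + 1/4 * ((C*r)^4 * (1/r)\<^sup>2) + 1/3 * ((C*r) * (C) * (1/r)) + 1/18 * ((C*r)\<^sup>2 * (1/r)\<^sup>2))) (at_right 0)"
  proof eventually_elim
    case (elim r)
    have r: "0 < r" "r < 1" using elim by auto
    have y: "\<bar>ysol \<alpha> v r\<bar> \<le> 2" "\<bar>yder \<alpha> v r\<bar> \<le> 1" using elim by (auto simp: dist_real_def)
    have p: "r powr \<alpha> \<le> r" "r powr \<alpha> \<le> 1" using powr_mono'[of 1 \<alpha> r] r \<alpha> by simp_all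
    have "r powr \<alpha> * \<bar>ysol \<alpha> v r\<bar> \<le> r * 2" using p y r by (intro mult_mono) auto
    then have u2: "\<bar>usol v r\<bar> \<le> 2 * r" by (simp add: usol_def abs_mult mult.commute)
    also have "\<dots> \<le> C * r" using C r by (intro mult_right_mono) auto
    finally have u: "\<bar>usol v r\<bar> \<le> C * r" .
    have "r powr (- \<alpha>) * r powr (2 * \<alpha>) = r powr \<alpha>" using r by (simp add: powr_add[symmetric])
    then have e: "r powr (- \<alpha>) * yflux \<alpha> v r = r powr \<alpha> * yder \<alpha> v r"
      unfolding yflux_eq[OF \<alpha> r(1)] mult.assoc[symmetric] by (simp only:)
    have 1: "\<bar>r powr \<alpha> * yder \<alpha> v r\<bar> \<le> 1 * 1" unfolding abs_mult using p y by (intro mult_mono) auto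
    have "\<alpha> * \<bar>usol v r\<bar> / r \<le> \<alpha> * (2 * r) / r" using u2 r \<alpha> by (intro divide_right_mono mult_left_mono) auto
    then have "\<bar>\<alpha> * usol v r / r\<bar> \<le> 2 * \<alpha>" using r \<alpha> by (simp add: abs_mult)
    then have u': "\<bar>uder v r\<bar> \<le> C" unfolding uder_def e C_def using 1 by linarith
    show ?case unfolding uJ_def real_norm_def
      by (rule abs_Jfun_le[where u = "usol v" and u' = "uder v", OF r(1) u u']) (use a v in auto)
  qed
  show ?thesis by (rule Lim_null_comparison[OF ev Jfun_majorant_tendsto_0[OF a C(1)]])
qed

text \<open>Suppose y stays nonnegative. Then y decreases, and the flux bounds u by a constant. On
  the other hand J increases strictly from 0 as the mass term is gone, and a positive lower bound on
  J forces |r u'| \<ge> 1 eventually. Then u would vary by more than a logarithm, which a bounded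
  positive function cannot do.\<close>

lemma crosses_1: "crosses 1"
proof (rule ccontr)
  assume "\<not> crosses 1"
  then have nn: "ysol \<alpha> 1 r \<ge> 0" if "r \<ge> 0" for r
  proof (cases "r = 0")
    case True then show ?thesis using ysol_0[OF \<alpha>, of 1] by simp
  next
    case False
    then have "r > 0" using that by simp
    then show ?thesis using \<open>\<not> crosses 1\<close> unfolding crosses_def using linorder_not_less by blast
  qed
  have pos: "ysol \<alpha> 1 r > 0" if "r \<ge> 0" for r using that by (intro ysol_pos_of_nonneg nn) auto
  have rhs1: "rhs \<alpha> 1 w (ysol \<alpha> 1 w) = - (w powr (2*\<alpha> - 2) * (ysol \<alpha> 1 w)^3)" if "w \<ge> 0" for w
    using ysol_rhs_sign[where v = 1 and r = w, OF nn that] by simp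
  have src1: "src \<alpha> 1 (fixg \<alpha> 1) w \<le> 0" if "w \<ge> 0" for w
    using rhs1[OF that] nn[OF that] by (simp add: src_fixg[OF \<alpha>])
  have fl: "yflux \<alpha> 1 t \<le> 0" for t
  proof -
    have "rint \<alpha> (\<lambda>w. 0 - src \<alpha> 1 (fixg \<alpha> 1) w) t \<ge> 0"
      using src1 by (intro rint_nonneg[OF \<alpha>] continuous_intros cont_src[OF \<alpha>]) auto
    moreover have "rint \<alpha> (\<lambda>w. 0 - src \<alpha> 1 (fixg \<alpha> 1) w) t = rint \<alpha> (\<lambda>w. 0) t - rint \<alpha> (src \<alpha> 1 (fixg \<alpha> 1)) t"
      by (rule rint_diff[OF \<alpha>]) (intro continuous_intros cont_src[OF \<alpha>])+
    moreover have "rint \<alpha> (\<lambda>w. 0) t = 0" by (simp add: rint_def[OF \<alpha>])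
    ultimately show ?thesis by (simp add: yflux_def[OF \<alpha>])
  qed
  have N: "yder \<alpha> 1 t \<le> 0" for t
    using fl[of t] unfolding yder_def[OF \<alpha>] yflux_def[OF \<alpha>] rmean_def[OF \<alpha>] by (intro mult_nonneg_nonpos) auto
  \<comment> \<open>The exponent in \<integral> w^(2\<alpha>) w^(2\<alpha> - 2) dw = r^\<beta> /
    \<beta> over [0, r].\<close>
  define \<beta> where "\<beta> = 4 * \<alpha> - 1"
  have \<beta>: "\<beta> > 3" using \<alpha> by (simp add: \<beta>_def)
  \<comment> \<open>As y decreases, y(w)^3 \<ge> y(r)^3 under the flux integral. The proof
    differentiates instead of estimating the integral: the sum \<open>h\<close> has derivative \<le>
    0 and limit 0 at the origin.\<close>
  have fl2: "yflux \<alpha> 1 r + (ysol \<alpha> 1 r)^3 * r powr \<beta> / \<beta> \<le> 0" if r: "r > 0" for r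
  proof -
    define h where "h = (\<lambda>r. yflux \<alpha> 1 r + (ysol \<alpha> 1 r)^3 * r powr \<beta> / \<beta>)"
    have dh: "(h has_real_derivative 3 * (ysol \<alpha> 1 t)\<^sup>2 * yder \<alpha> 1 t * t powr \<beta> / \<beta>) (at t)" if t: "t > 0" for t
    proof -
      have 1: "((\<lambda>t. t powr \<beta>) has_real_derivative \<beta> * t powr (\<beta> - 1)) (at t)" by (rule has_real_derivative_powr[OF t])
      have 2: "((\<lambda>t. (ysol \<alpha> 1 t)^3) has_real_derivative 3 * (ysol \<alpha> 1 t)\<^sup>2 * yder \<alpha> 1 t) (at t)"
        by (rule DERIV_cong[OF DERIV_power[OF ysol_deriv[OF \<alpha> _ _ t]]]) auto
      have p: "t powr (2*\<alpha>) * t powr (2*\<alpha> - 2) = t powr (\<beta> - 1)" using t by (simp add: powr_add[symmetric] \<beta>_def)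
      have "(h has_real_derivative t powr (2*\<alpha>) * rhs \<alpha> 1 t (ysol \<alpha> 1 t) +
         ((3 * (ysol \<alpha> 1 t)\<^sup>2 * yder \<alpha> 1 t) * t powr \<beta> + \<beta> * t powr (\<beta> - 1) * (ysol \<alpha> 1 t)^3) / \<beta>) (at t)"
        unfolding h_def by (intro DERIV_add DERIV_mult DERIV_cdivide yflux_deriv[OF \<alpha> t] 1 2)
      moreover have "t powr (2*\<alpha>) * rhs \<alpha> 1 t (ysol \<alpha> 1 t) = - (t powr (\<beta> - 1) * (ysol \<alpha> 1 t)^3)"
        using rhs1[of t] t p by (simp add: mult.assoc[symmetric])
      ultimately show ?thesis using \<beta> by (simp add: add_divide_distrib)
    qed
    have "h r \<le> h s" if "0 < s" "s < r" for s
    proof (rule deriv_nonpos_imp_ge[OF less_imp_le[OF that(2)] dh])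
      fix t show "3 * (ysol \<alpha> 1 t)\<^sup>2 * yder \<alpha> 1 t * t powr \<beta> / \<beta> \<le> 0"
        using N[of t] \<beta> by (intro divide_nonpos_pos mult_nonpos_nonneg mult_nonneg_nonpos) auto
    qed (use that in auto)
    then have "eventually (\<lambda>s. h r \<le> h s) (at_right 0)"
      unfolding eventually_at_right_field using r by (intro exI[of _ r]) auto
    moreover have "(h \<longlongrightarrow> 0 + 1^3 * 0 / \<beta>) (at_right 0)"
      unfolding h_def
    proof (intro tendsto_intros ysol_tendsto_1)
      have "(yflux \<alpha> 1 \<longlongrightarrow> yflux \<alpha> 1 0) (at 0 within {0..})"
        unfolding yflux_def[OF \<alpha>] using cont_rint[OF \<alpha> cont_src[OF \<alpha>]] by (auto simp: continuous_on_def)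
      then show "(yflux \<alpha> 1 \<longlongrightarrow> 0) (at_right 0)"
        unfolding yflux_def[OF \<alpha>] rint_0[OF \<alpha>] by (rule tendsto_within_subset) auto
      show "((\<lambda>x::real. x powr \<beta>) \<longlongrightarrow> 0) (at_right 0)" using \<beta> by real_asymp
    qed (use \<beta> in auto)
    ultimately have "h r \<le> 0 + 1^3 * 0 / \<beta>" by (intro tendsto_lowerbound[where F = "at_right (0::real)"]) auto
    then show ?thesis by (simp add: h_def)
  qed
  \<comment> \<open>Dividing \<open>fl2\<close> by r^(2\<alpha>) y^3 gives y'/y^3 \<le> -
    r^(2\<alpha> - 1) / \<beta>. Hence y^(-2) - r^(2\<alpha>)/(\<alpha> \<beta>) increases from 1,
    which bounds u^2 = r^(2\<alpha>) y^2.\<close>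
  have u2: "(usol 1 r)\<^sup>2 \<le> \<alpha> * \<beta>" if r: "r > 0" for r
  proof -
    define k where "k = (\<lambda>r. inverse ((ysol \<alpha> 1 r)\<^sup>2) - r powr (2*\<alpha>) / (\<alpha> * \<beta>))"
    define k' where "k' = (\<lambda>r. - 2 * yder \<alpha> 1 r / (ysol \<alpha> 1 r)^3 - 2 * r powr (2*\<alpha> - 1) / \<beta>)"
    have dk: "(k has_real_derivative k' t) (at t)" if t: "t > 0" for t
    proof -
      have y: "ysol \<alpha> 1 t > 0" using pos[of t] t by simp
      have 1: "((\<lambda>t. t powr (2*\<alpha>)) has_real_derivative (2*\<alpha>) * t powr (2*\<alpha> - 1)) (at t)" by (rule has_real_derivative_powr[OF t])
      have 2: "((\<lambda>t. (ysol \<alpha> 1 t)\<^sup>2) has_real_derivative 2 * ysol \<alpha> 1 t * yder \<alpha> 1 t) (at t)"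
        by (rule DERIV_cong[OF DERIV_power[OF ysol_deriv[OF \<alpha> _ _ t]]]) auto
      have "(k has_real_derivative - (inverse ((ysol \<alpha> 1 t)\<^sup>2) * (2 * ysol \<alpha> 1 t * yder \<alpha> 1 t) * inverse ((ysol \<alpha> 1 t)\<^sup>2))
          - (2*\<alpha>) * t powr (2*\<alpha> - 1) / (\<alpha> * \<beta>)) (at t)"
        unfolding k_def by (intro DERIV_diff DERIV_cdivide 1 DERIV_inverse'[OF 2]) (use y in auto)
      moreover have "- (inverse ((ysol \<alpha> 1 t)\<^sup>2) * (2 * ysol \<alpha> 1 t * yder \<alpha> 1 t) * inverse ((ysol \<alpha> 1 t)\<^sup>2))
          - (2*\<alpha>) * t powr (2*\<alpha> - 1) / (\<alpha> * \<beta>) = k' t"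
        unfolding k'_def using y \<alpha> \<beta> by (simp add: field_simps power2_eq_square power3_eq_cube)
      ultimately show ?thesis by simp
    qed
    have k'0: "k' t \<ge> 0" if t: "t > 0" for t
    proof -
      have y: "(ysol \<alpha> 1 t)^3 > 0" using pos[of t] t by simp
      have "t powr (2*\<alpha>) * yder \<alpha> 1 t + (ysol \<alpha> 1 t)^3 * t powr \<beta> / \<beta> \<le> 0" using fl2[OF t] yflux_eq[OF \<alpha> t] by simp
      moreover have "t powr \<beta> = t powr (2*\<alpha>) * t powr (2*\<alpha> - 1)" using t by (simp add: powr_add[symmetric] \<beta>_def)
      ultimately have "t powr (2*\<alpha>) * (yder \<alpha> 1 t + (ysol \<alpha> 1 t)^3 * t powr (2*\<alpha> - 1) / \<beta>) \<le> 0"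
        by (simp add: algebra_simps)
      then have "yder \<alpha> 1 t + (ysol \<alpha> 1 t)^3 * t powr (2*\<alpha> - 1) / \<beta> \<le> 0"
        using t by (simp add: mult_le_0_iff)
      then have "(yder \<alpha> 1 t + (ysol \<alpha> 1 t)^3 * (t powr (2*\<alpha> - 1) / \<beta>)) / (ysol \<alpha> 1 t)^3 \<le> 0"
        using y by (intro divide_nonpos_pos) auto
      then have "yder \<alpha> 1 t / (ysol \<alpha> 1 t)^3 + t powr (2*\<alpha> - 1) / \<beta> \<le> 0"
        using y by (simp add: add_divide_distrib)
      then show ?thesis by (simp add: k'_def)
    qed
    have "k s \<le> k r" if "0 < s" "s < r" for s
      by (rule deriv_nonneg_imp_le[OF less_imp_le[OF that(2)] dk]) (use that k'0 in auto)
    then have "eventually (\<lambda>s. k s \<le> k r) (at_right 0)"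
      unfolding eventually_at_right_field using r by (intro exI[of _ r]) auto
    moreover have "(k \<longlongrightarrow> inverse (1\<^sup>2) - 0 / (\<alpha> * \<beta>)) (at_right 0)"
      unfolding k_def
    proof (intro tendsto_intros ysol_tendsto_1)
      show "((\<lambda>x::real. x powr (2*\<alpha>)) \<longlongrightarrow> 0) (at_right 0)" using \<alpha> by real_asymp
    qed (use \<alpha> \<beta> in auto)
    ultimately have "inverse (1\<^sup>2) - 0 / (\<alpha> * \<beta>) \<le> k r" by (intro tendsto_upperbound[where F = "at_right (0::real)"]) auto
    then have k1: "r powr (2*\<alpha>) / (\<alpha> * \<beta>) \<le> inverse ((ysol \<alpha> 1 r)\<^sup>2)" by (simp add: k_def)
    have y: "(ysol \<alpha> 1 r)\<^sup>2 > 0" using pos[of r] r by simp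
    have "r powr (2*\<alpha>) * (ysol \<alpha> 1 r)\<^sup>2 \<le> \<alpha> * \<beta>"
      using k1 y \<alpha> \<beta> by (simp add: divide_le_eq field_simps)
    moreover have "(usol 1 r)\<^sup>2 = r powr (2*\<alpha>) * (ysol \<alpha> 1 r)\<^sup>2"
      using r by (simp add: usol_def power_mult_distrib power2_eq_square powr_add[symmetric])
    ultimately show ?thesis by simp
  qed
  define K where "K = sqrt (\<alpha> * \<beta>)"
  have K: "K > 0" "K\<^sup>2 = \<alpha> * \<beta>" using \<alpha> \<beta> by (auto simp: K_def)
  have upos: "usol 1 r > 0" if "r > 0" for r using pos[of r] that by (simp add: usol_def)
  have uK: "usol 1 r \<le> K" if "r > 0" for r
    by (rule power2_le_imp_le) (use u2[OF that] K in auto)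
  have dJ: "(uJ 1 has_real_derivative t powr (2/3) * ((2/27 + a/3) * (1/t)^3 - 2/3 * (1 - 1) * (1/t)) * (usol 1 t)\<^sup>2) (at t)" if "t > 0" for t
    by (rule uJ_deriv) (use that nn in auto)
  have Jinc: "uJ 1 x < uJ 1 y" if xy: "0 < x" "x < y" for x y
  proof (rule deriv_pos_imp_less[OF xy(2) dJ])
    fix t assume "x < t" "t < y"
    then have "t > 0" using xy by simp
    then show "0 < t powr (2/3) * ((2/27 + a/3) * (1/t)^3 - 2/3 * (1 - 1) * (1/t)) * (usol 1 t)\<^sup>2"
      using upos[of t] a by (simp add: add_pos_pos)
  qed (use xy in auto)
  define j where "j = uJ 1 1"
  have j: "j > 0" unfolding j_def
    by (rule pos_if_strict_increasing_from_0[OF uJ_tendsto_0]) (auto intro: Jinc)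
  \<comment> \<open>Times r^(4/3) the energy is a polynomial in u and r u'. It would be bounded if
    |r u'| \<le> 1 and u \<le> K, while j r^(4/3) is unbounded.\<close>
  have big: "\<bar>r * uder 1 r\<bar> \<ge> 1" if r: "r \<ge> 1" "j * r powr (4/3) > 1/2 + K^4/4 + K/3" for r
  proof (rule ccontr)
    assume "\<not> \<bar>r * uder 1 r\<bar> \<ge> 1"
    then have p1: "\<bar>r * uder 1 r\<bar> \<le> 1" by simp
    have r0: "r > 0" using r by simp
    have "j \<le> uJ 1 r" using Jinc[of 1 r] r by (cases "r = 1") (auto simp: j_def intro: less_imp_le)
    then have jJ: "r powr (4/3) * j \<le> r powr (4/3) * uJ 1 r" by (intro mult_left_mono) auto
    have "r powr (4/3) * r powr (2/3) = r\<^sup>2" using r0 by (simp add: powr_add[symmetric] powr_numeral)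
    then have "r powr (4/3) * uJ 1 r = r\<^sup>2 * (1/2 * (uder 1 r)\<^sup>2 - 1/2 * ((1 - 1 + a * (1/r)\<^sup>2) * (usol 1 r)\<^sup>2)
      + 1/4 * ((usol 1 r)^4 * (1/r)\<^sup>2) - 1/3 * (usol 1 r * uder 1 r * (1/r)) - 1/18 * ((usol 1 r)\<^sup>2 * (1/r)\<^sup>2))"
      unfolding uJ_def Jfun_def mult.assoc[symmetric] by simp
    also have "\<dots> = 1/2 * (r * uder 1 r)\<^sup>2 - a/2 * (usol 1 r)\<^sup>2 + 1/4 * (usol 1 r)^4 - 1/3 * (usol 1 r * (r * uder 1 r)) - 1/18 * (usol 1 r)\<^sup>2"
      using r0 by (simp add: field_simps power2_eq_square)
    also have "\<dots> \<le> 1/2 + K^4/4 + K/3"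
    proof -
      have 1: "(r * uder 1 r)\<^sup>2 \<le> 1" using p1 by (simp add: abs_square_le_1)
      have 2: "(usol 1 r)^4 \<le> K^4" using uK[OF r0] upos[OF r0] by (intro power_mono) auto
      have "\<bar>usol 1 r * (r * uder 1 r)\<bar> \<le> K * 1" unfolding abs_mult[of "usol 1 r"] using uK[OF r0] upos[OF r0] p1 K by (intro mult_mono) auto
      then have 3: "- (usol 1 r * (r * uder 1 r)) \<le> K" by simp
      have 4: "0 \<le> a/2 * (usol 1 r)\<^sup>2" "0 \<le> (usol 1 r)\<^sup>2" using a by auto
      show ?thesis using 1 2 3 4 by linarith
    qed
    finally show False using r(2) jJ by (simp add: mult.commute)
  qed
  have "filterlim (\<lambda>r::real. j * r powr (4/3)) at_top at_top" using j by real_asymp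
  then have "eventually (\<lambda>r. j * r powr (4/3) > 1/2 + K^4/4 + K/3) at_top" by (auto simp: filterlim_at_top_dense)
  then obtain R0 where R0: "\<And>r. r \<ge> R0 \<Longrightarrow> j * r powr (4/3) > 1/2 + K^4/4 + K/3" by (auto simp: eventually_at_top_linorder)
  define R where "R = max R0 1"
  have R: "R \<ge> 1" by (simp add: R_def)
  have big': "\<bar>r * uder 1 r\<bar> \<ge> 1" if "r \<ge> R" for r using that R0[of r] by (intro big) (auto simp: R_def)
  have cont: "continuous_on {R..S} (\<lambda>r. r * uder 1 r)" for S
  proof (intro continuous_on_mult continuous_on_id DERIV_continuous_on[OF has_field_derivative_at_within[OF uder_deriv]])
    fix x w :: real assume "x \<in> {R..S}" "0 \<le> w" "w \<le> x"
    then show "0 \<le> ysol \<alpha> 1 w" using nn by simp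
  qed (use R in auto)
  \<comment> \<open>The continuous function r u' avoids the interval (-1, 1) beyond
    \<open>R\<close>, so it cannot change sign.\<close>
  have iff: "(r * uder 1 r \<ge> 1) = (R * uder 1 R \<ge> 1)" if r: "r \<ge> R" for r
  proof (rule ccontr)
    assume "\<not> ?thesis"
    then consider "r * uder 1 r \<ge> 1" "R * uder 1 R \<le> -1" | "r * uder 1 r \<le> -1" "R * uder 1 R \<ge> 1"
      using big'[OF r] big'[of R] by fastforce
    then obtain t where "R \<le> t" "t \<le> r" "t * uder 1 t = 0"
    proof cases
      case 1
      then show ?thesis using IVT'[of "\<lambda>r. r * uder 1 r" R 0 r, OF _ _ r cont] that by force
    next
      case 2
      then show ?thesis using IVT2'[of "\<lambda>r. r * uder 1 r" r 0 R, OF _ _ r cont] that by force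
    qed
    then show False using big'[of t] by auto
  qed
  have lnd: "(ln has_real_derivative 1 / t) (at t)" if "t > 0" for t :: real
    using DERIV_ln[OF that] by (simp add: inverse_eq_divide)
  show False
  proof (cases "R * uder 1 R \<ge> 1")
    case True
    \<comment> \<open>On [R, S] the logarithm grows by K + 1, more than u can vary inside (0,
      K].\<close>
    define S where "S = R * exp (K + 1)"
    have S: "S \<ge> R" using R K by (simp add: S_def)
    have "usol 1 R - ln R \<le> usol 1 S - ln S"
    proof (rule deriv_nonneg_imp_le[OF S])
      fix x assume "R \<le> x"
      then have x: "x > 0" using R by simp
      show "((\<lambda>r. usol 1 r - ln r) has_real_derivative uder 1 x - 1 / x) (at x)"
        by (intro DERIV_diff usol_deriv lnd x) auto
    next
      fix x assume x: "R < x"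
      then have "x * uder 1 x \<ge> 1" using iff[of x] True by simp
      then show "0 \<le> uder 1 x - 1 / x" using x R by (simp add: divide_le_eq mult.commute)
    qed
    moreover have "ln S = ln R + (K + 1)" using R by (simp add: S_def ln_mult)
    ultimately show False using uK[of S] upos[of R] R S by simp
  next
    case False
    define S where "S = R * exp (K + 1)"
    have S: "S \<ge> R" using R K by (simp add: S_def)
    have "usol 1 S + ln S \<le> usol 1 R + ln R"
    proof (rule deriv_nonpos_imp_ge[OF S])
      fix x assume "R \<le> x"
      then have x: "x > 0" using R by simp
      show "((\<lambda>r. usol 1 r + ln r) has_real_derivative uder 1 x + 1 / x) (at x)"
        by (intro DERIV_add usol_deriv lnd x) auto
    next
      fix x assume x: "R < x"
      then have "x * uder 1 x \<le> -1" using iff[of x] False big'[of x] by auto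
      then have "x * (uder 1 x + 1 / x) \<le> 0" using x R by (simp add: distrib_left)
      then show "uder 1 x + 1 / x \<le> 0" using x R by (simp add: mult_le_0_iff)
    qed
    moreover have "ln S = ln R + (K + 1)" using R by (simp add: S_def ln_mult)
    ultimately show False using uK[of R] upos[of S] R S by simp
  qed
qed

section \<open>A profile from a parameter satisfying neither alternative\<close>

lemma ex_neither: "\<exists>v. 0 < v \<and> v < 1 \<and> \<not> below v \<and> \<not> crosses v"
proof (rule ccontr)
  assume n: "\<not> ?thesis"
  have op: "openin (top_of_set {0..1}) {v\<in>{0..1}. P v}"
    if "\<And>v. \<lbrakk>0 \<le> v; v \<le> 1; P v\<rbrakk> \<Longrightarrow> eventually P (at v within {0..1})" for P :: "real \<Rightarrow> bool"
    unfolding openin_euclidean_subtopology_iff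
  proof (intro conjI ballI)
    fix x assume x: "x \<in> {v\<in>{0..1}. P v}"
    then have "eventually P (at x within {0..1})" by (intro that) auto
    then obtain d where d: "d > 0" "\<forall>y\<in>{0..1}. y \<noteq> x \<and> dist y x < d \<longrightarrow> P y"
      unfolding eventually_at by blast
    then show "\<exists>e>0. \<forall>x'\<in>{0..1}. dist x' x < e \<longrightarrow> x' \<in> {v \<in> {0..1}. P v}"
      using x by (intro exI[of _ d]) auto
  qed auto
  have "\<not> (\<exists>e1 e2. openin (top_of_set {0..1::real}) e1 \<and> openin (top_of_set {0..1}) e2 \<and>
      {0..1} \<subseteq> e1 \<union> e2 \<and> e1 \<inter> e2 = {} \<and> e1 \<noteq> {} \<and> e2 \<noteq> {})"
    using connected_Icc[of 0 "1::real"] unfolding connected_openin .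
  moreover have "openin (top_of_set {0..1}) {v\<in>{0..1}. below v}" by (rule op) (rule eventually_below)
  moreover have "openin (top_of_set {0..1}) {v\<in>{0..1}. crosses v}" by (rule op) (rule eventually_crosses)
  moreover have "{0..1} \<subseteq> {v\<in>{0..1}. below v} \<union> {v\<in>{0..1}. crosses v}"
  proof
    fix v :: real assume v: "v \<in> {0..1}"
    show "v \<in> {v\<in>{0..1}. below v} \<union> {v\<in>{0..1}. crosses v}"
      using v n below_0 crosses_1 by (cases "v = 0"; cases "v = 1") auto
  qed
  moreover have "{v\<in>{0..1}. below v} \<inter> {v\<in>{0..1}. crosses v} = {}" using below_not_crosses by auto
  moreover have "0 \<in> {v\<in>{0..1}. below v}" "1 \<in> {v\<in>{0..1}. crosses v}" using below_0 crosses_1 by auto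
  ultimately show False by blast
qed

lemma ex_profile: "\<exists>u u'. profile a u u'"
proof -
  obtain v where th: "0 < v" "v < 1" "\<not> below v" "\<not> crosses v" using ex_neither by blast
  then have v: "0 \<le> v" "v \<le> 1" by auto
  define s u u' where "s = 1 - v" and "u = usol v" and "u' = uder v"
  have s: "s > 0" using th by (simp add: s_def)
  have nn: "ysol \<alpha> v r \<ge> 0" if "r \<ge> 0" for r
  proof (cases "r = 0")
    case True then show ?thesis using ysol_0[OF \<alpha> v] by simp
  next
    case False
    then have "r > 0" using that by simp
    then show ?thesis using th(4) unfolding crosses_def using linorder_not_less by blast
  qed
  have y: "ysol \<alpha> v r > 0" if "r \<ge> 0" for r by (rule ysol_pos_of_nonneg[OF v nn that])
  have upos: "u r > 0" if "r > 0" for r using y[of r] that by (simp add: u_def usol_def)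
  have du: "(u has_real_derivative u' r) (at r)" if "r > 0" for r
    unfolding u_def u'_def by (rule usol_deriv[OF v that])
  have du': "(u' has_real_derivative (s + a/r\<^sup>2) * u r - v * (u r)^3/r\<^sup>2) (at r)" if "r > 0" for r
    unfolding u_def u'_def s_def by (rule uder_deriv[OF v that nn])
  \<comment> \<open>Beyond \<open>r0\<close> the positive part of the factor in J' uses up at most
    half of the negative part, so the factor is at most -(s/3)/r.\<close>
  define r0 where "r0 = 1 + 3 * (2/27 + a/3) / s"
  have r0: "r0 \<ge> 1" using a s by (simp add: r0_def)
  have G0: "2/27 + a/3 \<le> s/3 * r\<^sup>2" if "r \<ge> r0" for r
  proof -
    have "3 * (2/27 + a/3) / s \<le> r" using that by (simp add: r0_def)
    then have "3 * (2/27 + a/3) \<le> r * s" using s by (simp add: divide_le_eq)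
    moreover have "r * 1 \<le> r * r" using that r0 by (intro mult_left_mono) auto
    then have "r * s \<le> r\<^sup>2 * s" using s by (intro mult_right_mono) (auto simp: power2_eq_square)
    ultimately have "3 * (2/27 + a/3) \<le> r\<^sup>2 * s" by (rule order_trans)
    then show ?thesis by (simp add: mult.commute)
  qed
  have J0: "uJ v r \<ge> 0" if r: "r \<ge> r0" for r
  proof (rule ccontr)
    assume "\<not> uJ v r \<ge> 0"
    moreover have "r > 0" using r r0 by simp
    moreover have "s/3 * r\<^sup>2 < 2/3 * s * r\<^sup>2" using s \<open>r > 0\<close> by simp
    then have "2/27 + a/3 < 2/3 * s * r\<^sup>2" using G0[OF r] by linarith
    ultimately have "below v" unfolding below_def s_def[symmetric] using y by (intro exI[of _ r]) auto
    with th(3) show False by simp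
  qed
  have dJ: "(uJ v has_real_derivative t powr (2/3) * ((2/27 + a/3) * (1/t)^3 - 2/3 * s * (1/t)) * (u t)\<^sup>2) (at t)" if "t > 0" for t
    unfolding u_def s_def by (rule uJ_deriv[OF v that nn])
  \<comment> \<open>If u \<ge> c from some point on, then J' \<le> -(s/3) c^2 r^(-1/3). The
    antiderivative (s/2) c^2 r^(2/3) drives J to minus infinity, against J \<ge> 0.\<close>
  have no_lb: "\<exists>r\<ge>R. u r < c" if R: "R \<ge> r0" and c: "c > 0" for R c
  proof (rule ccontr)
    assume "\<not> ?thesis"
    then have uc: "u r \<ge> c" if "r \<ge> R" for r using that by (meson linorder_not_less)
    have bound: "uJ v r + s/2 * c\<^sup>2 * r powr (2/3) \<le> uJ v R + s/2 * c\<^sup>2 * R powr (2/3)" if r: "R \<le> r" for r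
    proof (rule deriv_nonpos_imp_ge[OF r])
      fix t assume "R \<le> t"
      then have t: "t > 0" using R r0 by simp
      show "((\<lambda>r. uJ v r + s/2 * c\<^sup>2 * r powr (2/3)) has_real_derivative
         t powr (2/3) * ((2/27 + a/3) * (1/t)^3 - 2/3 * s * (1/t)) * (u t)\<^sup>2 + s/2 * c\<^sup>2 * (2/3 * t powr (2/3) / t)) (at t)"
        by (intro DERIV_add DERIV_cmult dJ powr_two_thirds_deriv t)
    next
      fix t assume t: "R < t"
      then have t0: "t > 0" using R r0 by simp
      have "(1/t)^3 * (2/27 + a/3 - s/3 * t\<^sup>2) \<le> 0" using t0 G0[of t] t R by (intro mult_nonneg_nonpos) auto
      also have "(1/t)^3 * (2/27 + a/3 - s/3 * t\<^sup>2) = (2/27 + a/3) * (1/t)^3 - s/3 * (1/t)"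
        using t0 by (simp add: right_diff_distrib power2_eq_square power3_eq_cube)
      finally have g: "(2/27 + a/3) * (1/t)^3 - 2/3 * s * (1/t) \<le> - (s/3 * (1/t))" by simp
      have "c\<^sup>2 \<le> (u t)\<^sup>2" using uc[of t] t c by (intro power_mono) auto
      then have "s/3 * (1/t) * c\<^sup>2 \<le> s/3 * (1/t) * (u t)\<^sup>2" using s t0 by (intro mult_left_mono) auto
      moreover have "((2/27 + a/3) * (1/t)^3 - 2/3 * s * (1/t)) * (u t)\<^sup>2 \<le> - (s/3 * (1/t)) * (u t)\<^sup>2"
        using g by (intro mult_right_mono) auto
      ultimately have "((2/27 + a/3) * (1/t)^3 - 2/3 * s * (1/t)) * (u t)\<^sup>2 + s/3 * (1/t) * c\<^sup>2
          \<le> - (s/3 * (1/t)) * (u t)\<^sup>2 + s/3 * (1/t) * (u t)\<^sup>2" by (rule add_mono[rotated])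
      then have "((2/27 + a/3) * (1/t)^3 - 2/3 * s * (1/t)) * (u t)\<^sup>2 + s/3 * (1/t) * c\<^sup>2 \<le> 0"
        by (simp only: minus_mult_left[symmetric] add.left_inverse)
      then have "t powr (2/3) * (((2/27 + a/3) * (1/t)^3 - 2/3 * s * (1/t)) * (u t)\<^sup>2 + s/3 * (1/t) * c\<^sup>2) \<le> 0"
        by (intro mult_nonneg_nonpos) auto
      then show "t powr (2/3) * ((2/27 + a/3) * (1/t)^3 - 2/3 * s * (1/t)) * (u t)\<^sup>2 + s/2 * c\<^sup>2 * (2/3 * t powr (2/3) / t) \<le> 0"
        by (simp add: distrib_left mult_ac)
    qed
    have "filterlim (\<lambda>r::real. s/2 * c\<^sup>2 * r powr (2/3)) at_top at_top" using s c by real_asymp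
    then have "eventually (\<lambda>r. s/2 * c\<^sup>2 * r powr (2/3) > uJ v R + s/2 * c\<^sup>2 * R powr (2/3)) at_top"
      unfolding filterlim_at_top_dense by blast
    then have "eventually (\<lambda>r. s/2 * c\<^sup>2 * r powr (2/3) > uJ v R + s/2 * c\<^sup>2 * R powr (2/3) \<and> r \<ge> R) at_top"
      by (rule eventually_conj) (rule eventually_ge_at_top)
    then obtain r where "s/2 * c\<^sup>2 * r powr (2/3) > uJ v R + s/2 * c\<^sup>2 * R powr (2/3)" "r \<ge> R"
      using eventually_happens'[OF trivial_limit_at_top_linorder] by blast
    then show False using bound[of r] J0[of r] R by linarith
  qed
  \<comment> \<open>Where u' = 0, the inequality J \<ge> 0 says that v u^4/r^2 is at least twice (s
    + a/r^2) u^2, which makes u'' negative. Every critical point beyond \<open>r0\<close> is thus a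
    strict maximum, so once u' is nonpositive it stays so.\<close>
  have crit: "(s + a/r\<^sup>2) * u r - v * (u r)^3/r\<^sup>2 < 0" if r: "r \<ge> r0" and z: "u' r = 0" for r
  proof -
    have r1: "r > 0" using r r0 by simp
    have J: "uJ v r = r powr (2/3) * (- 1/2 * ((s + a * (1/r)\<^sup>2) * (u r)\<^sup>2) + v/4 * ((u r)^4 * (1/r)\<^sup>2) - 1/18 * ((u r)\<^sup>2 * (1/r)\<^sup>2))"
      using z unfolding uJ_def Jfun_def u_def u'_def s_def by simp
    have "0 \<le> - 1/2 * ((s + a * (1/r)\<^sup>2) * (u r)\<^sup>2) + v/4 * ((u r)^4 * (1/r)\<^sup>2) - 1/18 * ((u r)\<^sup>2 * (1/r)\<^sup>2)"
      using J0[OF r] r1 unfolding J by (simp add: zero_le_mult_iff)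
    moreover have "0 \<le> (u r)\<^sup>2 * (1/r)\<^sup>2" by simp
    moreover have "0 < (s + a * (1/r)\<^sup>2) * (u r)\<^sup>2" using upos[OF r1] s a by (intro mult_pos_pos add_pos_nonneg) auto
    ultimately have "(s + a * (1/r)\<^sup>2) * (u r)\<^sup>2 < v * ((u r)^4 * (1/r)\<^sup>2)" by linarith
    then have "u r * ((s + a/r\<^sup>2) * u r) < u r * (v * (u r)^3/r\<^sup>2)"
      by (simp add: power_divide power2_eq_square power3_eq_cube power4_eq_xxxx mult_ac)
    then have "(s + a/r\<^sup>2) * u r < v * (u r)^3/r\<^sup>2" using upos[OF r1] by (simp only: mult_less_cancel_left_pos)
    then show ?thesis by simp
  qed
  have "\<exists>r1\<ge>r0. u' r1 \<le> 0"
  proof (rule ccontr)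
    assume "\<not> ?thesis"
    then have p: "u' r > 0" if "r \<ge> r0" for r using that by (meson linorder_not_less)
    have "u r0 \<le> u r" if "r0 \<le> r" for r
      by (rule deriv_nonneg_imp_le[OF that du]) (use r0 p in \<open>auto intro: less_imp_le\<close>)
    then show False using no_lb[of r0 "u r0"] upos[of r0] r0 by force
  qed
  then obtain r1 where r1: "r1 \<ge> r0" "u' r1 \<le> 0" by blast
  have cu': "continuous_on {x..y} u'" if "x > 0" for x y
    by (rule DERIV_continuous_on[OF has_field_derivative_at_within[OF du']]) (use that in auto)
  have u'neg: "u' r \<le> 0" if r: "r \<ge> r1" for r
  proof (rule ccontr)
    assume n: "\<not> u' r \<le> 0"
    then have rr: "r1 < r" using r r1 by (cases "r = r1") auto
    obtain z where z: "r1 \<le> z" "z < r" "u' z = 0" "\<And>y. \<lbrakk>z < y; y \<le> r\<rbrakk> \<Longrightarrow> u' y > 0"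
      by (rule last_zero_before_pos[of r1 r u']) (use cu' r1 r0 rr n in auto)
    have z0: "z > 0" using z r1 r0 by simp
    from DERIV_neg_dec_right[OF du'[OF z0] crit[OF _ z(3)]] z(1) r1(1)
    obtain e where e: "e > 0" "\<forall>h>0. h < e \<longrightarrow> u' (z + h) < u' z" by auto
    define h where "h = min (e/2) ((r - z)/2)"
    have h: "h > 0" "h < e" "h < r - z" using e(1) z(2) by (simp_all add: h_def min_def)
    then have "u' (z + h) < 0" using e(2) z(3) by metis
    then show False using h z(4)[of "z + h"] by simp
  qed
  have ulim: "(u \<longlongrightarrow> 0) at_top"
  proof (rule tendstoI)
    fix e :: real assume e: "e > 0"
    then obtain R where R: "R \<ge> r1" "u R < e" using no_lb[of r1 e] r1 by blast
    have "u r \<le> u R" if "R \<le> r" for r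
      by (rule deriv_nonpos_imp_ge[OF that du]) (use R r1 r0 u'neg in auto)
    then have "dist (u r) 0 < e" if "r \<ge> R" for r using that R r1 r0 upos[of r] by force
    then show "eventually (\<lambda>r. dist (u r) 0 < e) at_top" unfolding eventually_at_top_linorder by blast
  qed
  have u0: "(u \<longlongrightarrow> 0) (at_right 0)" unfolding u_def by (rule usol_tendsto_0[OF v])
  \<comment> \<open>The term a/r^2 is invariant under dilations; k^2 s = 1 restores the coefficient
    1 of u, and c^2 = v that of u^3.\<close>
  define k c where "k = 1 / sqrt s" and "c = sqrt v"
  have k: "k > 0" "k\<^sup>2 * s = 1" using s by (auto simp: k_def power_divide)
  have c: "c > 0" "c\<^sup>2 = v" using th by (auto simp: c_def)
  have dk: "((\<lambda>r. f (k * r)) has_real_derivative k * D) (at r)" if "(f has_real_derivative D) (at (k * r))" for f D r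
  proof -
    have "((\<lambda>r. k * r) has_real_derivative k) (at r)" using DERIV_cmult[OF DERIV_ident, of k r] by simp
    from DERIV_chain2[where g = "\<lambda>r. k * r" and x = r, OF that this] show ?thesis by (simp only: mult.commute)
  qed
  have "profile a (\<lambda>r. c * u (k * r)) (\<lambda>r. c * (k * u' (k * r)))"
    unfolding profile_def
  proof (intro conjI allI impI)
    fix r :: real assume r: "r > 0"
    then have kr: "k * r > 0" using k by simp
    show "0 < c * u (k * r)" using c upos[OF kr] by simp
    show "((\<lambda>r. c * u (k * r)) has_real_derivative c * (k * u' (k * r))) (at r)"
      by (intro DERIV_cmult dk du kr)
    have "((\<lambda>r. c * (k * u' (k * r))) has_real_derivative c * (k * (k * ((s + a/(k * r)\<^sup>2) * u (k * r) - v * (u (k * r))^3/(k * r)\<^sup>2)))) (at r)"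
      by (intro DERIV_cmult dk du' kr)
    moreover have "c * (k * (k * ((s + a/(k * r)\<^sup>2) * u (k * r) - v * (u (k * r))^3/(k * r)\<^sup>2)))
      = (k\<^sup>2 * s + a / r\<^sup>2) * (c * u (k * r)) - (c * u (k * r))^3 / r\<^sup>2"
      unfolding c(2)[symmetric] using k(1) r by (simp add: field_simps power2_eq_square power3_eq_cube)
    ultimately show "((\<lambda>r. c * (k * u' (k * r))) has_real_derivative (1 + a / r\<^sup>2) * (c * u (k * r)) - (c * u (k * r))^3 / r\<^sup>2) (at r)"
      unfolding k(2) by simp
  next
    have "filterlim (\<lambda>r. k * r) (at_right 0) (at_right 0)" using k by real_asymp
    from tendsto_mult_right_zero[OF filterlim_compose[OF u0 this], of c]
    show "((\<lambda>r. c * u (k * r)) \<longlongrightarrow> 0) (at_right 0)" .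
    have "filterlim (\<lambda>r. k * r) at_top at_top" using k by real_asymp
    from tendsto_mult_right_zero[OF filterlim_compose[OF ulim this], of c]
    show "((\<lambda>r. c * u (k * r)) \<longlongrightarrow> 0) at_top" .
  qed
  then show ?thesis by blast
qed

end

theorem profile_exists:
  assumes "a > 0"
  shows "\<exists>u u'. profile a u u'"
\<comment> \<open>The larger root of x^2 - x = a, which exceeds 1 because a > 0.\<close>
proof (rule ex_profile[of a "1/2 + sqrt (1/4 + a)"])
  have "sqrt (1/4) < sqrt (1/4 + a)" using assms by simp
  moreover have "sqrt (1/4) = (1/2::real)" by (simp add: real_sqrt_divide)
  ultimately show "1/2 + sqrt (1/4 + a) > 1" by simp
  show "a = (1/2 + sqrt (1/4 + a))\<^sup>2 - (1/2 + sqrt (1/4 + a))"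
    using assms by (simp add: power2_eq_square algebra_simps)
qed (rule assms)

section \<open>Smooth functions of one variable\<close>

lemma deriv_zero_outside:
  assumes "\<And>s. s \<notin> {p..q} \<Longrightarrow> f s = 0" "(f has_real_derivative d) (at r)" "r \<notin> {p..q}"
  shows "d = 0"
proof -
  have "(f has_real_derivative 0) (at r)"
    by (rule has_field_derivative_transform_within_open[of "\<lambda>_. 0" _ _ "- {p..q}"]) (use assms in auto)
  then show ?thesis using DERIV_unique assms(2) by blast
qed

text \<open>On open sets this is the class C^k. The derivative is a witness instead of
  \<open>deriv\<close>, so that closure properties follow by exhibiting a formula.\<close>

primrec diffable :: "nat \<Rightarrow> real set \<Rightarrow> (real \<Rightarrow> real) \<Rightarrow> bool" where
  "diffable 0 S f \<longleftrightarrow> continuous_on S f"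
| "diffable (Suc k) S f \<longleftrightarrow> (\<exists>f'. (\<forall>x\<in>S. (f has_real_derivative f' x) (at x)) \<and> diffable k S f')"

lemma diffable_SucI:
  "\<lbrakk>\<And>x. x \<in> S \<Longrightarrow> (f has_real_derivative f' x) (at x); diffable k S f'\<rbrakk> \<Longrightarrow> diffable (Suc k) S f"
  by auto

lemma diffable_imp_continuous: "diffable k S f \<Longrightarrow> continuous_on S f"
  by (cases k) (auto intro: DERIV_isCont continuous_at_imp_continuous_on)

lemma diffable_cong:
  assumes "open S" "\<And>x. x \<in> S \<Longrightarrow> f x = g x" "diffable k S f"
  shows "diffable k S g"
proof (cases k)
  case 0
  then show ?thesis using assms continuous_on_cong[of S S f g] by simp
next
  case (Suc j)
  then obtain f' where f': "\<forall>x\<in>S. (f has_real_derivative f' x) (at x)" "diffable j S f'" using assms(3) by auto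
  have "(g has_real_derivative f' x) (at x)" if "x \<in> S" for x
    by (rule has_field_derivative_transform_within_open[of f _ _ S]) (use that f' assms in auto)
  then show ?thesis using Suc f'(2) by auto
qed

lemma diffable_Suc_imp: "diffable (Suc k) S f \<Longrightarrow> diffable k S f"
proof (induction k arbitrary: f)
  case 0
  then show ?case using diffable_imp_continuous[OF 0] by simp
next
  case (Suc k)
  then obtain f' where "\<forall>x\<in>S. (f has_real_derivative f' x) (at x)" "diffable (Suc k) S f'"
    unfolding diffable.simps(2)[of "Suc k" S f] by blast
  moreover from Suc.IH[OF this(2)] have "diffable k S f'" .
  ultimately show ?case unfolding diffable.simps(2)[of k S f] by blast
qed

lemma diffable_subset: "\<lbrakk>diffable k S f; T \<subseteq> S\<rbrakk> \<Longrightarrow> diffable k T f"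
proof (induction k arbitrary: f)
  case (Suc k)
  then obtain f' where "\<forall>x\<in>S. (f has_real_derivative f' x) (at x)" "diffable k S f'" by auto
  then show ?case using Suc.IH Suc.prems(2) by (intro diffable_SucI[of T f f']) auto
qed (auto intro: continuous_on_subset)

lemma diffable_const: "diffable k S (\<lambda>x. c)"
proof (induction k arbitrary: c)
  case (Suc k)
  show ?case unfolding diffable.simps by (intro exI[of _ "\<lambda>x. 0"] conjI Suc.IH) auto
qed auto

lemma diffable_id: "diffable k S (\<lambda>x. x)"
proof (cases k)
  case (Suc j)
  show ?thesis unfolding Suc diffable.simps
    by (intro exI[of _ "\<lambda>x. 1"] conjI diffable_const) (auto intro!: derivative_eq_intros)
qed (auto intro: continuous_on_id)

lemma diffable_add: "\<lbrakk>diffable k S f; diffable k S g\<rbrakk> \<Longrightarrow> diffable k S (\<lambda>x. f x + g x)"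
proof (induction k arbitrary: f g)
  case (Suc k)
  then obtain f' g' where "\<forall>x\<in>S. (f has_real_derivative f' x) (at x)" "diffable k S f'"
    "\<forall>x\<in>S. (g has_real_derivative g' x) (at x)" "diffable k S g'" by auto
  then show ?case unfolding diffable.simps
    by (intro exI[of _ "\<lambda>x. f' x + g' x"] conjI Suc.IH) (auto intro: DERIV_add)
qed (auto intro: continuous_intros)

lemma diffable_mult: "\<lbrakk>diffable k S f; diffable k S g\<rbrakk> \<Longrightarrow> diffable k S (\<lambda>x. f x * g x)"
proof (induction k arbitrary: f g)
  case (Suc k)
  then obtain f' g' where *: "\<forall>x\<in>S. (f has_real_derivative f' x) (at x)" "diffable k S f'"
    "\<forall>x\<in>S. (g has_real_derivative g' x) (at x)" "diffable k S g'" by auto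
  have "diffable k S f" "diffable k S g" using Suc.prems by (auto dest: diffable_Suc_imp simp del: diffable.simps)
  then show ?case unfolding diffable.simps using *
    by (intro exI[of _ "\<lambda>x. f' x * g x + g' x * f x"] conjI diffable_add Suc.IH) (auto intro: DERIV_mult)
qed (auto intro: continuous_intros)

lemma diffable_cmult: "diffable k S f \<Longrightarrow> diffable k S (\<lambda>x. c * f x)"
  by (intro diffable_mult diffable_const)

lemma diffable_diff: "\<lbrakk>diffable k S f; diffable k S g\<rbrakk> \<Longrightarrow> diffable k S (\<lambda>x. f x - g x)"
  using diffable_add[of k S f "\<lambda>x. (-1) * g x"] diffable_cmult[of k S g "-1"] by simp

lemma diffable_power: "diffable k S f \<Longrightarrow> diffable k S (\<lambda>x. f x ^ n)"
  by (induction n) (auto intro: diffable_const diffable_mult)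

lemma diffable_compose:
  "\<lbrakk>diffable k T f; diffable k S g; \<And>x. x \<in> S \<Longrightarrow> g x \<in> T\<rbrakk> \<Longrightarrow> diffable k S (\<lambda>x. f (g x))"
proof (induction k arbitrary: f)
  case 0
  then show ?case by (auto intro: continuous_on_compose2[of T f S g])
next
  case (Suc k)
  then obtain f' g' where *: "\<forall>x\<in>T. (f has_real_derivative f' x) (at x)" "diffable k T f'"
    "\<forall>x\<in>S. (g has_real_derivative g' x) (at x)" "diffable k S g'" by auto
  have "diffable k S (\<lambda>x. f' (g x))"
    by (rule Suc.IH[OF *(2) diffable_Suc_imp[OF Suc.prems(2)] Suc.prems(3)])
  then have "diffable k S (\<lambda>x. f' (g x) * g' x)" using *(4) by (rule diffable_mult)
  moreover have "((\<lambda>x. f (g x)) has_real_derivative f' (g x) * g' x) (at x)" if x: "x \<in> S" for x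
  proof -
    show "((\<lambda>x. f (g x)) has_real_derivative f' (g x) * g' x) (at x)"
      using * Suc.prems(3)[OF x] x by (intro DERIV_chain2[where f = f and g = g]) auto
  qed
  ultimately show ?case by (rule diffable_SucI[rotated])
qed

lemma diffable_inverse: "(\<And>x. x \<in> S \<Longrightarrow> x \<noteq> 0) \<Longrightarrow> diffable k S inverse"
proof (induction k)
  case 0
  then show ?case by (auto intro!: continuous_intros)
next
  case (Suc k)
  have "diffable k S (\<lambda>x. (-1) * (inverse x * inverse x))"
    by (intro diffable_cmult diffable_mult Suc)
  moreover have "(inverse has_real_derivative (-1) * (inverse x * inverse x)) (at x)" if "x \<in> S" for x
    using Suc.prems[OF that] by (auto intro!: derivative_eq_intros)
  ultimately show ?case by (rule diffable_SucI[rotated])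
qed

lemma diffable_divide:
  "\<lbrakk>diffable k S f; diffable k S g; \<And>x. x \<in> S \<Longrightarrow> g x \<noteq> 0\<rbrakk> \<Longrightarrow> diffable k S (\<lambda>x. f x / g x)"
  unfolding divide_inverse
  by (rule diffable_mult[OF _ diffable_compose[where T = "-{0}", OF diffable_inverse]]) auto

lemma diffable_sqrt: "diffable k {0<..} sqrt"
proof (induction k)
  case 0
  then show ?case by (auto intro!: continuous_intros)
next
  case (Suc k)
  have "diffable k {0<..} (\<lambda>x. (1/2) / sqrt x)"
    by (intro diffable_divide diffable_const Suc) auto
  moreover have "(sqrt has_real_derivative (1/2) / sqrt x) (at x)" if "x \<in> {0<..}" for x
    using that by (auto intro!: derivative_eq_intros simp: field_simps)
  ultimately show ?case by (rule diffable_SucI[rotated])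
qed

lemma diffable_deriv:
  assumes "open S" "diffable (Suc k) S f" "\<And>x. x \<in> S \<Longrightarrow> (f has_real_derivative f' x) (at x)"
  shows "diffable k S f'"
proof -
  obtain g where g: "\<forall>x\<in>S. (f has_real_derivative g x) (at x)" "diffable k S g" using assms(2) by auto
  have "g x = f' x" if "x \<in> S" for x using DERIV_unique g(1) assms(3)[OF that] that by blast
  from diffable_cong[OF assms(1) this g(2)] show ?thesis .
qed

text \<open>On the overlap the two derivatives agree by uniqueness, so they glue. The purpose is
  extension by zero.\<close>

lemma diffable_Un:
  assumes "open S" "open T" "diffable k S f" "diffable k T f"
  shows "diffable k (S \<union> T) f"
  using assms(3,4)
proof (induction k arbitrary: f)
  case 0
  then show ?case using assms(1,2) by (auto intro: continuous_on_open_Un)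
next
  case (Suc k)
  then obtain f1 f2 where f12: "\<forall>x\<in>S. (f has_real_derivative f1 x) (at x)" "diffable k S f1"
    "\<forall>x\<in>T. (f has_real_derivative f2 x) (at x)" "diffable k T f2" by auto
  define f' where "f' = (\<lambda>x. if x \<in> S then f1 x else f2 x)"
  have eqT: "f2 x = f' x" if "x \<in> T" for x
    using f12 that DERIV_unique[of f "f1 x" x "f2 x"] by (auto simp: f'_def)
  have "diffable k S f'" by (rule diffable_cong[OF assms(1) _ f12(2)]) (simp add: f'_def)
  moreover have "diffable k T f'" by (rule diffable_cong[OF assms(2) eqT f12(4)])
  ultimately have "diffable k (S \<union> T) f'" by (rule Suc.IH)
  moreover have "\<forall>x\<in>S \<union> T. (f has_real_derivative f' x) (at x)" using f12 eqT by (auto simp: f'_def)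
  ultimately show ?case unfolding diffable.simps by blast
qed

section \<open>A smooth step\<close>

definition flat :: "nat \<Rightarrow> real \<Rightarrow> real" where
  "flat m x = (if x > 0 then inverse x ^ m * exp (- inverse x) else 0)"

text \<open>The family x^(-m) exp(-1/x) is closed under differentiation up to linear combinations,
  so smoothness follows for all m together. At 0 the difference quotient belongs to the family again
  and is beaten by the exponential.\<close>

lemma flat_deriv: "(flat m has_real_derivative flat (m + 2) x - real m * flat (m + 1) x) (at x)"
proof -
  consider "x > 0" | "x < 0" | "x = 0" by linarith
  then show ?thesis
  proof cases
    case 1
    have "((\<lambda>x. inverse x ^ m * exp (- inverse x)) has_real_derivative flat (m + 2) x - real m * flat (m + 1) x) (at x)"
    proof -
      have i: "(inverse has_real_derivative - (inverse x)\<^sup>2) (at x)"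
        using 1 by (auto intro!: derivative_eq_intros simp: power2_eq_square)
      have "((\<lambda>x. inverse x ^ m) has_real_derivative - (real m * inverse x ^ (m + 1))) (at x)"
        by (rule DERIV_cong[OF DERIV_power[OF i, of m]])
           (cases m; simp add: power2_eq_square mult_ac)
      moreover have "((\<lambda>x. exp (- inverse x)) has_real_derivative exp (- inverse x) * (inverse x)\<^sup>2) (at x)"
        using DERIV_fun_exp[OF DERIV_minus[OF i]] by simp
      ultimately have "((\<lambda>x. inverse x ^ m * exp (- inverse x)) has_real_derivative
        - (real m * inverse x ^ (m + 1)) * exp (- inverse x) + (exp (- inverse x) * (inverse x)\<^sup>2) * inverse x ^ m) (at x)"
        by (rule DERIV_mult)
      then show ?thesis by (rule DERIV_cong) (use 1 in \<open>simp add: flat_def power_add power2_eq_square mult_ac\<close>)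
    qed
    then show ?thesis
      by (rule has_field_derivative_transform_within_open[of _ _ _ "{0<..}"]) (use 1 in \<open>auto simp: flat_def\<close>)
  next
    case 2
    have "((\<lambda>x. 0) has_real_derivative flat (m + 2) x - real m * flat (m + 1) x) (at x)"
      using 2 by (simp add: flat_def)
    then show ?thesis
      by (rule has_field_derivative_transform_within_open[of _ _ _ "{..<0}"]) (use 2 in \<open>auto simp: flat_def\<close>)
  next
    case 3
    have r: "((\<lambda>y. (flat m y - flat m 0) / (y - 0)) \<longlongrightarrow> 0) (at_right 0)"
    proof (rule Lim_transform_eventually)
      show "((\<lambda>y. inverse y ^ (m + 1) * exp (- inverse y)) \<longlongrightarrow> 0) (at_right (0::real))"
      proof -
        have "((\<lambda>y::real. y ^ (m + 1) * exp (- y)) \<longlongrightarrow> 0) at_top"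
          using tendsto_power_div_exp_0[of "m + 1"] by (simp add: exp_minus divide_inverse)
        from filterlim_compose[OF this filterlim_inverse_at_top_right] show ?thesis .
      qed
      show "eventually (\<lambda>y. inverse y ^ (m + 1) * exp (- inverse y) = (flat m y - flat m 0) / (y - 0)) (at_right 0)"
        unfolding eventually_at_right_field by (intro exI[of _ 1]) (auto simp: flat_def divide_inverse)
    qed
    have l: "((\<lambda>y. (flat m y - flat m 0) / (y - 0)) \<longlongrightarrow> 0) (at_left 0)"
      by (rule Lim_transform_eventually[OF tendsto_const])
         (auto simp: eventually_at_left_field flat_def intro!: exI[of _ "-1"])
    have "((\<lambda>y. (flat m y - flat m 0) / (y - 0)) \<longlongrightarrow> 0) (at 0)" using l r by (rule filterlim_split_at)
    then show ?thesis using 3 by (simp add: has_field_derivative_iff flat_def)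
  qed
qed

lemma diffable_flat: "diffable k UNIV (flat m)"
proof (induction k arbitrary: m)
  case 0
  show ?case using flat_deriv by (auto intro: DERIV_isCont continuous_at_imp_continuous_on)
next
  case (Suc k)
  show ?case unfolding diffable.simps
    by (intro exI[of _ "\<lambda>x. flat (m + 2) x - real m * flat (m + 1) x"] conjI ballI flat_deriv
        diffable_diff diffable_cmult Suc)
qed

definition sstep :: "real \<Rightarrow> real" where
  "sstep x = flat 0 x / (flat 0 x + flat 0 (1 - x))"

lemma flat_nonneg: "flat m x \<ge> 0" by (simp add: flat_def)
lemma flat_pos: "x > 0 \<Longrightarrow> flat m x > 0" by (simp add: flat_def)

lemma sstep_denom: "flat 0 x + flat 0 (1 - x) > 0"
  using flat_pos[of x 0] flat_pos[of "1 - x" 0] flat_nonneg[of 0 x] flat_nonneg[of 0 "1 - x"]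
  by (cases "x > 0") (auto intro: add_pos_nonneg add_nonneg_pos)

lemma diffable_sstep: "diffable k UNIV sstep"
  unfolding sstep_def
proof (intro diffable_divide diffable_add diffable_flat)
  show "diffable k UNIV (\<lambda>x. flat 0 (1 - x))"
    by (rule diffable_compose[OF diffable_flat diffable_diff[OF diffable_const diffable_id]]) auto
  show "flat 0 x + flat 0 (1 - x) \<noteq> 0" for x using sstep_denom[of x] by simp
qed

lemma sstep_0: "x \<le> 0 \<Longrightarrow> sstep x = 0" by (simp add: sstep_def flat_def)
lemma sstep_1: "x \<ge> 1 \<Longrightarrow> sstep x = 1" using sstep_denom[of x] by (simp add: sstep_def flat_def)
lemma sstep_range: "0 \<le> sstep x" "sstep x \<le> 1"
  using sstep_denom[of x] flat_nonneg[of 0 x] flat_nonneg[of 0 "1 - x"] by (auto simp: sstep_def divide_le_eq)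

section \<open>Smooth functions on space\<close>

lemma partial_eqI:
  assumes "(f has_derivative f') (at x)"
  shows "partial i f x = f' (axis i 1)"
  unfolding partial_def using frechet_derivative_at[OF assms] by simp

lemma partial_add: "\<lbrakk>f differentiable at x; g differentiable at x\<rbrakk> \<Longrightarrow> partial i (\<lambda>x. f x + g x) x = partial i f x + partial i g x"
  unfolding partial_def by (subst frechet_derivative_at[symmetric, OF has_derivative_add]) (auto simp: frechet_derivative_works[symmetric])

lemma partial_mult:
  assumes "f differentiable at x" "g differentiable at x"
  shows "partial i (\<lambda>x. f x * g x) x = f x * partial i g x + partial i f x * g x"
proof -
  have "((\<lambda>x. f x * g x) has_derivative (\<lambda>h. f x * frechet_derivative g (at x) h + frechet_derivative f (at x) h * g x)) (at x)"
    using assms by (intro has_derivative_mult) (auto simp: frechet_derivative_works[symmetric])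
  from partial_eqI[OF this] show ?thesis by (simp add: partial_def)
qed

lemma partial_const: "partial i (\<lambda>x. c) x = 0"
  by (rule partial_eqI) (rule has_derivative_const)

lemma Ck_Suc_imp: "Ck (Suc k) f \<Longrightarrow> Ck k f"
proof (induction k arbitrary: f)
  case 0
  then show ?case by (auto intro: differentiable_imp_continuous_within continuous_at_imp_continuous_on)
next
  case (Suc k)
  then show ?case unfolding Ck.simps(2) by blast
qed

lemma Ck_const: "Ck k (\<lambda>x. c)"
proof (induction k arbitrary: c)
  case (Suc k)
  have "partial i (\<lambda>x. c) = (\<lambda>x. 0)" for i by (rule ext) (rule partial_const)
  then show ?case using Suc by simp
qed auto

lemma Ck_add: "\<lbrakk>Ck k f; Ck k g\<rbrakk> \<Longrightarrow> Ck k (\<lambda>x. f x + g x)"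
proof (induction k arbitrary: f g)
  case (Suc k)
  have "partial i (\<lambda>x. f x + g x) = (\<lambda>x. partial i f x + partial i g x)" for i
    using Suc.prems by (intro ext partial_add) auto
  then show ?case using Suc by (auto intro: differentiable_add)
qed (auto intro: continuous_intros)

lemma Ck_mult: "\<lbrakk>Ck k f; Ck k g\<rbrakk> \<Longrightarrow> Ck k (\<lambda>x. f x * g x)"
proof (induction k arbitrary: f g)
  case (Suc k)
  have "partial i (\<lambda>x. f x * g x) = (\<lambda>x. f x * partial i g x + partial i f x * g x)" for i
    using Suc.prems by (intro ext partial_mult) auto
  moreover have "Ck k f" "Ck k g" using Suc.prems by (auto dest: Ck_Suc_imp simp del: Ck.simps)
  ultimately show ?case using Suc by (auto intro!: Ck_add differentiable_mult)
qed (auto intro: continuous_intros)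

lemma Ck_cmult: "Ck k f \<Longrightarrow> Ck k (\<lambda>x. c * f x)" by (intro Ck_mult Ck_const)

lemma Ck_diff: "\<lbrakk>Ck k f; Ck k g\<rbrakk> \<Longrightarrow> Ck k (\<lambda>x. f x - g x)"
  using Ck_add[of k f "\<lambda>x. (-1) * g x"] Ck_cmult[of k g "-1"] by simp

lemma has_derivative_nth: "((\<lambda>x::R3. x $ i) has_derivative (\<lambda>h. h $ i)) (at x)"
  by (rule bounded_linear.has_derivative[OF bounded_linear_vec_nth]) (rule has_derivative_ident)

lemma Ck_nth: "Ck k (\<lambda>x. x $ i)"
proof (cases k)
  case 0 then show ?thesis by (auto intro!: continuous_intros)
next
  case (Suc j)
  have "partial l (\<lambda>x. x $ i) = (\<lambda>x. axis l 1 $ i)" for l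
    by (rule ext) (rule partial_eqI[OF has_derivative_nth])
  then show ?thesis unfolding Suc using has_derivative_nth
    by (auto intro: Ck_const simp: differentiable_def)
qed

lemma has_derivative_norm_sq: "((\<lambda>x::R3. (norm x)\<^sup>2) has_derivative (\<lambda>h. 2 * (x \<bullet> h))) (at x)"
  unfolding power2_norm_eq_inner
  by (auto intro!: derivative_eq_intros simp: inner_commute)

lemma partial_norm_sq_compose:
  assumes "(g has_real_derivative g') (at ((norm x)\<^sup>2))"
  shows "((\<lambda>x::R3. g ((norm x)\<^sup>2)) has_derivative (\<lambda>h. g' * (2 * (x \<bullet> h)))) (at x)"
    "partial i (\<lambda>x. g ((norm x)\<^sup>2)) x = 2 * (x $ i) * g'"
proof -
  show 1: "((\<lambda>x::R3. g ((norm x)\<^sup>2)) has_derivative (\<lambda>h. g' * (2 * (x \<bullet> h)))) (at x)"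
    using has_derivative_compose[OF has_derivative_norm_sq assms[unfolded has_field_derivative_def]]
    by (simp add: mult.commute)
  show "partial i (\<lambda>x. g ((norm x)\<^sup>2)) x = 2 * (x $ i) * g'"
    using partial_eqI[OF 1, of i] by (simp add: inner_axis mult_ac)
qed

text \<open>The argument |x|^2 is smooth at the origin, unlike |x|, and the partial derivatives 2
  x_i g'(|x|^2) are again products of the same kind.\<close>

lemma Ck_radial: "diffable k UNIV g \<Longrightarrow> Ck k (\<lambda>x. g ((norm x)\<^sup>2))"
proof (induction k arbitrary: g)
  case 0
  then show ?case by (auto intro!: continuous_intros continuous_on_compose2[of UNIV g])
next
  case (Suc k)
  then obtain g' where g': "\<forall>x. (g has_real_derivative g' x) (at x)" "diffable k UNIV g'" by auto
  have "partial i (\<lambda>x. g ((norm x)\<^sup>2)) = (\<lambda>x. 2 * (x $ i) * g' ((norm x)\<^sup>2))" for i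
    by (rule ext) (rule partial_norm_sq_compose(2)[OF g'(1)[rule_format]])
  moreover have "Ck k (\<lambda>x. 2 * (x $ i) * g' ((norm x)\<^sup>2))" for i
    by (intro Ck_mult Ck_const Ck_nth Suc.IH g')
  moreover have "(\<lambda>x. g ((norm x)\<^sup>2)) differentiable at x" for x :: R3
    unfolding differentiable_def by (rule exI, rule partial_norm_sq_compose(1)[OF g'(1)[rule_format]])
  ultimately show ?case unfolding Ck.simps by simp
qed

lemma sum_nth_sq: "(\<Sum>i\<in>UNIV. (x $ i)\<^sup>2) = (norm (x::R3))\<^sup>2"
  unfolding power2_norm_eq_inner inner_vec_def by (simp add: power2_eq_square)

lemma laplacian_radial:
  assumes g: "\<And>t. (g has_real_derivative g1 t) (at t)" and g1: "\<And>t. (g1 has_real_derivative g2 t) (at t)"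
  shows "laplacian (\<lambda>x. g ((norm x)\<^sup>2)) x = 6 * g1 ((norm x)\<^sup>2) + 4 * (norm x)\<^sup>2 * g2 ((norm x)\<^sup>2)"
proof -
  have 1: "partial i (\<lambda>x. g ((norm x)\<^sup>2)) = (\<lambda>x. (2 * (x $ i)) * g1 ((norm x)\<^sup>2))" for i
    by (rule ext) (rule partial_norm_sq_compose(2)[OF g])
  have 2: "partial i (\<lambda>x. (2 * (x $ i)) * g1 ((norm x)\<^sup>2)) x = (2 * (x $ i)) * (2 * (x $ i) * g2 ((norm x)\<^sup>2)) + 2 * g1 ((norm x)\<^sup>2)" for i
  proof -
    have d: "((\<lambda>x::R3. 2 * (x $ i)) has_derivative (\<lambda>h. 2 * (h $ i))) (at x)"
      by (intro has_derivative_mult_right has_derivative_nth)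
    have "partial i (\<lambda>x. 2 * (x $ i)) x = 2" using partial_eqI[OF d] by (simp add: axis_def)
    moreover have "(\<lambda>x::R3. 2 * (x $ i)) differentiable at x" "(\<lambda>x. g1 ((norm x)\<^sup>2)) differentiable at x"
      using d partial_norm_sq_compose(1)[OF g1] unfolding differentiable_def by blast+
    ultimately show ?thesis by (simp add: partial_mult partial_norm_sq_compose(2)[OF g1])
  qed
  have "laplacian (\<lambda>x. g ((norm x)\<^sup>2)) x = (\<Sum>i\<in>UNIV. 4 * g2 ((norm x)\<^sup>2) * (x $ i)\<^sup>2 + 2 * g1 ((norm x)\<^sup>2))"
    unfolding laplacian_def 1 2 by (simp add: power2_eq_square mult_ac)
  also have "\<dots> = 4 * g2 ((norm x)\<^sup>2) * (norm x)\<^sup>2 + 6 * g1 ((norm x)\<^sup>2)"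
    by (simp add: sum.distrib sum_distrib_left[symmetric] sum_nth_sq)
  finally show ?thesis by simp
qed

section \<open>Radial functions of the form \<eta>(r)/r\<close>

definition radial_lift :: "(real \<Rightarrow> real) \<Rightarrow> R3 \<Rightarrow> real" where
  "radial_lift \<eta> x = \<eta> (norm x) / norm x"

text \<open>Division by r removes the first-order term of the radial Laplacian, which becomes
  \<eta>''/r. For smoothness the lift is written as g(|x|^2) with g(t) = \<eta>(sqrt t)/sqrt t;
  since g vanishes below p^2, it is smooth on the whole line.\<close>

lemma radial_lift_test:
  assumes sm: "\<And>k. diffable k {0<..} \<eta>" and pq: "0 < p" "p < q"
    and supp: "\<And>r. r > 0 \<Longrightarrow> r \<notin> {p..q} \<Longrightarrow> \<eta> r = 0"
    and d1: "\<And>r. r > 0 \<Longrightarrow> (\<eta> has_real_derivative \<eta>1 r) (at r)"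
    and d2: "\<And>r. r > 0 \<Longrightarrow> (\<eta>1 has_real_derivative \<eta>2 r) (at r)"
  shows "radial_lift \<eta> \<in> test_functions (- {0})"
    "\<And>x. x \<noteq> 0 \<Longrightarrow> laplacian (radial_lift \<eta>) x = \<eta>2 (norm x) / norm x"
    "laplacian (radial_lift \<eta>) 0 = 0"
    "\<And>i x. x \<noteq> 0 \<Longrightarrow> partial i (radial_lift \<eta>) x = (\<eta>1 (norm x) / norm x - \<eta> (norm x) / (norm x)\<^sup>2) * (x $ i / norm x)"
proof -
  define g where "g = (\<lambda>t. if t > 0 then \<eta> (sqrt t) / sqrt t else 0)"
  have g0: "g t = 0" if "t < p\<^sup>2" for t
  proof (cases "t > 0")
    case True
    then have "sqrt t < p" using that pq real_less_lsqrt by (meson less_imp_le real_sqrt_less_mono real_sqrt_unique real_less_lsqrt)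
    then show ?thesis using supp[of "sqrt t"] True by (simp add: g_def)
  qed (simp add: g_def)
  have smg: "diffable k UNIV g" for k
  proof -
    have "diffable k {0<..} (\<lambda>t. \<eta> (sqrt t) / sqrt t)"
      by (intro diffable_divide diffable_compose[OF sm diffable_sqrt] diffable_sqrt) auto
    then have "diffable k {0<..} g" by (rule diffable_cong[rotated 2]) (auto simp: g_def)
    moreover have "diffable k {..<p\<^sup>2} g"
      by (rule diffable_cong[OF _ _ diffable_const[of k _ 0]]) (use g0 in auto)
    ultimately have "diffable k ({0<..} \<union> {..<p\<^sup>2}) g" by (intro diffable_Un) auto
    moreover have "{0<..} \<union> {..<p\<^sup>2} = UNIV" using pq by auto (metis less_le_trans not_less zero_less_power)
    ultimately show ?thesis by simp
  qed
  have eq: "radial_lift \<eta> = (\<lambda>x. g ((norm x)\<^sup>2))" by (rule ext) (auto simp: radial_lift_def g_def)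
  have out: "radial_lift \<eta> x = 0" if "norm x \<notin> {p..q}" for x
    using supp[of "norm x"] that by (cases "x = 0") (auto simp: radial_lift_def)
  define A where "A = {x::R3. p \<le> norm x \<and> norm x \<le> q}"
  have clA: "closed A" unfolding A_def by (intro closed_Collect_conj closed_Collect_le continuous_intros)
  have cA: "compact A" unfolding compact_eq_bounded_closed using clA
    by (auto simp: A_def bounded_iff intro: exI[of _ q])
  have sub: "closure {x. radial_lift \<eta> x \<noteq> 0} \<subseteq> A"
    by (rule closure_minimal[OF _ clA]) (use out in \<open>force simp: A_def\<close>)
  have "compact (closure {x. radial_lift \<eta> x \<noteq> 0})"
    using sub cA by (metis closed_closure compact_Int_closed inf.absorb_iff2 inf_commute)
  moreover have "A \<subseteq> - {0}" using pq by (auto simp: A_def)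
  ultimately show "radial_lift \<eta> \<in> test_functions (- {0})"
    using sub Ck_radial[OF smg] unfolding test_functions_def eq by auto
  obtain g1 where g1: "\<And>t. (g has_real_derivative g1 t) (at t)" "diffable (Suc 0) UNIV g1"
    using smg[of "Suc (Suc 0)"] unfolding diffable.simps(2)[of "Suc 0"] by auto
  obtain g2 where g2: "\<And>t. (g1 has_real_derivative g2 t) (at t)" using g1(2) by auto
  have sq: "((\<lambda>r. r\<^sup>2) has_real_derivative 2 * r) (at r)" for r :: real
    by (auto intro!: derivative_eq_intros)
  have eta: "\<eta> r = r * g (r\<^sup>2)" if "r > 0" for r using that by (simp add: g_def)
  have gc: "((\<lambda>r. g (r\<^sup>2)) has_real_derivative g1 (r\<^sup>2) * (2 * r)) (at r)" for r
    by (rule DERIV_chain2[OF g1(1) sq])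
  have g1c: "((\<lambda>r. g1 (r\<^sup>2)) has_real_derivative g2 (r\<^sup>2) * (2 * r)) (at r)" for r
    by (rule DERIV_chain2[OF g2 sq])
  have eta1: "\<eta>1 r = g (r\<^sup>2) + 2 * r\<^sup>2 * g1 (r\<^sup>2)" if r: "r > 0" for r
  proof -
    have "((\<lambda>r. r * g (r\<^sup>2)) has_real_derivative 1 * g (r\<^sup>2) + (g1 (r\<^sup>2) * (2 * r)) * r) (at r)"
      by (rule DERIV_mult[OF DERIV_ident gc])
    then have "(\<eta> has_real_derivative 1 * g (r\<^sup>2) + (g1 (r\<^sup>2) * (2 * r)) * r) (at r)"
      by (rule has_field_derivative_transform_within_open[of _ _ _ "{0<..}"]) (use r eta in auto)
    from DERIV_unique[OF this d1[OF r]] show ?thesis by (simp add: power2_eq_square mult_ac)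
  qed
  have eta2: "\<eta>2 r = r * (6 * g1 (r\<^sup>2) + 4 * r\<^sup>2 * g2 (r\<^sup>2))" if r: "r > 0" for r
  proof -
    have "((\<lambda>r. g (r\<^sup>2) + 2 * r\<^sup>2 * g1 (r\<^sup>2)) has_real_derivative g1 (r\<^sup>2) * (2 * r) + ((2 * (2 * r)) * g1 (r\<^sup>2) + (g2 (r\<^sup>2) * (2 * r)) * (2 * r\<^sup>2))) (at r)"
      by (intro DERIV_add DERIV_mult DERIV_cmult gc g1c sq)
    then have "(\<eta>1 has_real_derivative g1 (r\<^sup>2) * (2 * r) + ((2 * (2 * r)) * g1 (r\<^sup>2) + (g2 (r\<^sup>2) * (2 * r)) * (2 * r\<^sup>2))) (at r)"
      by (rule has_field_derivative_transform_within_open[of _ _ _ "{0<..}"]) (use r eta1 in auto)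
    from DERIV_unique[OF this d2[OF r]] show ?thesis by (simp add: power2_eq_square algebra_simps)
  qed
  show "laplacian (radial_lift \<eta>) x = \<eta>2 (norm x) / norm x" if "x \<noteq> 0" for x
    unfolding eq laplacian_radial[OF g1(1) g2] using eta2[of "norm x"] that by simp
  have "g1 0 = 0"
  proof -
    have "((\<lambda>x. 0) has_real_derivative 0) (at (0::real))" by simp
    then have "(g has_real_derivative 0) (at 0)"
      by (rule has_field_derivative_transform_within_open[of _ _ _ "{..<p\<^sup>2}"]) (use g0 pq in auto)
    from DERIV_unique[OF this g1(1)] show ?thesis by simp
  qed
  then show "laplacian (radial_lift \<eta>) 0 = 0" unfolding eq laplacian_radial[OF g1(1) g2] by simp
  show "partial i (radial_lift \<eta>) x = (\<eta>1 (norm x) / norm x - \<eta> (norm x) / (norm x)\<^sup>2) * (x $ i / norm x)" if "x \<noteq> 0" for i x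
  proof -
    have n: "norm x > 0" using that by simp
    have "partial i (radial_lift \<eta>) x = 2 * (x $ i) * g1 ((norm x)\<^sup>2)"
      unfolding eq by (rule partial_norm_sq_compose(2)[OF g1(1)])
    then show ?thesis unfolding eta1[OF n] eta[OF n] using n by (simp add: field_simps power2_eq_square)
  qed
qed

section \<open>The Hilbert space\<close>

lemma L2_measurable: "u \<in> L2 \<Longrightarrow> u \<in> borel_measurable borel"
  by (simp add: L2_def)

lemma L2_sq_integrable: "u \<in> L2 \<Longrightarrow> integrable lborel (\<lambda>x. (u x)\<^sup>2)"
  by (simp add: L2_def)

lemma L2_mult_integrable:
  assumes "u \<in> L2" "v \<in> L2"
  shows "integrable lborel (\<lambda>x. u x * v x)"
proof (rule Bochner_Integration.integrable_bound)
  show "integrable lborel (\<lambda>x. (u x)\<^sup>2 + (v x)\<^sup>2)"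
    using assms by (intro Bochner_Integration.integrable_add L2_sq_integrable)
  show "(\<lambda>x. u x * v x) \<in> borel_measurable lborel" using assms[THEN L2_measurable] by simp
  have "\<bar>u x * v x\<bar> \<le> (u x)\<^sup>2 + (v x)\<^sup>2" for x
  proof -
    have "2 * (\<bar>u x\<bar> * \<bar>v x\<bar>) \<le> (u x)\<^sup>2 + (v x)\<^sup>2"
      using zero_le_power2[of "\<bar>u x\<bar> - \<bar>v x\<bar>"] by (simp add: power2_eq_square algebra_simps)
    moreover have "0 \<le> \<bar>u x\<bar> * \<bar>v x\<bar>" by simp
    ultimately show ?thesis unfolding abs_mult by linarith
  qed
  then show "AE x in lborel. norm (u x * v x) \<le> norm ((u x)\<^sup>2 + (v x)\<^sup>2)" by simp
qed

lemma L2_add: assumes "u \<in> L2" "v \<in> L2" shows "(\<lambda>x. u x + v x) \<in> L2"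
proof -
  have "integrable lborel (\<lambda>x. (u x)\<^sup>2 + 2 * (u x * v x) + (v x)\<^sup>2)"
    using assms by (intro Bochner_Integration.integrable_add L2_sq_integrable integrable_mult_right L2_mult_integrable)
  then have "integrable lborel (\<lambda>x. (u x + v x)\<^sup>2)" by (simp add: power2_sum algebra_simps)
  then show ?thesis using assms by (auto simp: L2_def)
qed

lemma L2_cmult: "u \<in> L2 \<Longrightarrow> (\<lambda>x. c * u x) \<in> L2"
  by (auto simp: L2_def power_mult_distrib)

lemma L2_diff: "\<lbrakk>u \<in> L2; v \<in> L2\<rbrakk> \<Longrightarrow> (\<lambda>x. u x - v x) \<in> L2"
  using L2_add[of u "\<lambda>x. (-1) * v x"] L2_cmult[of v "-1"] by simp

lemma L2_inner_commute: "L2_inner u v = L2_inner v u"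
  by (simp add: L2_inner_def mult.commute)

lemma L2_inner_add_left: "\<lbrakk>u \<in> L2; v \<in> L2; w \<in> L2\<rbrakk> \<Longrightarrow> L2_inner (\<lambda>x. u x + v x) w = L2_inner u w + L2_inner v w"
  unfolding L2_inner_def by (simp add: distrib_right L2_mult_integrable)

lemma L2_inner_diff_left: "\<lbrakk>u \<in> L2; v \<in> L2; w \<in> L2\<rbrakk> \<Longrightarrow> L2_inner (\<lambda>x. u x - v x) w = L2_inner u w - L2_inner v w"
  unfolding L2_inner_def by (simp add: left_diff_distrib L2_mult_integrable)

lemma L2_inner_diff_right: "\<lbrakk>u \<in> L2; v \<in> L2; w \<in> L2\<rbrakk> \<Longrightarrow> L2_inner w (\<lambda>x. u x - v x) = L2_inner w u - L2_inner w v"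
  unfolding L2_inner_def by (simp add: right_diff_distrib L2_mult_integrable)

lemma L2_inner_cmult_left: "L2_inner (\<lambda>x. c * u x) w = c * L2_inner u w"
  unfolding L2_inner_def by (simp add: mult.assoc)

lemma L2_inner_nonneg: "0 \<le> L2_inner u u"
  unfolding L2_inner_def by (intro integral_nonneg_AE) auto

text \<open>The common core of the Cauchy-Schwarz inequalities for the inner product and for the
  form, both of which may be degenerate.\<close>

lemma quadratic_discriminant_le:
  fixes A B C :: real
  assumes "\<And>t. 0 \<le> A - 2 * t * B + t\<^sup>2 * C" "0 \<le> C"
  shows "B\<^sup>2 \<le> A * C"
proof (cases "C = 0")
  case True
  have "B = 0"
  proof (rule ccontr)
    assume "B \<noteq> 0"
    \<comment> \<open>At this t the expression, which is linear when C = 0, equals A - (A + 1) =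
      -1.\<close>
    then show False using assms(1)[of "(A + 1) / (2 * B)"] True by simp
  qed
  then show ?thesis using True by simp
next
  case False
  then have C: "C > 0" using assms(2) by simp
  have "0 \<le> (A - 2 * (B/C) * B + (B/C)\<^sup>2 * C) * C" using assms(1)[of "B/C"] C by (intro mult_nonneg_nonneg) auto
  also have "\<dots> = A * C - B\<^sup>2" using C by (simp add: power2_eq_square field_simps)
  finally show ?thesis by simp
qed

lemma L2_cauchy_schwarz:
  assumes "u \<in> L2" "v \<in> L2"
  shows "(L2_inner u v)\<^sup>2 \<le> L2_inner u u * L2_inner v v"
proof (rule quadratic_discriminant_le)
  fix t
  have tv: "(\<lambda>x. t * v x) \<in> L2" by (rule L2_cmult[OF assms(2)])
  have "L2_inner (\<lambda>x. u x - t * v x) (\<lambda>x. u x - t * v x) =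
     L2_inner u u - L2_inner u (\<lambda>x. t * v x) - (L2_inner (\<lambda>x. t * v x) u - L2_inner (\<lambda>x. t * v x) (\<lambda>x. t * v x))"
    using assms tv L2_diff[OF assms(1) tv] by (simp add: L2_inner_diff_left L2_inner_diff_right)
  also have "\<dots> = L2_inner u u - 2 * t * L2_inner u v + t\<^sup>2 * L2_inner v v"
    using L2_inner_cmult_left[of t v u] L2_inner_cmult_left[of t v "\<lambda>x. t * v x"] L2_inner_cmult_left[of t v v]
      L2_inner_commute[of u "\<lambda>x. t * v x"] L2_inner_commute[of v "\<lambda>x. t * v x"] L2_inner_commute[of u v]
    by (simp add: power2_eq_square)
  finally show "0 \<le> L2_inner u u - 2 * t * L2_inner u v + t\<^sup>2 * L2_inner v v"
    using L2_inner_nonneg[of "\<lambda>x. u x - t * v x"] by simp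
qed (rule L2_inner_nonneg)

lemma abs_le_sqrt_mult: "B\<^sup>2 \<le> A * C \<Longrightarrow> \<bar>B\<bar> \<le> sqrt A * sqrt C" for A B C :: real
  using real_sqrt_le_mono[of "B\<^sup>2" "A * C"] by (simp add: real_sqrt_mult)

lemma L2_tendsto_inner:
  assumes t: "L2_tendsto \<phi> u" and \<phi>: "\<And>n. \<phi> n \<in> L2" and u: "u \<in> L2" and v: "v \<in> L2"
  shows "(\<lambda>n. L2_inner (\<phi> n) v) \<longlonglongrightarrow> L2_inner u v"
proof (rule LIM_zero_cancel, rule Lim_null_comparison)
  show "eventually (\<lambda>n. norm (L2_inner (\<phi> n) v - L2_inner u v) \<le>
      sqrt (L2_inner (\<lambda>x. \<phi> n x - u x) (\<lambda>x. \<phi> n x - u x)) * sqrt (L2_inner v v)) sequentially"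
  proof (intro always_eventually allI)
    fix n
    have "\<bar>L2_inner (\<lambda>x. \<phi> n x - u x) v\<bar> \<le> sqrt (L2_inner (\<lambda>x. \<phi> n x - u x) (\<lambda>x. \<phi> n x - u x)) * sqrt (L2_inner v v)"
      by (intro abs_le_sqrt_mult L2_cauchy_schwarz L2_diff \<phi> u v)
    then show "norm (L2_inner (\<phi> n) v - L2_inner u v) \<le> sqrt (L2_inner (\<lambda>x. \<phi> n x - u x) (\<lambda>x. \<phi> n x - u x)) * sqrt (L2_inner v v)"
      by (simp add: L2_inner_diff_left[OF \<phi> u v])
  qed
  have "(\<lambda>n. sqrt (L2_inner (\<lambda>x. \<phi> n x - u x) (\<lambda>x. \<phi> n x - u x)) * sqrt (L2_inner v v)) \<longlonglongrightarrow> sqrt 0 * sqrt (L2_inner v v)"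
    using t unfolding L2_tendsto_def by (intro tendsto_intros)
  then show "(\<lambda>n. sqrt (L2_inner (\<lambda>x. \<phi> n x - u x) (\<lambda>x. \<phi> n x - u x)) * sqrt (L2_inner v v)) \<longlonglongrightarrow> 0" by simp
qed

section \<open>Symmetric forms\<close>

text \<open>The properties of the operator that the Friedrichs construction uses. Closability of the
  form rests on \<open>L_L2\<close>: the operator maps \<open>D\<close> into L^2.\<close>

locale nonneg_form =
  fixes D :: "(R3 \<Rightarrow> real) set" and L :: "(R3 \<Rightarrow> real) \<Rightarrow> R3 \<Rightarrow> real"
  assumes D_L2: "\<phi> \<in> D \<Longrightarrow> \<phi> \<in> L2"
    and L_L2: "\<phi> \<in> D \<Longrightarrow> L \<phi> \<in> L2"
    and D_diff: "\<lbrakk>\<phi> \<in> D; \<psi> \<in> D\<rbrakk> \<Longrightarrow> (\<lambda>x. \<phi> x - \<psi> x) \<in> D"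
    and D_cmult: "\<phi> \<in> D \<Longrightarrow> (\<lambda>x. c * \<phi> x) \<in> D"
    and L_diff: "\<lbrakk>\<phi> \<in> D; \<psi> \<in> D\<rbrakk> \<Longrightarrow> L (\<lambda>x. \<phi> x - \<psi> x) = (\<lambda>x. L \<phi> x - L \<psi> x)"
    and L_cmult: "\<phi> \<in> D \<Longrightarrow> L (\<lambda>x. c * \<phi> x) = (\<lambda>x. c * L \<phi> x)"
    and L_sym: "\<lbrakk>\<phi> \<in> D; \<psi> \<in> D\<rbrakk> \<Longrightarrow> L2_inner (L \<phi>) \<psi> = L2_inner (L \<psi>) \<phi>"
    and L_nonneg: "\<phi> \<in> D \<Longrightarrow> 0 \<le> L2_inner (L \<phi>) \<phi>"
begin

abbreviation "q \<phi> \<psi> \<equiv> L2_inner (L \<phi>) \<psi>"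

lemma q_diff_left: "\<lbrakk>\<phi> \<in> D; \<psi> \<in> D; \<zeta> \<in> D\<rbrakk> \<Longrightarrow> q (\<lambda>x. \<phi> x - \<psi> x) \<zeta> = q \<phi> \<zeta> - q \<psi> \<zeta>"
  by (simp add: L_diff L2_inner_diff_left L_L2 D_L2)

lemma q_diff_right: "\<lbrakk>\<phi> \<in> D; \<psi> \<in> D; \<zeta> \<in> D\<rbrakk> \<Longrightarrow> q \<zeta> (\<lambda>x. \<phi> x - \<psi> x) = q \<zeta> \<phi> - q \<zeta> \<psi>"
  by (simp add: L2_inner_diff_right L_L2 D_L2)

lemma q_cauchy_schwarz:
  assumes "\<phi> \<in> D" "\<psi> \<in> D"
  shows "\<bar>q \<phi> \<psi>\<bar> \<le> sqrt (q \<phi> \<phi>) * sqrt (q \<psi> \<psi>)"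
proof (rule abs_le_sqrt_mult, rule quadratic_discriminant_le)
  fix t
  have t: "(\<lambda>x. t * \<psi> x) \<in> D" by (rule D_cmult[OF assms(2)])
  have c: "q (\<lambda>x. t * \<psi> x) \<zeta> = t * q \<psi> \<zeta>" for \<zeta> by (simp add: L_cmult[OF assms(2)] L2_inner_cmult_left)
  have "q (\<lambda>x. \<phi> x - t * \<psi> x) (\<lambda>x. \<phi> x - t * \<psi> x) =
     q \<phi> \<phi> - q (\<lambda>x. t * \<psi> x) \<phi> - (q \<phi> (\<lambda>x. t * \<psi> x) - q (\<lambda>x. t * \<psi> x) (\<lambda>x. t * \<psi> x))"
    using assms t D_diff[OF assms(1) t] by (simp add: q_diff_left q_diff_right)
  also have "q \<phi> (\<lambda>x. t * \<psi> x) = t * q \<phi> \<psi>"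
    by (simp add: L_sym[OF assms(1) t] c L_sym[OF assms(2) assms(1)])
  also have "q (\<lambda>x. t * \<psi> x) (\<lambda>x. t * \<psi> x) = t * (t * q \<psi> \<psi>)" by (simp add: c L_sym[OF assms(2) t])
  finally have "q (\<lambda>x. \<phi> x - t * \<psi> x) (\<lambda>x. \<phi> x - t * \<psi> x) = q \<phi> \<phi> - 2 * t * q \<phi> \<psi> + t\<^sup>2 * q \<psi> \<psi>"
    by (simp add: c L_sym[OF assms(2) assms(1)] power2_eq_square)
  then show "0 \<le> q \<phi> \<phi> - 2 * t * q \<phi> \<psi> + t\<^sup>2 * q \<psi> \<psi>" using L_nonneg[OF D_diff[OF assms(1) t]] by simp
qed (use L_nonneg assms in auto)

text \<open>The right side minus the left side is q(\<phi> - 2 \<psi>, \<phi> - 2 \<psi>).\<close>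

lemma q_add_le: "\<lbrakk>\<phi> \<in> D; \<psi> \<in> D\<rbrakk> \<Longrightarrow> q \<phi> \<phi> \<le> 2 * q (\<lambda>x. \<phi> x - \<psi> x) (\<lambda>x. \<phi> x - \<psi> x) + 2 * q \<psi> \<psi>"
proof -
  assume a: "\<phi> \<in> D" "\<psi> \<in> D"
  have t: "(\<lambda>x. 2 * \<psi> x) \<in> D" by (rule D_cmult[OF a(2)])
  have c: "q (\<lambda>x. 2 * \<psi> x) \<zeta> = 2 * q \<psi> \<zeta>" for \<zeta> by (simp add: L_cmult[OF a(2)] L2_inner_cmult_left)
  have "0 \<le> q (\<lambda>x. \<phi> x - 2 * \<psi> x) (\<lambda>x. \<phi> x - 2 * \<psi> x)" by (intro L_nonneg D_diff a t)
  also have "\<dots> = q \<phi> \<phi> - 4 * q \<phi> \<psi> + 4 * q \<psi> \<psi>"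
    using a t D_diff[OF a(1) t] L_sym[OF a(1) t] L_sym[OF a(2) t] L_sym[OF a(2) a(1)]
    by (simp add: q_diff_left q_diff_right c)
  finally have 1: "4 * q \<phi> \<psi> \<le> q \<phi> \<phi> + 4 * q \<psi> \<psi>" by simp
  have "q (\<lambda>x. \<phi> x - \<psi> x) (\<lambda>x. \<phi> x - \<psi> x) = q \<phi> \<phi> - 2 * q \<phi> \<psi> + q \<psi> \<psi>"
    using a D_diff[OF a] L_sym[OF a(2) a(1)] by (simp add: q_diff_left q_diff_right)
  then show ?thesis using 1 by linarith
qed

lemma form_approxD:
  assumes "form_approx D L \<phi> u"
  shows "u \<in> L2" "\<And>n. \<phi> n \<in> D" "L2_tendsto \<phi> u"
    "\<And>\<epsilon>. \<epsilon> > 0 \<Longrightarrow> \<exists>N. \<forall>m\<ge>N. \<forall>n\<ge>N. q (\<lambda>x. \<phi> m x - \<phi> n x) (\<lambda>x. \<phi> m x - \<phi> n x) < \<epsilon>"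
  using assms by (auto simp: form_approx_def)

lemma form_approx_bounded:
  assumes "form_approx D L \<phi> u"
  obtains K N where "K > 0" "\<And>n. n \<ge> N \<Longrightarrow> q (\<phi> n) (\<phi> n) \<le> K"
proof -
  note f = form_approxD[OF assms]
  obtain N where N: "\<And>m n. \<lbrakk>m \<ge> N; n \<ge> N\<rbrakk> \<Longrightarrow> q (\<lambda>x. \<phi> m x - \<phi> n x) (\<lambda>x. \<phi> m x - \<phi> n x) < 1"
    using f(4)[of 1] by auto
  show thesis
  proof (rule that[of "2 * 1 + 2 * q (\<phi> N) (\<phi> N)" N])
    show "0 < 2 * 1 + 2 * q (\<phi> N) (\<phi> N)" using L_nonneg[OF f(2)[of N]] by simp
    fix n assume "n \<ge> N"
    then show "q (\<phi> n) (\<phi> n) \<le> 2 * 1 + 2 * q (\<phi> N) (\<phi> N)"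
      using q_add_le[OF f(2)[of n] f(2)[of N]] N[of n N] by simp
  qed
qed

lemma form_approx_const: "\<phi> \<in> D \<Longrightarrow> form_approx D L (\<lambda>_. \<phi>) \<phi>"
proof -
  assume a: "\<phi> \<in> D"
  have "L (\<lambda>x. 0 * \<phi> x) = (\<lambda>x. 0 * L \<phi> x)" by (rule L_cmult[OF a])
  then have "q (\<lambda>x. \<phi> x - \<phi> x) (\<lambda>x. \<phi> x - \<phi> x) = 0" by (simp add: L2_inner_def)
  then show ?thesis using a D_L2 by (auto simp: form_approx_def L2_tendsto_def L2_inner_def)
qed

text \<open>Closability. For \<zeta>_n = \<psi>_n - \<phi> write q(\<zeta>_n, \<zeta>_n) =
  q(\<zeta>_n, \<zeta>_n - \<zeta>_m) + q(\<zeta>_n, \<zeta>_m). The first term is small by the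
  Cauchy property; the second equals <L \<zeta>_n, \<zeta>_m> and tends to 0 for m \<rightarrow>
  \<infinity> because \<zeta>_m \<rightarrow> 0 in L^2.\<close>

lemma q_tendsto_0:
  assumes "form_approx D L \<psi> \<phi>" "\<phi> \<in> D"
  shows "(\<lambda>n. q (\<lambda>x. \<psi> n x - \<phi> x) (\<lambda>x. \<psi> n x - \<phi> x)) \<longlonglongrightarrow> 0"
proof (rule tendstoI)
  fix e :: real assume e: "e > 0"
  note f = form_approxD[OF assms(1)]
  define \<zeta> where "\<zeta> = (\<lambda>n x. \<psi> n x - \<phi> x)"
  have \<zeta>: "\<zeta> n \<in> D" for n unfolding \<zeta>_def by (intro D_diff f assms)
  obtain N where N: "\<And>m n. \<lbrakk>m \<ge> N; n \<ge> N\<rbrakk> \<Longrightarrow> q (\<lambda>x. \<psi> m x - \<psi> n x) (\<lambda>x. \<psi> m x - \<psi> n x) < e/2"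
    using f(4)[of "e/2"] e by auto
  have d: "(\<lambda>x. \<zeta> m x - \<zeta> n x) = (\<lambda>x. \<psi> m x - \<psi> n x)" for m n by (simp add: \<zeta>_def)
  have "q (\<zeta> n) (\<zeta> n) \<le> e/2" if n: "n \<ge> N" for n
  proof -
    let ?s = "sqrt (q (\<zeta> n) (\<zeta> n))"
    have "q (\<zeta> n) (\<zeta> n) - q (\<zeta> n) (\<zeta> m) \<le> ?s * sqrt (e/2)" if m: "m \<ge> N" for m
    proof -
      have "q (\<zeta> n) (\<zeta> n) - q (\<zeta> n) (\<zeta> m) = q (\<zeta> n) (\<lambda>x. \<zeta> n x - \<zeta> m x)" by (simp add: q_diff_right \<zeta>)
      also have "\<dots> \<le> ?s * sqrt (q (\<lambda>x. \<zeta> n x - \<zeta> m x) (\<lambda>x. \<zeta> n x - \<zeta> m x))"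
        using q_cauchy_schwarz[OF \<zeta>[of n] D_diff[OF \<zeta>[of n] \<zeta>[of m]]] by simp
      also have "\<dots> \<le> ?s * sqrt (e/2)"
        unfolding d using N[OF n m] L_nonneg[OF \<zeta>[of n]] by (intro mult_left_mono real_sqrt_le_mono) auto
      finally show ?thesis .
    qed
    then have ev: "eventually (\<lambda>m. q (\<zeta> n) (\<zeta> n) - q (\<zeta> n) (\<zeta> m) \<le> ?s * sqrt (e/2)) sequentially"
      unfolding eventually_sequentially by blast
    have "(\<lambda>m. L2_inner (\<psi> m) (L (\<zeta> n))) \<longlonglongrightarrow> L2_inner \<phi> (L (\<zeta> n))"
      by (intro L2_tendsto_inner f D_L2 L_L2 \<zeta>)
    then have "(\<lambda>m. L2_inner (\<psi> m) (L (\<zeta> n)) - L2_inner \<phi> (L (\<zeta> n))) \<longlonglongrightarrow> 0" by (rule LIM_zero)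
    moreover have "L2_inner (\<psi> m) (L (\<zeta> n)) - L2_inner \<phi> (L (\<zeta> n)) = q (\<zeta> n) (\<zeta> m)" for m
      using L2_inner_diff_left[OF D_L2[OF f(2)[of m]] D_L2[OF assms(2)] L_L2[OF \<zeta>[of n]]]
      by (simp add: \<zeta>_def L2_inner_commute)
    ultimately have "(\<lambda>m. q (\<zeta> n) (\<zeta> m)) \<longlonglongrightarrow> 0" by simp
    from tendsto_diff[OF tendsto_const this] have "(\<lambda>m. q (\<zeta> n) (\<zeta> n) - q (\<zeta> n) (\<zeta> m)) \<longlonglongrightarrow> q (\<zeta> n) (\<zeta> n) - 0" .
    from tendsto_upperbound[OF this ev] have "q (\<zeta> n) (\<zeta> n) \<le> ?s * sqrt (e/2)" by simp
    then have "?s * ?s \<le> ?s * sqrt (e/2)" using L_nonneg[OF \<zeta>[of n]] by simp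
    then have "?s \<le> sqrt (e/2)"
    proof (cases "?s > 0")
      case True
      with \<open>?s * ?s \<le> _\<close> show ?thesis by (simp only: mult_le_cancel_left_pos)
    next
      case False
      then show ?thesis using e real_sqrt_ge_zero[of "e/2"] by linarith
    qed
    then show ?thesis by (simp only: real_sqrt_le_iff)
  qed
  then show "eventually (\<lambda>n. dist (q (\<lambda>x. \<psi> n x - \<phi> x) (\<lambda>x. \<psi> n x - \<phi> x)) 0 < e) sequentially"
    unfolding eventually_sequentially using e L_nonneg[OF \<zeta>] unfolding \<zeta>_def dist_real_def
    by (intro exI[of _ N]) (force intro: le_less_trans)
qed

text \<open>\<open>closed_form\<close> provides only some approximating sequences, so the one for
  \<phi> need not be constant. By \<open>q_tendsto_0\<close> it may be replaced by \<phi> itself,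
  and then q(\<Phi>_n, \<phi>) = <\<Phi>_n, L \<phi>> passes to the limit in L^2.\<close>

lemma friedrichs_weak:
  assumes fr: "friedrichs D L u f" and \<phi>: "\<phi> \<in> D"
  shows "L2_inner u (L \<phi>) = L2_inner f \<phi>"
proof -
  have "closed_form D L u \<phi> (L2_inner f \<phi>)"
    using fr form_approx_const[OF \<phi>] \<phi> unfolding friedrichs_def form_domain_def by blast
  then obtain \<Phi> \<psi> where 1: "form_approx D L \<Phi> u" and 2: "form_approx D L \<psi> \<phi>"
    and lim: "(\<lambda>n. q (\<Phi> n) (\<psi> n)) \<longlonglongrightarrow> L2_inner f \<phi>" by (auto simp: closed_form_def)
  note f1 = form_approxD[OF 1] and f2 = form_approxD[OF 2]
  obtain K N where K: "K > 0" "\<And>n. n \<ge> N \<Longrightarrow> q (\<Phi> n) (\<Phi> n) \<le> K" using form_approx_bounded[OF 1] by blast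
  have "(\<lambda>n. q (\<Phi> n) (\<psi> n) - q (\<Phi> n) \<phi>) \<longlonglongrightarrow> 0"
  proof (rule Lim_null_comparison)
    show "eventually (\<lambda>n. norm (q (\<Phi> n) (\<psi> n) - q (\<Phi> n) \<phi>) \<le> sqrt K * sqrt (q (\<lambda>x. \<psi> n x - \<phi> x) (\<lambda>x. \<psi> n x - \<phi> x))) sequentially"
      unfolding eventually_sequentially
    proof (intro exI[of _ N] allI impI)
      fix n assume n: "N \<le> n"
      have "\<bar>q (\<Phi> n) (\<lambda>x. \<psi> n x - \<phi> x)\<bar> \<le> sqrt (q (\<Phi> n) (\<Phi> n)) * sqrt (q (\<lambda>x. \<psi> n x - \<phi> x) (\<lambda>x. \<psi> n x - \<phi> x))"
        by (intro q_cauchy_schwarz f1 D_diff f2 \<phi>)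
      also have "\<dots> \<le> sqrt K * sqrt (q (\<lambda>x. \<psi> n x - \<phi> x) (\<lambda>x. \<psi> n x - \<phi> x))"
        using K(2)[OF n] L_nonneg[OF D_diff[OF f2(2)[of n] \<phi>]] by (intro mult_right_mono) auto
      finally show "norm (q (\<Phi> n) (\<psi> n) - q (\<Phi> n) \<phi>) \<le> sqrt K * sqrt (q (\<lambda>x. \<psi> n x - \<phi> x) (\<lambda>x. \<psi> n x - \<phi> x))"
        by (simp add: q_diff_right[OF f2(2)[of n] \<phi> f1(2)[of n]])
    qed
    have "(\<lambda>n. sqrt K * sqrt (q (\<lambda>x. \<psi> n x - \<phi> x) (\<lambda>x. \<psi> n x - \<phi> x))) \<longlonglongrightarrow> sqrt K * sqrt 0"
      by (intro tendsto_intros q_tendsto_0[OF 2 \<phi>])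
    then show "(\<lambda>n. sqrt K * sqrt (q (\<lambda>x. \<psi> n x - \<phi> x) (\<lambda>x. \<psi> n x - \<phi> x))) \<longlonglongrightarrow> 0" by simp
  qed
  from tendsto_diff[OF lim this] have 3: "(\<lambda>n. q (\<Phi> n) \<phi>) \<longlonglongrightarrow> L2_inner f \<phi>" by simp
  have "(\<lambda>n. L2_inner (\<Phi> n) (L \<phi>)) \<longlonglongrightarrow> L2_inner u (L \<phi>)"
    by (intro L2_tendsto_inner f1 D_L2 L_L2 \<phi>)
  moreover have "L2_inner (\<Phi> n) (L \<phi>) = q (\<Phi> n) \<phi>" for n
    using L_sym[OF f1(2)[of n] \<phi>] by (simp add: L2_inner_commute)
  ultimately have "(\<lambda>n. q (\<Phi> n) \<phi>) \<longlonglongrightarrow> L2_inner u (L \<phi>)" by simp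
  from LIMSEQ_unique[OF this 3] show ?thesis .
qed

text \<open>Against a fixed element of \<open>D\<close> the form is eventually constant along
  \<Phi>. A general v is reached through its own approximations, with the boundedness of q(\<Phi>_n,
  \<Phi>_n) and Cauchy-Schwarz giving uniformity in n.\<close>

lemma friedrichsI:
  assumes ap: "form_approx D L \<Phi> Q" and f: "f \<in> L2"
    and ev: "\<And>\<psi>. \<psi> \<in> D \<Longrightarrow> eventually (\<lambda>n. q (\<Phi> n) \<psi> = L2_inner f \<psi>) sequentially"
  shows "friedrichs D L Q f"
  unfolding friedrichs_def
proof (intro conjI ballI f)
  show "Q \<in> form_domain D L" using ap by (auto simp: form_domain_def)
  fix v assume "v \<in> form_domain D L"
  then obtain \<psi> where ps: "form_approx D L \<psi> v" by (auto simp: form_domain_def)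
  note f1 = form_approxD[OF ap] and f2 = form_approxD[OF ps]
  obtain K N0 where K: "K > 0" "\<And>n. n \<ge> N0 \<Longrightarrow> q (\<Phi> n) (\<Phi> n) \<le> K" using form_approx_bounded[OF ap] by blast
  have "(\<lambda>n. q (\<Phi> n) (\<psi> n)) \<longlonglongrightarrow> L2_inner f v"
  proof (rule tendstoI)
    fix e :: real assume e: "e > 0"
    \<comment> \<open>Chosen so that sqrt K * sqrt d = e / 2.\<close>
    define d where "d = (e / 2)\<^sup>2 / K"
    have d: "d > 0" using e K by (simp add: d_def)
    obtain N1 where N1: "\<And>m n. \<lbrakk>m \<ge> N1; n \<ge> N1\<rbrakk> \<Longrightarrow> q (\<lambda>x. \<psi> m x - \<psi> n x) (\<lambda>x. \<psi> m x - \<psi> n x) < d"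
      using f2(4)[OF d] by auto
    have "(\<lambda>m. L2_inner (\<psi> m) f) \<longlonglongrightarrow> L2_inner v f"
      by (intro L2_tendsto_inner f2 D_L2 f)
    then have "eventually (\<lambda>m. dist (L2_inner (\<psi> m) f) (L2_inner v f) < e/2) sequentially" using e by (intro tendstoD) auto
    then obtain N2 where N2: "\<And>m. m \<ge> N2 \<Longrightarrow> dist (L2_inner (\<psi> m) f) (L2_inner v f) < e/2" by (auto simp: eventually_sequentially)
    define m where "m = max N1 N2"
    obtain N3 where N3: "\<And>n. n \<ge> N3 \<Longrightarrow> q (\<Phi> n) (\<psi> m) = L2_inner f (\<psi> m)"
      using ev[OF f2(2)[of m]] by (auto simp: eventually_sequentially)
    have "dist (q (\<Phi> n) (\<psi> n)) (L2_inner f v) < e" if n: "n \<ge> max (max N0 N1) N3" for n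
    proof -
      have "\<bar>q (\<Phi> n) (\<lambda>x. \<psi> n x - \<psi> m x)\<bar> \<le> sqrt (q (\<Phi> n) (\<Phi> n)) * sqrt (q (\<lambda>x. \<psi> n x - \<psi> m x) (\<lambda>x. \<psi> n x - \<psi> m x))"
        by (intro q_cauchy_schwarz f1 D_diff f2)
      also have "\<dots> \<le> sqrt K * sqrt d"
        using K(2)[of n] N1[of n m] n L_nonneg[OF D_diff[OF f2(2)[of n] f2(2)[of m]]] K(1)
        by (intro mult_mono real_sqrt_le_mono) (auto simp: m_def)
      also have "\<dots> = e / 2" using K(1) e by (simp add: real_sqrt_mult[symmetric] d_def)
      finally have 1: "\<bar>q (\<Phi> n) (\<psi> n) - q (\<Phi> n) (\<psi> m)\<bar> \<le> e / 2" by (simp add: q_diff_right[OF f2(2) f2(2) f1(2)])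
      have 2: "\<bar>L2_inner f (\<psi> m) - L2_inner f v\<bar> < e/2"
        using N2[of m] by (simp add: m_def dist_real_def L2_inner_commute)
      have "q (\<Phi> n) (\<psi> m) = L2_inner f (\<psi> m)" using n by (intro N3) simp
      then show ?thesis unfolding dist_real_def using 1 2 by linarith
    qed
    then show "eventually (\<lambda>n. dist (q (\<Phi> n) (\<psi> n)) (L2_inner f v) < e) sequentially"
      unfolding eventually_sequentially by blast
  qed
  then show "closed_form D L Q v (L2_inner f v)" using ap ps by (auto simp: closed_form_def)
qed

end

section \<open>Integration by parts\<close>

lemma integrable_compact_support:
  fixes f :: "R3 \<Rightarrow> real"
  assumes m: "f \<in> borel_measurable borel" and K: "compact K" and b: "\<And>x. x \<in> K \<Longrightarrow> \<bar>f x\<bar> \<le> B"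
    and z: "\<And>x. x \<notin> K \<Longrightarrow> f x = 0"
  shows "integrable lborel f"
proof (rule Bochner_Integration.integrable_bound)
  have "emeasure lborel K < \<infinity>" using K by (rule emeasure_compact_finite)
  moreover have "K \<in> sets lborel" using K by (simp add: borel_compact)
  ultimately show "integrable lborel (\<lambda>x. B * indicator K x)" by (intro integrable_mult_right) (simp add: integrable_indicator_iff)
  show "AE x in lborel. norm (f x) \<le> norm (B * indicator K x)"
    using b z by (intro always_eventually allI) (force simp: indicator_def)
qed (use m in simp)

lemma integrable_continuous_compact_support:
  fixes f :: "R3 \<Rightarrow> real"
  assumes c: "continuous_on UNIV f" and K: "compact K" and z: "\<And>x. x \<notin> K \<Longrightarrow> f x = 0"
  shows "integrable lborel f"
proof -
  have "bounded (f ` K)" by (intro compact_imp_bounded compact_continuous_image K continuous_on_subset[OF c]) auto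
  then obtain B where "\<And>x. x \<in> K \<Longrightarrow> \<bar>f x\<bar> \<le> B" unfolding bounded_iff real_norm_def by (metis imageI)
  then show ?thesis
    by (intro integrable_compact_support[OF _ K _ z]) (auto intro: borel_measurable_continuous_onI c)
qed

text \<open>By translation invariance every difference quotient in direction i has integral 0. The
  quotients are bounded by the maximum of the derivative on a fixed ball and converge to it.\<close>

lemma integral_partial_0:
  assumes f: "Ck 1 f" and K: "compact K" and z: "\<And>x. x \<notin> K \<Longrightarrow> f x = 0"
  shows "(\<integral>x. partial i f x \<partial>lborel) = 0"
proof -
  define v :: R3 where "v = axis i 1"
  have v1: "norm v = 1" by (simp add: v_def)
  have d: "(f has_derivative frechet_derivative f (at x)) (at x)" for x
    using f by (auto simp: frechet_derivative_works[symmetric])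
  have cp: "continuous_on UNIV (partial i f)" using f by (simp add: numeral_eq_Suc)
  have cf: "continuous_on UNIV f" using f Ck_Suc_imp[of 0 f] by simp
  have line: "((\<lambda>t. f (x + t *\<^sub>R v)) has_real_derivative partial i f (x + t *\<^sub>R v)) (at t)" for x t
  proof -
    have "((\<lambda>t. x + t *\<^sub>R v) has_derivative (\<lambda>h. h *\<^sub>R v)) (at t)"
      by (auto intro!: derivative_eq_intros)
    from has_derivative_compose[OF this d]
    have "((\<lambda>t. f (x + t *\<^sub>R v)) has_derivative (\<lambda>h. frechet_derivative f (at (x + t *\<^sub>R v)) (h *\<^sub>R v))) (at t)" .
    moreover have "frechet_derivative f (at (x + t *\<^sub>R v)) (h *\<^sub>R v) = partial i f (x + t *\<^sub>R v) * h" for h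
      using linear_scale[OF has_derivative_linear[OF d[of "x + t *\<^sub>R v"]], of h v]
      by (simp add: partial_def v_def mult.commute)
    ultimately show ?thesis unfolding has_field_derivative_def by (simp add: mult_commute_abs)
  qed
  obtain R where R: "\<And>x. x \<in> K \<Longrightarrow> norm x \<le> R" using compact_imp_bounded[OF K] by (auto simp: bounded_iff)
  \<comment> \<open>Steps have length at most 1, so all difference quotients vanish outside this
    ball.\<close>
  define C where "C = cball (0::R3) (R + 2)"
  have C: "compact C" by (simp add: C_def)
  have pz: "partial i f x = 0" if "x \<notin> cball 0 (R + 1)" for x
  proof -
    have "((\<lambda>x. 0) has_derivative (\<lambda>h. 0)) (at x)" by simp
    then have "(f has_derivative (\<lambda>h. 0)) (at x)"
      by (rule has_derivative_transform_within_open[of _ _ _ _ "- cball 0 (R+1)"])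
         (use that z R in \<open>force\<close>)+
    from partial_eqI[OF this] show ?thesis by simp
  qed
  have "bounded (partial i f ` C)" by (intro compact_imp_bounded compact_continuous_image C continuous_on_subset[OF cp]) auto
  then obtain M where M0: "\<And>x. x \<in> C \<Longrightarrow> \<bar>partial i f x\<bar> \<le> M" unfolding bounded_iff real_norm_def by (metis imageI)
  have M: "\<bar>partial i f x\<bar> \<le> max M 0" for x
    using M0[of x] pz[of x] by (cases "x \<in> C") (auto simp: C_def max_def)
  define s where "s = (\<lambda>n x. real (Suc n) * (f (x + (1 / real (Suc n)) *\<^sub>R v) - f x))"
  have int_f: "integrable lborel f" by (rule integrable_continuous_compact_support[OF cf K z])
  have dist: "distr lborel borel (\<lambda>x. x + c) = lborel" for c :: R3
  proof -
    have "(\<lambda>x. x + c) = (+) c" by (auto simp: add.commute)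
    then show ?thesis using lborel_distr_plus[of c] by simp
  qed
  have int_sh: "integrable lborel (\<lambda>x. f (x + c))" "(\<integral>x. f (x + c) \<partial>lborel) = (\<integral>x. f x \<partial>lborel)" for c
  proof -
    have m: "f \<in> borel_measurable borel" by (rule borel_measurable_continuous_onI[OF cf])
    have "integrable (distr lborel borel (\<lambda>x. x + c)) f" using int_f dist[of c] by simp
    then show "integrable lborel (\<lambda>x. f (x + c))" by (subst (asm) integrable_distr_eq) (use m in auto)
    have "(\<integral>x. f x \<partial>distr lborel borel (\<lambda>x. x + c)) = (\<integral>x. f (x + c) \<partial>lborel)"
      by (rule integral_distr) (use m in auto)
    then show "(\<integral>x. f (x + c) \<partial>lborel) = (\<integral>x. f x \<partial>lborel)" unfolding dist by simp
  qed
  have s0: "(\<integral>x. s n x \<partial>lborel) = 0" for n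
    unfolding s_def by (simp add: int_sh int_f Bochner_Integration.integral_diff)
  have "(\<lambda>n. \<integral>x. s n x \<partial>lborel) \<longlonglongrightarrow> (\<integral>x. partial i f x \<partial>lborel)"
  proof (rule integral_dominated_convergence)
    show "partial i f \<in> borel_measurable lborel" using borel_measurable_continuous_onI[OF cp] by simp
    show "s n \<in> borel_measurable lborel" for n
      unfolding s_def using borel_measurable_integrable[OF int_sh(1)] borel_measurable_integrable[OF int_f] by simp
    show "integrable lborel (\<lambda>x. max M 0 * indicator C x)"
      using emeasure_compact_finite[OF C] borel_compact[OF C] by (intro integrable_mult_right) (simp add: integrable_indicator_iff)
    show "AE x in lborel. (\<lambda>n. s n x) \<longlonglongrightarrow> partial i f x"
    proof (intro always_eventually allI)
      fix x
      have "((\<lambda>t. (f (x + t *\<^sub>R v) - f (x + 0 *\<^sub>R v)) / (t - 0)) \<longlongrightarrow> partial i f (x + 0 *\<^sub>R v)) (at 0)"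
        using line[of x 0] unfolding has_field_derivative_iff .
      moreover have "filterlim (\<lambda>n. 1 / real (Suc n)) (at 0) sequentially"
        unfolding filterlim_at using LIMSEQ_inverse_real_of_nat by (auto simp: inverse_eq_divide)
      ultimately have "(\<lambda>n. (f (x + (1 / real (Suc n)) *\<^sub>R v) - f (x + 0 *\<^sub>R v)) / (1 / real (Suc n) - 0)) \<longlonglongrightarrow> partial i f (x + 0 *\<^sub>R v)"
        by (rule filterlim_compose)
      then show "(\<lambda>n. s n x) \<longlonglongrightarrow> partial i f x" by (simp add: s_def mult.commute)
    qed
    show "AE x in lborel. norm (s n x) \<le> max M 0 * indicator C x" for n
    proof (intro always_eventually allI)
      fix x
      define h where "h = 1 / real (Suc n)"
      have h: "0 < h" "h \<le> 1" by (auto simp: h_def)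
      show "norm (s n x) \<le> max M 0 * indicator C x"
      proof (cases "x \<in> C")
        case True
        obtain t where "0 < t" "t < h" "f (x + h *\<^sub>R v) - f (x + 0 *\<^sub>R v) = (h - 0) * partial i f (x + t *\<^sub>R v)"
          using MVT2[OF h(1), of "\<lambda>t. f (x + t *\<^sub>R v)" "\<lambda>t. partial i f (x + t *\<^sub>R v)"] line by auto
        then have "\<bar>f (x + h *\<^sub>R v) - f x\<bar> \<le> h * max M 0"
          using M h by (simp add: abs_mult mult_left_mono)
        then have "\<bar>f (x + h *\<^sub>R v) - f x\<bar> / h \<le> max M 0" using h by (simp add: divide_le_eq mult.commute)
        moreover have "norm (s n x) = \<bar>f (x + h *\<^sub>R v) - f x\<bar> / h" unfolding s_def h_def real_norm_def abs_mult by simp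
        ultimately show ?thesis using True by simp
      next
        case False
        then have nx: "norm x > R + 2" by (simp add: C_def)
        have "norm x \<le> norm (x + h *\<^sub>R v) + norm (h *\<^sub>R v)" by (metis norm_diff_triangle_ineq add_diff_cancel norm_triangle_ineq4)
        then have "norm (x + h *\<^sub>R v) > R" using nx h v1 by simp
        then have "x \<notin> K" "x + h *\<^sub>R v \<notin> K" using R nx by force+
        then show ?thesis using False z by (simp add: s_def h_def)
      qed
    qed
  qed
  then show ?thesis using s0 by (simp add: LIMSEQ_const_iff)
qed

section \<open>The Schroedinger form\<close>

lemma test_functionD:
  assumes "\<phi> \<in> test_functions \<Omega>"
  shows "Ck k \<phi>" "continuous_on UNIV \<phi>" "\<phi> differentiable at x" "Ck k (partial i \<phi>)" "continuous_on UNIV (partial i \<phi>)"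
proof -
  have c: "Ck k \<phi>" for k using assms by (auto simp: test_functions_def)
  show "Ck k \<phi>" "continuous_on UNIV \<phi>" using c[of k] c[of 0] by auto
  show "\<phi> differentiable at x" "Ck k (partial i \<phi>)" "continuous_on UNIV (partial i \<phi>)" using c[of "Suc k"] c[of "Suc 0"] by auto
qed

lemma test_function_support:
  assumes "\<phi> \<in> test_functions \<Omega>"
  obtains K where "compact K" "K \<subseteq> \<Omega>" "\<And>x. x \<notin> K \<Longrightarrow> \<phi> x = 0"
proof (rule that[of "closure {x. \<phi> x \<noteq> 0}"])
  show "\<phi> x = 0" if "x \<notin> closure {x. \<phi> x \<noteq> 0}" for x
    using that closure_subset[of "{x. \<phi> x \<noteq> 0}"] by auto
qed (use assms in \<open>auto simp: test_functions_def\<close>)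

lemma test_functionI:
  assumes "\<And>k. Ck k \<phi>" "compact K" "K \<subseteq> \<Omega>" "\<And>x. x \<notin> K \<Longrightarrow> \<phi> x = 0"
  shows "\<phi> \<in> test_functions \<Omega>"
proof -
  have s: "closure {x. \<phi> x \<noteq> 0} \<subseteq> K"
    by (rule closure_minimal) (use assms compact_imp_closed in auto)
  then have "compact (closure {x. \<phi> x \<noteq> 0})"
    using compact_Int_closed[OF assms(2) closed_closure, of "{x. \<phi> x \<noteq> 0}"] by (simp add: inf.absorb2)
  then show ?thesis using s assms by (auto simp: test_functions_def)
qed

lemma test_functions_mono: "\<phi> \<in> test_functions \<Omega> \<Longrightarrow> \<phi> \<in> test_functions UNIV"
  by (auto simp: test_functions_def)

lemma test_functions_diff:
  assumes "\<phi> \<in> test_functions \<Omega>" "\<psi> \<in> test_functions \<Omega>"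
  shows "(\<lambda>x. \<phi> x - \<psi> x) \<in> test_functions \<Omega>"
proof -
  obtain K1 where K1: "compact K1" "K1 \<subseteq> \<Omega>" "\<And>x. x \<notin> K1 \<Longrightarrow> \<phi> x = 0" using test_function_support[OF assms(1)] by blast
  obtain K2 where K2: "compact K2" "K2 \<subseteq> \<Omega>" "\<And>x. x \<notin> K2 \<Longrightarrow> \<psi> x = 0" using test_function_support[OF assms(2)] by blast
  show ?thesis
    by (rule test_functionI[of _ "K1 \<union> K2"])
       (use K1 K2 in \<open>auto intro: Ck_diff test_functionD(1)[OF assms(1)] test_functionD(1)[OF assms(2)]\<close>)
qed

lemma test_functions_cmult:
  assumes "\<phi> \<in> test_functions \<Omega>"
  shows "(\<lambda>x. c * \<phi> x) \<in> test_functions \<Omega>"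
proof -
  obtain K1 where K1: "compact K1" "K1 \<subseteq> \<Omega>" "\<And>x. x \<notin> K1 \<Longrightarrow> \<phi> x = 0" using test_function_support[OF assms(1)] by blast
  show ?thesis
    by (rule test_functionI[of _ K1]) (use K1 in \<open>auto intro: Ck_cmult test_functionD(1)[OF assms(1)]\<close>)
qed

lemma partial_outside:
  assumes "closed K" "\<And>x. x \<notin> K \<Longrightarrow> f x = 0" "x \<notin> K"
  shows "partial i f x = 0"
proof -
  have "((\<lambda>x. 0) has_derivative (\<lambda>h. 0)) (at x)" by simp
  then have "(f has_derivative (\<lambda>h. 0)) (at x)"
    by (rule has_derivative_transform_within_open[of _ _ _ _ "- K"]) (use assms in auto)
  from partial_eqI[OF this] show ?thesis by simp
qed

lemma test_function_L2:
  assumes "\<phi> \<in> test_functions \<Omega>" shows "\<phi> \<in> L2"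
proof -
  obtain K where K: "compact K" "K \<subseteq> \<Omega>" "\<And>x. x \<notin> K \<Longrightarrow> \<phi> x = 0" using test_function_support[OF assms(1)] by blast
  have c: "continuous_on UNIV \<phi>" by (rule test_functionD[OF assms])
  have "integrable lborel (\<lambda>x. (\<phi> x)\<^sup>2)"
    by (rule integrable_continuous_compact_support[OF _ K(1)]) (use K c in \<open>auto intro: continuous_intros\<close>)
  then show ?thesis using borel_measurable_continuous_onI[OF c] by (simp add: L2_def)
qed

lemma partial_test_function:
  assumes "\<phi> \<in> test_functions \<Omega>" shows "partial i \<phi> \<in> test_functions \<Omega>"
proof -
  obtain K where K: "compact K" "K \<subseteq> \<Omega>" "\<And>x. x \<notin> K \<Longrightarrow> \<phi> x = 0" using test_function_support[OF assms(1)] by blast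
  show ?thesis
    by (rule test_functionI[OF test_functionD(4)[OF assms] K(1,2) partial_outside[OF compact_imp_closed[OF K(1)] K(3)]])
qed

lemma partial_by_parts:
  assumes "\<phi> \<in> test_functions UNIV" "\<psi> \<in> test_functions UNIV"
  shows "L2_inner \<phi> (partial i \<psi>) = - L2_inner (partial i \<phi>) \<psi>"
proof -
  obtain K where K: "compact K" "K \<subseteq> UNIV" "\<And>x. x \<notin> K \<Longrightarrow> \<phi> x = 0" using test_function_support[OF assms(1)] by blast
  have "(\<integral>x. partial i (\<lambda>x. \<phi> x * \<psi> x) x \<partial>lborel) = 0"
    by (rule integral_partial_0[OF Ck_mult[OF test_functionD(1)[OF assms(1)] test_functionD(1)[OF assms(2)]] K(1)])
       (simp add: K(3))
  moreover have "partial i (\<lambda>x. \<phi> x * \<psi> x) x = \<phi> x * partial i \<psi> x + partial i \<phi> x * \<psi> x" for x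
    by (intro partial_mult test_functionD(3)[OF assms(1)] test_functionD(3)[OF assms(2)])
  moreover have "integrable lborel (\<lambda>x. \<phi> x * partial i \<psi> x)" "integrable lborel (\<lambda>x. partial i \<phi> x * \<psi> x)"
    using assms by (auto intro!: L2_mult_integrable test_function_L2 partial_test_function)
  ultimately show ?thesis by (simp add: L2_inner_def)
qed

lemma laplacian_test:
  assumes "\<phi> \<in> test_functions \<Omega>"
  shows "continuous_on UNIV (laplacian \<phi>)" "laplacian \<phi> \<in> L2"
    "\<lbrakk>closed K; \<And>x. x \<notin> K \<Longrightarrow> \<phi> x = 0; x \<notin> K\<rbrakk> \<Longrightarrow> laplacian \<phi> x = 0"
proof -
  have pp: "partial i (partial i \<phi>) \<in> test_functions \<Omega>" for i by (intro partial_test_function assms)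
  show "continuous_on UNIV (laplacian \<phi>)" unfolding laplacian_def[abs_def]
    by (intro continuous_on_sum test_functionD(2)[OF pp])
  have "(\<lambda>x. \<Sum>i\<in>I. partial i (partial i \<phi>) x) \<in> L2" if "finite I" for I
    using that
  proof (induction I)
    case empty
    show ?case by (simp add: L2_def)
  next
    case (insert i I)
    then show ?case using L2_add[OF test_function_L2[OF pp[of i]] insert(3)] by simp
  qed
  then show "laplacian \<phi> \<in> L2" unfolding laplacian_def[abs_def] by simp
  show "laplacian \<phi> x = 0" if "closed K" "\<And>x. x \<notin> K \<Longrightarrow> \<phi> x = 0" "x \<notin> K"
    unfolding laplacian_def
    by (intro sum.neutral ballI partial_outside[OF that(1) partial_outside[OF that(1,2)] that(3)])
qed

lemma L2_inner_laplacian: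
  assumes "\<phi> \<in> test_functions UNIV" "\<psi> \<in> test_functions UNIV"
  shows "L2_inner (laplacian \<phi>) \<psi> = - (\<Sum>i\<in>UNIV. L2_inner (partial i \<phi>) (partial i \<psi>))"
proof -
  have "L2_inner (laplacian \<phi>) \<psi> = (\<Sum>i\<in>UNIV. L2_inner (partial i (partial i \<phi>)) \<psi>)"
    unfolding L2_inner_def laplacian_def sum_distrib_right
  proof (rule Bochner_Integration.integral_sum)
    fix i
    have "partial i (partial i \<phi>) \<in> test_functions UNIV" by (intro partial_test_function assms(1))
    then show "integrable lborel (\<lambda>x. partial i (partial i \<phi>) x * \<psi> x)"
      by (intro L2_mult_integrable test_function_L2[OF assms(2)]) (rule test_function_L2)
  qed
  also have "\<dots> = (\<Sum>i\<in>UNIV. - L2_inner (partial i \<phi>) (partial i \<psi>))"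
    using partial_by_parts[OF partial_test_function[OF assms(1)] assms(2)] by simp
  finally show ?thesis by (simp add: sum_negf)
qed

lemma laplacian_diff:
  assumes "\<phi> \<in> test_functions \<Omega>" "\<psi> \<in> test_functions \<Omega>"
  shows "laplacian (\<lambda>x. \<phi> x - \<psi> x) = (\<lambda>x. laplacian \<phi> x - laplacian \<psi> x)"
    and "laplacian (\<lambda>x. c * \<phi> x) = (\<lambda>x. c * laplacian \<phi> x)"
proof -
  have pc: "partial i (\<lambda>x. c * \<phi> x) = (\<lambda>x. c * partial i \<phi> x)" if "\<phi> \<in> test_functions \<Omega>" for i c \<phi>
    using partial_mult[of "\<lambda>x. c" _ \<phi> i] test_functionD(3)[OF that] partial_const[of i c] by (intro ext) simp
  have p: "partial i (\<lambda>x. \<phi> x - \<psi> x) = (\<lambda>x. partial i \<phi> x - partial i \<psi> x)"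
    if a: "\<phi> \<in> test_functions \<Omega>" "\<psi> \<in> test_functions \<Omega>" for i \<phi> \<psi>
  proof -
    have "partial i (\<lambda>x. \<phi> x + (-1) * \<psi> x) x = partial i \<phi> x + partial i (\<lambda>x. (-1) * \<psi> x) x" for x
      by (intro partial_add test_functionD(3)[OF a(1)] test_functionD(3)[OF test_functions_cmult[OF a(2)]])
    then show ?thesis unfolding pc[OF a(2)] by (intro ext) simp
  qed
  show "laplacian (\<lambda>x. \<phi> x - \<psi> x) = (\<lambda>x. laplacian \<phi> x - laplacian \<psi> x)"
    unfolding laplacian_def[abs_def] p[OF assms] p[OF partial_test_function[OF assms(1)] partial_test_function[OF assms(2)]]
    by (simp add: sum_subtractf)
  show "laplacian (\<lambda>x. c * \<phi> x) = (\<lambda>x. c * laplacian \<phi> x)"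
    unfolding laplacian_def[abs_def] pc[OF assms(1)] pc[OF partial_test_function[OF assms(1)]]
    by (simp add: sum_distrib_left)
qed

definition Lop :: "real \<Rightarrow> (R3 \<Rightarrow> real) \<Rightarrow> R3 \<Rightarrow> real" where
  "Lop a \<phi> x = - laplacian \<phi> x + a / (norm x)\<^sup>2 * \<phi> x"

lemma potential_bounded_support:
  assumes \<phi>: "\<phi> \<in> test_functions (- {0})"
  shows "(\<lambda>x. a / (norm x)\<^sup>2 * \<phi> x) \<in> L2"
proof -
  obtain K where K: "compact K" "K \<subseteq> - {0}" "\<And>x. x \<notin> K \<Longrightarrow> \<phi> x = 0" using test_function_support[OF \<phi>] by blast
  have c: "continuous_on UNIV \<phi>" by (rule test_functionD[OF \<phi>])
  have m: "(\<lambda>x. a / (norm x)\<^sup>2 * \<phi> x) \<in> borel_measurable borel"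
    using borel_measurable_continuous_onI[OF c] by measurable
  have "continuous_on K (\<lambda>x. (a / (norm x)\<^sup>2 * \<phi> x)\<^sup>2)"
    using K by (intro continuous_intros continuous_on_subset[OF c]) auto
  then have "bounded ((\<lambda>x. (a / (norm x)\<^sup>2 * \<phi> x)\<^sup>2) ` K)" by (intro compact_imp_bounded compact_continuous_image K)
  then obtain B where "\<forall>y\<in>(\<lambda>x. (a / (norm x)\<^sup>2 * \<phi> x)\<^sup>2) ` K. \<bar>y\<bar> \<le> B"
    unfolding bounded_iff real_norm_def by blast
  then have B: "\<And>x. x \<in> K \<Longrightarrow> \<bar>(a / (norm x)\<^sup>2 * \<phi> x)\<^sup>2\<bar> \<le> B" by blast
  have "integrable lborel (\<lambda>x. (a / (norm x)\<^sup>2 * \<phi> x)\<^sup>2)"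
    by (rule integrable_compact_support[OF _ K(1) B]) (use m K in auto)
  then show ?thesis using m by (simp add: L2_def)
qed

lemma Lop_inner:
  assumes "\<phi> \<in> test_functions (- {0})" "\<psi> \<in> test_functions (- {0})"
  shows "L2_inner (Lop a \<phi>) \<psi> = (\<Sum>i\<in>UNIV. L2_inner (partial i \<phi>) (partial i \<psi>)) + (\<integral>x. a / (norm x)\<^sup>2 * \<phi> x * \<psi> x \<partial>lborel)"
proof -
  have m: "(\<lambda>x. - laplacian \<phi> x) \<in> L2" using L2_cmult[OF laplacian_test(2)[OF assms(1)], of "-1"] by simp
  have "L2_inner (Lop a \<phi>) \<psi> = L2_inner (\<lambda>x. - laplacian \<phi> x) \<psi> + L2_inner (\<lambda>x. a / (norm x)\<^sup>2 * \<phi> x) \<psi>"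
    unfolding Lop_def[abs_def] by (intro L2_inner_add_left m potential_bounded_support test_function_L2[OF assms(2)] assms)
  moreover have "L2_inner (\<lambda>x. - laplacian \<phi> x) \<psi> = - L2_inner (laplacian \<phi>) \<psi>" by (simp add: L2_inner_def)
  ultimately show ?thesis
    using L2_inner_laplacian[OF assms[THEN test_functions_mono]] by (simp add: L2_inner_def)
qed

lemma Lop_form:
  assumes a: "a \<ge> 0"
  shows "nonneg_form (test_functions (- {0})) (Lop a)"
proof
  fix \<phi> assume \<phi>: "\<phi> \<in> test_functions (- {0})"
  show "\<phi> \<in> L2" by (rule test_function_L2[OF \<phi>])
  show "(\<lambda>x. c * \<phi> x) \<in> test_functions (- {0})" for c by (rule test_functions_cmult[OF \<phi>])
  show "Lop a (\<lambda>x. c * \<phi> x) = (\<lambda>x. c * Lop a \<phi> x)" for c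
    unfolding Lop_def[abs_def] laplacian_diff(2)[OF \<phi> \<phi>] by (simp add: algebra_simps)
  have m: "(\<lambda>x. - laplacian \<phi> x) \<in> L2" using L2_cmult[OF laplacian_test(2)[OF \<phi>], of "-1"] by simp
  show "Lop a \<phi> \<in> L2" unfolding Lop_def[abs_def] by (intro L2_add m potential_bounded_support \<phi>)
  have "0 \<le> (\<integral>x. a / (norm x)\<^sup>2 * \<phi> x * \<phi> x \<partial>lborel)"
    using a by (intro integral_nonneg_AE always_eventually allI) (simp add: mult.assoc)
  then show "0 \<le> L2_inner (Lop a \<phi>) \<phi>"
    unfolding Lop_inner[OF \<phi> \<phi>] by (intro add_nonneg_nonneg sum_nonneg L2_inner_nonneg)
next
  fix \<phi> \<psi> assume p: "\<phi> \<in> test_functions (- {0})" "\<psi> \<in> test_functions (- {0})"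
  show "(\<lambda>x. \<phi> x - \<psi> x) \<in> test_functions (- {0})" by (rule test_functions_diff[OF p])
  show "Lop a (\<lambda>x. \<phi> x - \<psi> x) = (\<lambda>x. Lop a \<phi> x - Lop a \<psi> x)"
    unfolding Lop_def[abs_def] laplacian_diff(1)[OF p] by (simp add: algebra_simps diff_divide_distrib)
  show "L2_inner (Lop a \<phi>) \<psi> = L2_inner (Lop a \<psi>) \<phi>"
    unfolding Lop_inner[OF p] Lop_inner[OF p(2,1)] using L2_inner_commute[of "partial _ \<phi>" "partial _ \<psi>"]
    by (simp add: mult_ac)
qed

lemma H_a_Lop: "H_a a = friedrichs (test_functions (- {0})) (Lop a)"
  unfolding H_a_def Lop_def[abs_def] by simp

lemma potential_le_form:
  assumes \<phi>: "\<phi> \<in> test_functions (- {0})"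
  shows "integrable lborel (\<lambda>x. (\<phi> x)\<^sup>2 / (norm x)\<^sup>2)"
    "a * (\<integral>x. (\<phi> x)\<^sup>2 / (norm x)\<^sup>2 \<partial>lborel) \<le> L2_inner (Lop a \<phi>) \<phi>"
proof -
  have "integrable lborel (\<lambda>x. (1 / (norm x)\<^sup>2 * \<phi> x) * \<phi> x)"
    by (intro L2_mult_integrable potential_bounded_support test_function_L2[OF \<phi>] \<phi>)
  then show "integrable lborel (\<lambda>x. (\<phi> x)\<^sup>2 / (norm x)\<^sup>2)" by (simp add: power2_eq_square)
  have "(\<integral>x. a / (norm x)\<^sup>2 * \<phi> x * \<phi> x \<partial>lborel) = (\<integral>x. a * ((\<phi> x)\<^sup>2 / (norm x)\<^sup>2) \<partial>lborel)"
    by (simp add: power2_eq_square mult.assoc)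
  also have "\<dots> = a * (\<integral>x. (\<phi> x)\<^sup>2 / (norm x)\<^sup>2 \<partial>lborel)" by (rule integral_mult_right_zero)
  finally show "a * (\<integral>x. (\<phi> x)\<^sup>2 / (norm x)\<^sup>2 \<partial>lborel) \<le> L2_inner (Lop a \<phi>) \<phi>"
    unfolding Lop_inner[OF \<phi> \<phi>] using sum_nonneg[of UNIV "\<lambda>i. L2_inner (partial i \<phi>) (partial i \<phi>)"] L2_inner_nonneg by simp
qed

text \<open>For a > 0 the potential energy is bounded by the form, hence along the approximating
  sequence. Where 1/|x|^2 is bounded, L^2 convergence carries the bound over to Q; monotone
  convergence then removes the restriction.\<close>

lemma form_domain_hardy:
  assumes a: "a > 0" and Q: "Q \<in> form_domain (test_functions (- {0})) (Lop a)"
  shows "integrable lborel (\<lambda>x. (Q x)\<^sup>2 / (norm x)\<^sup>2)"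
proof -
  interpret nonneg_form "test_functions (- {0})" "Lop a" by (rule Lop_form) (use a in simp)
  obtain \<phi> where ap: "form_approx (test_functions (- {0})) (Lop a) \<phi> Q" using Q by (auto simp: form_domain_def)
  note f = form_approxD[OF ap]
  obtain K N where K: "K > 0" "\<And>n. n \<ge> N \<Longrightarrow> q (\<phi> n) (\<phi> n) \<le> K" using form_approx_bounded[OF ap] by blast
  define S where "S = (\<lambda>k. {x::R3. norm x > 1 / real (Suc k)})"
  have mQ: "Q \<in> borel_measurable borel" by (rule L2_measurable[OF f(1)])
  have mS: "S k \<in> sets borel" for k unfolding S_def by measurable
  have inv: "indicator (S k) x / (norm x)\<^sup>2 \<le> (real (Suc k))\<^sup>2" for k and x :: R3
  proof (cases "x \<in> S k")
    case True
    then have n: "norm x > 1 / real (Suc k)" by (simp add: S_def)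
    have "1 / (norm x)\<^sup>2 \<le> 1 / (1 / real (Suc k))\<^sup>2"
      using n by (intro divide_left_mono power_mono mult_pos_pos zero_less_power) (auto intro: less_trans[of 0 "1 / real (Suc k)"])
    then show ?thesis using True by (simp add: power_divide)
  qed simp
  have iS: "integrable lborel (\<lambda>x. indicator (S k) x * ((u x)\<^sup>2 / (norm x)\<^sup>2))"
      "(\<integral>x. indicator (S k) x * ((u x)\<^sup>2 / (norm x)\<^sup>2) \<partial>lborel) \<le> (real (Suc k))\<^sup>2 * L2_inner u u" if u: "u \<in> L2" for u k
  proof -
    have le: "indicator (S k) x * ((u x)\<^sup>2 / (norm x)\<^sup>2) \<le> (real (Suc k))\<^sup>2 * (u x)\<^sup>2" for x
      using mult_right_mono[OF inv[of k x], of "(u x)\<^sup>2"] by (simp add: mult.commute)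
    show 1: "integrable lborel (\<lambda>x. indicator (S k) x * ((u x)\<^sup>2 / (norm x)\<^sup>2))"
    proof (rule Bochner_Integration.integrable_bound)
      show "integrable lborel (\<lambda>x. (real (Suc k))\<^sup>2 * (u x)\<^sup>2)" by (intro integrable_mult_right L2_sq_integrable u)
      show "(\<lambda>x. indicator (S k) x * ((u x)\<^sup>2 / (norm x)\<^sup>2)) \<in> borel_measurable lborel"
        using mS L2_measurable[OF u] by measurable
      show "AE x in lborel. norm (indicator (S k) x * ((u x)\<^sup>2 / (norm x)\<^sup>2)) \<le> norm ((real (Suc k))\<^sup>2 * (u x)\<^sup>2)"
        using le by (intro always_eventually allI) (simp add: abs_mult)
    qed
    have "(\<integral>x. indicator (S k) x * ((u x)\<^sup>2 / (norm x)\<^sup>2) \<partial>lborel) \<le> (\<integral>x. (real (Suc k))\<^sup>2 * (u x)\<^sup>2 \<partial>lborel)"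
      using 1 le by (intro integral_mono integrable_mult_right L2_sq_integrable u) auto
    then show "(\<integral>x. indicator (S k) x * ((u x)\<^sup>2 / (norm x)\<^sup>2) \<partial>lborel) \<le> (real (Suc k))\<^sup>2 * L2_inner u u"
      by (simp add: L2_inner_def power2_eq_square)
  qed
  define I where "I = (\<lambda>k. \<integral>x. indicator (S k) x * ((Q x)\<^sup>2 / (norm x)\<^sup>2) \<partial>lborel)"
  \<comment> \<open>The index n is chosen after k: the L^2 error has to beat (k + 1)^2, the size of
    the weight on \<open>S k\<close>. The resulting bound does not depend on k.\<close>
  have Ib: "I k \<le> 2 * K / a + 2" for k
  proof -
    have "eventually (\<lambda>n. dist (L2_inner (\<lambda>x. \<phi> n x - Q x) (\<lambda>x. \<phi> n x - Q x)) 0 < 1 / (real (Suc k))\<^sup>2) sequentially"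
      using f(3) unfolding L2_tendsto_def by (intro tendstoD) auto
    then have "eventually (\<lambda>n. dist (L2_inner (\<lambda>x. \<phi> n x - Q x) (\<lambda>x. \<phi> n x - Q x)) 0 < 1 / (real (Suc k))\<^sup>2 \<and> n \<ge> N) sequentially"
      by (intro eventually_conj eventually_ge_at_top)
    then obtain n where n: "dist (L2_inner (\<lambda>x. \<phi> n x - Q x) (\<lambda>x. \<phi> n x - Q x)) 0 < 1 / (real (Suc k))\<^sup>2" "n \<ge> N"
      using eventually_happens'[OF trivial_limit_sequentially] by blast
    define d where "d = (\<lambda>x. \<phi> n x - Q x)"
    have d: "d \<in> L2" unfolding d_def by (intro L2_diff D_L2 f)
    have pl: "integrable lborel (\<lambda>x. (\<phi> n x)\<^sup>2 / (norm x)\<^sup>2)" by (rule potential_le_form[OF f(2)])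
    have "I k \<le> (\<integral>x. 2 * ((\<phi> n x)\<^sup>2 / (norm x)\<^sup>2) + 2 * (indicator (S k) x * ((d x)\<^sup>2 / (norm x)\<^sup>2)) \<partial>lborel)"
      unfolding I_def
    proof (rule integral_mono)
      fix x
      have "(Q x)\<^sup>2 \<le> 2 * (\<phi> n x)\<^sup>2 + 2 * (d x)\<^sup>2"
        using zero_le_power2[of "2 * \<phi> n x - Q x"] by (simp add: d_def power2_eq_square algebra_simps)
      then have "(Q x)\<^sup>2 / (norm x)\<^sup>2 \<le> (2 * (\<phi> n x)\<^sup>2 + 2 * (d x)\<^sup>2) / (norm x)\<^sup>2" by (rule divide_right_mono) simp
      then show "indicator (S k) x * ((Q x)\<^sup>2 / (norm x)\<^sup>2) \<le> 2 * ((\<phi> n x)\<^sup>2 / (norm x)\<^sup>2) + 2 * (indicator (S k) x * ((d x)\<^sup>2 / (norm x)\<^sup>2))"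
        by (cases "x \<in> S k") (auto simp: add_divide_distrib)
    qed (intro iS f d pl Bochner_Integration.integrable_add integrable_mult_right)+
    also have "\<dots> = 2 * (\<integral>x. (\<phi> n x)\<^sup>2 / (norm x)\<^sup>2 \<partial>lborel) + 2 * (\<integral>x. indicator (S k) x * ((d x)\<^sup>2 / (norm x)\<^sup>2) \<partial>lborel)"
      by (simp only: integral_mult_right_zero
          Bochner_Integration.integral_add[OF integrable_mult_right[OF pl] integrable_mult_right[OF iS(1)[OF d]]])
    also have "\<dots> \<le> 2 * (K / a) + 2 * 1"
    proof (intro add_mono mult_left_mono)
      have "a * (\<integral>x. (\<phi> n x)\<^sup>2 / (norm x)\<^sup>2 \<partial>lborel) \<le> K" using potential_le_form(2)[OF f(2)[of n], of a] K(2)[OF n(2)] by simp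
      then show "(\<integral>x. (\<phi> n x)\<^sup>2 / (norm x)\<^sup>2 \<partial>lborel) \<le> K / a" using a by (simp add: le_divide_eq mult.commute)
      have "(\<integral>x. indicator (S k) x * ((d x)\<^sup>2 / (norm x)\<^sup>2) \<partial>lborel) \<le> (real (Suc k))\<^sup>2 * L2_inner d d" by (rule iS(2)[OF d])
      also have "\<dots> \<le> (real (Suc k))\<^sup>2 * (1 / (real (Suc k))\<^sup>2)"
        using n(1) by (intro mult_left_mono) (auto simp: d_def)
      finally show "(\<integral>x. indicator (S k) x * ((d x)\<^sup>2 / (norm x)\<^sup>2) \<partial>lborel) \<le> 1" by simp
    qed auto
    finally show ?thesis by simp
  qed
  have inc: "indicator (S k) x * ((Q x)\<^sup>2 / (norm x)\<^sup>2) \<le> indicator (S l) x * ((Q x)\<^sup>2 / (norm x)\<^sup>2)" if "k \<le> l" for k l x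
  proof -
    have "1 / real (Suc l) \<le> 1 / real (Suc k)" using that by (intro divide_left_mono) auto
    then have "S k \<subseteq> S l" by (auto simp: S_def)
    then show ?thesis by (intro mult_right_mono) (auto simp: indicator_def)
  qed
  have "incseq I" unfolding incseq_def I_def
    using inc by (intro allI impI integral_mono iS f) auto
  then obtain z where z: "I \<longlonglongrightarrow> z" using incseq_convergent[of I] Ib by blast
  show ?thesis
  proof (rule integrable_monotone_convergence[OF iS(1)[OF f(1)]])
    show "AE x in lborel. mono (\<lambda>k. indicator (S k) x * ((Q x)\<^sup>2 / (norm x)\<^sup>2))"
      using inc by (intro always_eventually allI monoI) auto
    show "AE x in lborel. (\<lambda>k. indicator (S k) x * ((Q x)\<^sup>2 / (norm x)\<^sup>2)) \<longlonglongrightarrow> (Q x)\<^sup>2 / (norm x)\<^sup>2"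
    proof (intro always_eventually allI)
      fix x
      show "(\<lambda>k. indicator (S k) x * ((Q x)\<^sup>2 / (norm x)\<^sup>2)) \<longlonglongrightarrow> (Q x)\<^sup>2 / (norm x)\<^sup>2"
      proof (cases "x = 0")
        case False
        then obtain n where "1 / real (Suc n) < norm x" using reals_Archimedean[of "norm x"] by (auto simp: inverse_eq_divide)
        then have "x \<in> S k" if "k \<ge> n" for k
        proof -
          have "1 / real (Suc k) \<le> 1 / real (Suc n)" using that by (intro divide_left_mono) auto
          then show ?thesis using \<open>1 / real (Suc n) < norm x\<close> by (simp add: S_def)
        qed
        then have "eventually (\<lambda>k. indicator (S k) x * ((Q x)\<^sup>2 / (norm x)\<^sup>2) = (Q x)\<^sup>2 / (norm x)\<^sup>2) sequentially"
          unfolding eventually_sequentially by (intro exI[of _ n]) auto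
        then show ?thesis by (rule tendsto_eventually)
      qed simp
    qed
    show "(\<lambda>k. \<integral>x. indicator (S k) x * ((Q x)\<^sup>2 / (norm x)\<^sup>2) \<partial>lborel) \<longlonglongrightarrow> z" using z by (simp add: I_def)
    show "(\<lambda>x. (Q x)\<^sup>2 / (norm x)\<^sup>2) \<in> borel_measurable lborel" using mQ by measurable
  qed
qed

section \<open>Radial integration\<close>

definition radial_measure :: "real measure" where
  "radial_measure = density lborel (\<lambda>r. ennreal (indicator {0<..} r * (4 * pi * r\<^sup>2)))"

lemma content_ball_R3: "r \<ge> 0 \<Longrightarrow> emeasure lborel (cball (0::R3) r) = ennreal (4/3 * pi * r^3)"
proof -
  assume r: "r \<ge> 0"
  have "emeasure lborel (cball (0::R3) r) = ennreal (unit_ball_vol 3 * r^3)"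
    using emeasure_cball[OF r, of "0::R3"] by simp
  then show ?thesis unfolding unit_ball_vol_3 .
qed

lemma emeasure_radial_measure_Icc:
  assumes "r \<ge> 0"
  shows "emeasure radial_measure {..r} = ennreal (4/3 * pi * r^3)"
proof -
  have "emeasure radial_measure {..r} = (\<integral>\<^sup>+x. ennreal (indicator {0<..} x * (4 * pi * x\<^sup>2)) * indicator {..r} x \<partial>lborel)"
    unfolding radial_measure_def by (subst emeasure_density) auto
  also have "\<dots> = (\<integral>\<^sup>+x. ennreal (4 * pi * x\<^sup>2) * indicator {0..r} x \<partial>lborel)"
    by (intro nn_integral_cong) (auto simp: indicator_def)
  also have "\<dots> = ennreal (4/3 * pi * r^3 - 4/3 * pi * 0^3)"
    by (rule nn_integral_FTC_Icc[where F = "\<lambda>x. 4/3 * pi * x^3"]) (use assms in \<open>auto intro!: derivative_eq_intros\<close>)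
  finally show ?thesis by simp
qed

text \<open>Polar coordinates for radial functions: on the half-lines {..r}, which generate the
  Borel sets, both measures give the volume of a ball.\<close>

lemma distr_norm: "distr (lborel :: R3 measure) borel norm = radial_measure"
proof (rule measure_eqI_generator_eq[where E = "range (\<lambda>r::real. {..r})" and \<Omega> = UNIV and A = "\<lambda>n. {..real n}"])
  show "Int_stable (range (\<lambda>r::real. {..r}))"
    by (auto simp: Int_stable_def intro!: exI[of _ "min _ _"])
  have s: "sets borel = sigma_sets UNIV (range (\<lambda>r::real. {..r}))"
    unfolding borel_eq_atMost[where 'a = real] by (rule sets_measure_of) simp
  show "sets (distr (lborel :: R3 measure) borel norm) = sigma_sets UNIV (range (\<lambda>r::real. {..r}))" using s by simp
  show "sets radial_measure = sigma_sets UNIV (range (\<lambda>r::real. {..r}))" using s by (simp add: radial_measure_def)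
  show "(\<Union>n. {..real n}) = UNIV" using real_arch_simple by auto
  have e: "emeasure (distr (lborel :: R3 measure) borel norm) {..r} = emeasure (lborel :: R3 measure) {x. norm x \<le> r}" for r :: real
    by (subst emeasure_distr) (auto intro!: arg_cong[where f = "emeasure lborel"])
  show "emeasure (distr (lborel :: R3 measure) borel norm) {..real n} \<noteq> \<infinity>" for n
  proof -
    have "{x::R3. norm x \<le> real n} = cball 0 (real n)" by auto
    then show ?thesis unfolding e by (simp add: content_ball_R3)
  qed
  fix X assume "X \<in> range (\<lambda>r::real. {..r})"
  then obtain r where X: "X = {..r}" by auto
  show "emeasure (distr (lborel :: R3 measure) borel norm) X = emeasure radial_measure X"
  proof (cases "r \<ge> 0")
    case True
    have "{x::R3. norm x \<le> r} = cball 0 r" by auto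
    then show ?thesis unfolding X e using True by (simp add: content_ball_R3 emeasure_radial_measure_Icc)
  next
    case False
    then have n: "{x::R3. norm x \<le> r} = {}" by (auto simp: not_le intro: less_le_trans)
    have "emeasure radial_measure {..r} \<le> emeasure radial_measure {..0}"
      using False by (intro emeasure_mono) (auto simp: radial_measure_def)
    then have "emeasure radial_measure {..r} = 0" using emeasure_radial_measure_Icc[of 0] by simp
    then show ?thesis unfolding X e n by simp
  qed
qed auto

lemma integrable_radial_iff:
  fixes h :: "real \<Rightarrow> real"
  assumes "h \<in> borel_measurable borel"
  shows "integrable (lborel :: R3 measure) (\<lambda>x. h (norm x)) \<longleftrightarrow> integrable lborel (\<lambda>r. indicator {0<..} r * (r\<^sup>2 * h r))"
proof -
  have "integrable (lborel :: R3 measure) (\<lambda>x. h (norm x)) \<longleftrightarrow> integrable radial_measure h"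
    unfolding distr_norm[symmetric] by (rule integrable_distr_eq[symmetric]) (use assms in auto)
  also have "\<dots> \<longleftrightarrow> integrable lborel (\<lambda>r. (indicator {0<..} r * (4 * pi * r\<^sup>2)) *\<^sub>R h r)"
    unfolding radial_measure_def
    by (rule integrable_density) (use assms in auto)
  also have "(\<lambda>r. (indicator {0<..} r * (4 * pi * r\<^sup>2)) *\<^sub>R h r) = (\<lambda>r. (4 * pi) * (indicator {0<..} r * (r\<^sup>2 * h r)))"
    by (auto simp: mult_ac)
  also have "integrable lborel \<dots> \<longleftrightarrow> integrable lborel (\<lambda>r. indicator {0<..} r * (r\<^sup>2 * h r))"
    by (simp only: integrable_mult_left_iff) auto
  finally show ?thesis .
qed

lemma integral_radial:
  fixes h :: "real \<Rightarrow> real"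
  assumes "h \<in> borel_measurable borel"
  shows "(\<integral>x. h (norm x) \<partial>(lborel :: R3 measure)) = 4 * pi * (\<integral>r. indicator {0<..} r * (r\<^sup>2 * h r) \<partial>lborel)"
proof -
  have "(\<integral>x. h (norm x) \<partial>(lborel :: R3 measure)) = (\<integral>r. h r \<partial>radial_measure)"
    unfolding distr_norm[symmetric] by (rule integral_distr[symmetric]) (use assms in auto)
  also have "\<dots> = (\<integral>r. (indicator {0<..} r * (4 * pi * r\<^sup>2)) *\<^sub>R h r \<partial>lborel)"
    unfolding radial_measure_def by (rule integral_density) (use assms in auto)
  also have "(\<lambda>r. (indicator {0<..} r * (4 * pi * r\<^sup>2)) *\<^sub>R h r) = (\<lambda>r. (4 * pi) * (indicator {0<..} r * (r\<^sup>2 * h r)))"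
    by (auto simp: mult_ac)
  finally show ?thesis by simp
qed

lemma AE_radial_iff:
  assumes "{r. P r} \<in> sets borel"
  shows "(AE x in (lborel :: R3 measure). P (norm x)) \<longleftrightarrow> (AE r in lborel. r > 0 \<longrightarrow> P r)"
proof -
  have "(AE x in (lborel :: R3 measure). P (norm x)) \<longleftrightarrow> (AE r in distr (lborel :: R3 measure) borel norm. P r)"
    by (rule AE_distr_iff[symmetric]) (use assms in auto)
  also have "\<dots> \<longleftrightarrow> (AE r in lborel. r > 0 \<longrightarrow> P r)"
    unfolding distr_norm radial_measure_def
    by (subst AE_density) (auto intro!: AE_cong simp: indicator_def)
  finally show ?thesis .
qed

text \<open>The radial part of a radial function may be non-measurable; restricting the function itself
  to almost any ray through the origin gives a Borel representative.\<close>

lemma radial_measurable: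
  assumes u: "u \<in> borel_measurable borel" and rad: "radial u"
  obtains f where "f \<in> borel_measurable borel" "AE x in lborel. u x = f (norm x)"
proof -
  obtain f0 :: "real \<Rightarrow> real" where f0: "AE x in lborel. u x = f0 (norm x)" using rad by (auto simp: radial_def)
  obtain N where N: "N \<in> null_sets (lborel :: R3 measure)" "{x. u x \<noteq> f0 (norm x)} \<subseteq> N"
    using f0 by (auto simp: eventually_ae_filter)
  have Nm: "N \<in> sets borel" using N(1) by auto
  have AN: "AE x in (lborel :: R3 measure). x \<notin> N" by (rule AE_not_in[OF N(1)])
  \<comment> \<open>Dilations preserve null sets.\<close>
  have sc: "AE x in (lborel :: R3 measure). t *\<^sub>R x \<notin> N" if t: "t \<noteq> 0" for t :: real
  proof -
    have "lborel = density (distr (lborel :: R3 measure) borel (\<lambda>x. 0 + t *\<^sub>R x)) (\<lambda>_. \<bar>t\<bar> ^ DIM(R3))"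
      by (rule lborel_affine[OF t])
    then have "AE x in density (distr (lborel :: R3 measure) borel (\<lambda>x. 0 + t *\<^sub>R x)) (\<lambda>_. \<bar>t\<bar> ^ DIM(R3)). x \<notin> N"
      using AN by (rule subst)
    then have "AE x in distr (lborel :: R3 measure) borel (\<lambda>x. 0 + t *\<^sub>R x). x \<notin> N"
      by (subst (asm) AE_density) (use t in auto)
    moreover have "{x. x \<notin> N} \<in> sets borel" using borel_comp[OF Nm] by (simp add: Compl_eq)
    ultimately show ?thesis by (subst (asm) AE_distr_iff) auto
  qed
  have mm: "{p :: real \<times> R3. fst p *\<^sub>R snd p \<notin> N} \<in> sets (lborel \<Otimes>\<^sub>M lborel)"
  proof -
    have "(\<lambda>p :: real \<times> R3. fst p *\<^sub>R snd p) \<in> borel_measurable (borel \<Otimes>\<^sub>M borel)" by measurable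
    then have "(\<lambda>p :: real \<times> R3. fst p *\<^sub>R snd p) -` (- N) \<inter> space (borel \<Otimes>\<^sub>M borel) \<in> sets (borel \<Otimes>\<^sub>M borel)"
      by (rule measurable_sets) (use Nm in auto)
    moreover have "sets (lborel \<Otimes>\<^sub>M lborel :: (real \<times> R3) measure) = sets (borel \<Otimes>\<^sub>M borel)"
      by (intro sets_pair_measure_cong) auto
    ultimately show ?thesis by (simp add: vimage_def space_pair_measure)
  qed
  have "AE t in (lborel :: real measure). AE x in (lborel :: R3 measure). t *\<^sub>R x \<notin> N"
  proof -
    have "AE t in (lborel :: real measure). t \<noteq> 0" by (rule AE_lborel_singleton)
    then show ?thesis by eventually_elim (rule sc)
  qed
  then have "AE p in (lborel \<Otimes>\<^sub>M lborel :: (real \<times> R3) measure). fst p *\<^sub>R snd p \<notin> N"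
    by (intro lborel_pair.AE_pair_measure) (use mm in \<open>auto simp: space_pair_measure pred_def\<close>)
  \<comment> \<open>By Fubini the quantifiers may be exchanged: for almost every x the line through
    x meets N only for a null set of factors t.\<close>
  then have sw: "AE x in (lborel :: R3 measure). AE t in (lborel :: real measure). t *\<^sub>R x \<notin> N"
    using lborel_pair.AE_commute[of "\<lambda>t x. t *\<^sub>R x \<notin> N"] mm lborel_pair.AE_pair[of "\<lambda>p. fst p *\<^sub>R snd p \<notin> N"]
    by (auto simp: space_pair_measure)
  have "AE x in (lborel :: R3 measure). x \<noteq> 0" by (rule AE_lborel_singleton)
  with sw have "AE x in (lborel :: R3 measure). x \<noteq> 0 \<and> (AE t in (lborel :: real measure). t *\<^sub>R x \<notin> N)" by eventually_elim auto
  then obtain x where x: "x \<noteq> 0" "AE t in (lborel :: real measure). t *\<^sub>R x \<notin> N"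
  proof -
    assume A: "AE x in (lborel :: R3 measure). x \<noteq> 0 \<and> (AE t in (lborel :: real measure). t *\<^sub>R x \<notin> N)"
    have "ae_filter (lborel :: R3 measure) \<noteq> bot" by (simp add: ae_filter_eq_bot_iff)
    from eventually_happens'[OF this A] show thesis using that by blast
  qed
  define f where "f = (\<lambda>r. u ((r / norm x) *\<^sub>R x))"
  have fm: "f \<in> borel_measurable borel" unfolding f_def using u by measurable
  have "AE t in (lborel :: real measure). (t / norm x) *\<^sub>R x \<notin> N"
  proof -
    have "lborel = density (distr (lborel :: real measure) borel (\<lambda>t. 0 + (1 / norm x) * t)) (\<lambda>_. \<bar>1 / norm x\<bar>)"
      using x by (intro lborel_real_affine) auto
    then have "AE t in density (distr (lborel :: real measure) borel (\<lambda>t. 0 + (1 / norm x) * t)) (\<lambda>_. \<bar>1 / norm x\<bar>). t *\<^sub>R x \<notin> N"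
      using x(2) by (rule subst)
    moreover have p: "{t :: real. t *\<^sub>R x \<notin> N} \<in> sets borel"
    proof -
      have "(\<lambda>t :: real. t *\<^sub>R x) -` (- N) \<inter> space borel \<in> sets borel"
        by (rule measurable_sets[where A = borel]) (use Nm in auto)
      then show ?thesis by (simp add: vimage_def)
    qed
    ultimately have "AE t in distr (lborel :: real measure) borel (\<lambda>t. 0 + (1 / norm x) * t). t *\<^sub>R x \<notin> N"
      by (subst (asm) AE_density) (use x in auto)
    then show ?thesis by (subst (asm) AE_distr_iff) (use p in auto)
  qed
  then have "AE t in (lborel :: real measure). t > 0 \<longrightarrow> f t = f0 t"
  proof eventually_elim
    case (elim t)
    show ?case
    proof
      assume t: "t > 0"
      have "u ((t / norm x) *\<^sub>R x) = f0 (norm ((t / norm x) *\<^sub>R x))" using elim N(2) by blast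
      then show "f t = f0 t" using t x by (simp add: f_def)
    qed
  qed
  then obtain M where M: "M \<in> null_sets (lborel :: real measure)" "{t. \<not> (t > 0 \<longrightarrow> f t = f0 t)} \<subseteq> M"
    by (auto simp: eventually_ae_filter)
  have "AE t in (lborel :: real measure). t > 0 \<longrightarrow> t \<notin> M" using AE_not_in[OF M(1)] by eventually_elim auto
  moreover have "{t. t \<notin> M} \<in> sets borel" using M(1) by (auto simp: Collect_neg_eq)
  ultimately have "AE y in (lborel :: R3 measure). norm y \<notin> M" by (subst AE_radial_iff) auto
  moreover have "AE x in (lborel :: R3 measure). x \<noteq> 0" by (rule AE_lborel_singleton)
  ultimately have "AE y in lborel. u y = f (norm y)" using f0
  proof eventually_elim
    case (elim y)
    then have "norm y > 0" by simp
    then have "f (norm y) = f0 (norm y)" using elim(1) M(2) by blast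
    then show ?case using elim by simp
  qed
  then show thesis using fm that by blast
qed

section \<open>The profile yields a solution\<close>

lemma exp_tail_integrable:
  fixes c :: real
  assumes c: "c > 0"
  shows "integrable lborel (\<lambda>r. indicator {0<..} r * exp (- c * r))"
proof (rule integrableI_nn_integral_finite)
  have lim: "((\<lambda>r. - exp (- c * r) / c) \<longlongrightarrow> 0) at_top" using c by real_asymp
  have "(\<integral>\<^sup>+ r. ennreal (indicator {0<..} r * exp (- c * r)) \<partial>lborel) \<le> (\<integral>\<^sup>+ r. ennreal (exp (- c * r)) * indicator {0..} r \<partial>lborel)"
    by (intro nn_integral_mono) (auto simp: indicator_def)
  also have "\<dots> = ennreal (0 - (- exp (- c * 0) / c))"
  proof (rule nn_integral_FTC_atLeast[OF _ _ _ lim])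
    fix x :: real
    show "((\<lambda>r. - exp (- c * r) / c) has_real_derivative exp (- c * x)) (at x)"
      using c by (auto intro!: derivative_eq_intros)
  qed auto
  finally have le: "(\<integral>\<^sup>+ r. ennreal (indicator {0<..} r * exp (- c * r)) \<partial>lborel) \<le> ennreal (1 / c)" by simp
  define v where "v = enn2real (\<integral>\<^sup>+ r. ennreal (indicator {0<..} r * exp (- c * r)) \<partial>lborel)"
  show "(\<integral>\<^sup>+ r. ennreal (indicator {0<..} r * exp (- c * r)) \<partial>lborel) = ennreal v"
    unfolding v_def using le by (subst ennreal_enn2real) (auto simp: top.not_eq_extremum intro: le_less_trans)
qed auto

lemma exp_ge_square: "r\<^sup>2 * exp (- r) \<le> 16 * exp (- (1/2) * r)" if "r \<ge> 0" for r :: real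
proof -
  have "r / 4 \<le> exp (r / 4)" using exp_ge_add_one_self[of "r/4"] by linarith
  then have "(r / 4)\<^sup>2 \<le> (exp (r / 4))\<^sup>2" using that by (intro power_mono) auto
  then have "r\<^sup>2 \<le> 16 * exp (r / 2)" by (simp add: power_divide exp_double[symmetric])
  then have "r\<^sup>2 * exp (- r) \<le> (16 * exp (r / 2)) * exp (- r)" by (intro mult_right_mono) auto
  also have "\<dots> = 16 * exp (- (1/2) * r)" by (simp add: mult.assoc exp_add[symmetric])
  finally show ?thesis .
qed

lemma indicator_continuous_measurable:
  fixes f :: "real \<Rightarrow> real"
  assumes "continuous_on {0<..} f"
  shows "(\<lambda>r. indicator {0<..} r * f r) \<in> borel_measurable borel"
  using borel_measurable_continuous_on_indicator[OF _ assms] by simp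

lemma integrable_cut:
  fixes f :: "real \<Rightarrow> real"
  assumes c: "continuous_on {0<..} f" and p: "0 < p" and z: "\<And>r. \<lbrakk>r > 0; r \<notin> {p..q}\<rbrakk> \<Longrightarrow> f r = 0"
  shows "integrable lborel (\<lambda>r. indicator {0<..} r * f r)"
proof -
  have "continuous_on {p..q} f" by (rule continuous_on_subset[OF c]) (use p in auto)
  then have "set_integrable lborel {p..q} f" by (rule borel_integrable_atLeastAtMost')
  moreover have "indicator {p..q} r *\<^sub>R f r = indicator {0<..} r * f r" for r
    using p z[of r] by (auto simp: indicator_def)
  ultimately show ?thesis unfolding set_integrable_def by (simp only:)
qed

section \<open>Smooth cutoffs in the radius\<close>

definition dsstep :: "real \<Rightarrow> real" where "dsstep = deriv sstep"
definition ddsstep :: "real \<Rightarrow> real" where "ddsstep = deriv dsstep"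

lemma sstep_derivs:
  "(sstep has_real_derivative dsstep x) (at x)" "(dsstep has_real_derivative ddsstep x) (at x)" "diffable k UNIV dsstep"
proof -
  obtain f' where f': "\<forall>x\<in>UNIV. (sstep has_real_derivative f' x) (at x)"
    using diffable_sstep[of "Suc 0"] by auto
  then have "dsstep = f'" unfolding dsstep_def by (intro ext) (auto intro: DERIV_imp_deriv)
  then show 1: "(sstep has_real_derivative dsstep x) (at x)" for x using f' by auto
  show 2: "diffable k UNIV dsstep" for k by (rule diffable_deriv[OF _ diffable_sstep]) (use 1 in auto)
  obtain f2 where f2: "\<forall>x\<in>UNIV. (dsstep has_real_derivative f2 x) (at x)" using 2[of "Suc 0"] by auto
  then have "ddsstep = f2" unfolding ddsstep_def by (intro ext) (auto intro: DERIV_imp_deriv)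
  then show "(dsstep has_real_derivative ddsstep x) (at x)" using f2 by auto
qed

lemma dsstep_0: "x < 0 \<or> x > 1 \<Longrightarrow> dsstep x = 0"
proof -
  assume x: "x < 0 \<or> x > 1"
  have "(sstep has_real_derivative 0) (at x)"
  proof (cases "x < 0")
    case True
    show ?thesis
      by (rule has_field_derivative_transform_within_open[of "\<lambda>_. 0" _ _ "{..<0}"]) (use True in \<open>auto simp: sstep_0\<close>)
  next
    case False
    show ?thesis
      by (rule has_field_derivative_transform_within_open[of "\<lambda>_. 1" _ _ "{1<..}"]) (use False x in \<open>auto simp: sstep_1\<close>)
  qed
  from DERIV_unique[OF sstep_derivs(1) this] show ?thesis .
qed

lemma dsstep_bounded: obtains S where "S > 0" "\<And>x. \<bar>dsstep x\<bar> \<le> S"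
proof -
  have "continuous_on {0..1} dsstep" using diffable_imp_continuous[OF sstep_derivs(3)[of 0]] by (rule continuous_on_subset) auto
  then have "bounded (dsstep ` {0..1})" by (intro compact_imp_bounded compact_continuous_image) auto
  then obtain B where B: "\<forall>y\<in>dsstep ` {0..1}. \<bar>y\<bar> \<le> B" unfolding bounded_iff real_norm_def by blast
  have "\<bar>dsstep x\<bar> \<le> max B 1" for x
  proof (cases "x < 0 \<or> x > 1")
    case True
    then show ?thesis by (simp add: dsstep_0)
  next
    case False
    then have "\<bar>dsstep x\<bar> \<le> B" using B by auto
    then show ?thesis by simp
  qed
  then show thesis by (intro that[of "max B 1"]) auto
qed

definition cut :: "nat \<Rightarrow> real \<Rightarrow> real" where
  "cut n r = sstep (real (Suc n) * r - 1) * sstep (real (Suc n) + 1 - r)"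
definition dcut :: "nat \<Rightarrow> real \<Rightarrow> real" where
  "dcut n r = real (Suc n) * dsstep (real (Suc n) * r - 1) * sstep (real (Suc n) + 1 - r)
     - sstep (real (Suc n) * r - 1) * dsstep (real (Suc n) + 1 - r)"
definition ddcut :: "nat \<Rightarrow> real \<Rightarrow> real" where "ddcut n = deriv (dcut n)"

lemma affine_compose_deriv:
  assumes "\<And>x. (f has_real_derivative f' x) (at x)"
  shows "((\<lambda>r. f (c * r - 1)) has_real_derivative c * f' (c * r - 1)) (at r)"
    "((\<lambda>r. f (c + 1 - r)) has_real_derivative - f' (c + 1 - r)) (at r)"
proof -
  have 1: "((\<lambda>r. c * r - 1) has_real_derivative c) (at r)" by (auto intro!: derivative_eq_intros)
  have 2: "((\<lambda>r. c + 1 - r) has_real_derivative -1) (at r)" by (auto intro!: derivative_eq_intros)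
  show "((\<lambda>r. f (c * r - 1)) has_real_derivative c * f' (c * r - 1)) (at r)"
    using DERIV_chain2[where f = f and g = "\<lambda>r. c * r - 1", OF assms 1] by (simp add: mult.commute)
  show "((\<lambda>r. f (c + 1 - r)) has_real_derivative - f' (c + 1 - r)) (at r)"
    using DERIV_chain2[where f = f and g = "\<lambda>r. c + 1 - r", OF assms 2] by simp
qed

lemma cut_deriv: "(cut n has_real_derivative dcut n r) (at r)"
  unfolding cut_def[abs_def] dcut_def
  by (rule DERIV_cong[OF DERIV_mult[OF affine_compose_deriv[OF sstep_derivs(1)]]]) simp

lemma diffable_affine: "diffable k UNIV f \<Longrightarrow> diffable k UNIV (\<lambda>r. f (c * r - 1))"
  "diffable k UNIV f \<Longrightarrow> diffable k UNIV (\<lambda>r. f (c + 1 - r))"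
  by (rule diffable_compose[where T = UNIV and f = f], assumption,
      intro diffable_diff diffable_cmult diffable_const diffable_id, simp)+

lemma diffable_cut: "diffable k UNIV (cut n)" "diffable k UNIV (dcut n)"
  unfolding cut_def[abs_def] dcut_def[abs_def]
  by (intro diffable_diff diffable_mult diffable_const diffable_affine diffable_sstep sstep_derivs)+

lemma dcut_deriv: "(dcut n has_real_derivative ddcut n r) (at r)"
proof -
  obtain f2 where f2: "\<forall>x\<in>UNIV. (dcut n has_real_derivative f2 x) (at x)" using diffable_cut(2)[of "Suc 0" n] by auto
  then have "ddcut n = f2" unfolding ddcut_def by (intro ext) (auto intro: DERIV_imp_deriv)
  then show ?thesis using f2 by auto
qed

lemma cut_0: "r \<notin> {1 / real (Suc n)..real (Suc n) + 1} \<Longrightarrow> cut n r = 0"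
proof -
  assume "r \<notin> {1 / real (Suc n)..real (Suc n) + 1}"
  then consider "r < 1 / real (Suc n)" | "r > real (Suc n) + 1" by force
  then show ?thesis
  proof cases
    case 1
    then have "real (Suc n) * r - 1 \<le> 0" by (simp add: less_divide_eq mult.commute)
    then show ?thesis by (simp only: cut_def sstep_0 mult_zero_left)
  next
    case 2
    then have "real (Suc n) + 1 - r \<le> 0" by simp
    then show ?thesis by (simp only: cut_def sstep_0 mult_zero_right)
  qed
qed

lemma cut_1: "\<lbrakk>2 / real (Suc n) \<le> r; r \<le> real (Suc n)\<rbrakk> \<Longrightarrow> cut n r = 1"
proof -
  assume "2 / real (Suc n) \<le> r" "r \<le> real (Suc n)"
  then have "real (Suc n) * r - 1 \<ge> 1" "real (Suc n) + 1 - r \<ge> 1" by (simp_all add: divide_le_eq mult.commute)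
  then show ?thesis by (simp only: cut_def sstep_1)
qed

lemma cut_range: "0 \<le> cut n r" "cut n r \<le> 1"
  unfolding cut_def using sstep_range by (auto intro: mult_le_one)

lemma cut_1_derivs: "\<lbrakk>2 / real (Suc n) < r; r < real (Suc n)\<rbrakk> \<Longrightarrow> dcut n r = 0" "\<lbrakk>2 / real (Suc n) < r; r < real (Suc n)\<rbrakk> \<Longrightarrow> ddcut n r = 0"
proof -
  show 1: "dcut n r = 0" if "2 / real (Suc n) < r" "r < real (Suc n)" for r
  proof -
    have "(cut n has_real_derivative 0) (at r)"
      by (rule has_field_derivative_transform_within_open[of "\<lambda>_. 1" _ _ "{2 / real (Suc n)<..<real (Suc n)}"])
         (use that cut_1[of n] in auto)
    then show ?thesis using DERIV_unique cut_deriv by blast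
  qed
  show "ddcut n r = 0" if "2 / real (Suc n) < r" "r < real (Suc n)"
  proof -
    have "(dcut n has_real_derivative 0) (at r)"
      by (rule has_field_derivative_transform_within_open[of "\<lambda>_. 0" _ _ "{2 / real (Suc n)<..<real (Suc n)}"])
         (use that 1 in auto)
    then show ?thesis using DERIV_unique dcut_deriv by blast
  qed
qed

text \<open>Uniform in n: the inner step has slope of order N = n + 1, but only where N r \<le> 2,
  so N \<le> 2/r there. The singularity 1/r is compensated later by the linear vanishing of
  u.\<close>

lemma dcut_bound:
  assumes S: "\<And>x. \<bar>dsstep x\<bar> \<le> S" and r: "r > 0"
  shows "\<bar>dcut n r\<bar> \<le> S * (2 / r + 1)"
proof -
  let ?N = "real (Suc n)"
  have S0: "S \<ge> 0" using S[of 0] by simp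
  have 1: "\<bar>?N * dsstep (?N * r - 1)\<bar> \<le> S * (2 / r)"
  proof (cases "?N * r - 1 > 1")
    case True
    then show ?thesis using dsstep_0[of "?N * r - 1"] S0 r by (simp del: of_nat_Suc)
  next
    case False
    then have "?N \<le> 2 / r" using r by (simp add: le_divide_eq)
    then have "\<bar>dsstep (?N * r - 1)\<bar> * ?N \<le> S * (2 / r)" using S S0 by (intro mult_mono) auto
    then show ?thesis by (simp add: abs_mult mult.commute)
  qed
  have s: "\<bar>sstep x\<bar> \<le> 1" for x using sstep_range[of x] by simp
  have "\<bar>?N * dsstep (?N * r - 1) * sstep (?N + 1 - r)\<bar> \<le> S * (2 / r) * 1"
    unfolding abs_mult[of "?N * dsstep (?N * r - 1)"] by (rule mult_mono[OF 1 s]) (use S0 r in auto)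
  moreover have "\<bar>sstep (?N * r - 1) * dsstep (?N + 1 - r)\<bar> \<le> 1 * S"
    unfolding abs_mult by (rule mult_mono[OF s S]) auto
  ultimately show ?thesis unfolding dcut_def distrib_left by linarith
qed

lemma eventually_cut_1:
  assumes "r > 0"
  shows "eventually (\<lambda>n. 2 / real (Suc n) < r \<and> r < real (Suc n)) sequentially"
proof -
  have "eventually (\<lambda>n. real (Suc n) > 2 / r) sequentially" "eventually (\<lambda>n. real (Suc n) > r) sequentially"
    using filterlim_compose[OF filterlim_real_sequentially filterlim_Suc] unfolding filterlim_at_top_dense by auto
  then show ?thesis
  proof eventually_elim
    case (elim n)
    then show ?case using assms by (simp add: divide_less_eq mult.commute)
  qed
qed

section \<open>The function on space built from a profile\<close>

locale ground_profile =
  fixes a :: real and u u' :: "real \<Rightarrow> real"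
  assumes a: "a > 0" and prof: "profile a u u'"
begin

lemma upos: "r > 0 \<Longrightarrow> u r > 0" and du: "r > 0 \<Longrightarrow> (u has_real_derivative u' r) (at r)"
  and du': "r > 0 \<Longrightarrow> (u' has_real_derivative ((1 + a/r\<^sup>2) * u r - (u r)^3/r\<^sup>2)) (at r)"
  using prof by (auto simp: profile_def)

lemma smooth: "diffable k {0<..} u \<and> diffable k {0<..} u'"
proof (induction k)
  case 0
  have "continuous_on {0<..} u" "continuous_on {0<..} u'"
    using du du' by (auto intro!: continuous_at_imp_continuous_on DERIV_isCont)
  then show ?case by simp
next
  case (Suc k)
  have "diffable k {0<..} (\<lambda>r. (1 + a/r\<^sup>2) * u r - (u r)^3/r\<^sup>2)"
    by (intro diffable_diff diffable_mult diffable_add diffable_divide diffable_power diffable_const diffable_id Suc[THEN conjunct1]) auto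
  then show ?case using Suc du du' by (auto intro!: diffable_SucI simp del: diffable.simps)
qed

lemma cont: "continuous_on {0<..} u" "continuous_on {0<..} u'"
  using smooth[of 0] by auto

text \<open>One majorant combines the linear vanishing at 0 with the decay at infinity; compactness
  handles the range between. The factor 2 in \<open>2 * C\<close> pays for exp(-r/2) \<ge> 1/2 on r
  \<le> 1.\<close>

lemma bounds: obtains M where "M > 0" "\<And>r. r > 0 \<Longrightarrow> u r \<le> M * r * exp (- r/2)" "\<And>r. r > 0 \<Longrightarrow> \<bar>u' r\<bar> \<le> M * exp (- r/2)"
proof -
  obtain C d where C: "C > 0" "d > 0" "\<And>r. \<lbrakk>0 < r; r < d\<rbrakk> \<Longrightarrow> 0 \<le> u' r \<and> u' r \<le> C \<and> u r \<le> C * r"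
    using profile_near_0[OF a prof] by metis
  obtain D R where D: "D > 0" "R > 0" "\<And>r. r \<ge> R \<Longrightarrow> u' r < 0 \<and> u r \<le> D * exp (-r/2) \<and> \<bar>u' r\<bar> \<le> D * exp (-r/2)"
    using profile_near_inf[OF a prof] by metis
  define T where "T = max R 1"
  define b where "b = min d 1"
  have bd: "\<exists>B. \<forall>r\<in>{b..T}. \<bar>f r\<bar> \<le> B" if "continuous_on {0<..} f" for f :: "real \<Rightarrow> real"
  proof -
    have "continuous_on {b..T} f" by (rule continuous_on_subset[OF that]) (use C in \<open>auto simp: b_def\<close>)
    then have "bounded (f ` {b..T})" by (intro compact_imp_bounded compact_continuous_image) auto
    then show ?thesis unfolding bounded_iff real_norm_def by blast
  qed
  obtain B1 where B1: "\<And>r. r \<in> {b..T} \<Longrightarrow> \<bar>u r / (r * exp (- r/2))\<bar> \<le> B1"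
    using bd[of "\<lambda>r. u r / (r * exp (- r/2))"] cont by (force intro!: continuous_intros)
  obtain B2 where B2: "\<And>r. r \<in> {b..T} \<Longrightarrow> \<bar>u' r / exp (- r/2)\<bar> \<le> B2"
    using bd[of "\<lambda>r. u' r / exp (- r/2)"] cont by (force intro!: continuous_intros)
  define M where "M = max (2 * C) (max D (max B1 B2))"
  have M: "2 * C \<le> M" "D \<le> M" "B1 \<le> M" "B2 \<le> M" by (auto simp: M_def)
  have M0: "M > 0" using M C by linarith
  have e: "1 \<le> 2 * exp (- r/2)" if "r \<le> 1" for r :: real
  proof -
    have "1 + (- r/2) \<le> exp (- r/2)" by (rule exp_ge_add_one_self)
    then show ?thesis using that by linarith
  qed
  have "u r \<le> M * r * exp (- r/2) \<and> \<bar>u' r\<bar> \<le> M * exp (- r/2)" if r: "r > 0" for r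
  proof -
    consider "r < b" | "r \<in> {b..T}" | "r > T" by force
    then show ?thesis
    proof cases
      case 1
      then have rr: "r < d" "r \<le> 1" by (auto simp: b_def)
      have 2: "C * 1 \<le> C * (2 * exp (- r/2))" using e[OF rr(2)] C by (intro mult_left_mono) auto
      also have "\<dots> \<le> M * exp (- r/2)" using M by (simp add: mult.assoc[symmetric] mult.commute)
      finally have 3: "C \<le> M * exp (- r/2)" by simp
      then have "C * r \<le> M * exp (- r/2) * r" using r by (intro mult_right_mono) auto
      then show ?thesis using C(3)[OF r rr(1)] 3 by (simp add: mult_ac)
    next
      case 2
      have "u r / (r * exp (- r/2)) \<le> M" using B1[OF 2] M by linarith
      moreover have "\<bar>u' r\<bar> / exp (- r/2) \<le> M" using B2[OF 2] M by (simp add: abs_divide)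
      ultimately show ?thesis using r by (simp add: divide_le_eq mult_ac)
    next
      case 3
      then have rr: "r \<ge> R" "r \<ge> 1" by (auto simp: T_def)
      have m: "D * exp (- r/2) \<le> M * exp (- r/2)" using M by simp
      also have "\<dots> \<le> M * exp (- r/2) * r" using rr M0 mult_left_mono[of 1 r "M * exp (- r/2)"] by simp
      finally have m2: "D * exp (- r/2) \<le> M * r * exp (- r/2)" by (simp only: mult_ac)
      show ?thesis using D(3)[OF rr(1)] m m2 by (meson order_trans)
    qed
  qed
  then show thesis using M0 that by blast
qed

definition Q :: "R3 \<Rightarrow> real" where "Q = radial_lift u"
definition HQ :: "R3 \<Rightarrow> real" where "HQ x = - Q x + (Q x)^3"

lemma Q_alt: "Q x = indicator {0<..} (norm x) * u (norm x) / norm x"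
  by (cases "x = 0") (auto simp: Q_def radial_lift_def)

lemma Q_measurable: "Q \<in> borel_measurable borel"
proof -
  have "(\<lambda>x::R3. indicator {0<..} (norm x) * u (norm x)) \<in> borel_measurable borel"
    by (rule measurable_compose[OF _ indicator_continuous_measurable[OF cont(1)]]) auto
  then show ?thesis unfolding Q_alt[abs_def] by measurable
qed

lemma Q_bound: assumes M: "M > 0" "\<And>r. r > 0 \<Longrightarrow> u r \<le> M * r * exp (- r/2)"
  shows "0 \<le> Q x" "Q x \<le> M * exp (- norm x/2)"
proof -
  show "0 \<le> Q x" using upos[of "norm x"] by (cases "x = 0") (auto simp: Q_def radial_lift_def less_imp_le)
  show "Q x \<le> M * exp (- norm x/2)"
    using M(1) M(2)[of "norm x"] by (cases "x = 0") (auto simp: Q_def radial_lift_def divide_le_eq mult_ac)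
qed

lemma integrable_radial_majorant:
  fixes g :: "R3 \<Rightarrow> real"
  assumes m: "g \<in> borel_measurable borel" and b: "\<And>x. x \<noteq> 0 \<Longrightarrow> \<bar>g x\<bar> \<le> c * exp (- (1/2) * norm x) / (norm x)\<^sup>2"
  shows "integrable lborel g"
proof (rule Bochner_Integration.integrable_bound)
  have "integrable (lborel :: R3 measure) (\<lambda>x. c * exp (- (1/2) * norm x) / (norm x)\<^sup>2)
     \<longleftrightarrow> integrable lborel (\<lambda>r. indicator {0<..} r * (r\<^sup>2 * (c * exp (- (1/2) * r) / r\<^sup>2)))"
    by (rule integrable_radial_iff) auto
  also have "(\<lambda>r::real. indicator {0<..} r * (r\<^sup>2 * (c * exp (- (1/2) * r) / r\<^sup>2))) = (\<lambda>r. c * (indicator {0<..} r * exp (- (1/2) * r)))"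
    by (auto simp: indicator_def)
  also have "integrable lborel \<dots>" by (intro integrable_mult_right exp_tail_integrable) simp
  finally show "integrable (lborel :: R3 measure) (\<lambda>x. c * exp (- (1/2) * norm x) / (norm x)\<^sup>2)" by simp
  show "AE x in lborel. norm (g x) \<le> norm (c * exp (- (1/2) * norm x) / (norm x)\<^sup>2)"
    using AE_lborel_singleton[of "0::R3"]
  proof eventually_elim
    case (elim x)
    show ?case unfolding real_norm_def by (rule order_trans[OF b[OF elim] abs_ge_self])
  qed
qed (use m in simp)

lemma Q_L2: "Q \<in> L2"
proof -
  obtain M where M: "M > 0" "\<And>r. r > 0 \<Longrightarrow> u r \<le> M * r * exp (- r/2)" "\<And>r. r > 0 \<Longrightarrow> \<bar>u' r\<bar> \<le> M * exp (- r/2)"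
    by (rule bounds) blast
  have "integrable lborel (\<lambda>x. (Q x)\<^sup>2)"
  proof (rule integrable_radial_majorant)
    fix x :: R3 assume x: "x \<noteq> 0"
    have "(Q x)\<^sup>2 \<le> (M * exp (- norm x/2))\<^sup>2" by (intro power_mono Q_bound[OF M(1,2)])
    also have "\<dots> = M\<^sup>2 * exp (- norm x)" by (simp add: power_mult_distrib exp_double[symmetric])
    also have "\<dots> = M\<^sup>2 * ((norm x)\<^sup>2 * exp (- norm x)) / (norm x)\<^sup>2" using x by simp
    also have "\<dots> \<le> M\<^sup>2 * (16 * exp (- (1/2) * norm x)) / (norm x)\<^sup>2"
      by (intro divide_right_mono mult_left_mono exp_ge_square) auto
    finally show "\<bar>(Q x)\<^sup>2\<bar> \<le> (M\<^sup>2 * 16) * exp (- (1/2) * norm x) / (norm x)\<^sup>2" by (simp add: mult.assoc)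
  qed (use Q_measurable in measurable)
  then show ?thesis using Q_measurable by (simp add: L2_def)
qed

lemma HQ_L2: "HQ \<in> L2"
proof -
  obtain M where M: "M > 0" "\<And>r. r > 0 \<Longrightarrow> u r \<le> M * r * exp (- r/2)" "\<And>r. r > 0 \<Longrightarrow> \<bar>u' r\<bar> \<le> M * exp (- r/2)"
    by (rule bounds) blast
  have m: "HQ \<in> borel_measurable borel" unfolding HQ_def[abs_def] using Q_measurable by measurable
  have QM: "0 \<le> Q x \<and> Q x \<le> M" for x
  proof -
    have "M * exp (- norm x/2) \<le> M * 1" using M by (intro mult_left_mono) auto
    then show ?thesis using Q_bound[OF M(1,2), of x] by simp
  qed
  have "integrable lborel (\<lambda>x. (HQ x)\<^sup>2)"
  proof (rule Bochner_Integration.integrable_bound)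
    show "integrable lborel (\<lambda>x. (1 + M\<^sup>2)\<^sup>2 * (Q x)\<^sup>2)" by (intro integrable_mult_right L2_sq_integrable Q_L2)
    have "\<bar>HQ x\<bar> \<le> (1 + M\<^sup>2) * Q x" for x
    proof -
      have "(Q x)\<^sup>2 * Q x \<le> M\<^sup>2 * Q x" using QM[of x] by (intro mult_right_mono power_mono) auto
      moreover have "(Q x)\<^sup>2 * Q x = (Q x)^3" by (simp add: power2_eq_square power3_eq_cube)
      moreover have "0 \<le> (Q x)^3" "0 \<le> M\<^sup>2 * Q x" using QM[of x] by simp_all
      ultimately show ?thesis using QM[of x] unfolding HQ_def distrib_right abs_le_iff by linarith
    qed
    then have "(HQ x)\<^sup>2 \<le> ((1 + M\<^sup>2) * Q x)\<^sup>2" for x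
      by (metis abs_ge_zero power2_abs power_mono)
    then show "AE x in lborel. norm ((HQ x)\<^sup>2) \<le> norm ((1 + M\<^sup>2)\<^sup>2 * (Q x)\<^sup>2)"
      by (simp add: power_mult_distrib)
  qed (use m in measurable)
  then show ?thesis using m by (simp add: L2_def)
qed

text \<open>Stated abstractly so that the energy formula applies to the cutoffs \<open>cut n\<close>
  and to their differences alike.\<close>

definition is_cut :: "(real \<Rightarrow> real) \<Rightarrow> (real \<Rightarrow> real) \<Rightarrow> (real \<Rightarrow> real) \<Rightarrow> bool" where
  "is_cut c c1 c2 \<longleftrightarrow> (\<forall>k. diffable k UNIV c) \<and> (\<forall>r. (c has_real_derivative c1 r) (at r)) \<and>
     (\<forall>r. (c1 has_real_derivative c2 r) (at r)) \<and> (\<exists>p>0. \<exists>q>p. \<forall>r. r \<notin> {p..q} \<longrightarrow> c r = 0)"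

lemma is_cut_cut: "is_cut (cut n) (dcut n) (ddcut n)"
  unfolding is_cut_def
proof (intro conjI allI diffable_cut cut_deriv dcut_deriv)
  have "1 / real (Suc n) \<le> 1" by simp
  then have "1 / real (Suc n) < real (Suc n) + 1" by linarith
  then show "\<exists>p>0. \<exists>q>p. \<forall>r. r \<notin> {p..q} \<longrightarrow> cut n r = 0"
    by (intro exI[of _ "1 / real (Suc n)"] conjI exI[of _ "real (Suc n) + 1"]) (auto intro: cut_0)
qed

lemma is_cut_diff:
  assumes "is_cut c c1 c2" "is_cut e e1 e2"
  shows "is_cut (\<lambda>r. c r - e r) (\<lambda>r. c1 r - e1 r) (\<lambda>r. c2 r - e2 r)"
proof -
  obtain p q where pq: "p > 0" "q > p" "\<forall>r. r \<notin> {p..q} \<longrightarrow> c r = 0" using assms(1) by (auto simp: is_cut_def)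
  obtain p' q' where pq': "p' > 0" "q' > p'" "\<forall>r. r \<notin> {p'..q'} \<longrightarrow> e r = 0" using assms(2) by (auto simp: is_cut_def)
  have "\<exists>p>0. \<exists>q>p. \<forall>r. r \<notin> {p..q} \<longrightarrow> c r - e r = 0"
  proof -
    have "c r - e r = 0" if "r \<notin> {min p p'..max q q'}" for r
    proof -
      have "r \<notin> {p..q}" "r \<notin> {p'..q'}" using that by auto
      then show ?thesis using pq(3) pq'(3) by simp
    qed
    moreover have "min p p' > 0" "max q q' > min p p'" using pq(1,2) pq'(1,2) by auto
    ultimately show ?thesis by blast
  qed
  then show ?thesis using assms unfolding is_cut_def by (auto intro: diffable_diff DERIV_diff)
qed

lemma is_cut_1_0:
  assumes "is_cut c c1 c2"
  obtains p q where "0 < p" "p < q" "\<And>r. r \<notin> {p..q} \<Longrightarrow> c r = 0" "\<And>r. r \<notin> {p..q} \<Longrightarrow> c1 r = 0" "\<And>r. r \<notin> {p..q} \<Longrightarrow> c2 r = 0"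
proof -
  obtain p q where pq: "p > 0" "q > p" "\<forall>r. r \<notin> {p..q} \<longrightarrow> c r = 0" using assms by (auto simp: is_cut_def)
  have d: "(c has_real_derivative c1 r) (at r)" "(c1 has_real_derivative c2 r) (at r)" for r using assms by (auto simp: is_cut_def)
  have 1: "c1 r = 0" if "r \<notin> {p..q}" for r by (rule deriv_zero_outside[OF _ d(1) that]) (use pq in auto)
  have "c2 r = 0" if "r \<notin> {p..q}" for r by (rule deriv_zero_outside[OF 1 d(2) that])
  with 1 pq show thesis by (intro that[of p q]) auto
qed

text \<open>With \<eta> = c u the Laplacian of the lift is \<eta>''/r. The profile equation turns -c
  u''/r together with the potential into c times \<open>HQ\<close>, and what remains is the
  commutator of the operator with c.\<close>

lemma cut_lift:
  assumes c: "is_cut c c1 c2"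
  shows "radial_lift (\<lambda>r. c r * u r) \<in> test_functions (- {0})"
    "\<And>x. x \<noteq> 0 \<Longrightarrow> Lop a (radial_lift (\<lambda>r. c r * u r)) x
       = c (norm x) * HQ x - (c2 (norm x) * u (norm x) + 2 * (c1 (norm x) * u' (norm x))) / norm x"
    "\<And>i x. x \<noteq> 0 \<Longrightarrow> partial i (radial_lift (\<lambda>r. c r * u r)) x
       = c (norm x) * ((u' (norm x) / norm x - u (norm x) / (norm x)\<^sup>2) * (x $ i / norm x)) + c1 (norm x) * u (norm x) / norm x * (x $ i / norm x)"
proof -
  obtain p q where pq: "0 < p" "p < q" "\<And>r. r \<notin> {p..q} \<Longrightarrow> c r = 0" using c by (auto simp: is_cut_def)
  have d: "(c has_real_derivative c1 r) (at r)" "(c1 has_real_derivative c2 r) (at r)" for r using c by (auto simp: is_cut_def)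
  define \<eta>1 where "\<eta>1 = (\<lambda>r. c1 r * u r + u' r * c r)"
  define \<eta>2 where "\<eta>2 = (\<lambda>r. (c2 r * u r + u' r * c1 r) + (((1 + a/r\<^sup>2) * u r - (u r)^3/r\<^sup>2) * c r + c1 r * u' r))"
  have sm: "diffable k {0<..} (\<lambda>r. c r * u r)" for k
  proof (rule diffable_mult)
    show "diffable k {0<..} c" by (rule diffable_subset[of k UNIV]) (use c in \<open>auto simp: is_cut_def\<close>)
  qed (use smooth in auto)
  have d1: "((\<lambda>r. c r * u r) has_real_derivative \<eta>1 r) (at r)" if "r > 0" for r
    unfolding \<eta>1_def by (rule DERIV_mult[OF d(1) du[OF that]])
  have d2: "(\<eta>1 has_real_derivative \<eta>2 r) (at r)" if "r > 0" for r
    unfolding \<eta>1_def \<eta>2_def by (rule DERIV_add[OF DERIV_mult[OF d(2) du[OF that]] DERIV_mult[OF du'[OF that] d(1)]])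
  have z: "c r * u r = 0" if "r > 0" "r \<notin> {p..q}" for r using pq(3)[OF that(2)] by simp
  show "radial_lift (\<lambda>r. c r * u r) \<in> test_functions (- {0})"
    by (rule radial_lift_test(1)[OF sm pq(1,2) z d1 d2])
  show "Lop a (radial_lift (\<lambda>r. c r * u r)) x
       = c (norm x) * HQ x - (c2 (norm x) * u (norm x) + 2 * (c1 (norm x) * u' (norm x))) / norm x" if x: "x \<noteq> 0" for x
  proof -
    have alg: "- (((c2 * U + U' * c1) + (((1 + a/r\<^sup>2) * U - U^3/r\<^sup>2) * c + c1 * U')) / r) + a / r\<^sup>2 * (c * U / r)
      = c * (- (U / r) + (U / r)^3) - (c2 * U + 2 * (c1 * U')) / r" if "r \<noteq> 0" for r U U' c c1 c2 :: real
      using that by (simp add: field_simps power2_eq_square power3_eq_cube)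
    have "laplacian (radial_lift (\<lambda>r. c r * u r)) x = \<eta>2 (norm x) / norm x"
      by (rule radial_lift_test(2)[OF sm pq(1,2) z d1 d2]) (assumption | rule x)+
    then show ?thesis
      unfolding Lop_def \<eta>2_def HQ_def Q_def
      unfolding radial_lift_def using alg[of "norm x" "c2 (norm x)" "u (norm x)" "u' (norm x)" "c1 (norm x)" "c (norm x)"] x by simp
  qed
  show "partial i (radial_lift (\<lambda>r. c r * u r)) x
       = c (norm x) * ((u' (norm x) / norm x - u (norm x) / (norm x)\<^sup>2) * (x $ i / norm x)) + c1 (norm x) * u (norm x) / norm x * (x $ i / norm x)"
    if x: "x \<noteq> 0" for i x
  proof -
    have alg: "((c1 * U + U' * c) / r - c * U / r\<^sup>2) * y = c * ((U' / r - U / r\<^sup>2) * y) + c1 * U / r * y" for r U U' c c1 y :: real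
      by (simp add: algebra_simps add_divide_distrib diff_divide_distrib)
    have "partial i (radial_lift (\<lambda>r. c r * u r)) x = (\<eta>1 (norm x) / norm x - c (norm x) * u (norm x) / (norm x)\<^sup>2) * (x $ i / norm x)"
      by (rule radial_lift_test(4)[OF sm pq(1,2) z d1 d2]) (assumption | rule x)+
    then show ?thesis unfolding \<eta>1_def by (simp only: alg)
  qed
qed

text \<open>A localization formula. The commutator contributes -(c'' u + 2 c' u') c u = c'^2 u^2 -
  (c c' u^2)', and the total derivative integrates to 0, so second derivatives of the cutoff
  disappear from the energy.\<close>

lemma cut_form:
  assumes c: "is_cut c c1 c2"
  shows "L2_inner (Lop a (radial_lift (\<lambda>r. c r * u r))) (radial_lift (\<lambda>r. c r * u r))
    = 4 * pi * ((\<integral>r. indicator {0<..} r * ((c r)\<^sup>2 * ((u r)^4 / r\<^sup>2 - (u r)\<^sup>2)) \<partial>lborel) + (\<integral>r. indicator {0<..} r * ((c1 r)\<^sup>2 * (u r)\<^sup>2) \<partial>lborel))"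
    "integrable lborel (\<lambda>r. indicator {0<..} r * ((c r)\<^sup>2 * ((u r)^4 / r\<^sup>2 - (u r)\<^sup>2)))"
    "integrable lborel (\<lambda>r. indicator {0<..} r * ((c1 r)\<^sup>2 * (u r)\<^sup>2))"
proof -
  obtain p q where pq: "0 < p" "p < q" and z: "\<And>r. r \<notin> {p..q} \<Longrightarrow> c r = 0" "\<And>r. r \<notin> {p..q} \<Longrightarrow> c1 r = 0" "\<And>r. r \<notin> {p..q} \<Longrightarrow> c2 r = 0"
    using is_cut_1_0[OF c] by blast
  have d: "(c has_real_derivative c1 r) (at r)" "(c1 has_real_derivative c2 r) (at r)" for r using c by (auto simp: is_cut_def)
  have cc: "continuous_on {0<..} c" "continuous_on {0<..} c1"
    using d by (auto intro!: continuous_at_imp_continuous_on DERIV_isCont)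
  have "diffable (Suc (Suc 0)) UNIV c" using c by (auto simp: is_cut_def simp del: diffable.simps)
  then have "diffable (Suc 0) UNIV c1" by (rule diffable_deriv[OF open_UNIV]) (rule d)
  then have "diffable 0 UNIV c2" by (rule diffable_deriv[OF open_UNIV]) (rule d)
  then have cc2: "continuous_on {0<..} c2" using continuous_on_subset[of UNIV c2] by simp
  define A where "A = (\<lambda>r. (c r)\<^sup>2 * ((u r)^4 / r\<^sup>2 - (u r)\<^sup>2))"
  define B where "B = (\<lambda>r. (c1 r)\<^sup>2 * (u r)\<^sup>2)"
  define G where "G = (\<lambda>r. c r * c1 r * (u r)\<^sup>2)"
  define G' where "G' = (\<lambda>r. (c1 r * c1 r + c2 r * c r) * (u r)\<^sup>2 + 2 * u r * u' r * (c r * c1 r))"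
  have dG: "(G has_real_derivative G' r) (at r)" if "r > 0" for r
    unfolding G_def G'_def
    by (rule DERIV_cong[OF DERIV_mult[OF DERIV_mult[OF d] DERIV_power[OF du[OF that], of 2]]]) (simp add: mult_ac)
  have iA: "integrable lborel (\<lambda>r. indicator {0<..} r * A r)"
    by (rule integrable_cut[OF _ pq(1)]) (use z in \<open>auto simp: A_def intro!: continuous_intros cc cont\<close>)
  have iB: "integrable lborel (\<lambda>r. indicator {0<..} r * B r)"
    by (rule integrable_cut[OF _ pq(1)]) (use z in \<open>auto simp: B_def intro!: continuous_intros cc cont\<close>)
  have cG': "continuous_on {0<..} G'" unfolding G'_def by (intro continuous_intros cc cc2 cont)
  have iG: "integrable lborel (\<lambda>r. indicator {0<..} r * G' r)"
    by (rule integrable_cut[where q = q, OF cG' pq(1)]) (use z in \<open>auto simp: G'_def\<close>)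
  show "integrable lborel (\<lambda>r. indicator {0<..} r * ((c r)\<^sup>2 * ((u r)^4 / r\<^sup>2 - (u r)\<^sup>2)))"
    "integrable lborel (\<lambda>r. indicator {0<..} r * ((c1 r)\<^sup>2 * (u r)\<^sup>2))" using iA iB by (simp_all add: A_def B_def)
  have G0: "(\<integral>r. indicator {0<..} r * G' r \<partial>lborel) = 0"
  proof -
    have "(\<lambda>r. indicator {0<..} r * G' r) = (\<lambda>r. indicator {p/2..q+1} r *\<^sub>R G' r)"
      using pq z by (auto simp: indicator_def G'_def fun_eq_iff)
    moreover have "(\<integral>r. indicator {p/2..q+1} r *\<^sub>R G' r \<partial>lborel) = G (q + 1) - G (p/2)"
    proof (rule integral_FTC_Icc)
      show "continuous_on {p/2..q+1} G'" by (rule continuous_on_subset[OF cG']) (use pq in auto)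
      fix x assume "p/2 \<le> x" "x \<le> q + 1"
      then show "(G has_vector_derivative G' x) (at x within {p/2..q+1})"
        using dG[of x] pq by (auto simp: has_real_derivative_iff_has_vector_derivative[symmetric] intro: has_field_derivative_at_within)
    qed (use pq in auto)
    ultimately show ?thesis using z pq by (simp add: G_def)
  qed
  define h where "h = (\<lambda>r. indicator {0<..} r * ((A r + B r - G' r) / r\<^sup>2))"
  have hm: "h \<in> borel_measurable borel"
    unfolding h_def by (rule indicator_continuous_measurable) (auto simp: A_def B_def intro!: continuous_intros cG' cc cont)
  have eq: "Lop a (radial_lift (\<lambda>r. c r * u r)) x * radial_lift (\<lambda>r. c r * u r) x = h (norm x)" for x
  proof (cases "x = 0")
    case False
    have alg: "(C * (- (U / r) + (U / r)^3) - (C2 * U + 2 * (C1 * U')) / r) * (C * U / r)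
      = (C\<^sup>2 * (U^4 / r\<^sup>2 - U\<^sup>2) + C1\<^sup>2 * U\<^sup>2 - ((C1 * C1 + C2 * C) * U\<^sup>2 + 2 * U * U' * (C * C1))) / r\<^sup>2" if "r \<noteq> 0" for r U U' C C1 C2 :: real
      using that by (simp add: field_simps power2_eq_square power3_eq_cube power4_eq_xxxx)
    have "h (norm x) = (A (norm x) + B (norm x) - G' (norm x)) / (norm x)\<^sup>2" using False by (simp add: h_def)
    then show ?thesis
      unfolding cut_lift(2)[OF c False] HQ_def Q_def A_def B_def G'_def
      unfolding radial_lift_def using alg[of "norm x"] False by simp
  qed (simp add: h_def radial_lift_def)
  have "L2_inner (Lop a (radial_lift (\<lambda>r. c r * u r))) (radial_lift (\<lambda>r. c r * u r)) = (\<integral>x. h (norm x) \<partial>(lborel :: R3 measure))"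
    unfolding L2_inner_def eq ..
  also have "\<dots> = 4 * pi * (\<integral>r. indicator {0<..} r * (r\<^sup>2 * h r) \<partial>lborel)" by (rule integral_radial[OF hm])
  also have "(\<lambda>r. indicator {0<..} r * (r\<^sup>2 * h r)) = (\<lambda>r. indicator {0<..} r * A r + indicator {0<..} r * B r - indicator {0<..} r * G' r)"
    by (auto simp: h_def indicator_def)
  also have "(\<integral>r. indicator {0<..} r * A r + indicator {0<..} r * B r - indicator {0<..} r * G' r \<partial>lborel)
     = (\<integral>r. indicator {0<..} r * A r \<partial>lborel) + (\<integral>r. indicator {0<..} r * B r \<partial>lborel) - 0"
    using iA iB iG G0 by simp
  finally show "L2_inner (Lop a (radial_lift (\<lambda>r. c r * u r))) (radial_lift (\<lambda>r. c r * u r))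
    = 4 * pi * ((\<integral>r. indicator {0<..} r * ((c r)\<^sup>2 * ((u r)^4 / r\<^sup>2 - (u r)\<^sup>2)) \<partial>lborel) + (\<integral>r. indicator {0<..} r * ((c1 r)\<^sup>2 * (u r)\<^sup>2) \<partial>lborel))"
    by (simp add: A_def B_def)
qed

section \<open>Approximation by cut-off profiles\<close>

definition cutQ :: "nat \<Rightarrow> R3 \<Rightarrow> real" where "cutQ n = radial_lift (\<lambda>r. cut n r * u r)"

lemma cutQ_eq: "cutQ n x = cut n (norm x) * Q x"
  by (simp add: cutQ_def Q_def radial_lift_def)

lemma cutQ_test: "cutQ n \<in> test_functions (- {0})"
  unfolding cutQ_def by (rule cut_lift(1)[OF is_cut_cut])

lemma cut_tendsto: "r > 0 \<Longrightarrow> (\<lambda>n. cut n r) \<longlonglongrightarrow> 1" "r > 0 \<Longrightarrow> (\<lambda>n. dcut n r) \<longlonglongrightarrow> 0"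
  by (rule tendsto_eventually, rule eventually_mono[OF eventually_cut_1], auto simp: cut_1_derivs intro!: cut_1)+

lemma cutQ_L2_tendsto: "L2_tendsto cutQ Q"
  unfolding L2_tendsto_def L2_inner_def
proof -
  have m: "cutQ n \<in> borel_measurable borel" for n
    by (rule borel_measurable_continuous_onI[OF test_functionD(2)[OF cutQ_test]])
  have "(\<lambda>n. \<integral>x. (cutQ n x - Q x) * (cutQ n x - Q x) \<partial>lborel) \<longlonglongrightarrow> (\<integral>x. 0 \<partial>(lborel :: R3 measure))"
  proof (rule integral_dominated_convergence[OF _ _ L2_sq_integrable[OF Q_L2]])
    show "(\<lambda>x. (cutQ n x - Q x) * (cutQ n x - Q x)) \<in> borel_measurable lborel" for n
      using m[of n] Q_measurable by measurable
    show "AE x in lborel. (\<lambda>n. (cutQ n x - Q x) * (cutQ n x - Q x)) \<longlonglongrightarrow> 0"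
      using AE_lborel_singleton[of "0::R3"]
    proof eventually_elim
      case (elim x)
      have "(\<lambda>n. (cut n (norm x) * Q x - Q x) * (cut n (norm x) * Q x - Q x)) \<longlonglongrightarrow> (1 * Q x - Q x) * (1 * Q x - Q x)"
        by (intro tendsto_intros cut_tendsto) (use elim in auto)
      then show ?case by (simp add: cutQ_eq)
    qed
    show "AE x in lborel. norm ((cutQ n x - Q x) * (cutQ n x - Q x)) \<le> (Q x)\<^sup>2" for n
    proof (intro always_eventually allI)
      fix x :: R3
      have "\<bar>cut n (norm x) - 1\<bar> \<le> 1" using cut_range[of n "norm x"] by simp
      then have "(cut n (norm x) - 1)\<^sup>2 \<le> 1" by (simp add: abs_square_le_1)
      then have "(cut n (norm x) - 1)\<^sup>2 * (Q x)\<^sup>2 \<le> 1 * (Q x)\<^sup>2" by (intro mult_right_mono) auto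
      moreover have "(cutQ n x - Q x) * (cutQ n x - Q x) = (cut n (norm x) - 1)\<^sup>2 * (Q x)\<^sup>2"
        by (simp add: cutQ_eq power2_eq_square algebra_simps)
      ultimately show "norm ((cutQ n x - Q x) * (cutQ n x - Q x)) \<le> (Q x)\<^sup>2" by simp
    qed
  qed simp
  then show "(\<lambda>n. \<integral>x. (cutQ n x - Q x) * (cutQ n x - Q x) \<partial>lborel) \<longlonglongrightarrow> 0" by simp
qed

text \<open>The rate drops from 1/2 to 1/4 to absorb the factor 2 + r, which is r times the 2/r + 1
  of \<open>dcut_bound\<close>.\<close>

lemma dcut_u_bound: obtains c where "c > 0" "\<And>n r. r > 0 \<Longrightarrow> \<bar>dcut n r * u r\<bar> \<le> c * exp (- (1/4) * r)"
    "\<And>r. r > 0 \<Longrightarrow> \<bar>u' r\<bar> + u r / r \<le> c * exp (- (1/4) * r)"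
proof -
  obtain M where M: "M > 0" "\<And>r. r > 0 \<Longrightarrow> u r \<le> M * r * exp (- r/2)" "\<And>r. r > 0 \<Longrightarrow> \<bar>u' r\<bar> \<le> M * exp (- r/2)"
    by (rule bounds) blast
  obtain S where S: "S > 0" "\<And>x. \<bar>dsstep x\<bar> \<le> S" using dsstep_bounded by blast
  have e: "(2 + r) * exp (- r/2) \<le> 4 * exp (- (1/4) * r)" if "r > 0" for r :: real
  proof -
    have "2 + r \<le> 4 * exp (r / 4)" using exp_ge_add_one_self[of "r/4"] by linarith
    then have "(2 + r) * exp (- r/2) \<le> (4 * exp (r / 4)) * exp (- r/2)" by (intro mult_right_mono) auto
    also have "\<dots> = 4 * exp (- (1/4) * r)" by (simp add: mult.assoc exp_add[symmetric])
    finally show ?thesis .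
  qed
  show thesis
  proof (rule that[of "4 * S * M + 4 * M"])
    show "0 < 4 * S * M + 4 * M" using S M by (simp add: add_pos_pos)
    fix r :: real assume r: "r > 0"
    have ex: "0 \<le> exp (- (1/4) * r)" by simp
    show "\<bar>dcut n r * u r\<bar> \<le> (4 * S * M + 4 * M) * exp (- (1/4) * r)" for n
    proof -
      have "\<bar>dcut n r * u r\<bar> \<le> (S * (2 / r + 1)) * (M * r * exp (- r/2))"
        unfolding abs_mult using dcut_bound[OF S(2) r, of n] M(2)[OF r] upos[OF r] S r by (intro mult_mono) auto
      also have "\<dots> = S * M * ((2 + r) * exp (- r/2))" using r by (simp add: field_simps)
      also have "\<dots> \<le> S * M * (4 * exp (- (1/4) * r))" using S M by (intro mult_left_mono e r) auto
      also have "\<dots> \<le> (4 * S * M + 4 * M) * exp (- (1/4) * r)" using M ex by (simp add: distrib_right)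
      finally show ?thesis .
    qed
    have "u r / r \<le> M * exp (- r/2)" using M(2)[OF r] r by (simp add: divide_le_eq mult_ac)
    then have "\<bar>u' r\<bar> + u r / r \<le> M * (2 * exp (- r/2))" using M(3)[OF r] by simp
    also have "\<dots> \<le> M * ((2 + r) * exp (- r/2))" using M r by (intro mult_left_mono mult_right_mono) auto
    also have "\<dots> \<le> M * (4 * exp (- (1/4) * r))" using M by (intro mult_left_mono e r) auto
    also have "\<dots> \<le> (4 * S * M + 4 * M) * exp (- (1/4) * r)" using M S ex by (simp add: distrib_right)
    finally show "\<bar>u' r\<bar> + u r / r \<le> (4 * S * M + 4 * M) * exp (- (1/4) * r)" .
  qed
qed

lemma dcut_energy_tendsto: "(\<lambda>n. \<integral>r. indicator {0<..} r * ((dcut n r)\<^sup>2 * (u r)\<^sup>2) \<partial>lborel) \<longlonglongrightarrow> 0"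
proof -
  obtain c where c: "c > 0" "\<And>n r. r > 0 \<Longrightarrow> \<bar>dcut n r * u r\<bar> \<le> c * exp (- (1/4) * r)" using dcut_u_bound by metis
  have "(\<lambda>n. \<integral>r. indicator {0<..} r * ((dcut n r)\<^sup>2 * (u r)\<^sup>2) \<partial>lborel) \<longlonglongrightarrow> (\<integral>r. 0 \<partial>(lborel :: real measure))"
  proof (rule integral_dominated_convergence)
    show "(\<lambda>r. indicator {0<..} r * ((dcut n r)\<^sup>2 * (u r)\<^sup>2)) \<in> borel_measurable lborel" for n
      using borel_measurable_integrable[OF cut_form(3)[OF is_cut_cut]] .
    show "integrable lborel (\<lambda>r. c\<^sup>2 * (indicator {0<..} r * exp (- (1/2) * r)))"
      by (intro integrable_mult_right exp_tail_integrable) simp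
    show "AE r in lborel. (\<lambda>n. indicator {0<..} r * ((dcut n r)\<^sup>2 * (u r)\<^sup>2)) \<longlonglongrightarrow> 0"
    proof (intro always_eventually allI)
      fix r :: real
      show "(\<lambda>n. indicator {0<..} r * ((dcut n r)\<^sup>2 * (u r)\<^sup>2)) \<longlonglongrightarrow> 0"
      proof (cases "r > 0")
        case True
        have "(\<lambda>n. indicator {0<..} r * ((dcut n r)\<^sup>2 * (u r)\<^sup>2)) \<longlonglongrightarrow> indicator {0<..} r * (0\<^sup>2 * (u r)\<^sup>2)"
          by (intro tendsto_intros cut_tendsto True)
        then show ?thesis by simp
      qed simp
    qed
    show "AE r in lborel. norm (indicator {0<..} r * ((dcut n r)\<^sup>2 * (u r)\<^sup>2)) \<le> c\<^sup>2 * (indicator {0<..} r * exp (- (1/2) * r))" for n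
    proof (intro always_eventually allI)
      fix r :: real
      show "norm (indicator {0<..} r * ((dcut n r)\<^sup>2 * (u r)\<^sup>2)) \<le> c\<^sup>2 * (indicator {0<..} r * exp (- (1/2) * r))"
      proof (cases "r > 0")
        case True
        have "\<bar>dcut n r * u r\<bar>\<^sup>2 \<le> (c * exp (- (1/4) * r))\<^sup>2" by (intro power_mono c True) simp
        also have "\<dots> = c\<^sup>2 * exp (- (1/2) * r)" by (simp add: power_mult_distrib exp_double[symmetric])
        finally show ?thesis using True by (simp add: power_mult_distrib)
      qed simp
    qed
  qed simp
  then show ?thesis by simp
qed

definition wdens :: "real \<Rightarrow> real" where "wdens r = \<bar>(u r)^4 / r\<^sup>2 - (u r)\<^sup>2\<bar>"

lemma wdens_bound: obtains c where "\<And>r. r > 0 \<Longrightarrow> wdens r \<le> c * exp (- (1/2) * r)"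
proof -
  obtain M where M: "M > 0" "\<And>r. r > 0 \<Longrightarrow> u r \<le> M * r * exp (- r/2)" "\<And>r. r > 0 \<Longrightarrow> \<bar>u' r\<bar> \<le> M * exp (- r/2)"
    by (rule bounds) blast
  have "wdens r \<le> ((M\<^sup>2 + 1) * (M\<^sup>2 * 16)) * exp (- (1/2) * r)" if r: "r > 0" for r
  proof -
    have "(u r)\<^sup>2 \<le> (M * r * exp (- r/2))\<^sup>2" using M(2)[OF r] upos[OF r] by (intro power_mono) auto
    also have "\<dots> = M\<^sup>2 * (r\<^sup>2 * exp (- r))" by (simp add: power_mult_distrib exp_double[symmetric] mult.assoc)
    finally have 1: "(u r)\<^sup>2 \<le> M\<^sup>2 * (r\<^sup>2 * exp (- r))" .
    also have "\<dots> \<le> M\<^sup>2 * (16 * exp (- (1/2) * r))" using r by (intro mult_left_mono exp_ge_square) auto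
    finally have 2: "(u r)\<^sup>2 \<le> M\<^sup>2 * 16 * exp (- (1/2) * r)" by simp
    have "M\<^sup>2 * (r\<^sup>2 * exp (- r)) \<le> M\<^sup>2 * (r\<^sup>2 * 1)" using r by (intro mult_left_mono) auto
    then have "(u r)\<^sup>2 / r\<^sup>2 \<le> M\<^sup>2" using 1 r by (simp add: divide_le_eq)
    then have "(u r)\<^sup>2 / r\<^sup>2 * (u r)\<^sup>2 \<le> M\<^sup>2 * (u r)\<^sup>2" by (intro mult_right_mono) auto
    then have "(u r)^4 / r\<^sup>2 \<le> M\<^sup>2 * (u r)\<^sup>2" by (simp add: power2_eq_square power4_eq_xxxx)
    moreover have "0 \<le> (u r)^4 / r\<^sup>2" "0 \<le> (u r)\<^sup>2" "0 \<le> M\<^sup>2 * (u r)\<^sup>2" by auto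
    ultimately have "wdens r \<le> (M\<^sup>2 + 1) * (u r)\<^sup>2" unfolding wdens_def distrib_right by linarith
    also have "\<dots> \<le> (M\<^sup>2 + 1) * (M\<^sup>2 * 16 * exp (- (1/2) * r))" using 2 by (intro mult_left_mono) auto
    finally show ?thesis by (simp add: mult.assoc)
  qed
  then show thesis using that by blast
qed

lemma tail_energy:
  "integrable lborel (\<lambda>r. indicator {0<..} r * ((1 - cut n r)\<^sup>2 * wdens r))"
  "(\<lambda>n. \<integral>r. indicator {0<..} r * ((1 - cut n r)\<^sup>2 * wdens r) \<partial>lborel) \<longlonglongrightarrow> 0"
proof -
  obtain c where c: "\<And>r. r > 0 \<Longrightarrow> wdens r \<le> c * exp (- (1/2) * r)" using wdens_bound by blast
  have w0: "wdens r \<ge> 0" for r by (simp add: wdens_def)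
  have cc: "continuous_on {0<..} (cut n)" for n
    using cut_deriv by (auto intro!: continuous_at_imp_continuous_on DERIV_isCont)
  have m: "(\<lambda>r. indicator {0<..} r * ((1 - cut n r)\<^sup>2 * wdens r)) \<in> borel_measurable lborel" for n
    using indicator_continuous_measurable[of "\<lambda>r. (1 - cut n r)\<^sup>2 * wdens r"]
    by (simp add: wdens_def continuous_intros cc cont)
  have i: "integrable lborel (\<lambda>r. c * (indicator {0<..} r * exp (- (1/2) * r)))"
    by (intro integrable_mult_right exp_tail_integrable) simp
  have b: "norm (indicator {0<..} r * ((1 - cut n r)\<^sup>2 * wdens r)) \<le> c * (indicator {0<..} r * exp (- (1/2) * r))" for n r
  proof (cases "r > 0")
    case True
    have "\<bar>1 - cut n r\<bar> \<le> 1" using cut_range[of n r] by simp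
    then have "(1 - cut n r)\<^sup>2 \<le> 1" by (simp add: abs_square_le_1)
    then have "(1 - cut n r)\<^sup>2 * wdens r \<le> 1 * wdens r" using w0 by (intro mult_right_mono) auto
    then show ?thesis using c[OF True] True w0[of r] by simp
  qed simp
  show "integrable lborel (\<lambda>r. indicator {0<..} r * ((1 - cut n r)\<^sup>2 * wdens r))" for n
    by (rule Bochner_Integration.integrable_bound[OF i m]) (use b in \<open>auto intro!: always_eventually intro: order_trans[OF _ abs_ge_self]\<close>)
  have "(\<lambda>n. \<integral>r. indicator {0<..} r * ((1 - cut n r)\<^sup>2 * wdens r) \<partial>lborel) \<longlonglongrightarrow> (\<integral>r. 0 \<partial>(lborel :: real measure))"
  proof (rule integral_dominated_convergence[OF _ m i])
    show "AE r in lborel. (\<lambda>n. indicator {0<..} r * ((1 - cut n r)\<^sup>2 * wdens r)) \<longlonglongrightarrow> 0"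
    proof (intro always_eventually allI)
      fix r :: real
      show "(\<lambda>n. indicator {0<..} r * ((1 - cut n r)\<^sup>2 * wdens r)) \<longlonglongrightarrow> 0"
      proof (cases "r > 0")
        case True
        have "(\<lambda>n. indicator {0<..} r * ((1 - cut n r)\<^sup>2 * wdens r)) \<longlonglongrightarrow> indicator {0<..} r * ((1 - 1)\<^sup>2 * wdens r)"
          by (intro tendsto_intros cut_tendsto True)
        then show ?thesis by simp
      qed simp
    qed
    show "AE r in lborel. norm (indicator {0<..} r * ((1 - cut n r)\<^sup>2 * wdens r)) \<le> c * (indicator {0<..} r * exp (- (1/2) * r))" for n
      using b by (intro always_eventually allI)
  qed simp
  then show "(\<lambda>n. \<integral>r. indicator {0<..} r * ((1 - cut n r)\<^sup>2 * wdens r) \<partial>lborel) \<longlonglongrightarrow> 0" by simp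
qed

text \<open>\<open>cut_form\<close> splits the energy of a difference. The part with (cut m - cut
  n)^2 is a tail, estimated through 1 - cut m and 1 - cut n; the part with derivatives is handled by
  \<open>dcut_energy_tendsto\<close>. As u^4/r^2 - u^2 has no definite sign, its absolute value
  \<open>wdens\<close> enters.\<close>

lemma cutQ_form_cauchy:
  assumes e: "\<epsilon> > 0"
  shows "\<exists>N. \<forall>m\<ge>N. \<forall>n\<ge>N. L2_inner (Lop a (\<lambda>x. cutQ m x - cutQ n x)) (\<lambda>x. cutQ m x - cutQ n x) < \<epsilon>"
proof -
  define E where "E = (\<lambda>n. \<integral>r. indicator {0<..} r * ((1 - cut n r)\<^sup>2 * wdens r) \<partial>lborel)"
  define F where "F = (\<lambda>n. \<integral>r. indicator {0<..} r * ((dcut n r)\<^sup>2 * (u r)\<^sup>2) \<partial>lborel)"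
  have le: "L2_inner (Lop a (\<lambda>x. cutQ m x - cutQ n x)) (\<lambda>x. cutQ m x - cutQ n x) \<le> 4 * pi * ((2 * E m + 2 * E n) + (2 * F m + 2 * F n))" for m n
  proof -
    have cc: "is_cut (\<lambda>r. cut m r - cut n r) (\<lambda>r. dcut m r - dcut n r) (\<lambda>r. ddcut m r - ddcut n r)"
      by (intro is_cut_diff is_cut_cut)
    have eq: "(\<lambda>x. cutQ m x - cutQ n x) = radial_lift (\<lambda>r. (cut m r - cut n r) * u r)"
      by (rule ext) (simp add: cutQ_def radial_lift_def left_diff_distrib diff_divide_distrib)
    have sq: "(x - y)\<^sup>2 \<le> 2 * x\<^sup>2 + 2 * y\<^sup>2" for x y :: real
      using zero_le_power2[of "x + y"] by (simp add: power2_eq_square algebra_simps)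
    have 1: "(\<integral>r. indicator {0<..} r * ((cut m r - cut n r)\<^sup>2 * ((u r)^4 / r\<^sup>2 - (u r)\<^sup>2)) \<partial>lborel)
        \<le> (\<integral>r. 2 * (indicator {0<..} r * ((1 - cut m r)\<^sup>2 * wdens r)) + 2 * (indicator {0<..} r * ((1 - cut n r)\<^sup>2 * wdens r)) \<partial>lborel)"
    proof (rule integral_mono[OF cut_form(2)[OF cc]])
      show "integrable lborel (\<lambda>r. 2 * (indicator {0<..} r * ((1 - cut m r)\<^sup>2 * wdens r)) + 2 * (indicator {0<..} r * ((1 - cut n r)\<^sup>2 * wdens r)))"
        by (intro Bochner_Integration.integrable_add integrable_mult_right tail_energy)
      fix r
      have "(cut m r - cut n r)\<^sup>2 * ((u r)^4 / r\<^sup>2 - (u r)\<^sup>2) \<le> (cut m r - cut n r)\<^sup>2 * wdens r"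
        by (intro mult_left_mono) (auto simp: wdens_def)
      also have "\<dots> \<le> (2 * (1 - cut n r)\<^sup>2 + 2 * (1 - cut m r)\<^sup>2) * wdens r"
        using sq[of "1 - cut n r" "1 - cut m r"] by (intro mult_right_mono) (auto simp: wdens_def)
      finally have "(cut m r - cut n r)\<^sup>2 * ((u r)^4 / r\<^sup>2 - (u r)\<^sup>2) \<le> 2 * ((1 - cut m r)\<^sup>2 * wdens r) + 2 * ((1 - cut n r)\<^sup>2 * wdens r)"
        by (simp add: distrib_right mult.assoc)
      then show "indicator {0<..} r * ((cut m r - cut n r)\<^sup>2 * ((u r)^4 / r\<^sup>2 - (u r)\<^sup>2))
        \<le> 2 * (indicator {0<..} r * ((1 - cut m r)\<^sup>2 * wdens r)) + 2 * (indicator {0<..} r * ((1 - cut n r)\<^sup>2 * wdens r))"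
        by (cases "r > 0") auto
    qed
    also have "\<dots> = 2 * E m + 2 * E n"
      unfolding E_def
      by (simp only: integral_mult_right_zero Bochner_Integration.integral_add[OF integrable_mult_right[OF tail_energy(1)] integrable_mult_right[OF tail_energy(1)]])
    finally have 1: "(\<integral>r. indicator {0<..} r * ((cut m r - cut n r)\<^sup>2 * ((u r)^4 / r\<^sup>2 - (u r)\<^sup>2)) \<partial>lborel) \<le> 2 * E m + 2 * E n" .
    have 2: "(\<integral>r. indicator {0<..} r * ((dcut m r - dcut n r)\<^sup>2 * (u r)\<^sup>2) \<partial>lborel)
        \<le> (\<integral>r. 2 * (indicator {0<..} r * ((dcut m r)\<^sup>2 * (u r)\<^sup>2)) + 2 * (indicator {0<..} r * ((dcut n r)\<^sup>2 * (u r)\<^sup>2)) \<partial>lborel)"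
    proof (rule integral_mono[OF cut_form(3)[OF cc]])
      show "integrable lborel (\<lambda>r. 2 * (indicator {0<..} r * ((dcut m r)\<^sup>2 * (u r)\<^sup>2)) + 2 * (indicator {0<..} r * ((dcut n r)\<^sup>2 * (u r)\<^sup>2)))"
        by (intro Bochner_Integration.integrable_add integrable_mult_right cut_form(3)[OF is_cut_cut])
      fix r
      have "(dcut m r - dcut n r)\<^sup>2 * (u r)\<^sup>2 \<le> (2 * (dcut m r)\<^sup>2 + 2 * (dcut n r)\<^sup>2) * (u r)\<^sup>2"
        using sq by (intro mult_right_mono) auto
      then have "(dcut m r - dcut n r)\<^sup>2 * (u r)\<^sup>2 \<le> 2 * ((dcut m r)\<^sup>2 * (u r)\<^sup>2) + 2 * ((dcut n r)\<^sup>2 * (u r)\<^sup>2)"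
        by (simp only: distrib_right mult.assoc)
      then show "indicator {0<..} r * ((dcut m r - dcut n r)\<^sup>2 * (u r)\<^sup>2)
        \<le> 2 * (indicator {0<..} r * ((dcut m r)\<^sup>2 * (u r)\<^sup>2)) + 2 * (indicator {0<..} r * ((dcut n r)\<^sup>2 * (u r)\<^sup>2))"
        by (cases "r > 0") auto
    qed
    also have "\<dots> = 2 * F m + 2 * F n"
      unfolding F_def
      by (simp only: integral_mult_right_zero Bochner_Integration.integral_add[OF integrable_mult_right[OF cut_form(3)[OF is_cut_cut]] integrable_mult_right[OF cut_form(3)[OF is_cut_cut]]])
    finally have 2: "(\<integral>r. indicator {0<..} r * ((dcut m r - dcut n r)\<^sup>2 * (u r)\<^sup>2) \<partial>lborel) \<le> 2 * F m + 2 * F n" .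
    show ?thesis unfolding eq cut_form(1)[OF cc] using 1 2 by (intro mult_left_mono add_mono) auto
  qed
  have lim: "E \<longlonglongrightarrow> 0" "F \<longlonglongrightarrow> 0" unfolding E_def F_def by (rule tail_energy(2), rule dcut_energy_tendsto)
  \<comment> \<open>All four terms below d make the bound smaller than 4 pi * 16 d =
    \<epsilon>.\<close>
  define d where "d = \<epsilon> / (64 * pi)"
  have d: "d > 0" using e by (simp add: d_def)
  have "eventually (\<lambda>n. E n < d \<and> F n < d) sequentially"
    using order_tendstoD(2)[OF lim(1) d] order_tendstoD(2)[OF lim(2) d] by (rule eventually_conj)
  then obtain N where N: "\<And>n. n \<ge> N \<Longrightarrow> E n < d \<and> F n < d" by (auto simp: eventually_sequentially)
  show ?thesis
  proof (intro exI[of _ N] allI impI)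
    fix m n assume mn: "m \<ge> N" "n \<ge> N"
    have "(2 * E m + 2 * E n) + (2 * F m + 2 * F n) < 16 * d" using N[OF mn(1)] N[OF mn(2)] d by linarith
    then have "4 * pi * ((2 * E m + 2 * E n) + (2 * F m + 2 * F n)) < 4 * pi * (16 * d)" by simp
    also have "\<dots> = \<epsilon>" by (simp add: d_def)
    finally show "L2_inner (Lop a (\<lambda>x. cutQ m x - cutQ n x)) (\<lambda>x. cutQ m x - cutQ n x) < \<epsilon>" using le[of m n] by linarith
  qed
qed

lemma cutQ_form_approx: "form_approx (test_functions (- {0})) (Lop a) cutQ Q"
  unfolding form_approx_def using Q_L2 cutQ_test cutQ_L2_tendsto cutQ_form_cauchy by blast

lemma solves_Q: "solves a Q"
  unfolding solves_def
proof (intro exI[of _ HQ] conjI)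
  show "AE x in lborel. - HQ x - Q x + (Q x) ^ 3 = 0" by (simp add: HQ_def)
  interpret nonneg_form "test_functions (- {0})" "Lop a" by (rule Lop_form) (use a in simp)
  show "H_a a Q HQ" unfolding H_a_Lop
  proof (rule friedrichsI[OF cutQ_form_approx HQ_L2])
    fix \<psi> assume psi: "\<psi> \<in> test_functions (- {0})"
    obtain K where K: "compact K" "K \<subseteq> - {0}" "\<And>x. x \<notin> K \<Longrightarrow> \<psi> x = 0" using test_function_support[OF psi] by blast
    obtain \<rho> where \<rho>: "\<And>x. x \<in> K \<Longrightarrow> norm x \<le> \<rho>" using compact_imp_bounded[OF K(1)] unfolding bounded_iff by blast
    \<comment> \<open>The support of \<psi> is bounded and keeps a positive distance from the
      origin. From some n on the cutoff equals 1 around it, so the operator applied to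
      \<open>cutQ n\<close> is exactly \<open>HQ\<close> there.\<close>
    have "\<exists>\<delta>>0. \<forall>x\<in>K. \<delta> \<le> norm x"
    proof (cases "K = {}")
      case True then show ?thesis by (intro exI[of _ 1]) auto
    next
      case False
      have "continuous_on K (norm :: R3 \<Rightarrow> real)" by (intro continuous_intros)
      then obtain x0 where "x0 \<in> K" "\<forall>y\<in>K. norm x0 \<le> norm y" using continuous_attains_inf[OF K(1) False] by blast
      then show ?thesis using K(2) by (intro exI[of _ "norm x0"]) auto
    qed
    then obtain \<delta> where \<delta>: "\<delta> > 0" "\<And>x. x \<in> K \<Longrightarrow> \<delta> \<le> norm x" by blast
    have "eventually (\<lambda>n. 2 / real (Suc n) < \<delta> \<and> \<delta> < real (Suc n)) sequentially" by (rule eventually_cut_1[OF \<delta>(1)])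
    moreover have "eventually (\<lambda>n. 2 / real (Suc n) < max \<rho> 1 \<and> max \<rho> 1 < real (Suc n)) sequentially" by (rule eventually_cut_1) simp
    ultimately show "eventually (\<lambda>n. L2_inner (Lop a (cutQ n)) \<psi> = L2_inner HQ \<psi>) sequentially"
    proof eventually_elim
      case (elim n)
      have "(\<lambda>x. Lop a (cutQ n) x * \<psi> x) = (\<lambda>x. HQ x * \<psi> x)"
      proof (rule ext)
      fix x show "Lop a (cutQ n) x * \<psi> x = HQ x * \<psi> x"
      proof (cases "x \<in> K")
        case True
        have x: "x \<noteq> 0" using True K by auto
        have r: "2 / real (Suc n) < norm x" "norm x < real (Suc n)" using elim \<delta>(2)[OF True] \<rho>[OF True] by auto
        have "cut n (norm x) = 1" using r by (intro cut_1) auto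
        then show ?thesis unfolding cutQ_def cut_lift(2)[OF is_cut_cut x] using cut_1_derivs[OF r] by simp
      qed (use K in simp)
      qed
      then show ?case unfolding L2_inner_def by (simp only:)
    qed
  qed
qed

text \<open>The classical gradient is the weak one, but now test functions may live at the origin.
  The identity is proved for \<open>cutQ n\<close> and passed to the limit; the gradient of Q and
  the error term from \<open>dcut n\<close> are both dominated by the square integrable k.\<close>

lemma Q_H1: "Q \<in> H1"
  unfolding H1_def
proof (intro CollectI conjI allI Q_L2)
  fix i :: 3
  obtain c where c: "c > 0" "\<And>n r. r > 0 \<Longrightarrow> \<bar>dcut n r * u r\<bar> \<le> c * exp (- (1/4) * r)"
    "\<And>r. r > 0 \<Longrightarrow> \<bar>u' r\<bar> + u r / r \<le> c * exp (- (1/4) * r)" using dcut_u_bound by metis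
  define g where "g = (\<lambda>x::R3. (u' (norm x) / norm x - u (norm x) / (norm x)\<^sup>2) * (x $ i / norm x))"
  define k where "k = (\<lambda>x::R3. c * exp (- (1/4) * norm x) / norm x)"
  have gk: "\<bar>g x\<bar> \<le> k x" if x: "x \<noteq> 0" for x
  proof -
    have n: "norm x > 0" using x by simp
    have 1: "\<bar>x $ i / norm x\<bar> \<le> 1" using component_le_norm_cart[of x i] n by (simp add: abs_divide)
    have "u' (norm x) / norm x - u (norm x) / (norm x)\<^sup>2 = (u' (norm x) - u (norm x) / norm x) / norm x"
      by (simp add: diff_divide_distrib power2_eq_square)
    then have "\<bar>u' (norm x) / norm x - u (norm x) / (norm x)\<^sup>2\<bar> = \<bar>u' (norm x) - u (norm x) / norm x\<bar> / norm x"
      by (simp only: abs_divide abs_norm_cancel)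
    also have "\<dots> \<le> (\<bar>u' (norm x)\<bar> + u (norm x) / norm x) / norm x"
    proof (rule divide_right_mono)
      have "0 \<le> u (norm x) / norm x" using upos[OF n] n by simp
      then show "\<bar>u' (norm x) - u (norm x) / norm x\<bar> \<le> \<bar>u' (norm x)\<bar> + u (norm x) / norm x" by linarith
    qed simp
    also have "\<dots> \<le> k x" unfolding k_def using c(3)[OF n] by (intro divide_right_mono) auto
    finally have "\<bar>g x\<bar> \<le> k x * 1" unfolding g_def abs_mult using 1 by (intro mult_mono) auto
    then show ?thesis by simp
  qed
  have gm: "g \<in> borel_measurable borel"
  proof -
    have 1: "(\<lambda>x::R3. indicator {0<..} (norm x) * (u' (norm x) / norm x - u (norm x) / (norm x)\<^sup>2)) \<in> borel_measurable borel"
      by (rule measurable_compose[OF _ indicator_continuous_measurable]) (auto intro!: continuous_intros cont)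
    have e: "g = (\<lambda>x. indicator {0<..} (norm x) * (u' (norm x) / norm x - u (norm x) / (norm x)\<^sup>2) * (x $ i / norm x))"
      by (auto simp: g_def indicator_def fun_eq_iff)
    show ?thesis unfolding e using 1 by measurable
  qed
  have km: "k \<in> borel_measurable borel" unfolding k_def by measurable
  have ksq: "(k x)\<^sup>2 = c\<^sup>2 * exp (- (1/2) * norm x) / (norm x)\<^sup>2" for x
    by (simp add: k_def power_divide power_mult_distrib exp_double[symmetric])
  have kL2: "k \<in> L2"
    using km integrable_radial_majorant[of "\<lambda>x. (k x)\<^sup>2" "c\<^sup>2"] by (simp add: L2_def ksq)
  have "integrable lborel (\<lambda>x. (g x)\<^sup>2)"
  proof (rule integrable_radial_majorant)
    fix x :: R3 assume x: "x \<noteq> 0"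
    have "(g x)\<^sup>2 \<le> (k x)\<^sup>2" using gk[OF x] by (metis abs_ge_zero power2_abs power_mono)
    then show "\<bar>(g x)\<^sup>2\<bar> \<le> c\<^sup>2 * exp (- (1/2) * norm x) / (norm x)\<^sup>2" by (simp only: ksq abs_power2)
  qed (use gm in measurable)
  then have gL2: "g \<in> L2" using gm by (simp add: L2_def)
  show "\<exists>g\<in>L2. \<forall>\<phi>\<in>test_functions UNIV. L2_inner Q (partial i \<phi>) = - L2_inner g \<phi>"
  proof (intro bexI[OF _ gL2] ballI)
    fix \<phi> assume phi: "\<phi> \<in> test_functions UNIV"
    have phL2: "\<phi> \<in> L2" by (rule test_function_L2[OF phi])
    have "(\<lambda>n. L2_inner (cutQ n) (partial i \<phi>)) \<longlonglongrightarrow> L2_inner Q (partial i \<phi>)"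
      by (intro L2_tendsto_inner cutQ_L2_tendsto test_function_L2[OF cutQ_test] Q_L2 test_function_L2[OF partial_test_function[OF phi]])
    moreover have "L2_inner (cutQ n) (partial i \<phi>) = - L2_inner (partial i (cutQ n)) \<phi>" for n
      by (rule partial_by_parts[OF test_functions_mono[OF cutQ_test] phi])
    ultimately have 1: "(\<lambda>n. - L2_inner (partial i (cutQ n)) \<phi>) \<longlonglongrightarrow> L2_inner Q (partial i \<phi>)" by simp
    have pc: "partial i (cutQ n) x = cut n (norm x) * g x + dcut n (norm x) * u (norm x) / norm x * (x $ i / norm x)" if "x \<noteq> 0" for n x
      unfolding cutQ_def g_def by (rule cut_lift(3)[OF is_cut_cut that])
    have "(\<lambda>n. L2_inner (partial i (cutQ n)) \<phi>) \<longlonglongrightarrow> L2_inner g \<phi>"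
      unfolding L2_inner_def
    proof (rule integral_dominated_convergence[where w = "\<lambda>x. 2 * (k x * \<bar>\<phi> x\<bar>)"])
      have mp: "\<phi> \<in> borel_measurable borel" by (rule L2_measurable[OF phL2])
      show "(\<lambda>x. g x * \<phi> x) \<in> borel_measurable lborel" using gm mp by measurable
      have "partial i (cutQ n) \<in> borel_measurable borel" for n
        by (rule L2_measurable[OF test_function_L2[OF partial_test_function[OF cutQ_test]]])
      then show "(\<lambda>x. partial i (cutQ n) x * \<phi> x) \<in> borel_measurable lborel" for n using mp by measurable
      have "(\<lambda>x. \<bar>\<phi> x\<bar>) \<in> L2" using phL2 by (auto simp: L2_def)
      then show "integrable lborel (\<lambda>x. 2 * (k x * \<bar>\<phi> x\<bar>))" by (intro integrable_mult_right L2_mult_integrable kL2)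
      show "AE x in lborel. (\<lambda>n. partial i (cutQ n) x * \<phi> x) \<longlonglongrightarrow> g x * \<phi> x"
        using AE_lborel_singleton[of "0::R3"]
      proof eventually_elim
        case (elim x)
        have "(\<lambda>n. (cut n (norm x) * g x + dcut n (norm x) * u (norm x) / norm x * (x $ i / norm x)) * \<phi> x)
           \<longlonglongrightarrow> (1 * g x + 0 * u (norm x) / norm x * (x $ i / norm x)) * \<phi> x"
          by (intro tendsto_intros cut_tendsto) (use elim in auto)
        then show ?case by (simp add: pc[OF elim])
      qed
      show "AE x in lborel. norm (partial i (cutQ n) x * \<phi> x) \<le> 2 * (k x * \<bar>\<phi> x\<bar>)" for n
        using AE_lborel_singleton[of "0::R3"]
      proof eventually_elim
        case (elim x)
        have n: "norm x > 0" using elim by simp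
        have "\<bar>cut n (norm x) * g x\<bar> \<le> 1 * k x"
          unfolding abs_mult using cut_range[of n "norm x"] gk[OF elim] by (intro mult_mono) auto
        moreover have "\<bar>dcut n (norm x) * u (norm x) / norm x * (x $ i / norm x)\<bar> \<le> k x * 1"
        proof -
          have "\<bar>dcut n (norm x) * u (norm x) / norm x\<bar> \<le> k x"
            unfolding k_def abs_divide using c(2)[OF n, of n] by (simp add: divide_right_mono)
          moreover have "\<bar>x $ i / norm x\<bar> \<le> 1" using component_le_norm_cart[of x i] n by (simp add: abs_divide)
          moreover have "0 \<le> k x" using c(1) by (simp add: k_def)
          ultimately show ?thesis unfolding abs_mult[of "dcut n (norm x) * u (norm x) / norm x"] by (intro mult_mono) auto
        qed
        ultimately have "\<bar>partial i (cutQ n) x\<bar> \<le> 2 * k x" unfolding pc[OF elim] by linarith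
        then have "\<bar>partial i (cutQ n) x\<bar> * \<bar>\<phi> x\<bar> \<le> 2 * k x * \<bar>\<phi> x\<bar>" by (intro mult_right_mono) auto
        then show ?case by (simp add: abs_mult mult.assoc)
      qed
    qed
    from tendsto_minus[OF this] 1 show "L2_inner Q (partial i \<phi>) = - L2_inner g \<phi>"
      by (metis LIMSEQ_unique)
  qed
qed

theorem Q_solution: "nonneg_radial_solution a Q"
  unfolding nonneg_radial_solution_def
proof (intro conjI Q_H1 solves_Q)
  have pos: "Q x > 0" if "x \<noteq> 0" for x using upos[of "norm x"] that by (simp add: Q_def radial_lift_def)
  show "\<not> (AE x in lborel. Q x = 0)"
  proof
    assume "AE x in lborel. Q x = 0"
    with AE_lborel_singleton[of "0::R3"] have A: "AE x in (lborel :: R3 measure). False"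
      by eventually_elim (use pos in force)
    have "ae_filter (lborel :: R3 measure) \<noteq> bot" by (simp add: ae_filter_eq_bot_iff)
    from eventually_happens'[OF this A] show False by blast
  qed
  show "AE x in lborel. 0 \<le> Q x"
    using AE_lborel_singleton[of "0::R3"] by eventually_elim (use pos in \<open>force intro: less_imp_le\<close>)
  show "radial Q" unfolding radial_def by (intro exI[of _ "\<lambda>r. u r / r"]) (simp add: Q_def radial_lift_def)
qed

end

section \<open>The lemma of du Bois-Reymond on the half-line\<close>

text \<open>Smooth functions with compact support in the open half-line, extended by 0 to the whole
  line so that their derivatives exist everywhere.\<close>

definition bump_class :: "(real \<Rightarrow> real) set" where
  "bump_class = {f. (\<forall>k. diffable k UNIV f) \<and> (\<exists>p>0. \<exists>q>p. \<forall>r. r \<notin> {p..q} \<longrightarrow> f r = 0)}"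

definition loc_integrable :: "(real \<Rightarrow> real) \<Rightarrow> bool" where
  "loc_integrable d \<longleftrightarrow> (\<forall>p>0. \<forall>q. integrable lborel (\<lambda>r. indicator {p..q} r * d r))"

lemma bump_classD:
  assumes "f \<in> bump_class"
  obtains p q where "0 < p" "p < q" "\<And>r. r \<notin> {p..q} \<Longrightarrow> f r = 0"
  using assms by (auto simp: bump_class_def)

lemma bump_continuous: "f \<in> bump_class \<Longrightarrow> continuous_on S f"
  by (rule continuous_on_subset[of UNIV]) (auto simp: bump_class_def intro: diffable_imp_continuous)

lemma bump_diffable: "f \<in> bump_class \<Longrightarrow> diffable k UNIV f" by (simp add: bump_class_def)

lemma bump_bounded:
  assumes "f \<in> bump_class"
  obtains B where "B \<ge> 0" "\<And>r. \<bar>f r\<bar> \<le> B"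
proof -
  obtain p q where pq: "0 < p" "p < q" "\<And>r. r \<notin> {p..q} \<Longrightarrow> f r = 0" using bump_classD[OF assms] by blast
  have "bounded (f ` {p..q})" by (intro compact_imp_bounded compact_continuous_image bump_continuous assms) auto
  then obtain B where B: "\<forall>y\<in>f ` {p..q}. \<bar>y\<bar> \<le> B" unfolding bounded_iff real_norm_def by blast
  have "\<bar>f r\<bar> \<le> max B 0" for r
  proof (cases "r \<in> {p..q}")
    case True
    then have "\<bar>f r\<bar> \<le> B" using B by blast
    then show ?thesis by simp
  qed (simp add: pq(3))
  then show thesis by (intro that[of "max B 0"]) auto
qed

lemma bump_combine:
  assumes "f \<in> bump_class" "g \<in> bump_class"
  shows "(\<lambda>r. f r - c * g r) \<in> bump_class"
proof -
  obtain p q where pq: "0 < p" "p < q" "\<And>r. r \<notin> {p..q} \<Longrightarrow> f r = 0" using bump_classD[OF assms(1)] by blast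
  obtain p' q' where pq': "0 < p'" "p' < q'" "\<And>r. r \<notin> {p'..q'} \<Longrightarrow> g r = 0" using bump_classD[OF assms(2)] by blast
  have "f r - c * g r = 0" if "r \<notin> {min p p'..max q q'}" for r
  proof -
    have "r \<notin> {p..q}" "r \<notin> {p'..q'}" using that by auto
    then show ?thesis using pq(3) pq'(3) by simp
  qed
  moreover have "min p p' > 0" "max q q' > min p p'" using pq(1,2) pq'(1,2) by auto
  ultimately have "\<exists>p>0. \<exists>q>p. \<forall>r. r \<notin> {p..q} \<longrightarrow> f r - c * g r = 0" by blast
  moreover have "diffable k UNIV (\<lambda>r. f r - c * g r)" for k
    by (rule diffable_diff[OF bump_diffable[OF assms(1)] diffable_cmult[OF bump_diffable[OF assms(2)]]])
  ultimately show ?thesis unfolding bump_class_def by blast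
qed

lemma bump_times_id: "f \<in> bump_class \<Longrightarrow> (\<lambda>r. r * f r) \<in> bump_class"
  unfolding bump_class_def by (auto intro!: diffable_mult diffable_id)

lemma bump_deriv:
  assumes f: "f \<in> bump_class" and d: "\<And>r. (f has_real_derivative f' r) (at r)"
  shows "f' \<in> bump_class"
proof -
  obtain p q where pq: "0 < p" "p < q" "\<And>r. r \<notin> {p..q} \<Longrightarrow> f r = 0" using bump_classD[OF f] by blast
  have z: "f' r = 0" if r: "r \<notin> {p..q}" for r
    by (rule deriv_zero_outside[OF pq(3) d r])
  have "diffable k UNIV f'" for k by (rule diffable_deriv[OF open_UNIV bump_diffable[OF f]]) (rule d)
  then show ?thesis using pq(1,2) z unfolding bump_class_def by blast
qed

lemma bump_integral_eq:
  assumes f: "f \<in> bump_class" and pq: "\<And>r. r \<notin> {p..q} \<Longrightarrow> f r = 0" and s: "s \<le> p" "q \<le> t"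
  shows "(\<integral>r. f r \<partial>lborel) = integral {s..t} f" "integrable lborel f"
proof -
  have i: "set_integrable lborel {s..t} f" by (rule borel_integrable_atLeastAtMost') (rule bump_continuous[OF f])
  have e: "(\<lambda>r. indicator {s..t} r *\<^sub>R f r) = f"
  proof
    fix r
    show "indicator {s..t} r *\<^sub>R f r = f r"
    proof (cases "r \<in> {s..t}")
      case False
      then have "r \<notin> {p..q}" using s by auto
      then show ?thesis by (simp add: pq)
    qed simp
  qed
  show "integrable lborel f" using i unfolding set_integrable_def e .
  show "(\<integral>r. f r \<partial>lborel) = integral {s..t} f"
    using set_borel_integral_eq_integral(2)[OF i] unfolding set_lebesgue_integral_def e .
qed

lemma bump_integrable: "f \<in> bump_class \<Longrightarrow> integrable lborel f"
  by (meson bump_classD bump_integral_eq(2) order_refl)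

lemma bump_integral_deriv:
  assumes f: "f \<in> bump_class" and d: "\<And>r. (f has_real_derivative f' r) (at r)"
  shows "(\<integral>r. f' r \<partial>lborel) = 0"
proof -
  obtain p q where pq: "0 < p" "p < q" "\<And>r. r \<notin> {p..q} \<Longrightarrow> f r = 0" using bump_classD[OF f] by blast
  have f': "f' \<in> bump_class" by (rule bump_deriv[OF f d])
  have z: "f' r = 0" if r: "r \<notin> {p..q}" for r
    by (rule deriv_zero_outside[OF pq(3) d r])
  have "(f' has_integral (f (q + 1) - f (p / 2))) {p/2..q+1}"
    by (rule fundamental_theorem_of_calculus)
       (use pq d in \<open>auto simp: has_real_derivative_iff_has_vector_derivative[symmetric] intro: has_field_derivative_at_within\<close>)
  moreover have "f (q + 1) = 0" "f (p/2) = 0" using pq by auto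
  ultimately have "integral {p/2..q+1} f' = 0" by (simp add: integral_unique)
  then show ?thesis using bump_integral_eq(1)[of f' p q "p/2" "q+1", OF f' z] pq by simp
qed

text \<open>The antiderivative started left of the support vanishes again on its right because the
  integral of f is 0.\<close>

lemma bump_antideriv:
  assumes f: "f \<in> bump_class" and i: "(\<integral>r. f r \<partial>lborel) = 0"
  obtains g where "g \<in> bump_class" "\<And>r. (g has_real_derivative f r) (at r)"
proof -
  obtain p q where pq: "0 < p" "p < q" "\<And>r. r \<notin> {p..q} \<Longrightarrow> f r = 0" using bump_classD[OF f] by blast
  define g where "g = (\<lambda>r. integral {p/2..r} f)"
  have g0: "g r = 0" if "r < p" for r
  proof -
    have "integral {p/2..r} f = integral {p/2..r} (\<lambda>_. 0)"
      by (intro Henstock_Kurzweil_Integration.integral_cong pq) (use that in auto)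
    then show ?thesis by (simp add: g_def)
  qed
  have g1: "g r = 0" if "r > q" for r
    using bump_integral_eq(1)[of f p q "p/2" r, OF f pq(3)] i that pq by (simp add: g_def)
  have d: "(g has_real_derivative f r) (at r)" for r
  proof (cases "r < p")
    case True
    have "(g has_real_derivative 0) (at r)"
      by (rule has_field_derivative_transform_within_open[of "\<lambda>_. 0" _ _ "{..<p}"]) (use True g0 in auto)
    then show ?thesis using pq(3)[of r] True by simp
  next
    case False
    then have r: "p/2 < r" using pq by simp
    have "(g has_real_derivative f r) (at r within {p/2..r+1})"
      unfolding g_def using r by (intro integral_has_real_derivative bump_continuous f) auto
    then show ?thesis using r by (simp add: at_within_Icc_at)
  qed
  have "diffable k UNIV g" for k
    by (rule diffable_Suc_imp, rule diffable_SucI[OF d bump_diffable[OF f]])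
  moreover have "g r = 0" if "r \<notin> {p..q}" for r using g0 g1 that by force
  ultimately have "g \<in> bump_class" using pq(1,2) unfolding bump_class_def by blast
  with d show thesis using that by blast
qed

lemma loc_integrable_mult_bump:
  assumes d: "loc_integrable d" and f: "f \<in> bump_class"
  shows "integrable lborel (\<lambda>r. d r * f r)"
proof -
  obtain p q where pq: "0 < p" "p < q" "\<And>r. r \<notin> {p..q} \<Longrightarrow> f r = 0" using bump_classD[OF f] by blast
  obtain B where B: "B \<ge> 0" "\<And>r. \<bar>f r\<bar> \<le> B" using bump_bounded[OF f] by blast
  have i: "integrable lborel (\<lambda>r. indicator {p..q} r * d r)" using d pq by (auto simp: loc_integrable_def)
  have e: "d r * f r = (indicator {p..q} r * d r) * f r" for r using pq(3) by (cases "r \<in> {p..q}") auto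
  have fm: "f \<in> borel_measurable lborel" using borel_measurable_continuous_onI[OF bump_continuous[OF f]] by simp
  show ?thesis unfolding e
  proof (rule Bochner_Integration.integrable_bound)
    show "integrable lborel (\<lambda>r. B * (indicator {p..q} r * d r))" by (intro integrable_mult_right i)
    show "(\<lambda>r. indicator {p..q} r * d r * f r) \<in> borel_measurable lborel"
      by (rule borel_measurable_times[OF borel_measurable_integrable[OF i] fm])
    have "\<bar>indicator {p..q} r * d r\<bar> * \<bar>f r\<bar> \<le> \<bar>indicator {p..q} r * d r\<bar> * B" for r
      using B by (intro mult_left_mono) auto
    then show "AE r in lborel. norm (indicator {p..q} r * d r * f r) \<le> norm (B * (indicator {p..q} r * d r))"
      using B by (simp add: abs_mult mult_ac)
  qed
qed

lemma loc_integrable_continuous: "continuous_on {0<..} d \<Longrightarrow> loc_integrable d"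
  unfolding loc_integrable_def
proof (intro allI impI)
  fix p q :: real assume c: "continuous_on {0<..} d" and p: "p > 0"
  have "set_integrable lborel {p..q} d"
    by (rule borel_integrable_atLeastAtMost', rule continuous_on_subset[OF c]) (use p in auto)
  then show "integrable lborel (\<lambda>r. indicator {p..q} r * d r)" by (simp add: set_integrable_def)
qed

lemma loc_integrable_diff: "\<lbrakk>loc_integrable d; loc_integrable e\<rbrakk> \<Longrightarrow> loc_integrable (\<lambda>r. d r - e r)"
  unfolding loc_integrable_def right_diff_distrib by auto

section \<open>Orthogonality to test functions\<close>

definition plateau :: "nat \<Rightarrow> real \<Rightarrow> real \<Rightarrow> real \<Rightarrow> real" where
  "plateau n p q r = sstep (real n * (r - p)) * sstep (real n * (q - r))"

lemma plateau_bump: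
  assumes "0 < p" "p < q"
  shows "plateau n p q \<in> bump_class"
proof -
  have "diffable k UNIV (plateau n p q)" for k
  proof -
    have "diffable k UNIV (\<lambda>r. sstep (real n * (r - p)))"
      by (rule diffable_compose[OF diffable_sstep diffable_cmult[OF diffable_diff[OF diffable_id diffable_const]]]) simp
    moreover have "diffable k UNIV (\<lambda>r. sstep (real n * (q - r)))"
      by (rule diffable_compose[OF diffable_sstep diffable_cmult[OF diffable_diff[OF diffable_const diffable_id]]]) simp
    ultimately show ?thesis unfolding plateau_def[abs_def] by (rule diffable_mult)
  qed
  moreover have "plateau n p q r = 0" if r: "r \<notin> {p..q}" for r
  proof -
    consider "r < p" | "r > q" using r by force
    then show ?thesis
    proof cases
      case 1
      then have "real n * (r - p) \<le> 0" by (intro mult_nonneg_nonpos) auto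
      then show ?thesis by (simp only: plateau_def sstep_0 mult_zero_left)
    next
      case 2
      then have "real n * (q - r) \<le> 0" by (intro mult_nonneg_nonpos) auto
      then show ?thesis by (simp only: plateau_def sstep_0 mult_zero_right)
    qed
  qed
  ultimately show ?thesis using assms unfolding bump_class_def by blast
qed

lemma plateau_range: "0 \<le> plateau n p q r" "plateau n p q r \<le> 1"
  unfolding plateau_def using sstep_range by (auto intro: mult_le_one)

lemma plateau_tendsto: "(\<lambda>n. plateau n p q r) \<longlonglongrightarrow> indicator {p<..<q} r"
proof -
  have ev: "eventually (\<lambda>n. real n * x \<ge> 1) sequentially" if "x > 0" for x :: real
  proof -
    have "filterlim (\<lambda>n. real n * x) at_top sequentially"
      using that by (intro filterlim_at_top_mult_tendsto_pos[OF tendsto_const _ filterlim_real_sequentially]) auto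
    then show ?thesis by (auto simp: filterlim_at_top)
  qed
  consider "r \<le> p" | "q \<le> r" | "p < r" "r < q" by linarith
  then show ?thesis
  proof cases
    case 1
    then have "real n * (r - p) \<le> 0" for n by (intro mult_nonneg_nonpos) auto
    then have "plateau n p q r = 0" for n by (simp only: plateau_def sstep_0 mult_zero_left)
    then show ?thesis using 1 by simp
  next
    case 2
    then have "real n * (q - r) \<le> 0" for n by (intro mult_nonneg_nonpos) auto
    then have "plateau n p q r = 0" for n by (simp only: plateau_def sstep_0 mult_zero_right)
    then show ?thesis using 2 by simp
  next
    case 3
    then have "eventually (\<lambda>n. real n * (r - p) \<ge> 1 \<and> real n * (q - r) \<ge> 1) sequentially" by (intro eventually_conj ev) auto
    then have "eventually (\<lambda>n. plateau n p q r = 1) sequentially"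
      by eventually_elim (simp add: plateau_def sstep_1)
    then show ?thesis using 3 by (intro tendsto_eventually) simp
  qed
qed

text \<open>The positive and negative parts are densities of finite measures that agree on all
  half-lines. The measures coincide, and so do the densities almost everywhere.\<close>

lemma AE_zero_if_interval_integrals_zero:
  fixes e :: "real \<Rightarrow> real"
  assumes i: "integrable lborel e" and z: "\<And>x. (\<integral>r. indicator {x<..} r * e r \<partial>lborel) = 0"
  shows "AE r in lborel. e r = 0"
proof -
  define P N where "P = (\<lambda>r. max (e r) 0)" and "N = (\<lambda>r. max (- e r) 0)"
  have iP: "integrable lborel P" "integrable lborel N" unfolding P_def N_def using i by (auto intro: integrable_max)
  have mP: "P \<in> borel_measurable lborel" "N \<in> borel_measurable lborel" using iP by auto
  have em: "emeasure (density lborel (\<lambda>r. ennreal (g r))) {x<..} = ennreal (\<integral>r. indicator {x<..} r * g r \<partial>lborel)"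
    if g: "integrable lborel g" "\<And>r. 0 \<le> g r" for g :: "real \<Rightarrow> real" and x
  proof -
    have ig: "integrable lborel (\<lambda>r. indicator {x<..} r * g r)"
      by (rule Bochner_Integration.integrable_bound[OF g(1)]) (use g in \<open>auto simp: indicator_def intro!: always_eventually\<close>)
    have "emeasure (density lborel (\<lambda>r. ennreal (g r))) {x<..} = (\<integral>\<^sup>+r. ennreal (g r) * indicator {x<..} r \<partial>lborel)"
      by (subst emeasure_density) (use g in auto)
    also have "\<dots> = (\<integral>\<^sup>+r. ennreal (indicator {x<..} r * g r) \<partial>lborel)"
      by (intro nn_integral_cong) (auto simp: indicator_def)
    also have "\<dots> = ennreal (\<integral>r. indicator {x<..} r * g r \<partial>lborel)"
      by (rule nn_integral_eq_integral[OF ig]) (use g in auto)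
    finally show ?thesis .
  qed
  have nn: "0 \<le> P r" "0 \<le> N r" for r by (auto simp: P_def N_def)
  have "density lborel (\<lambda>r. ennreal (P r)) = density lborel (\<lambda>r. ennreal (N r))"
  proof (rule measure_eqI_lessThan)
    fix x
    show "emeasure (density lborel (\<lambda>r. ennreal (P r))) {x<..} < \<infinity>" by (simp add: em[OF iP(1) nn(1)])
    have ii: "integrable lborel (\<lambda>r. indicator {x<..} r * P r)" "integrable lborel (\<lambda>r. indicator {x<..} r * N r)"
      by (rule Bochner_Integration.integrable_bound[OF iP(1)], use iP in \<open>auto simp: indicator_def intro!: always_eventually\<close>)
         (rule Bochner_Integration.integrable_bound[OF iP(2)], use iP in \<open>auto simp: indicator_def intro!: always_eventually\<close>)
    have "indicator {x<..} r * P r - indicator {x<..} r * N r = indicator {x<..} r * e r" for r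
      by (auto simp: P_def N_def max_def indicator_def)
    then have "(\<integral>r. indicator {x<..} r * P r \<partial>lborel) - (\<integral>r. indicator {x<..} r * N r \<partial>lborel) = (\<integral>r. indicator {x<..} r * e r \<partial>lborel)"
      using Bochner_Integration.integral_diff[OF ii] by simp
    then show "emeasure (density lborel (\<lambda>r. ennreal (P r))) {x<..} = emeasure (density lborel (\<lambda>r. ennreal (N r))) {x<..}"
      using z[of x] by (simp add: em[OF iP(1) nn(1)] em[OF iP(2) nn(2)])
  qed auto
  then have "AE r in lborel. ennreal (P r) = ennreal (N r)"
    by (subst (asm) sigma_finite_measure.density_unique_iff[OF sigma_finite_lborel]) (use mP in auto)
  then show ?thesis
  proof eventually_elim
    case (elim r)
    then have "P r = N r" using nn by (simp add: ennreal_inj)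
    then show ?case by (auto simp: P_def N_def max_def split: if_splits)
  qed
qed

text \<open>Plateaus converge boundedly to the indicator of (p, q), so all interval integrals
  vanish; countably many intervals exhaust the half-line.\<close>

lemma AE_zero_if_orthogonal:
  assumes e: "loc_integrable e" and o: "\<And>f. f \<in> bump_class \<Longrightarrow> (\<integral>r. e r * f r \<partial>lborel) = 0"
  shows "AE r in lborel. r > 0 \<longrightarrow> e r = 0"
proof -
  have ivl: "(\<integral>r. indicator {p<..<q} r * e r \<partial>lborel) = 0" if pq: "0 < p" "p < q" for p q
  proof -
    have i: "integrable lborel (\<lambda>r. indicator {p..q} r * e r)" using e pq by (auto simp: loc_integrable_def)
    have eqn: "e r * plateau n p q r = (indicator {p..q} r * e r) * plateau n p q r" for r n
    proof (cases "r \<in> {p..q}")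
      case False
      then consider "r < p" | "r > q" by force
      then have "plateau n p q r = 0"
      proof cases
        case 1
        then have "real n * (r - p) \<le> 0" by (intro mult_nonneg_nonpos) auto
        then show ?thesis by (simp only: plateau_def sstep_0 mult_zero_left)
      next
        case 2
        then have "real n * (q - r) \<le> 0" by (intro mult_nonneg_nonpos) auto
        then show ?thesis by (simp only: plateau_def sstep_0 mult_zero_right)
      qed
      then show ?thesis by simp
    qed simp
    have pm: "plateau n p q \<in> borel_measurable lborel" for n
      using borel_measurable_continuous_onI[OF bump_continuous[OF plateau_bump[OF pq]]] by simp
    have em: "(\<lambda>r. indicator {p..q} r * e r) \<in> borel_measurable lborel" using i by auto
    have "(\<lambda>n. \<integral>r. (indicator {p..q} r * e r) * plateau n p q r \<partial>lborel) \<longlonglongrightarrow> (\<integral>r. (indicator {p..q} r * e r) * indicator {p<..<q} r \<partial>lborel)"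
    proof (rule integral_dominated_convergence[OF _ _ integrable_norm[OF i]])
      show "(\<lambda>r. indicator {p..q} r * e r * indicator {p<..<q} r) \<in> borel_measurable lborel"
        by (rule borel_measurable_times[OF em borel_measurable_indicator]) simp
      show "(\<lambda>r. indicator {p..q} r * e r * plateau n p q r) \<in> borel_measurable lborel" for n
        by (rule borel_measurable_times[OF em pm])
      show "AE r in lborel. (\<lambda>n. indicator {p..q} r * e r * plateau n p q r) \<longlonglongrightarrow> indicator {p..q} r * e r * indicator {p<..<q} r"
        by (intro always_eventually allI tendsto_mult tendsto_const plateau_tendsto)
      show "AE r in lborel. norm (indicator {p..q} r * e r * plateau n p q r) \<le> norm (indicator {p..q} r * e r)" for n
      proof (intro always_eventually allI)
        fix r
        have "\<bar>indicator {p..q} r * e r\<bar> * \<bar>plateau n p q r\<bar> \<le> \<bar>indicator {p..q} r * e r\<bar> * 1"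
          using plateau_range[of n p q r] by (intro mult_left_mono) auto
        then show "norm (indicator {p..q} r * e r * plateau n p q r) \<le> norm (indicator {p..q} r * e r)" by (simp add: abs_mult)
      qed
    qed
    moreover have "(\<integral>r. (indicator {p..q} r * e r) * plateau n p q r \<partial>lborel) = 0" for n
      using o[OF plateau_bump[OF pq, of n]] by (simp only: eqn)
    ultimately have "(\<integral>r. (indicator {p..q} r * e r) * indicator {p<..<q} r \<partial>lborel) = 0" by (simp add: LIMSEQ_const_iff)
    moreover have "(indicator {p..q} r * e r) * indicator {p<..<q} r = indicator {p<..<q} r * e r" for r by (auto simp: indicator_def)
    ultimately show ?thesis by simp
  qed
  have loc: "AE r in lborel. indicator {p<..<q} r * e r = 0" if pq: "0 < p" "p < q" for p q
  proof (rule AE_zero_if_interval_integrals_zero)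
    have i: "integrable lborel (\<lambda>r. indicator {p..q} r * e r)" using e pq by (auto simp: loc_integrable_def)
    have "integrable lborel (\<lambda>r. indicator {p<..<q} r * (indicator {p..q} r * e r))"
      by (rule Bochner_Integration.integrable_bound[OF i]) (use i in \<open>auto simp: indicator_def intro!: always_eventually\<close>)
    moreover have "indicator {p<..<q} r * (indicator {p..q} r * e r) = indicator {p<..<q} r * e r" for r by (auto simp: indicator_def)
    ultimately show "integrable lborel (\<lambda>r. indicator {p<..<q} r * e r)" by simp
    fix x
    have eq: "indicator {x<..} r * (indicator {p<..<q} r * e r) = indicator {max x p<..<q} r * e r" for r by (auto simp: indicator_def)
    show "(\<integral>r. indicator {x<..} r * (indicator {p<..<q} r * e r) \<partial>lborel) = 0"
      unfolding eq using ivl[of "max x p" q] pq by (cases "max x p < q") auto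
  qed
  have "AE r in lborel. \<forall>n. indicator {1 / real (Suc n)<..<real (Suc n) + 1} r * e r = 0"
    unfolding AE_all_countable
  proof
    fix n
    have "1 / real (Suc n) \<le> 1" by simp
    then have "1 / real (Suc n) < real (Suc n) + 1" by linarith
    then show "AE r in lborel. indicator {1 / real (Suc n)<..<real (Suc n) + 1} r * e r = 0" by (intro loc) simp_all
  qed
  then show ?thesis
  proof eventually_elim
    case (elim r)
    show ?case
    proof
      assume r: "r > 0"
      obtain n1 where n1: "1 / real (Suc n1) < r" using reals_Archimedean[OF r] by (auto simp: inverse_eq_divide)
      obtain n2 where n2: "r < real n2" using reals_Archimedean2 by blast
      define n where "n = max n1 n2"
      have "1 / real (Suc n) \<le> 1 / real (Suc n1)" by (intro divide_left_mono) (auto simp: n_def)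
      then have "r \<in> {1 / real (Suc n)<..<real (Suc n) + 1}" using n1 n2 by (auto simp: n_def)
      then show "e r = 0" using elim[rule_format, of n] by simp
    qed
  qed
qed

lemma unit_bump: obtains b where "b \<in> bump_class" "(\<integral>r. b r \<partial>lborel) = 1"
proof -
  define c where "c = plateau 1 1 4"
  have c: "c \<in> bump_class" unfolding c_def by (rule plateau_bump) auto
  have ic: "integrable lborel c" by (rule bump_integrable[OF c])
  have "(\<integral>r. indicator {2..3::real} r \<partial>lborel) \<le> (\<integral>r. c r \<partial>lborel)"
  proof (rule integral_mono)
    show "integrable lborel (indicator {2..3::real} :: real \<Rightarrow> real)" by (simp add: integrable_indicator_iff)
    show "indicator {2..3} r \<le> c r" for r :: real
      using plateau_range[of 1 1 4 r] by (auto simp: c_def plateau_def indicator_def sstep_1)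
  qed (rule ic)
  moreover have "(\<integral>r. indicator {2..3::real} r \<partial>lborel) = (1::real)" by simp
  ultimately have pos: "(\<integral>r. c r \<partial>lborel) \<ge> 1" by simp
  define k where "k = (\<integral>r. c r \<partial>lborel)"
  \<comment> \<open>This is c/k, written in the shape that \<open>bump_combine\<close>
    provides.\<close>
  have "(\<lambda>r. c r - (1 - 1/k) * c r) \<in> bump_class" by (rule bump_combine[OF c c])
  moreover have "(\<integral>r. c r - (1 - 1/k) * c r \<partial>lborel) = 1"
    using ic pos by (simp add: k_def[symmetric] algebra_simps)
  ultimately show thesis by (rule that)
qed

text \<open>After subtraction of a multiple of a unit bump b, a test function has integral 0 and is
  the derivative of another one. So d acts on test functions like the constant \<integral> d
  b.\<close>

lemma du_bois_reymond_1:
  assumes d: "loc_integrable d" and o: "\<And>f f'. \<lbrakk>f \<in> bump_class; \<And>r. (f has_real_derivative f' r) (at r)\<rbrakk> \<Longrightarrow> (\<integral>r. d r * f' r \<partial>lborel) = 0"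
  shows "\<exists>c. AE r in lborel. r > 0 \<longrightarrow> d r = c"
proof -
  obtain b where b: "b \<in> bump_class" "(\<integral>r. b r \<partial>lborel) = 1" using unit_bump by blast
  define c where "c = (\<integral>r. d r * b r \<partial>lborel)"
  have lc: "loc_integrable (\<lambda>r. c)" by (intro loc_integrable_continuous continuous_intros)
  have "AE r in lborel. r > 0 \<longrightarrow> d r - c = 0"
  proof (rule AE_zero_if_orthogonal[OF loc_integrable_diff[OF d lc]])
    fix f assume f: "f \<in> bump_class"
    define m where "m = (\<integral>r. f r \<partial>lborel)"
    have fm: "(\<lambda>r. f r - m * b r) \<in> bump_class" by (rule bump_combine[OF f b(1)])
    have "(\<integral>r. f r - m * b r \<partial>lborel) = 0"
      using bump_integrable[OF f] bump_integrable[OF b(1)] b(2) by (simp add: m_def)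
    then obtain g where g: "g \<in> bump_class" "\<And>r. (g has_real_derivative f r - m * b r) (at r)" using bump_antideriv[OF fm] by blast
    have "0 = (\<integral>r. d r * (f r - m * b r) \<partial>lborel)" using o[OF g] by simp
    also have "\<dots> = (\<integral>r. d r * f r - m * (d r * b r) \<partial>lborel)" by (simp add: algebra_simps)
    also have "\<dots> = (\<integral>r. d r * f r \<partial>lborel) - m * c"
      using loc_integrable_mult_bump[OF d f] loc_integrable_mult_bump[OF d b(1)] by (simp add: c_def)
    finally have 1: "(\<integral>r. d r * f r \<partial>lborel) = m * c" by simp
    have "(\<integral>r. (d r - c) * f r \<partial>lborel) = (\<integral>r. d r * f r - c * f r \<partial>lborel)" by (simp add: algebra_simps)
    also have "\<dots> = m * c - c * m" using loc_integrable_mult_bump[OF d f] bump_integrable[OF f] 1 by (simp add: m_def)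
    finally show "(\<integral>r. (d r - c) * f r \<partial>lborel) = 0" by simp
  qed
  then show ?thesis by (intro exI[of _ c]) simp
qed

text \<open>Reduction to first order. For f with integral m, f - m b is a derivative, whence
  \<integral> d f' = m C with C = \<integral> d b'. Since \<integral> r f' = -m, the function d + C
  r is orthogonal to every f'.\<close>

lemma du_bois_reymond_2:
  assumes d: "loc_integrable d" and o: "\<And>f f' f''. \<lbrakk>f \<in> bump_class; \<And>r. (f has_real_derivative f' r) (at r); \<And>r. (f' has_real_derivative f'' r) (at r)\<rbrakk>
     \<Longrightarrow> (\<integral>r. d r * f'' r \<partial>lborel) = 0"
  shows "\<exists>c0 c1. AE r in lborel. r > 0 \<longrightarrow> d r = c0 + c1 * r"
proof -
  obtain b where b: "b \<in> bump_class" "(\<integral>r. b r \<partial>lborel) = 1" using unit_bump by blast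
  obtain b' where b': "\<And>r. (b has_real_derivative b' r) (at r)" using bump_diffable[OF b(1), of "Suc 0"] by auto
  have b'b: "b' \<in> bump_class" by (rule bump_deriv[OF b(1) b'])
  define C where "C = (\<integral>r. d r * b' r \<partial>lborel)"
  have lC: "loc_integrable (\<lambda>r. (- C) * r)" by (intro loc_integrable_continuous continuous_intros)
  have "\<exists>c. AE r in lborel. r > 0 \<longrightarrow> d r - (- C) * r = c"
  proof (rule du_bois_reymond_1[OF loc_integrable_diff[OF d lC]])
    fix f f' assume f: "f \<in> bump_class" and f': "\<And>r. (f has_real_derivative f' r) (at r)"
    have f'b: "f' \<in> bump_class" by (rule bump_deriv[OF f f'])
    define m where "m = (\<integral>r. f r \<partial>lborel)"
    have fm: "(\<lambda>r. f r - m * b r) \<in> bump_class" by (rule bump_combine[OF f b(1)])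
    have "(\<integral>r. f r - m * b r \<partial>lborel) = 0"
      using bump_integrable[OF f] bump_integrable[OF b(1)] b(2) by (simp add: m_def)
    then obtain g where g: "g \<in> bump_class" "\<And>r. (g has_real_derivative f r - m * b r) (at r)" using bump_antideriv[OF fm] by blast
    have "0 = (\<integral>r. d r * (f' r - m * b' r) \<partial>lborel)" using o[OF g DERIV_diff[OF f' DERIV_cmult[OF b']]] by simp
    also have "\<dots> = (\<integral>r. d r * f' r - m * (d r * b' r) \<partial>lborel)" by (simp add: algebra_simps)
    also have "\<dots> = (\<integral>r. d r * f' r \<partial>lborel) - m * C"
      using loc_integrable_mult_bump[OF d f'b] loc_integrable_mult_bump[OF d b'b] by (simp add: C_def)
    finally have 1: "(\<integral>r. d r * f' r \<partial>lborel) = m * C" by simp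
    have "((\<lambda>r. r * f r) has_real_derivative f r + r * f' r) (at r)" for r
      using DERIV_mult[OF DERIV_ident f', of r] by (simp add: mult.commute)
    from bump_integral_deriv[OF bump_times_id[OF f] this]
    have "(\<integral>r. f r + r * f' r \<partial>lborel) = 0" .
    then have 2: "(\<integral>r. r * f' r \<partial>lborel) = - m"
      using bump_integrable[OF f] bump_integrable[OF bump_times_id[OF f'b]] by (simp add: m_def)
    have "(\<integral>r. (d r - (- C) * r) * f' r \<partial>lborel) = (\<integral>r. d r * f' r + C * (r * f' r) \<partial>lborel)" by (simp add: algebra_simps)
    also have "\<dots> = m * C + C * (- m)"
      using loc_integrable_mult_bump[OF d f'b] bump_integrable[OF bump_times_id[OF f'b]] 1 2 by simp
    finally show "(\<integral>r. (d r - (- C) * r) * f' r \<partial>lborel) = 0" by simp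
  qed
  then obtain c where "AE r in lborel. r > 0 \<longrightarrow> d r - (- C) * r = c" by blast
  then have "AE r in lborel. r > 0 \<longrightarrow> d r = c + (- C) * r" by eventually_elim auto
  then show ?thesis by blast
qed

section \<open>Regularity of weak solutions of the radial equation\<close>

text \<open>\<open>\<integral> green s r * G r\<close> is the solution of \<open>U'' = G\<close> with \<open>U(1) = U'(1) = 0\<close>.\<close>

definition green :: "real \<Rightarrow> real \<Rightarrow> real" where
  "green s r = (if r > 1 then max (s - r) 0 else max (r - s) 0)"

lemma green_bound:
  assumes "0 < p" "p \<le> s" "s \<le> q"
  shows "\<bar>green s r\<bar> \<le> max q 1 * indicator {min p 1..max q 1} r"
  using assms by (auto simp: green_def indicator_def max_def min_def)

lemma green_lipschitz: "\<bar>green s r - green t r\<bar> \<le> \<bar>s - t\<bar>"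
  by (auto simp: green_def max_def)

lemma green_measurable: "(\<lambda>r. green s r) \<in> borel_measurable borel"
  unfolding green_def by measurable

text \<open>Twofold integration by parts on the side of r away from 1, where compact support kills
  the far boundary term. The base point is 1 because the source is integrable only away from
  0.\<close>

lemma green_representation:
  assumes f: "f \<in> bump_class" and d1: "\<And>r. (f has_real_derivative f' r) (at r)"
    and d2: "\<And>r. (f' has_real_derivative f'' r) (at r)"
  shows "(\<integral>s. green s r * f'' s \<partial>lborel) = f r"
proof -
  obtain p q where pq: "0 < p" "p < q" "\<And>r. r \<notin> {p..q} \<Longrightarrow> f r = 0" using bump_classD[OF f] by blast
  have f'b: "f' \<in> bump_class" by (rule bump_deriv[OF f d1])
  have f''b: "f'' \<in> bump_class" by (rule bump_deriv[OF f'b d2])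
  have z1: "f' r = 0" if r: "r \<notin> {p..q}" for r
    by (rule deriv_zero_outside[OF pq(3) d1 r])
  have z2: "f'' r = 0" if r: "r \<notin> {p..q}" for r
    by (rule deriv_zero_outside[OF z1 d2 r])
  show ?thesis
  proof (cases "r > 1")
    case True
    define T where "T = max q r + 1"
    have T: "r \<le> T" "T \<notin> {p..q}" by (auto simp: T_def)
    have c: "continuous_on {r..T} (\<lambda>s. (s - r) * f'' s)" by (intro continuous_intros bump_continuous f''b)
    have i: "set_integrable lborel {r..T} (\<lambda>s. (s - r) * f'' s)" by (rule borel_integrable_atLeastAtMost'[OF c])
    have e: "green s r * f'' s = indicator {r..T} s *\<^sub>R ((s - r) * f'' s)" for s
    proof (cases "s \<in> {r..T}")
      case False
      then consider "s < r" | "s > q" by (force simp: T_def)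
      then show ?thesis using False True z2[of s] by cases (auto simp: green_def)
    qed (use True in \<open>simp add: green_def\<close>)
    have "((\<lambda>s. (s - r) * f'' s) has_integral (((T - r) * f' T - f T) - ((r - r) * f' r - f r))) {r..T}"
    proof (rule fundamental_theorem_of_calculus[OF T(1)])
      fix s
      have "((\<lambda>s. (s - r) * f' s - f s) has_real_derivative (1 * f' s + f'' s * (s - r) - f' s)) (at s)"
        by (intro DERIV_diff DERIV_mult d1 d2) (auto intro!: derivative_eq_intros)
      then have "((\<lambda>s. (s - r) * f' s - f s) has_real_derivative (s - r) * f'' s) (at s)" by (simp add: mult.commute)
      then show "((\<lambda>s. (s - r) * f' s - f s) has_vector_derivative (s - r) * f'' s) (at s within {r..T})"
        using has_field_derivative_at_within has_real_derivative_iff_has_vector_derivative by blast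
    qed
    then have "integral {r..T} (\<lambda>s. (s - r) * f'' s) = f r"
      using z1[OF T(2)] pq(3)[OF T(2)] by (simp add: integral_unique)
    then show ?thesis
      using set_borel_integral_eq_integral(2)[OF i] unfolding set_lebesgue_integral_def e by simp
  next
    case False
    define T where "T = min (p/2) (r - 1)"
    have T: "T \<le> r" "T \<notin> {p..q}" using pq by (auto simp: T_def)
    have c: "continuous_on {T..r} (\<lambda>s. (r - s) * f'' s)" by (intro continuous_intros bump_continuous f''b)
    have i: "set_integrable lborel {T..r} (\<lambda>s. (r - s) * f'' s)" by (rule borel_integrable_atLeastAtMost'[OF c])
    have e: "green s r * f'' s = indicator {T..r} s *\<^sub>R ((r - s) * f'' s)" for s
    proof (cases "s \<in> {T..r}")
      case False
      then consider "s > r" | "s < p" using pq by (force simp: T_def)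
      then show ?thesis using False \<open>\<not> 1 < r\<close> z2[of s] by cases (auto simp: green_def)
    qed (use False in \<open>simp add: green_def\<close>)
    have "((\<lambda>s. (r - s) * f'' s) has_integral (((r - r) * f' r + f r) - ((r - T) * f' T + f T))) {T..r}"
    proof (rule fundamental_theorem_of_calculus[OF T(1)])
      fix s
      have "((\<lambda>s. (r - s) * f' s + f s) has_real_derivative ((-1) * f' s + f'' s * (r - s) + f' s)) (at s)"
        by (intro DERIV_add DERIV_mult d1 d2) (auto intro!: derivative_eq_intros)
      then have "((\<lambda>s. (r - s) * f' s + f s) has_real_derivative (r - s) * f'' s) (at s)" by (simp add: mult.commute)
      then show "((\<lambda>s. (r - s) * f' s + f s) has_vector_derivative (r - s) * f'' s) (at s within {T..r})"
        using has_field_derivative_at_within has_real_derivative_iff_has_vector_derivative by blast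
    qed
    then have "integral {T..r} (\<lambda>s. (r - s) * f'' s) = f r"
      using z1[OF T(2)] pq(3)[OF T(2)] by (simp add: integral_unique)
    then show ?thesis
      using set_borel_integral_eq_integral(2)[OF i] unfolding set_lebesgue_integral_def e by simp
  qed
qed

lemma green_integrable:
  assumes G: "loc_integrable G" and s: "s > 0"
  shows "integrable lborel (\<lambda>r. green s r * G r)"
proof -
  have i: "integrable lborel (\<lambda>r. indicator {min s 1..max s 1} r * G r)" using G s by (auto simp: loc_integrable_def)
  have g: "\<bar>green s r\<bar> \<le> max s 1 * indicator {min s 1..max s 1} r" for r using green_bound[OF s] by simp
  have e: "green s r * G r = green s r * (indicator {min s 1..max s 1} r * G r)" for r
    using g[of r] by (cases "r \<in> {min s 1..max s 1}") auto
  show ?thesis unfolding e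
  proof (rule Bochner_Integration.integrable_bound)
    show "integrable lborel (\<lambda>r. max s 1 * (indicator {min s 1..max s 1} r * G r))" by (intro integrable_mult_right i)
    show "(\<lambda>r. green s r * (indicator {min s 1..max s 1} r * G r)) \<in> borel_measurable lborel"
      by (rule borel_measurable_times[OF _ borel_measurable_integrable[OF i]]) (use green_measurable in simp)
    have "\<bar>green s r\<bar> \<le> \<bar>max s 1\<bar>" for r using s by (auto simp: green_def max_def)
    then show "AE r in lborel. norm (green s r * (indicator {min s 1..max s 1} r * G r)) \<le> norm (max s 1 * (indicator {min s 1..max s 1} r * G r))"
      unfolding real_norm_def abs_mult[of "green s _"] abs_mult[of "max s 1"]
      by (intro always_eventually allI mult_right_mono) auto
  qed
qed

text \<open>The kernel is Lipschitz in s, and for s near a given point it is supported in a fixed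
  compact subset of the open half-line.\<close>

lemma green_potential_continuous:
  assumes G: "loc_integrable G"
  shows "continuous_on {0<..} (\<lambda>s. \<integral>r. green s r * G r \<partial>lborel)"
proof -
  have "isCont (\<lambda>s. \<integral>r. green s r * G r \<partial>lborel) s0" if s0: "s0 > 0" for s0
  proof -
    define m M where "m = min (s0/2) 1" and "M = max (s0+1) 1"
    have i: "integrable lborel (\<lambda>r. indicator {m..M} r * G r)" using G s0 by (auto simp: loc_integrable_def m_def)
    define L where "L = (\<integral>r. norm (indicator {m..M} r * G r) \<partial>lborel)"
    have lip: "\<bar>(\<integral>r. green s r * G r \<partial>lborel) - (\<integral>r. green t r * G r \<partial>lborel)\<bar> \<le> \<bar>s - t\<bar> * L"
      if s: "s \<in> {s0/2..s0+1}" and t: "t \<in> {s0/2..s0+1}" for s t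
    proof -
      have pos: "s > 0" "t > 0" using s t s0 by auto
      have ii: "integrable lborel (\<lambda>r. green s r * G r - green t r * G r)"
        by (intro Bochner_Integration.integrable_diff green_integrable[OF G] pos)
      have "(\<integral>r. green s r * G r \<partial>lborel) - (\<integral>r. green t r * G r \<partial>lborel) = (\<integral>r. green s r * G r - green t r * G r \<partial>lborel)"
        by (rule Bochner_Integration.integral_diff[symmetric]; intro green_integrable[OF G] pos)
      also have "norm \<dots> \<le> (\<integral>r. \<bar>s - t\<bar> * norm (indicator {m..M} r * G r) \<partial>lborel)"
      proof (rule order_trans[OF integral_norm_bound], rule integral_mono[OF integrable_norm[OF ii]])
        show "integrable lborel (\<lambda>r. \<bar>s - t\<bar> * norm (indicator {m..M} r * G r))" by (intro integrable_mult_right integrable_norm i)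
        fix r
        show "norm (green s r * G r - green t r * G r) \<le> \<bar>s - t\<bar> * norm (indicator {m..M} r * G r)"
        proof (cases "r \<in> {m..M}")
          case True
          have "\<bar>green s r - green t r\<bar> * \<bar>G r\<bar> \<le> \<bar>s - t\<bar> * \<bar>G r\<bar>" by (intro mult_right_mono green_lipschitz) simp
          then show ?thesis using True by (simp add: left_diff_distrib[symmetric] abs_mult)
        next
          case False
          have "green s r = 0" "green t r = 0"
            using green_bound[of "s0/2" s "s0+1" r] green_bound[of "s0/2" t "s0+1" r] s t s0 False by (auto simp: m_def M_def)
          then show ?thesis by simp
        qed
      qed
      finally show ?thesis by (simp add: L_def)
    qed
    have "((\<lambda>s. (\<integral>r. green s r * G r \<partial>lborel) - (\<integral>r. green s0 r * G r \<partial>lborel)) \<longlongrightarrow> 0) (at s0)"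
    proof (rule Lim_null_comparison)
      have "eventually (\<lambda>s. s \<in> {s0/2<..<s0+1}) (at s0)"
        using s0 by (intro eventually_at_in_open') auto
      then show "eventually (\<lambda>s. norm ((\<integral>r. green s r * G r \<partial>lborel) - (\<integral>r. green s0 r * G r \<partial>lborel)) \<le> \<bar>s - s0\<bar> * L) (at s0)"
      proof eventually_elim
        case (elim s)
        then show ?case using lip[of s s0] s0 by simp
      qed
      have "((\<lambda>s. \<bar>s - s0\<bar> * L) \<longlongrightarrow> \<bar>s0 - s0\<bar> * L) (at s0)" by (intro tendsto_intros)
      then show "((\<lambda>s. \<bar>s - s0\<bar> * L) \<longlongrightarrow> 0) (at s0)" by simp
    qed
    then show ?thesis unfolding isCont_def by (simp add: LIM_zero_iff)
  qed
  then show ?thesis by (intro continuous_at_imp_continuous_on ballI) auto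
qed

text \<open>Fubini and \<open>green_representation\<close>. For s in the support of f'' the kernel
  lives on [m, M], so G may be restricted to that interval, and the integrand is dominated by a
  product of integrable functions.\<close>

lemma green_weak:
  assumes G: "loc_integrable G" and f: "f \<in> bump_class" and d1: "\<And>r. (f has_real_derivative f' r) (at r)"
    and d2: "\<And>r. (f' has_real_derivative f'' r) (at r)"
  shows "(\<integral>s. (\<integral>r. green s r * G r \<partial>lborel) * f'' s \<partial>lborel) = (\<integral>r. G r * f r \<partial>lborel)"
proof -
  obtain p q where pq: "0 < p" "p < q" "\<And>r. r \<notin> {p..q} \<Longrightarrow> f r = 0" using bump_classD[OF f] by blast
  have f'b: "f' \<in> bump_class" by (rule bump_deriv[OF f d1])
  have f''b: "f'' \<in> bump_class" by (rule bump_deriv[OF f'b d2])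
  have z1: "f' r = 0" if r: "r \<notin> {p..q}" for r
    by (rule deriv_zero_outside[OF pq(3) d1 r])
  have z2: "f'' r = 0" if r: "r \<notin> {p..q}" for r
    by (rule deriv_zero_outside[OF z1 d2 r])
  define m M where "m = min p 1" and "M = max q 1"
  define g where "g = (\<lambda>r. indicator {m..M} r * G r)"
  have ig: "integrable lborel g" using G pq by (auto simp: loc_integrable_def m_def g_def)
  have gm: "g \<in> borel_measurable borel" using ig by auto
  have if'': "integrable lborel f''" by (rule bump_integrable[OF f''b])
  have fm: "f'' \<in> borel_measurable borel" using if'' by auto
  have kb: "\<bar>green s r * g r * f'' s\<bar> \<le> M * (\<bar>g r\<bar> * \<bar>f'' s\<bar>)" for s r
  proof (cases "s \<in> {p..q}")
    case True
    then have "\<bar>green s r\<bar> \<le> M * indicator {m..M} r" using green_bound[of p s q r] pq by (auto simp: m_def M_def)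
    also have "\<dots> \<le> M" by (auto simp: indicator_def M_def)
    finally have "\<bar>green s r\<bar> * (\<bar>g r\<bar> * \<bar>f'' s\<bar>) \<le> M * (\<bar>g r\<bar> * \<bar>f'' s\<bar>)" by (intro mult_right_mono) auto
    then show ?thesis by (simp add: abs_mult mult.assoc)
  qed (simp add: z2)
  have km: "(\<lambda>(s, r). green s r * g r * f'' s) \<in> borel_measurable (lborel \<Otimes>\<^sub>M lborel)"
  proof -
    have 1: "(\<lambda>x::real \<times> real. green (fst x) (snd x)) \<in> borel_measurable (lborel \<Otimes>\<^sub>M lborel)"
      unfolding green_def by measurable
    have 2: "(\<lambda>x::real \<times> real. g (snd x)) \<in> borel_measurable (lborel \<Otimes>\<^sub>M lborel)" using gm by measurable
    have 3: "(\<lambda>x::real \<times> real. f'' (fst x)) \<in> borel_measurable (lborel \<Otimes>\<^sub>M lborel)" using fm by measurable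
    show ?thesis using borel_measurable_times[OF borel_measurable_times[OF 1 2] 3] by (simp add: case_prod_beta')
  qed
  have ib: "integrable (lborel \<Otimes>\<^sub>M lborel) (\<lambda>(s, r). M * (\<bar>g r\<bar> * \<bar>f'' s\<bar>))"
  proof (rule lborel_pair.Fubini_integrable)
    have 2: "(\<lambda>x::real \<times> real. g (snd x)) \<in> borel_measurable (lborel \<Otimes>\<^sub>M lborel)" using gm by measurable
    have 3: "(\<lambda>x::real \<times> real. f'' (fst x)) \<in> borel_measurable (lborel \<Otimes>\<^sub>M lborel)" using fm by measurable
    show "(\<lambda>(s, r). M * (\<bar>g r\<bar> * \<bar>f'' s\<bar>)) \<in> borel_measurable (lborel \<Otimes>\<^sub>M lborel)"
      unfolding case_prod_beta' using 2 3 by measurable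
    have e: "(\<integral>r. norm (case (s, r) of (s, r) \<Rightarrow> M * (\<bar>g r\<bar> * \<bar>f'' s\<bar>)) \<partial>lborel) = (\<bar>M\<bar> * (\<integral>r. \<bar>g r\<bar> \<partial>lborel)) * \<bar>f'' s\<bar>" for s
      by (simp add: abs_mult)
    show "integrable lborel (\<lambda>s. \<integral>r. norm (case (s, r) of (s, r) \<Rightarrow> M * (\<bar>g r\<bar> * \<bar>f'' s\<bar>)) \<partial>lborel)"
      unfolding e by (intro integrable_mult_right integrable_abs if'')
    show "AE s in lborel. integrable lborel (\<lambda>r. case (s, r) of (s, r) \<Rightarrow> M * (\<bar>g r\<bar> * \<bar>f'' s\<bar>))"
      using ig by (intro always_eventually allI) auto
  qed
  have ik: "integrable (lborel \<Otimes>\<^sub>M lborel) (\<lambda>(s, r). green s r * g r * f'' s)"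
  proof (rule Bochner_Integration.integrable_bound[OF ib km])
    show "AE x in lborel \<Otimes>\<^sub>M lborel. norm (case x of (s, r) \<Rightarrow> green s r * g r * f'' s) \<le> norm (case x of (s, r) \<Rightarrow> M * (\<bar>g r\<bar> * \<bar>f'' s\<bar>))"
    proof (intro always_eventually allI)
      fix x :: "real \<times> real"
      obtain s r where x: "x = (s, r)" by force
      show "norm (case x of (s, r) \<Rightarrow> green s r * g r * f'' s) \<le> norm (case x of (s, r) \<Rightarrow> M * (\<bar>g r\<bar> * \<bar>f'' s\<bar>))"
        unfolding x prod.case real_norm_def by (rule order_trans[OF kb abs_ge_self])
    qed
  qed
  have "(\<integral>s. (\<integral>r. green s r * G r \<partial>lborel) * f'' s \<partial>lborel) = (\<integral>s. (\<integral>r. green s r * g r * f'' s \<partial>lborel) \<partial>lborel)"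
  proof (rule Bochner_Integration.integral_cong[OF refl])
    fix s
    show "(\<integral>r. green s r * G r \<partial>lborel) * f'' s = (\<integral>r. green s r * g r * f'' s \<partial>lborel)"
    proof (cases "s \<in> {p..q}")
      case True
      have "(\<lambda>r. green s r * G r) = (\<lambda>r. green s r * g r)"
      proof
        fix r show "green s r * G r = green s r * g r"
      proof (cases "r \<in> {m..M}")
        case False
        then have "green s r = 0" using True green_bound[of p s q r] pq by (auto simp: m_def M_def)
        then show ?thesis by simp
      qed (simp add: g_def)
      qed
      then show ?thesis by simp
    qed (simp add: z2)
  qed
  also have "\<dots> = (\<integral>r. (\<integral>s. green s r * g r * f'' s \<partial>lborel) \<partial>lborel)" by (rule lborel_pair.Fubini_integral[OF ik, symmetric])
  also have "\<dots> = (\<integral>r. G r * f r \<partial>lborel)"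
  proof (rule Bochner_Integration.integral_cong[OF refl])
    fix r
    have "(\<integral>s. green s r * g r * f'' s \<partial>lborel) = (\<integral>s. g r * (green s r * f'' s) \<partial>lborel)" by (simp add: mult_ac)
    also have "\<dots> = g r * f r" by (simp only: integral_mult_right_zero green_representation[OF f d1 d2])
    also have "\<dots> = G r * f r"
    proof (cases "r \<in> {p..q}")
      case True
      then have "r \<in> {m..M}" by (auto simp: m_def M_def)
      then show ?thesis by (simp add: g_def)
    qed (simp add: pq(3))
    finally show "(\<integral>s. green s r * g r * f'' s \<partial>lborel) = G r * f r" .
  qed
  finally show ?thesis .
qed

lemma loc_integrable_weak_integral_diff:
  assumes "loc_integrable d" "loc_integrable e" "f \<in> bump_class"
  shows "(\<integral>r. (d r - e r) * f r \<partial>lborel) = (\<integral>r. d r * f r \<partial>lborel) - (\<integral>r. e r * f r \<partial>lborel)"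
  unfolding left_diff_distrib
  by (rule Bochner_Integration.integral_diff; rule loc_integrable_mult_bump) (rule assms)+

text \<open>The Green potential U has weak second derivative G, so u - U is weakly affine and u
  inherits the continuity of U.\<close>

lemma weak_solution_continuous:
  assumes u: "loc_integrable u" and G: "loc_integrable G"
    and weak: "\<And>f f' f''. \<lbrakk>f \<in> bump_class; \<And>r. (f has_real_derivative f' r) (at r); \<And>r. (f' has_real_derivative f'' r) (at r)\<rbrakk>
       \<Longrightarrow> (\<integral>r. u r * f'' r \<partial>lborel) = (\<integral>r. G r * f r \<partial>lborel)"
  obtains w where "continuous_on {0<..} w" "AE r in lborel. r > 0 \<longrightarrow> u r = w r"
proof -
  define U where "U = (\<lambda>s. \<integral>r. green s r * G r \<partial>lborel)"
  have cU: "continuous_on {0<..} U" unfolding U_def by (rule green_potential_continuous[OF G])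
  have lU: "loc_integrable U" by (rule loc_integrable_continuous[OF cU])
  have "\<exists>c0 c1. AE r in lborel. r > 0 \<longrightarrow> u r - U r = c0 + c1 * r"
  proof (rule du_bois_reymond_2[OF loc_integrable_diff[OF u lU]])
    fix f f' f'' assume f: "f \<in> bump_class" and d: "\<And>r. (f has_real_derivative f' r) (at r)" "\<And>r. (f' has_real_derivative f'' r) (at r)"
    have f''b: "f'' \<in> bump_class" by (rule bump_deriv[OF bump_deriv[OF f d(1)] d(2)])
    have "(\<integral>r. U r * f'' r \<partial>lborel) = (\<integral>r. G r * f r \<partial>lborel)" unfolding U_def by (rule green_weak[OF G f d])
    then show "(\<integral>r. (u r - U r) * f'' r \<partial>lborel) = 0"
      using weak[OF f d] loc_integrable_weak_integral_diff[OF u lU f''b] by simp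
  qed
  then obtain c0 c1 where c: "AE r in lborel. r > 0 \<longrightarrow> u r - U r = c0 + c1 * r" by blast
  show thesis
  proof (rule that)
    show "continuous_on {0<..} (\<lambda>r. U r + c0 + c1 * r)" by (intro continuous_intros cU)
    show "AE r in lborel. r > 0 \<longrightarrow> u r = U r + c0 + c1 * r" using c by eventually_elim auto
  qed
qed

lemma continuous_AE_zero:
  fixes f :: "real \<Rightarrow> real"
  assumes c: "continuous_on {0<..} f" and z: "AE r in lborel. r > 0 \<longrightarrow> f r = 0" and r: "r > 0"
  shows "f r = 0"
proof (rule ccontr)
  assume n: "f r \<noteq> 0"
  define A where "A = {0<..} \<inter> f -` (- {0})"
  have o: "open A" unfolding A_def by (rule continuous_open_preimage[OF c]) auto
  have "A \<in> sets lborel" using o by simp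
  moreover have "AE x in lborel. x \<notin> A" using z by eventually_elim (auto simp: A_def)
  ultimately have "A \<in> null_sets lborel" by (simp add: AE_iff_null_sets)
  then have "negligible A" by (simp add: negligible_iff_null_sets null_sets_completionI)
  moreover have "r \<in> A" using n r by (simp add: A_def)
  ultimately show False using open_not_negligible[OF o] by blast
qed

lemma antiderivative_halfline:
  fixes g :: "real \<Rightarrow> real"
  assumes "continuous_on {0<..} g"
  obtains F where "\<And>r. r > 0 \<Longrightarrow> (F has_real_derivative g r) (at r)"
proof -
  have "\<exists>F. \<forall>x::real. ereal 0 < ereal x \<longrightarrow> ereal x < \<infinity> \<longrightarrow> (F has_vector_derivative g x) (at x)"
  proof (rule einterval_antiderivative)
    show "isCont g x" if "ereal 0 < ereal x" for x
      using continuous_on_interior[OF assms, of x] that by (simp add: interior_open)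
  qed simp
  then show thesis using that by (auto simp: has_real_derivative_iff_has_vector_derivative)
qed

lemma classical_weak:
  assumes f: "f \<in> bump_class" and d1: "\<And>r. (f has_real_derivative f' r) (at r)"
    and d2: "\<And>r. (f' has_real_derivative f'' r) (at r)"
    and V: "\<And>r. r > 0 \<Longrightarrow> (V has_real_derivative V' r) (at r)"
    and V': "\<And>r. r > 0 \<Longrightarrow> (V' has_real_derivative g r) (at r)" and g: "continuous_on {0<..} g"
  shows "(\<integral>r. V r * f'' r \<partial>lborel) = (\<integral>r. g r * f r \<partial>lborel)"
proof -
  obtain p q where pq: "0 < p" "p < q" "\<And>r. r \<notin> {p..q} \<Longrightarrow> f r = 0" using bump_classD[OF f] by blast
  have f'b: "f' \<in> bump_class" by (rule bump_deriv[OF f d1])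
  have f''b: "f'' \<in> bump_class" by (rule bump_deriv[OF f'b d2])
  have z1: "f' r = 0" if r: "r \<notin> {p..q}" for r
    by (rule deriv_zero_outside[OF pq(3) d1 r])
  have z2: "f'' r = 0" if r: "r \<notin> {p..q}" for r
    by (rule deriv_zero_outside[OF z1 d2 r])
  define x y where "x = p/2" and "y = q + 1"
  have xy: "0 < x" "x \<le> y" "x \<notin> {p..q}" "y \<notin> {p..q}" using pq by (auto simp: x_def y_def)
  have lV: "loc_integrable V" by (intro loc_integrable_continuous continuous_at_imp_continuous_on ballI DERIV_isCont[OF V]) simp
  have lg: "loc_integrable g" by (rule loc_integrable_continuous[OF g])
  have cV: "continuous_on {x..y} V"
    by (intro continuous_at_imp_continuous_on ballI DERIV_isCont[OF V]) (use xy in auto)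
  have cg: "continuous_on {x..y} g" by (rule continuous_on_subset[OF g]) (use xy in auto)
  have i: "set_integrable lborel {x..y} (\<lambda>r. V r * f'' r - g r * f r)"
    by (intro borel_integrable_atLeastAtMost' continuous_intros cV cg bump_continuous f f''b)
  have e: "V r * f'' r - g r * f r = indicator {x..y} r *\<^sub>R (V r * f'' r - g r * f r)" for r
  proof (cases "r \<in> {x..y}")
    case False
    then have "r \<notin> {p..q}" using pq by (auto simp: x_def y_def)
    then show ?thesis by (simp add: z2 pq)
  qed simp
  have "((\<lambda>r. V r * f'' r - g r * f r) has_integral ((V y * f' y - V' y * f y) - (V x * f' x - V' x * f x))) {x..y}"
  proof (rule fundamental_theorem_of_calculus[OF xy(2)])
    fix r assume "r \<in> {x..y}"
    then have r: "r > 0" using xy by auto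
    have "((\<lambda>r. V r * f' r - V' r * f r) has_real_derivative (V' r * f' r + f'' r * V r - (g r * f r + f' r * V' r))) (at r)"
      by (intro DERIV_diff DERIV_mult d1 d2 V V' r)
    then have "((\<lambda>r. V r * f' r - V' r * f r) has_real_derivative V r * f'' r - g r * f r) (at r)" by (simp add: mult.commute)
    then show "((\<lambda>r. V r * f' r - V' r * f r) has_vector_derivative V r * f'' r - g r * f r) (at r within {x..y})"
      using has_field_derivative_at_within has_real_derivative_iff_has_vector_derivative by blast
  qed
  then have "integral {x..y} (\<lambda>r. V r * f'' r - g r * f r) = 0"
    using z1[OF xy(3)] z1[OF xy(4)] pq(3)[OF xy(3)] pq(3)[OF xy(4)] by (simp add: integral_unique)
  then have "(\<integral>r. V r * f'' r - g r * f r \<partial>lborel) = 0"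
    using set_borel_integral_eq_integral(2)[OF i] unfolding set_lebesgue_integral_def e[symmetric] by simp
  then show ?thesis
    using Bochner_Integration.integral_diff[OF loc_integrable_mult_bump[OF lV f''b] loc_integrable_mult_bump[OF lg f]] by simp
qed

text \<open>With a continuous representative z the source F(r, z) is continuous and has a classical
  second antiderivative V. Again u - V is affine, which gives a C^2 representative w; two continuous
  representatives agree everywhere, so w itself solves the equation.\<close>

lemma weak_solution_C2:
  assumes u: "loc_integrable u" and G: "loc_integrable (\<lambda>r. F r (u r))"
    and weak: "\<And>f f' f''. \<lbrakk>f \<in> bump_class; \<And>r. (f has_real_derivative f' r) (at r); \<And>r. (f' has_real_derivative f'' r) (at r)\<rbrakk>
       \<Longrightarrow> (\<integral>r. u r * f'' r \<partial>lborel) = (\<integral>r. F r (u r) * f r \<partial>lborel)"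
    and F: "\<And>w. continuous_on {0<..} w \<Longrightarrow> continuous_on {0<..} (\<lambda>r. F r (w r))"
  obtains w w' where "AE r in lborel. r > 0 \<longrightarrow> u r = w r" "\<And>r. r > 0 \<Longrightarrow> (w has_real_derivative w' r) (at r)"
    "\<And>r. r > 0 \<Longrightarrow> (w' has_real_derivative F r (w r)) (at r)"
proof -
  obtain z where z: "continuous_on {0<..} z" "AE r in lborel. r > 0 \<longrightarrow> u r = z r"
    by (rule weak_solution_continuous[OF u G weak]) blast+
  define g where "g = (\<lambda>r. F r (z r))"
  have cg: "continuous_on {0<..} g" unfolding g_def by (rule F[OF z(1)])
  have lg: "loc_integrable g" by (rule loc_integrable_continuous[OF cg])
  obtain \<Phi> where \<Phi>: "\<And>r. r > 0 \<Longrightarrow> (\<Phi> has_real_derivative g r) (at r)" using antiderivative_halfline[OF cg] by blast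
  have c\<Phi>: "continuous_on {0<..} \<Phi>" by (intro continuous_at_imp_continuous_on ballI DERIV_isCont[OF \<Phi>]) simp
  obtain V where V: "\<And>r. r > 0 \<Longrightarrow> (V has_real_derivative \<Phi> r) (at r)" using antiderivative_halfline[OF c\<Phi>] by blast
  have cV: "continuous_on {0<..} V" by (intro continuous_at_imp_continuous_on ballI DERIV_isCont[OF V]) simp
  have lV: "loc_integrable V" by (rule loc_integrable_continuous[OF cV])
  have "\<exists>c0 c1. AE r in lborel. r > 0 \<longrightarrow> u r - V r = c0 + c1 * r"
  proof (rule du_bois_reymond_2[OF loc_integrable_diff[OF u lV]])
    fix f f' f'' assume f: "f \<in> bump_class" and d: "\<And>r. (f has_real_derivative f' r) (at r)" "\<And>r. (f' has_real_derivative f'' r) (at r)"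
    have f''b: "f'' \<in> bump_class" by (rule bump_deriv[OF bump_deriv[OF f d(1)] d(2)])
    obtain p q where pq: "0 < p" "p < q" "\<And>r. r \<notin> {p..q} \<Longrightarrow> f r = 0" using bump_classD[OF f] by blast
    have "(\<integral>r. V r * f'' r \<partial>lborel) = (\<integral>r. g r * f r \<partial>lborel)" by (rule classical_weak[OF f d V \<Phi> cg])
    also have "\<dots> = (\<integral>r. F r (u r) * f r \<partial>lborel)"
    proof (rule integral_cong_AE)
      show "(\<lambda>r. g r * f r) \<in> borel_measurable lborel" using loc_integrable_mult_bump[OF lg f] by auto
      show "(\<lambda>r. F r (u r) * f r) \<in> borel_measurable lborel" using loc_integrable_mult_bump[OF G f] by auto
      show "AE r in lborel. g r * f r = F r (u r) * f r"
        using z(2)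
      proof eventually_elim
        case (elim r)
        show ?case
        proof (cases "r > 0")
          case False
          then have "r \<notin> {p..q}" using pq by auto
          then show ?thesis by (simp add: pq)
        qed (use elim in \<open>simp add: g_def\<close>)
      qed
    qed
    finally show "(\<integral>r. (u r - V r) * f'' r \<partial>lborel) = 0"
      using weak[OF f d] loc_integrable_weak_integral_diff[OF u lV f''b] by simp
  qed
  then obtain c0 c1 where c: "AE r in lborel. r > 0 \<longrightarrow> u r - V r = c0 + c1 * r" by blast
  define w where "w = (\<lambda>r. V r + c0 + c1 * r)"
  have uw: "AE r in lborel. r > 0 \<longrightarrow> u r = w r" using c by eventually_elim (auto simp: w_def)
  have cw: "continuous_on {0<..} (\<lambda>r. w r - z r)" unfolding w_def by (intro continuous_intros cV z)
  have "AE r in lborel. r > 0 \<longrightarrow> w r - z r = 0" using uw z(2) by eventually_elim auto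
  then have wz: "w r = z r" if "r > 0" for r using continuous_AE_zero[OF cw _ that] by simp
  show thesis
  proof (rule that[OF uw, of "\<lambda>r. \<Phi> r + c1"])
    fix r :: real assume r: "r > 0"
    show "(w has_real_derivative \<Phi> r + c1) (at r)"
      unfolding w_def using V[OF r] by (auto intro!: derivative_eq_intros)
    show "((\<lambda>r. \<Phi> r + c1) has_real_derivative F r (w r)) (at r)"
      using \<Phi>[OF r] wz[OF r] by (auto intro!: derivative_eq_intros simp: g_def)
  qed
qed

section \<open>Positivity and decay of weak solutions\<close>

text \<open>Pointwise control from integrals: w(r) is expressed through w and w'' on an interval of
  length l, with w' integrated away. The length is r near the origin and 1 near infinity.\<close>

lemma interpolation_bound:
  fixes w w' w'' B :: "real \<Rightarrow> real"
  assumes l: "l > 0" and d1: "\<And>s. s \<in> {r..r+l} \<Longrightarrow> (w has_real_derivative w' s) (at s)"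
    and d2: "\<And>s. s \<in> {r..r+l} \<Longrightarrow> (w' has_real_derivative w'' s) (at s)"
    and B: "B integrable_on {r..r+l}" "\<And>s. s \<in> {r..r+l} \<Longrightarrow> l * \<bar>w'' s\<bar> + 4 * \<bar>w s\<bar> / l \<le> B s"
  shows "w r \<le> integral {r..r+l} B"
proof -
  define x where "x = (\<lambda>s. (s - r) / l)"
  txt \<open>Integrate by parts against the cubic \<open>k\<close> with \<open>k(0) = k(1) = k'(1) = 0\<close> and \<open>k'(0) = 1\<close>.\<close>
  define k k1 k2 where "k = (\<lambda>y::real. y - 2 * y^2 + y^3)" and "k1 = (\<lambda>y::real. 1 - 4 * y + 3 * y^2)" and "k2 = (\<lambda>y::real. - 4 + 6 * y)"
  define A where "A = (\<lambda>s. l * (k (x s) * w' s) - k1 (x s) * w s)"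
  have dx: "(x has_real_derivative 1 / l) (at s)" for s
    unfolding x_def using l by (auto intro!: derivative_eq_intros)
  have dk: "(k has_real_derivative k1 y) (at y)" for y
    unfolding k_def k1_def by (auto intro!: derivative_eq_intros simp: power2_eq_square)
  have dk1: "(k1 has_real_derivative k2 y) (at y)" for y
    unfolding k1_def k2_def by (auto intro!: derivative_eq_intros)
  have dkx: "((\<lambda>s. k (x s)) has_real_derivative k1 (x s) * (1 / l)) (at s)" for s by (rule DERIV_chain2[OF dk dx])
  have dk1x: "((\<lambda>s. k1 (x s)) has_real_derivative k2 (x s) * (1 / l)) (at s)" for s by (rule DERIV_chain2[OF dk1 dx])
  have alg: "l * (K1 * (1/l) * W1 + W2 * K) - (K2 * (1/l) * W + W1 * K1) = l * (K * W2) - K2 * W / l" for K K1 K2 W W1 W2 :: real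
  proof -
    have "l * (K1 * (1/l) * W1) = (l * (1/l)) * (K1 * W1)" by (simp only: mult_ac)
    then have "l * (K1 * (1/l) * W1) = K1 * W1" using l by simp
    then show ?thesis by (simp add: distrib_left mult_ac)
  qed
  have dA: "(A has_real_derivative l * (k (x s) * w'' s) - k2 (x s) * w s / l) (at s)" if s: "s \<in> {r..r+l}" for s
    using DERIV_diff[OF DERIV_cmult[OF DERIV_mult[OF dkx d2[OF s]], of l] DERIV_mult[OF dk1x d1[OF s]]]
    unfolding A_def alg .
  have hi: "((\<lambda>s. l * (k (x s) * w'' s) - k2 (x s) * w s / l) has_integral (A (r + l) - A r)) {r..r+l}"
    by (rule fundamental_theorem_of_calculus)
       (use l dA has_field_derivative_at_within has_real_derivative_iff_has_vector_derivative in \<open>auto, blast\<close>)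
  have xe: "x (r + l) = 1" "x r = 0" using l by (auto simp: x_def)
  have "A (r + l) - A r = w r" unfolding A_def xe by (simp add: k_def k1_def)
  then have h: "((\<lambda>s. l * (k (x s) * w'' s) - k2 (x s) * w s / l) has_integral w r) {r..r+l}" using hi by simp
  show ?thesis
  proof (rule has_integral_le[OF h integrable_integral[OF B(1)]])
    fix s assume s: "s \<in> {r..r+l}"
    have x01: "0 \<le> x s" "x s \<le> 1" using s l by (auto simp: x_def divide_simps)
    have "k (x s) = x s * (1 - x s)^2" by (simp add: k_def power2_eq_square power3_eq_cube algebra_simps)
    moreover have "(1 - x s)^2 \<le> 1" using x01 by (intro power_le_one) auto
    ultimately have k01: "\<bar>k (x s)\<bar> \<le> 1" using x01 by (simp add: mult_le_one)
    have k2b: "\<bar>k2 (x s)\<bar> \<le> 4" using x01 by (simp add: k2_def)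
    have "k (x s) * w'' s \<le> \<bar>k (x s)\<bar> * \<bar>w'' s\<bar>" by (simp add: abs_mult[symmetric])
    also have "\<dots> \<le> 1 * \<bar>w'' s\<bar>" by (rule mult_right_mono[OF k01]) simp
    finally have 1: "l * (k (x s) * w'' s) \<le> l * \<bar>w'' s\<bar>" using l by simp
    have "- (k2 (x s) * w s) \<le> \<bar>k2 (x s)\<bar> * \<bar>w s\<bar>" by (simp add: abs_mult[symmetric])
    also have "\<dots> \<le> 4 * \<bar>w s\<bar>" by (rule mult_right_mono[OF k2b]) simp
    finally have "- (k2 (x s) * w s) / l \<le> 4 * \<bar>w s\<bar> / l" using l by (intro divide_right_mono) auto
    then show "l * (k (x s) * w'' s) - k2 (x s) * w s / l \<le> B s" using 1 B(2)[OF s] by simp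
  qed
qed

definition ode_rhs :: "real \<Rightarrow> real \<Rightarrow> real \<Rightarrow> real" where
  "ode_rhs a r w = (1 + a/r\<^sup>2) * w - w^3/r\<^sup>2"

text \<open>For Q = w/r the three terms are, up to the factor 4 pi, the radial densities of Q^2,
  Q^2/|x|^2 and Q^6.\<close>

definition ode_energy :: "(real \<Rightarrow> real) \<Rightarrow> real \<Rightarrow> real" where
  "ode_energy w r = (w r)\<^sup>2 + (w r)\<^sup>2 / r\<^sup>2 + (w r)^6 / r^4"

lemma le_one_plus_square: "(x::real) \<le> 1 + x\<^sup>2"
proof -
  have "(x - 1)\<^sup>2 = x\<^sup>2 - 2 * x + 1" by (simp add: power2_diff)
  moreover have "0 \<le> (x - 1)\<^sup>2" "0 \<le> x\<^sup>2" by simp_all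
  ultimately show ?thesis by linarith
qed

lemma le_weighted_square:
  assumes "d > 0" shows "(x::real) \<le> d + x\<^sup>2 / d"
proof -
  have "x / d \<le> 1 + (x / d)\<^sup>2" by (rule le_one_plus_square)
  then have "d * (x / d) \<le> d * (1 + (x / d)\<^sup>2)" using assms by (intro mult_left_mono) auto
  then show ?thesis using assms by (simp add: power2_eq_square distrib_left)
qed

lemma ode_rhs_abs: "w \<ge> 0 \<Longrightarrow> a > 0 \<Longrightarrow> \<bar>ode_rhs a r w\<bar> \<le> w + a * (w / r\<^sup>2) + w^3/r\<^sup>2"
proof -
  assume w: "w \<ge> 0" and a: "a > 0"
  have "ode_rhs a r w = w + a * (w / r\<^sup>2) - w^3/r\<^sup>2" by (simp add: ode_rhs_def distrib_right)
  moreover have "0 \<le> a * (w / r\<^sup>2)" "0 \<le> w^3/r\<^sup>2" using w a by auto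
  ultimately show ?thesis using w by linarith
qed

text \<open>On [r, 2r] the radii r and s are comparable, so every term is controlled by w, y = w/s
  or z = w^3/s^2, whose squares make up the energy; x \<le> 1 + x^2 does the rest.\<close>

lemma bound_near_0:
  assumes a: "a > 0" and w: "w s \<ge> 0" and r: "0 < r" "r \<le> 1" and s: "s \<in> {r..r+r}"
  shows "r * \<bar>ode_rhs a s (w s)\<bar> + 4 * \<bar>w s\<bar> / r \<le> (11 + a) * (1 + ode_energy w s)"
proof -
  have sp: "s > 0" "r \<le> s" "s \<le> 2 * r" using s r by auto
  define y z where "y = w s / s" and "z = (w s)^3 / s\<^sup>2"
  have y0: "0 \<le> y" "0 \<le> z" using w sp by (auto simp: y_def z_def)
  have E: "ode_energy w s = (w s)\<^sup>2 + y\<^sup>2 + z\<^sup>2"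
    by (simp add: ode_energy_def y_def z_def power_divide power_mult[symmetric])
  have "r * \<bar>ode_rhs a s (w s)\<bar> \<le> r * (w s + a * (w s / s\<^sup>2) + (w s)^3/s\<^sup>2)"
    using ode_rhs_abs[OF w a, of s] r by (intro mult_left_mono) auto
  also have "\<dots> = r * w s + a * ((r / s) * y) + r * z"
    by (simp add: y_def z_def distrib_left power2_eq_square)
  finally have 1: "r * \<bar>ode_rhs a s (w s)\<bar> \<le> r * w s + a * ((r / s) * y) + r * z" .
  have 2: "r * w s \<le> w s" using r w by (simp add: mult_left_le_one_le)
  have "r / s \<le> 1" using sp by simp
  then have "(r / s) * y \<le> y" using y0 sp r by (intro mult_left_le_one_le) auto
  then have 3: "a * ((r / s) * y) \<le> a * y" by (rule mult_left_mono) (use a in simp)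
  have 4: "r * z \<le> z" using r y0 by (simp add: mult_left_le_one_le)
  have e: "w s / r = (s / r) * y" using sp by (simp add: y_def)
  have "s / r \<le> 2" using sp r by (simp add: divide_simps)
  then have "w s / r \<le> 2 * y" unfolding e by (rule mult_right_mono) (rule y0)
  moreover have "4 * \<bar>w s\<bar> / r = 4 * (w s / r)" using w by simp
  ultimately have 5: "4 * \<bar>w s\<bar> / r \<le> 8 * y" by linarith
  define T where "T = 1 + ode_energy w s"
  have "0 \<le> (w s)\<^sup>2" "0 \<le> y\<^sup>2" "0 \<le> z\<^sup>2" by auto
  then have q: "w s \<le> T" "y \<le> T" "z \<le> T" "0 \<le> T"
    using le_one_plus_square[of "w s"] le_one_plus_square[of y] le_one_plus_square[of z] unfolding T_def E by linarith+
  have q': "a * y \<le> a * T" by (rule mult_left_mono[OF q(2)]) (use a in simp)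
  have "r * \<bar>ode_rhs a s (w s)\<bar> \<le> w s + a * y + z"
    by (rule order_trans[OF 1]) (intro add_mono 2 3 4)
  then have "r * \<bar>ode_rhs a s (w s)\<bar> + 4 * \<bar>w s\<bar> / r \<le> 11 * T + a * T" using 5 q q' by linarith
  then show ?thesis by (simp add: T_def distrib_right)
qed

text \<open>The interval of integration no longer shrinks, so the additive constant has to be small
  by itself: x \<le> d + x^2/d with d at disposal.\<close>

lemma bound_near_inf:
  assumes a: "a > 0" and w: "w s \<ge> 0" and d: "d > 0" and s: "s \<ge> 1"
  shows "1 * \<bar>ode_rhs a s (w s)\<bar> + 4 * \<bar>w s\<bar> / 1 \<le> (6 + a) * (d + ode_energy w s / d)"
proof -
  define z where "z = (w s)^3 / s\<^sup>2"
  have E: "ode_energy w s = (w s)\<^sup>2 + (w s)\<^sup>2 / s\<^sup>2 + z\<^sup>2"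
    by (simp add: ode_energy_def z_def power_divide power_mult[symmetric])
  have "w s / s\<^sup>2 \<le> w s" using w s by (simp add: divide_simps mult_le_cancel_left1)
  then have "a * (w s / s\<^sup>2) \<le> a * w s" by (rule mult_left_mono) (use a in simp)
  then have 1: "\<bar>ode_rhs a s (w s)\<bar> \<le> w s + a * w s + z"
    using ode_rhs_abs[OF w a, of s] by (simp add: z_def)
  define T where "T = d + ode_energy w s / d"
  have nn: "0 \<le> (w s)\<^sup>2 / s\<^sup>2" by simp
  have "(w s)\<^sup>2 / d \<le> ode_energy w s / d" "z\<^sup>2 / d \<le> ode_energy w s / d"
    unfolding E using d nn by (auto intro!: divide_right_mono)
  then have q: "w s \<le> T" "z \<le> T" using le_weighted_square[OF d, of "w s"] le_weighted_square[OF d, of z] by (auto simp: T_def)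
  have "a * w s \<le> a * T" using q a by simp
  moreover have "(6 + a) * T = 6 * T + a * T" by (simp add: distrib_right)
  ultimately have "1 * \<bar>ode_rhs a s (w s)\<bar> + 4 * \<bar>w s\<bar> / 1 \<le> (6 + a) * T" using 1 q w by simp
  then show ?thesis by (simp add: T_def)
qed

text \<open>Let J be the primitive of the energy density. Near 0 the bound is of the form r + J(2r),
  which tends to 0 by continuity of J; near infinity it involves J(r + 1) - J(r), which tends to 0
  because J converges.\<close>

lemma ode_energy_limits:
  assumes a: "a > 0" and nn: "\<And>r. r > 0 \<Longrightarrow> w r \<ge> 0"
    and d1: "\<And>r. r > 0 \<Longrightarrow> (w has_real_derivative w' r) (at r)"
    and d2: "\<And>r. r > 0 \<Longrightarrow> (w' has_real_derivative ode_rhs a r (w r)) (at r)"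
    and P: "integrable lborel (\<lambda>r. indicator {0<..} r * ode_energy w r)"
  shows "(w \<longlongrightarrow> 0) (at_right 0)" "(w \<longlongrightarrow> 0) at_top"
proof -
  define p where "p = (\<lambda>r. indicator {0<..} r * ode_energy w r)"
  have pU: "p integrable_on UNIV" unfolding p_def by (rule integrable_on_lborel[OF P])
  have pI: "p integrable_on {x..y}" for x y by (rule integrable_on_subinterval[OF pU]) auto
  have pe: "p s = ode_energy w s" if "s > 0" for s using that by (simp add: p_def)
  have pn: "0 \<le> p s" for s by (auto simp: p_def ode_energy_def)
  define J where "J = (\<lambda>x. integral {0..x} p)"
  have J: "integral {x..y} p = J y - J x" if "0 \<le> x" "x \<le> y" for x y
    using Henstock_Kurzweil_Integration.integral_combine[OF that pI] by (simp add: J_def)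
  have cJ: "continuous_on {0..3} J" unfolding J_def by (rule indefinite_integral_continuous_1[OF pI])
  show "(w \<longlongrightarrow> 0) (at_right 0)"
  proof (rule tendsto_sandwich[OF _ _ tendsto_const])
    show "eventually (\<lambda>r. 0 \<le> w r) (at_right 0)" using nn by (auto simp: eventually_at_filter)
    have "w r \<le> (11 + a) * (r + J (2 * r))" if r: "0 < r" "r \<le> 1" for r
    proof -
      have B: "((\<lambda>s. (11 + a) * (1 + p s)) has_integral (11 + a) * ((r + r - r) * 1 + integral {r..r+r} p)) {r..r+r}"
        using has_integral_const_real[of "1::real" r "r+r"] r
        by (intro has_integral_mult_right has_integral_add integrable_integral pI) simp
      have "w r \<le> integral {r..r+r} (\<lambda>s. (11 + a) * (1 + p s))"
      proof (rule interpolation_bound[OF r(1)])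
        fix s assume s: "s \<in> {r..r+r}"
        then have sp: "s > 0" using r by auto
        show "(w has_real_derivative w' s) (at s)" "(w' has_real_derivative ode_rhs a s (w s)) (at s)" using d1 d2 sp by auto
        show "r * \<bar>ode_rhs a s (w s)\<bar> + 4 * \<bar>w s\<bar> / r \<le> (11 + a) * (1 + p s)"
          unfolding pe[OF sp] by (rule bound_near_0[where w = w, OF a nn[OF sp] r s])
      qed (use B in blast)
      also have "\<dots> = (11 + a) * (r + integral {r..r+r} p)" using integral_unique[OF B] by simp
      also have "\<dots> \<le> (11 + a) * (r + J (2 * r))"
      proof -
        have "0 \<le> J r" unfolding J_def by (rule Henstock_Kurzweil_Integration.integral_nonneg[OF pI]) (rule pn)
        then have "integral {r..r+r} p \<le> J (2 * r)" using J[of r "r + r"] r by simp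
        then show ?thesis using a by simp
      qed
      finally show ?thesis .
    qed
    then show "eventually (\<lambda>r. w r \<le> (11 + a) * (r + J (2 * r))) (at_right 0)"
      unfolding eventually_at_right_field by (intro exI[of _ 1]) auto
    have "J 0 = 0" by (simp add: J_def)
    moreover have "(J \<longlongrightarrow> J 0) (at 0 within {0..3})" using cJ by (auto simp: continuous_on_def)
    moreover have "filterlim (\<lambda>r::real. 2 * r) (at 0 within {0..3}) (at_right 0)"
      unfolding filterlim_at
    proof
      have "((\<lambda>r::real. 2 * r) \<longlongrightarrow> 2 * 0) (at_right 0)" by (intro tendsto_intros)
      then show "((\<lambda>r::real. 2 * r) \<longlongrightarrow> 0) (at_right 0)" by simp
      show "eventually (\<lambda>r::real. 2 * r \<in> {0..3} \<and> 2 * r \<noteq> 0) (at_right 0)"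
        unfolding eventually_at_right_field by (intro exI[of _ 1]) auto
    qed
    ultimately have "((\<lambda>r. J (2 * r)) \<longlongrightarrow> 0) (at_right 0)" using filterlim_compose[of J "nhds 0"] by auto
    then have "((\<lambda>r. (11 + a) * (r + J (2 * r))) \<longlongrightarrow> (11 + a) * (0 + 0)) (at_right 0)" by (intro tendsto_intros)
    then show "((\<lambda>r. (11 + a) * (r + J (2 * r))) \<longlongrightarrow> 0) (at_right 0)" by simp
  qed
  have Jlim: "(J \<longlongrightarrow> (\<integral>x. p x \<partial>lborel)) at_top"
  proof -
    have "((\<lambda>y. \<integral>x. indicator {..y} x *\<^sub>R p x \<partial>lborel) \<longlongrightarrow> (\<integral>x. p x \<partial>lborel)) at_top"
      by (rule tendsto_integral_at_top) (use P in \<open>auto simp: p_def\<close>)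
    moreover have "(\<integral>x. indicator {..y} x *\<^sub>R p x \<partial>lborel) = J y" for y
    proof -
      have e: "(\<lambda>x. indicator {..y} x *\<^sub>R p x) = (\<lambda>x. indicator {0..y} x *\<^sub>R p x)" by (auto simp: p_def indicator_def)
      have i: "set_integrable lborel {0..y} p"
        unfolding set_integrable_def
        by (rule Bochner_Integration.integrable_bound[OF P]) (use P in \<open>auto simp: p_def indicator_def intro!: always_eventually\<close>)
      show ?thesis unfolding e using set_borel_integral_eq_integral(2)[OF i] by (simp add: J_def set_lebesgue_integral_def)
    qed
    ultimately show ?thesis by simp
  qed
  show "(w \<longlongrightarrow> 0) at_top"
  proof (rule tendstoI)
    fix e :: real assume e: "e > 0"
    \<comment> \<open>The final bound is (6 + a) * 2 d = e / 2, as soon as the increment of J is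
      below d^2.\<close>
    define d where "d = e / (4 * (6 + a))"
    have d: "d > 0" using e a by (simp add: d_def)
    have "filterlim (\<lambda>r::real. r + 1) at_top at_top" by (intro filterlim_tendsto_add_at_top[OF tendsto_const filterlim_ident, of 1, unfolded add.commute[of 1]])
    then have "((\<lambda>r. J (r + 1) - J r) \<longlongrightarrow> (\<integral>x. p x \<partial>lborel) - (\<integral>x. p x \<partial>lborel)) at_top"
      by (intro tendsto_diff Jlim filterlim_compose[OF Jlim])
    then have "eventually (\<lambda>r. J (r + 1) - J r < d\<^sup>2) at_top" using d by (intro order_tendstoD(2)[where y = 0]) auto
    moreover have "eventually (\<lambda>r::real. r \<ge> 1) at_top" by (rule eventually_ge_at_top)
    ultimately show "eventually (\<lambda>r. dist (w r) 0 < e) at_top"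
    proof eventually_elim
      case (elim r)
      have B: "((\<lambda>s. (6 + a) * (d + p s / d)) has_integral (6 + a) * ((r + 1 - r) * d + integral {r..r+1} p / d)) {r..r+1}"
        using has_integral_const_real[of d r "r+1"] elim
        by (intro has_integral_mult_right has_integral_add has_integral_divide integrable_integral pI) simp
      have "w r \<le> integral {r..r+1} (\<lambda>s. (6 + a) * (d + p s / d))"
      proof (rule interpolation_bound)
        fix s assume s: "s \<in> {r..r+1}"
        then have sp: "s > 0" "s \<ge> 1" using elim by auto
        show "(w has_real_derivative w' s) (at s)" "(w' has_real_derivative ode_rhs a s (w s)) (at s)" using d1 d2 sp by auto
        show "1 * \<bar>ode_rhs a s (w s)\<bar> + 4 * \<bar>w s\<bar> / 1 \<le> (6 + a) * (d + p s / d)"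
          unfolding pe[OF sp(1)] by (rule bound_near_inf[where w = w, OF a nn[OF sp(1)] d sp(2)])
      qed (use B in \<open>simp, blast\<close>)
      also have "\<dots> = (6 + a) * (d + (J (r + 1) - J r) / d)"
        unfolding integral_unique[OF B] using J[of r "r+1"] elim by simp
      also have "\<dots> < (6 + a) * (d + d)"
      proof -
        have "(J (r + 1) - J r) / d < d\<^sup>2 / d" using elim d by (intro divide_strict_right_mono) auto
        then have "(J (r + 1) - J r) / d < d" using d by (simp add: power2_eq_square)
        then show ?thesis using a by (intro mult_strict_left_mono) auto
      qed
      also have "\<dots> = e / 2"
      proof -
        have "(6 + a) * d = e / 4" using a by (simp add: d_def divide_simps)
        then show ?thesis by (simp add: distrib_left)
      qed
      finally show ?case using nn[of r] elim e by simp
    qed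
  qed
qed

text \<open>A zero would be a minimum, so w and w' both vanish there. The equation is linear in w
  with coefficient 1 + a/t^2 - w^2/t^2, bounded on a compact interval reaching to \<open>r0\<close>,
  and uniqueness contradicts w(r0) \<noteq> 0.\<close>

lemma ode_positive:
  assumes nn: "\<And>r. r > 0 \<Longrightarrow> w r \<ge> 0"
    and d1: "\<And>r. r > 0 \<Longrightarrow> (w has_real_derivative w' r) (at r)"
    and d2: "\<And>r. r > 0 \<Longrightarrow> (w' has_real_derivative ode_rhs a r (w r)) (at r)"
    and nz: "r0 > 0" "w r0 \<noteq> 0" and r: "r > 0"
  shows "w r > 0"
proof (rule ccontr)
  assume "\<not> w r > 0"
  then have z: "w r = 0" using nn[OF r] by simp
  have "w' r = 0"
  proof (rule DERIV_local_min[OF d1[OF r], of r])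
    show "\<forall>y. \<bar>r - y\<bar> < r \<longrightarrow> w r \<le> w y"
    proof (intro allI impI)
      fix y assume "\<bar>r - y\<bar> < r"
      then have "y > 0" by linarith
      then show "w r \<le> w y" using nn z by simp
    qed
  qed (rule r)
  define c d where "c = min r r0" and "d = max r r0"
  have cd: "0 < c" "r \<in> {c..d}" "r0 \<in> {c..d}" using r nz by (auto simp: c_def d_def)
  define b where "b = (\<lambda>t. (1 + a/t\<^sup>2) - (w t)\<^sup>2/t\<^sup>2)"
  have "continuous_on {c..d} w" by (intro continuous_at_imp_continuous_on ballI DERIV_isCont[OF d1]) (use cd in auto)
  then have "continuous_on {c..d} b" unfolding b_def using cd by (intro continuous_intros) auto
  then have "bounded (b ` {c..d})" by (intro compact_imp_bounded compact_continuous_image) auto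
  then obtain B where B: "\<forall>y\<in>b ` {c..d}. \<bar>y\<bar> \<le> B" unfolding bounded_iff real_norm_def by blast
  have "w r0 = 0"
  proof (rule linear_ode_zero[of c d b B w w' r])
    show "\<bar>b t\<bar> \<le> B" if "t \<in> {c..d}" for t using B that by blast
    fix t assume "t \<in> {c..d}"
    then have t: "t > 0" using cd by auto
    show "(w has_real_derivative w' t) (at t)" by (rule d1[OF t])
    have "ode_rhs a t (w t) = b t * w t" by (simp add: ode_rhs_def b_def left_diff_distrib power2_eq_square power3_eq_cube)
    then show "(w' has_real_derivative b t * w t) (at t)" using d2[OF t] by simp
  qed (use cd z \<open>w' r = 0\<close> in auto)
  then show False using nz by simp
qed

lemma ode_energy_loc_integrable:
  assumes a: "a > 0" and m: "u \<in> borel_measurable borel" and nn: "\<And>r. r > 0 \<Longrightarrow> u r \<ge> 0"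
    and P: "integrable lborel (\<lambda>r. indicator {0<..} r * ode_energy u r)"
  shows "loc_integrable u" "loc_integrable (\<lambda>r. ode_rhs a r (u r))"
proof -
  have bnd: "loc_integrable g" if gm: "g \<in> borel_measurable borel"
    and g: "\<And>p r. \<lbrakk>p > 0; r \<ge> p\<rbrakk> \<Longrightarrow> \<bar>g r\<bar> \<le> C p * (1 + ode_energy u r)" for g C
    unfolding loc_integrable_def
  proof (intro allI impI)
    fix p q :: real assume p: "p > 0"
    show "integrable lborel (\<lambda>r. indicator {p..q} r * g r)"
    proof (rule Bochner_Integration.integrable_bound)
      have "integrable lborel (\<lambda>r. indicator {p..q} r :: real)" using emeasure_bounded_finite[of "{p..q}"] by (simp add: integrable_indicator_iff)
      then show "integrable lborel (\<lambda>r. C p * (indicator {p..q} r + indicator {0<..} r * ode_energy u r))"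
        by (intro integrable_mult_right Bochner_Integration.integrable_add P)
      show "(\<lambda>r. indicator {p..q} r * g r) \<in> borel_measurable lborel" using gm by measurable
      show "AE r in lborel. norm (indicator {p..q} r * g r) \<le> norm (C p * (indicator {p..q} r + indicator {0<..} r * ode_energy u r))"
      proof (intro always_eventually allI)
        fix r
        show "norm (indicator {p..q} r * g r) \<le> norm (C p * (indicator {p..q} r + indicator {0<..} r * ode_energy u r))"
        proof (cases "r \<in> {p..q}")
          case True
          then have "r > 0" "\<bar>g r\<bar> \<le> C p * (1 + ode_energy u r)" using g[OF p, of r] p by auto
          then show ?thesis using True by simp
        qed simp
      qed
    qed
  qed
  have E: "(u r)\<^sup>2 \<le> ode_energy u r" for r by (simp add: ode_energy_def)
  show "loc_integrable u"
  proof (rule bnd[OF m, of "\<lambda>_. 1"])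
    fix p r :: real assume "p > 0" "r \<ge> p"
    show "\<bar>u r\<bar> \<le> 1 * (1 + ode_energy u r)" using le_one_plus_square[of "\<bar>u r\<bar>"] E[of r] by simp
  qed
  show "loc_integrable (\<lambda>r. ode_rhs a r (u r))"
  proof (rule bnd[where C = "\<lambda>p. 2 + a / p\<^sup>2"])
    show "(\<lambda>r. ode_rhs a r (u r)) \<in> borel_measurable borel" unfolding ode_rhs_def using m by measurable
    fix p r :: real assume p: "p > 0" "r \<ge> p"
    then have r: "r > 0" by simp
    have z2: "((u r)^3 / r\<^sup>2)\<^sup>2 \<le> ode_energy u r"
      by (simp add: ode_energy_def power_divide power_mult[symmetric])
    have z: "(u r)^3 / r\<^sup>2 \<le> 1 + ode_energy u r" using le_one_plus_square[of "(u r)^3 / r\<^sup>2"] z2 by linarith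
    have y: "u r \<le> 1 + ode_energy u r" using le_one_plus_square[of "u r"] E[of r] by linarith
    have "a * (u r / r\<^sup>2) = (a / r\<^sup>2) * u r" by simp
    also have "\<dots> \<le> (a / p\<^sup>2) * (1 + ode_energy u r)"
      using p r a nn[OF r] y by (intro mult_mono divide_left_mono power_mono) auto
    finally have "\<bar>ode_rhs a r (u r)\<bar> \<le> (1 + ode_energy u r) + (a / p\<^sup>2) * (1 + ode_energy u r) + (1 + ode_energy u r)"
      using ode_rhs_abs[OF nn[OF r] a, of r] z y by linarith
    also have "\<dots> = (2 + a / p\<^sup>2) * (1 + ode_energy u r)" by (simp add: distrib_right)
    finally show "\<bar>ode_rhs a r (u r)\<bar> \<le> (2 + a / p\<^sup>2) * (1 + ode_energy u r)" .
  qed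
qed

lemma weak_solution_profile:
  assumes a: "a > 0" and m: "u \<in> borel_measurable borel" and nn: "\<And>r. r > 0 \<Longrightarrow> u r \<ge> 0"
    and nz: "\<not> (AE r in lborel. r > 0 \<longrightarrow> u r = 0)"
    and P: "integrable lborel (\<lambda>r. indicator {0<..} r * ode_energy u r)"
    and weak: "\<And>f f' f''. \<lbrakk>f \<in> bump_class; \<And>r. (f has_real_derivative f' r) (at r); \<And>r. (f' has_real_derivative f'' r) (at r)\<rbrakk>
       \<Longrightarrow> (\<integral>r. u r * f'' r \<partial>lborel) = (\<integral>r. ode_rhs a r (u r) * f r \<partial>lborel)"
  obtains w w' where "profile a w w'" "AE r in lborel. r > 0 \<longrightarrow> u r = w r"
proof -
  have cF: "continuous_on {0<..} (\<lambda>r. ode_rhs a r (w r))" if "continuous_on {0<..} w" for w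
    unfolding ode_rhs_def using that by (intro continuous_intros) auto
  have lu: "loc_integrable u" by (rule ode_energy_loc_integrable(1)[OF a m _ P]) (rule nn)
  have lG: "loc_integrable (\<lambda>r. ode_rhs a r (u r))" by (rule ode_energy_loc_integrable(2)[OF a m _ P]) (rule nn)
  obtain w w' where uw: "AE r in lborel. r > 0 \<longrightarrow> u r = w r"
    and d1: "\<And>r. r > 0 \<Longrightarrow> (w has_real_derivative w' r) (at r)"
    and d2: "\<And>r. r > 0 \<Longrightarrow> (w' has_real_derivative ode_rhs a r (w r)) (at r)"
    by (rule weak_solution_C2[where F = "ode_rhs a", OF lu lG weak cF]) blast+
  have cw: "continuous_on {0<..} w" by (intro continuous_at_imp_continuous_on ballI DERIV_isCont[OF d1]) simp
  have cm: "continuous_on {0<..} (\<lambda>r. min (w r) 0)" by (intro continuous_intros cw)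
  have "AE r in lborel. r > 0 \<longrightarrow> min (w r) 0 = 0"
    using uw
  proof eventually_elim
    case (elim r)
    then show ?case using nn[of r] by (auto simp: min_def)
  qed
  then have wnn: "w r \<ge> 0" if "r > 0" for r using continuous_AE_zero[OF cm _ that] by linarith
  have "\<exists>r0>0. w r0 \<noteq> 0"
  proof (rule ccontr)
    assume "\<not> ?thesis"
    then have "AE r in lborel. r > 0 \<longrightarrow> u r = 0" using uw by auto
    then show False using nz by blast
  qed
  then obtain r0 where r0: "r0 > 0" "w r0 \<noteq> 0" by blast
  have wpos: "w r > 0" if "r > 0" for r by (rule ode_positive[OF wnn d1 d2 r0 that])
  have Pw: "integrable lborel (\<lambda>r. indicator {0<..} r * ode_energy w r)"
  proof (rule integrable_cong_AE_imp[OF P])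
    have "(\<lambda>r. indicator {0<..} r *\<^sub>R ode_energy w r) \<in> borel_measurable borel"
      unfolding ode_energy_def
      by (rule borel_measurable_continuous_on_indicator) (auto intro!: continuous_intros cw)
    then show "(\<lambda>r. indicator {0<..} r * ode_energy w r) \<in> borel_measurable lborel" by simp
    show "AE r in lborel. indicator {0<..} r * ode_energy u r = indicator {0<..} r * ode_energy w r"
      using uw by eventually_elim (auto simp: ode_energy_def indicator_def)
  qed
  have "profile a w w'"
    unfolding profile_def using wpos d1 d2 ode_energy_limits[OF a wnn d1 d2 Pw] by (simp add: ode_rhs_def)
  then show thesis using uw by (rule that)
qed

section \<open>Reduction of radial solutions to profiles\<close>

lemma integrable_radial_transfer:
  fixes h :: "real \<Rightarrow> real"
  assumes F: "integrable (lborel :: R3 measure) F" and h: "h \<in> borel_measurable borel" and ae: "AE x in lborel. F x = h (norm x)"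
  shows "integrable lborel (\<lambda>r. indicator {0<..} r * (r\<^sup>2 * h r))"
proof -
  have "integrable (lborel :: R3 measure) (\<lambda>x. h (norm x))"
    by (rule integrable_cong_AE_imp[OF F _ ae]) (use h in measurable)
  then show ?thesis using integrable_radial_iff[OF h] by simp
qed

lemma integral_radial_transfer:
  fixes h :: "real \<Rightarrow> real" and F :: "R3 \<Rightarrow> real"
  assumes F: "F \<in> borel_measurable borel" and h: "h \<in> borel_measurable borel" and ae: "AE x in lborel. F x = h (norm x)"
  shows "(\<integral>x. F x \<partial>lborel) = 4 * pi * (\<integral>r. indicator {0<..} r * (r\<^sup>2 * h r) \<partial>lborel)"
proof -
  have "(\<integral>x. F x \<partial>lborel) = (\<integral>x. h (norm x) \<partial>(lborel :: R3 measure))"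
    by (rule integral_cong_AE) (use F h ae in auto)
  then show ?thesis using integral_radial[OF h] by simp
qed

lemma nonneg_radial_solution_profile:
  assumes a: "a > 0" and R: "nonneg_radial_solution a R"
  obtains w w' where "profile a w w'" "AE x in lborel. R x = w (norm x) / norm x"
proof -
  have R1: "R \<in> H1" "\<not> (AE x in lborel. R x = 0)" "AE x in lborel. 0 \<le> R x" "radial R" "solves a R"
    using R by (auto simp: nonneg_radial_solution_def)
  have RL2: "R \<in> L2" using R1(1) by (simp add: H1_def)
  have Rm: "R \<in> borel_measurable borel" by (rule L2_measurable[OF RL2])
  obtain HR where fr: "friedrichs (test_functions (- {0})) (Lop a) R HR" and HR: "AE x in lborel. - HR x - R x + (R x)^3 = 0"
    using R1(5) unfolding solves_def H_a_Lop by blast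
  have HRL2: "HR \<in> L2" and Rdom: "R \<in> form_domain (test_functions (- {0})) (Lop a)" using fr by (auto simp: friedrichs_def)
  interpret nonneg_form "test_functions (- {0})" "Lop a" by (rule Lop_form) (use a in simp)
  obtain f0 where f0: "f0 \<in> borel_measurable borel" "AE x in lborel. R x = f0 (norm x)"
    by (rule radial_measurable[OF Rm R1(4)]) blast
  \<comment> \<open>Removing negative values on a null set makes u nonnegative at every r > 0, as
    the one-dimensional lemmas require.\<close>
  define g where "g = (\<lambda>r. max (f0 r) 0)"
  have gm: "g \<in> borel_measurable borel" unfolding g_def using f0(1) by measurable
  have Rg: "AE x in lborel. R x = g (norm x)" using f0(2) R1(3) by eventually_elim (simp add: g_def)
  have HRg: "AE x in lborel. HR x = - g (norm x) + (g (norm x))^3" using HR Rg by eventually_elim simp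
  define u where "u = (\<lambda>r. r * g r)"
  have um: "u \<in> borel_measurable borel" unfolding u_def using gm by measurable
  have unn: "u r \<ge> 0" if "r > 0" for r using that by (simp add: u_def g_def)
  have P: "integrable lborel (\<lambda>r. indicator {0<..} r * ode_energy u r)"
  proof -
    have 1: "integrable lborel (\<lambda>r. indicator {0<..} r * (r\<^sup>2 * (g r)\<^sup>2))"
      by (rule integrable_radial_transfer[OF L2_sq_integrable[OF RL2]]) (use gm Rg in auto)
    have 2: "integrable lborel (\<lambda>r. indicator {0<..} r * (r\<^sup>2 * ((g r)\<^sup>2 / r\<^sup>2)))"
      by (rule integrable_radial_transfer[OF form_domain_hardy[OF a Rdom]]) (use gm Rg in auto)
    \<comment> \<open>By the equation R^3 = HR + R almost everywhere, and both summands lie in L^2;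
      so R^6 is integrable.\<close>
    have 3: "integrable lborel (\<lambda>r. indicator {0<..} r * (r\<^sup>2 * (g r)^6))"
    proof (rule integrable_radial_transfer[OF L2_sq_integrable[OF L2_add[OF HRL2 RL2]]])
      show "AE x in lborel. (HR x + R x)\<^sup>2 = (g (norm x))^6" using HRg Rg
      proof eventually_elim
        case (elim x)
        then have "HR x + R x = (g (norm x))^3" by simp
        then show ?case by (simp add: power_mult[symmetric])
      qed
    qed (use gm in measurable)
    have e: "indicator {0<..} r * (r\<^sup>2 * (g r)\<^sup>2) + indicator {0<..} r * (r\<^sup>2 * ((g r)\<^sup>2 / r\<^sup>2)) + indicator {0<..} r * (r\<^sup>2 * (g r)^6)
      = indicator {0<..} r * ode_energy u r" for r :: real
    proof (cases "r > 0")
      case True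
      have e: "r^6 * (g r)^6 = r^4 * (r\<^sup>2 * (g r)^6)" by (simp flip: power_add mult.assoc)
      have e': "(r * g r)^6 / r^4 = r\<^sup>2 * (g r)^6" unfolding power_mult_distrib e by (rule nonzero_mult_div_cancel_left) (use True in simp)
      show ?thesis unfolding ode_energy_def u_def e' using True by (simp add: power_mult_distrib)
    qed simp
    show ?thesis using Bochner_Integration.integrable_add[OF Bochner_Integration.integrable_add[OF 1 2] 3] unfolding e .
  qed
  have lu: "loc_integrable u" by (rule ode_energy_loc_integrable(1)[OF a um _ P]) (rule unn)
  have lG: "loc_integrable (\<lambda>r. ode_rhs a r (u r))" by (rule ode_energy_loc_integrable(2)[OF a um _ P]) (rule unn)
  have nz: "\<not> (AE r in lborel. r > 0 \<longrightarrow> u r = 0)"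
  proof
    assume "AE r in lborel. r > 0 \<longrightarrow> u r = 0"
    then have "AE r in lborel. r > 0 \<longrightarrow> g r = 0" by eventually_elim (auto simp: u_def)
    then have "AE x in (lborel :: R3 measure). g (norm x) = 0"
      by (subst AE_radial_iff) (use gm in auto)
    then have "AE x in lborel. R x = 0" using Rg by eventually_elim simp
    then show False using R1(2) by blast
  qed
  \<comment> \<open>Radial lifts of bumps are test functions off the origin. In the weak equation
    the volume element r^2 cancels the 1/r of the lift and the 1/r of R = u/r, leaving the
    one-dimensional equation.\<close>
  have weak: "(\<integral>r. u r * f'' r \<partial>lborel) = (\<integral>r. ode_rhs a r (u r) * f r \<partial>lborel)"
    if f: "f \<in> bump_class" and d1: "\<And>r. (f has_real_derivative f' r) (at r)" and d2: "\<And>r. (f' has_real_derivative f'' r) (at r)" for f f' f''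
  proof -
    obtain p q where pq: "0 < p" "p < q" "\<And>r. r \<notin> {p..q} \<Longrightarrow> f r = 0" using bump_classD[OF f] by blast
    have f'b: "f' \<in> bump_class" by (rule bump_deriv[OF f d1])
    have f''b: "f'' \<in> bump_class" by (rule bump_deriv[OF f'b d2])
    have f'0: "f' r = 0" if "r \<notin> {p..q}" for r by (rule deriv_zero_outside[OF pq(3) d1 that])
    have f''0: "f'' r = 0" if "r \<notin> {p..q}" for r by (rule deriv_zero_outside[OF f'0 d2 that])
    have dk: "diffable k {0<..} f" for k by (rule diffable_subset[OF bump_diffable[OF f]]) simp
    define \<phi> where "\<phi> = radial_lift f"
    have t: "\<phi> \<in> test_functions (- {0})" and lap: "\<And>x. x \<noteq> 0 \<Longrightarrow> laplacian \<phi> x = f'' (norm x) / norm x"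
      using radial_lift_test(1,2)[of f p q f' f''] dk pq d1 d2 unfolding \<phi>_def by blast+
    have \<phi>L2: "\<phi> \<in> L2" by (rule test_function_L2[OF t])
    have LL2: "Lop a \<phi> \<in> L2" by (rule L_L2[OF t])
    define h1 h2 where "h1 = (\<lambda>r. g r * (- f'' r / r + a / r\<^sup>2 * (f r / r)))" and "h2 = (\<lambda>r. (- g r + (g r)^3) * (f r / r))"
    have fm: "f \<in> borel_measurable borel" "f'' \<in> borel_measurable borel"
      using borel_measurable_continuous_onI[OF bump_continuous] f f''b by blast+
    have hm: "h1 \<in> borel_measurable borel" "h2 \<in> borel_measurable borel"
      unfolding h1_def h2_def using gm fm by measurable
    have i1: "integrable lborel (\<lambda>x. R x * Lop a \<phi> x)" by (rule L2_mult_integrable[OF RL2 LL2])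
    have i2: "integrable lborel (\<lambda>x. HR x * \<phi> x)" by (rule L2_mult_integrable[OF HRL2 \<phi>L2])
    have e1: "AE x in lborel. R x * Lop a \<phi> x = h1 (norm x)"
      using Rg AE_lborel_singleton[of "0::R3"]
    proof eventually_elim
      case (elim x)
      have "Lop a \<phi> x = - (f'' (norm x) / norm x) + a / (norm x)\<^sup>2 * (f (norm x) / norm x)"
        unfolding Lop_def lap[OF elim(2)] by (simp add: \<phi>_def radial_lift_def)
      then show ?case using elim by (simp add: h1_def)
    qed
    have e2: "AE x in lborel. HR x * \<phi> x = h2 (norm x)"
      using HRg by eventually_elim (simp add: h2_def \<phi>_def radial_lift_def)
    have j1: "integrable lborel (\<lambda>r. indicator {0<..} r * (r\<^sup>2 * h1 r))" by (rule integrable_radial_transfer[OF i1 hm(1) e1])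
    have j2: "integrable lborel (\<lambda>r. indicator {0<..} r * (r\<^sup>2 * h2 r))" by (rule integrable_radial_transfer[OF i2 hm(2) e2])
    have "(\<integral>x. R x * Lop a \<phi> x \<partial>lborel) = (\<integral>x. HR x * \<phi> x \<partial>lborel)"
      using friedrichs_weak[OF fr t] by (simp add: L2_inner_def)
    moreover have "(\<integral>x. R x * Lop a \<phi> x \<partial>lborel) = 4 * pi * (\<integral>r. indicator {0<..} r * (r\<^sup>2 * h1 r) \<partial>lborel)"
      by (rule integral_radial_transfer[OF _ hm(1) e1]) (use i1 in auto)
    moreover have "(\<integral>x. HR x * \<phi> x \<partial>lborel) = 4 * pi * (\<integral>r. indicator {0<..} r * (r\<^sup>2 * h2 r) \<partial>lborel)"
      by (rule integral_radial_transfer[OF _ hm(2) e2]) (use i2 in auto)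
    ultimately have "(\<integral>r. indicator {0<..} r * (r\<^sup>2 * h2 r) \<partial>lborel) - (\<integral>r. indicator {0<..} r * (r\<^sup>2 * h1 r) \<partial>lborel) = 0" by simp
    then have "(\<integral>r. indicator {0<..} r * (r\<^sup>2 * h2 r) - indicator {0<..} r * (r\<^sup>2 * h1 r) \<partial>lborel) = 0"
      using Bochner_Integration.integral_diff[OF j2 j1] by simp
    moreover have "indicator {0<..} r * (r\<^sup>2 * h2 r) - indicator {0<..} r * (r\<^sup>2 * h1 r) = u r * f'' r - ode_rhs a r (u r) * f r" for r
    proof (cases "r > 0")
      case True
      \<comment> \<open>With i for 1/r the claim is a polynomial identity modulo r i = 1.\<close>
      define i where "i = 1 / r"
      have i: "r * i = 1" using True by (simp add: i_def)
      have "r\<^sup>2 * ((- g r + (g r)^3) * (f r * i)) - r\<^sup>2 * (g r * (- f'' r * i + a * i\<^sup>2 * (f r * i)))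
         = (r * g r) * f'' r - ((1 + a * i\<^sup>2) * (r * g r) - (r * g r)^3 * i\<^sup>2) * f r"
        using i by algebra
      moreover have "h2 r = (- g r + (g r)^3) * (f r * i)" "h1 r = g r * (- f'' r * i + a * i\<^sup>2 * (f r * i))"
        "ode_rhs a r (u r) = (1 + a * i\<^sup>2) * (r * g r) - (r * g r)^3 * i\<^sup>2"
        by (simp_all add: h1_def h2_def ode_rhs_def u_def i_def power_inverse divide_inverse)
      ultimately show ?thesis using True by (simp add: u_def)
    next
      case False
      then have "r \<notin> {p..q}" using pq by auto
      then show ?thesis using False pq(3) f''0 by simp
    qed
    ultimately have "(\<integral>r. u r * f'' r - ode_rhs a r (u r) * f r \<partial>lborel) = 0" by simp
    then show ?thesis
      using Bochner_Integration.integral_diff[OF loc_integrable_mult_bump[OF lu f''b] loc_integrable_mult_bump[OF lG f]] by simp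
  qed
  obtain w w' where w: "profile a w w'" "AE r in lborel. r > 0 \<longrightarrow> u r = w r"
    by (rule weak_solution_profile[OF a um _ nz P weak]) (use unn in blast)+
  have cw: "continuous_on {0<..} w"
    using w(1) by (intro continuous_at_imp_continuous_on ballI DERIV_isCont[of w]) (auto simp: profile_def)
  have w0m: "(\<lambda>r. indicator {0<..} r * w r) \<in> borel_measurable borel" by (rule indicator_continuous_measurable[OF cw])
  \<comment> \<open>The profile is known to be continuous only for r > 0; the indicator makes it a
    Borel function on the line, as the passage from r to |x| demands.\<close>
  have "AE r in lborel. r > 0 \<longrightarrow> u r = indicator {0<..} r * w r" using w(2) by eventually_elim auto
  then have "AE x in (lborel :: R3 measure). u (norm x) = indicator {0<..} (norm x) * w (norm x)"
    by (subst AE_radial_iff) (use um w0m in measurable)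
  then have "AE x in lborel. R x = w (norm x) / norm x"
    using Rg AE_lborel_singleton[of "0::R3"]
  proof eventually_elim
    case (elim x)
    then have "norm x * R x = w (norm x)" by (simp add: u_def)
    then show ?case using elim by (simp add: field_simps)
  qed
  with w(1) show thesis by (rule that)
qed

theorem theorem3p2:
  fixes a :: real
  assumes "a > 0"
  shows "\<exists>Q. nonneg_radial_solution a Q \<and>
           (\<forall>R. nonneg_radial_solution a R \<longrightarrow> (AE x in lborel. R x = Q x))"
proof -
  obtain u u' where p: "profile a u u'" using profile_exists[OF assms] by blast
  interpret ground_profile a u u' by unfold_locales (rule assms, rule p)
  have "AE x in lborel. R x = Q x" if R: "nonneg_radial_solution a R" for R
  proof -
    obtain w w' where w: "profile a w w'" "AE x in lborel. R x = w (norm x) / norm x"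
      by (rule nonneg_radial_solution_profile[OF assms R]) blast
    show ?thesis using w(2) AE_lborel_singleton[of "0::R3"]
    proof eventually_elim
      case (elim x)
      then show ?case using profile_unique[OF assms w(1) p, of "norm x"] by (simp add: Q_def radial_lift_def)
    qed
  qed
  then show ?thesis using Q_solution by blast
qed

end
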